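(* Let $U$ be a deformable $\mathcal{R}$-algebra such that $\mathrm{gr}\,U$ is a commutative Noetherian ring. Then $\widehat{U}_K$ is a flat $\widehat{U_{1}}_{K}$-module on both sides.
   Context: $K$ is a complete discretely valued field with valuation ring $\mathcal{R}$, $\pi\in\mathcal{R}$ a fixed non-zero non-unit. For an $\mathcal{R}$-module $M$, $\widehat{M}=\varprojlim M/\pi^aM$ and $\widehat{M}_K:=\widehat{M}\otimes_{\mathcal{R}}K$. A positively filtered $\mathcal{R}$-algebra $U$ (exhaustive filtration $F_0U\subseteq F_1U\subseteq\cdots$ with $F_iU\cdot F_jU\subseteq F_{i+j}U$) is deformable if $\mathrm{gr}\,U$ is flat over $\mathcal{R}$. Its $n$-th deformation is the subring $U_n:=\sum_{i\ge0}\pi^{in}F_iU$; in particular $U_0=U$ and $U_1=\sum_{i\ge0}\pi^iF_iU$. $\widehat{U_1}_K$ is the $K$-Banach algebra $\widehat{U_1}\otimes_{\mathcal{R}}K$, and it maps to $\widehat{U}_K$ via the inclusion $U_1\subseteq U$. *)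

theory Defs
  imports "HOL-Algebra.Algebra"
begin

subsection \<open>Complete discretely valued fields\<close>

text \<open>A valuation is a function \<open>v\<close> into the integers whose value at zero is irrelevant (it plays
  the part of infinity); \<open>val_ball K v N\<close> is the set of elements of valuation at least \<open>N\<close>.
  The value group is a nonzero subgroup of the integers, not necessarily everything.\<close>

definition val_ball :: "('k, 'z) ring_scheme \<Rightarrow> ('k \<Rightarrow> int) \<Rightarrow> int \<Rightarrow> 'k set" where
  "val_ball K v N = {x \<in> carrier K. x = \<zero>\<^bsub>K\<^esub> \<or> N \<le> v x}"

locale complete_discretely_valued_field = field K for K (structure) +
  fixes v :: "'a \<Rightarrow> int"
  assumes val_mult: "\<lbrakk>x \<in> carrier K - {\<zero>}; y \<in> carrier K - {\<zero>}\<rbrakk> \<Longrightarrow> v (x \<otimes> y) = v x + v y"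
    and val_add: "\<lbrakk>x \<in> carrier K - {\<zero>}; y \<in> carrier K - {\<zero>}; x \<oplus> y \<noteq> \<zero>\<rbrakk>
      \<Longrightarrow> min (v x) (v y) \<le> v (x \<oplus> y)"
    and val_nontrivial: "\<exists>x \<in> carrier K - {\<zero>}. v x \<noteq> 0"
    and val_complete: "\<And>s :: nat \<Rightarrow> 'a.
      \<lbrakk>\<And>n. s n \<in> carrier K;
       \<And>N. \<exists>n0. \<forall>m\<ge>n0. \<forall>n\<ge>n0. s m \<ominus> s n \<in> val_ball K v N\<rbrakk>
      \<Longrightarrow> \<exists>l \<in> carrier K. \<forall>N. \<exists>n0. \<forall>n\<ge>n0. s n \<ominus> l \<in> val_ball K v N"

definition valuation_ring :: "('k, 'z) ring_scheme \<Rightarrow> ('k \<Rightarrow> int) \<Rightarrow> ('k, 'z) ring_scheme" where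
  "valuation_ring K v = K\<lparr>carrier := val_ball K v 0\<rparr>"


subsection \<open>Modules and algebras over noncommutative rings\<close>

text \<open>The library locale \<^locale>\<open>module\<close> demands a commutative ring of scalars, and
  \<^locale>\<open>algebra\<close> a commutative algebra.\<close>

locale left_module = R?: ring R + M?: abelian_group M
  for R :: "('a, 'z) ring_scheme" (structure) and M :: "('a, 'b, 'y) module_scheme" (structure) +
  assumes smult_closed [simp, intro]:
      "\<lbrakk>a \<in> carrier R; x \<in> carrier M\<rbrakk> \<Longrightarrow> a \<odot>\<^bsub>M\<^esub> x \<in> carrier M"
    and smult_l_distr:
      "\<lbrakk>a \<in> carrier R; b \<in> carrier R; x \<in> carrier M\<rbrakk>
        \<Longrightarrow> (a \<oplus> b) \<odot>\<^bsub>M\<^esub> x = a \<odot>\<^bsub>M\<^esub> x \<oplus>\<^bsub>M\<^esub> b \<odot>\<^bsub>M\<^esub> x"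
    and smult_r_distr:
      "\<lbrakk>a \<in> carrier R; x \<in> carrier M; y \<in> carrier M\<rbrakk>
        \<Longrightarrow> a \<odot>\<^bsub>M\<^esub> (x \<oplus>\<^bsub>M\<^esub> y) = a \<odot>\<^bsub>M\<^esub> x \<oplus>\<^bsub>M\<^esub> a \<odot>\<^bsub>M\<^esub> y"
    and smult_assoc1:
      "\<lbrakk>a \<in> carrier R; b \<in> carrier R; x \<in> carrier M\<rbrakk>
        \<Longrightarrow> (a \<otimes> b) \<odot>\<^bsub>M\<^esub> x = a \<odot>\<^bsub>M\<^esub> (b \<odot>\<^bsub>M\<^esub> x)"
    and smult_one [simp]: "x \<in> carrier M \<Longrightarrow> \<one> \<odot>\<^bsub>M\<^esub> x = x"

lemma left_module_iff_module:
  assumes "cring R"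
  shows "left_module R M \<longleftrightarrow> module R M"
  using assms
  by (auto simp: left_module_def left_module_axioms_def module_def module_axioms_def cring_def)

definition opposite_ring :: "('a, 'z) ring_scheme \<Rightarrow> ('a, 'z) ring_scheme" where
  "opposite_ring R = R\<lparr>monoid.mult := \<lambda>x y. y \<otimes>\<^bsub>R\<^esub> x\<rparr>"

text \<open>In a right module the term \<open>a \<odot> x\<close> stands for the product of \<open>x\<close> with the scalar \<open>a\<close>
  on the right.\<close>

definition right_module :: "('a, 'z) ring_scheme \<Rightarrow> ('a, 'm, 'y) module_scheme \<Rightarrow> bool" where
  "right_module R M \<longleftrightarrow> left_module (opposite_ring R) M"

definition linear_maps ::
  "('a, 'z) ring_scheme \<Rightarrow> ('a, 'm, 'x) module_scheme \<Rightarrow> ('a, 'n, 'y) module_scheme \<Rightarrow> ('m \<Rightarrow> 'n) set"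
  where "linear_maps R M N = {f \<in> hom (add_monoid M) (add_monoid N).
    \<forall>a \<in> carrier R. \<forall>x \<in> carrier M. f (a \<odot>\<^bsub>M\<^esub> x) = a \<odot>\<^bsub>N\<^esub> f x}"

locale assoc_algebra = R?: cring R + left_module R U + U?: ring U
  for R :: "('a, 'z) ring_scheme" (structure) and U :: "('a, 'b, 'y) module_scheme" (structure) +
  assumes smult_mult_left: "\<lbrakk>a \<in> carrier R; x \<in> carrier U; y \<in> carrier U\<rbrakk>
      \<Longrightarrow> (a \<odot>\<^bsub>U\<^esub> x) \<otimes>\<^bsub>U\<^esub> y = a \<odot>\<^bsub>U\<^esub> (x \<otimes>\<^bsub>U\<^esub> y)"
    and smult_mult_right: "\<lbrakk>a \<in> carrier R; x \<in> carrier U; y \<in> carrier U\<rbrakk>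
      \<Longrightarrow> x \<otimes>\<^bsub>U\<^esub> (a \<odot>\<^bsub>U\<^esub> y) = a \<odot>\<^bsub>U\<^esub> (x \<otimes>\<^bsub>U\<^esub> y)"


subsection \<open>Tensor products\<close>

text \<open>The tensor product over \<open>A\<close> of a right module \<open>M\<close> and a left module \<open>N\<close> is the free abelian
  group on \<open>carrier M \<times> carrier N\<close> modulo the subgroup generated by the usual relations.\<close>

definition tensor_relators ::
  "('a, 'z) ring_scheme \<Rightarrow> ('a, 'm, 'x) module_scheme \<Rightarrow> ('a, 'n, 'y) module_scheme \<Rightarrow> ('m \<times> 'n \<Rightarrow>\<^sub>0 int) set"
  where "tensor_relators A M N =
    {frag_of (x \<oplus>\<^bsub>M\<^esub> x', y) - frag_of (x, y) - frag_of (x', y) | x x' y.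
       x \<in> carrier M \<and> x' \<in> carrier M \<and> y \<in> carrier N} \<union>
    {frag_of (x, y \<oplus>\<^bsub>N\<^esub> y') - frag_of (x, y) - frag_of (x, y') | x y y'.
       x \<in> carrier M \<and> y \<in> carrier N \<and> y' \<in> carrier N} \<union>
    {frag_of (a \<odot>\<^bsub>M\<^esub> x, y) - frag_of (x, a \<odot>\<^bsub>N\<^esub> y) | a x y.
       a \<in> carrier A \<and> x \<in> carrier M \<and> y \<in> carrier N}"

definition tensor_kernel ::
  "('a, 'z) ring_scheme \<Rightarrow> ('a, 'm, 'x) module_scheme \<Rightarrow> ('a, 'n, 'y) module_scheme \<Rightarrow> ('m \<times> 'n \<Rightarrow>\<^sub>0 int) set"
  where "tensor_kernel A M N =
    generate (free_Abelian_group (carrier M \<times> carrier N)) (tensor_relators A M N)"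

definition tensor_group ::
  "('a, 'z) ring_scheme \<Rightarrow> ('a, 'm, 'x) module_scheme \<Rightarrow> ('a, 'n, 'y) module_scheme \<Rightarrow> ('m \<times> 'n \<Rightarrow>\<^sub>0 int) set monoid"
  where "tensor_group A M N = free_Abelian_group (carrier M \<times> carrier N) Mod tensor_kernel A M N"

definition tensor_class ::
  "('a, 'z) ring_scheme \<Rightarrow> ('a, 'm, 'x) module_scheme \<Rightarrow> ('a, 'n, 'y) module_scheme \<Rightarrow>
    ('m \<times> 'n \<Rightarrow>\<^sub>0 int) \<Rightarrow> ('m \<times> 'n \<Rightarrow>\<^sub>0 int) set"
  where "tensor_class A M N c =
    tensor_kernel A M N #>\<^bsub>free_Abelian_group (carrier M \<times> carrier N)\<^esub> c"

text \<open>\<open>tensor_map A M' N' f g\<close> is the map from the tensor product of \<open>M\<close> and \<open>N\<close> to that of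
  \<open>M'\<close> and \<open>N'\<close> induced by \<open>f\<close> and \<open>g\<close>. As for \<^const>\<open>rcoset_mult\<close>, maps on cosets are written as
  the union of the image cosets of all representatives; these all coincide.\<close>

definition tensor_map ::
  "('a, 'z) ring_scheme \<Rightarrow> ('a, 'p, 'x) module_scheme \<Rightarrow> ('a, 'q, 'y) module_scheme \<Rightarrow>
    ('m \<Rightarrow> 'p) \<Rightarrow> ('n \<Rightarrow> 'q) \<Rightarrow> ('m \<times> 'n \<Rightarrow>\<^sub>0 int) set \<Rightarrow> ('p \<times> 'q \<Rightarrow>\<^sub>0 int) set"
  where "tensor_map A M' N' f g C =
    (\<Union>c\<in>C. tensor_class A M' N' (frag_extend (\<lambda>(x, y). frag_of (f x, g y)) c))"

text \<open>The tensor product of two algebras over a commutative ring, with the product determined by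
  multiplying pure tensors factorwise.\<close>

definition tensor_algebra ::
  "('a, 'z) ring_scheme \<Rightarrow> ('a, 'm, 'x) module_scheme \<Rightarrow> ('a, 'n, 'y) module_scheme \<Rightarrow> ('m \<times> 'n \<Rightarrow>\<^sub>0 int) set ring"
  where "tensor_algebra R S T =
    \<lparr>carrier = carrier (tensor_group R S T),
     monoid.mult = \<lambda>C D. \<Union>c\<in>C. \<Union>d\<in>D. tensor_class R S T
       (frag_extend (\<lambda>(x, y). frag_extend (\<lambda>(x', y'). frag_of (x \<otimes>\<^bsub>S\<^esub> x', y \<otimes>\<^bsub>T\<^esub> y')) d) c),
     one = tensor_class R S T (frag_of (\<one>\<^bsub>S\<^esub>, \<one>\<^bsub>T\<^esub>)),
     ring.zero = \<one>\<^bsub>tensor_group R S T\<^esub>,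
     add = (\<otimes>\<^bsub>tensor_group R S T\<^esub>)\<rparr>"


subsection \<open>Flatness\<close>

text \<open>A definition cannot quantify over all modules, only over those whose elements belong to a
  given type; this type is the first argument. A theorem with flatness as its conclusion should
  leave that type a free type variable. Where flatness is a hypothesis, the type of the elements of
  \<open>A\<close> is enough: it accommodates \<open>A\<close> and all its one-sided ideals, and a module is flat
  as soon as tensoring preserves the injectivity of the inclusions of these ideals into \<open>A\<close>.\<close>

definition flat_left_module ::
  "'n itself \<Rightarrow> ('a, 'z) ring_scheme \<Rightarrow> ('a, 'm, 'y) module_scheme \<Rightarrow> bool"
  where "flat_left_module TYPE('n) A M \<longleftrightarrow> left_module A M \<and>
    (\<forall>(N :: ('a, 'n) module) (N' :: ('a, 'n) module) f.
      right_module A N \<and> right_module A N' \<and> f \<in> linear_maps A N N' \<and> inj_on f (carrier N) \<longrightarrow>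
      inj_on (tensor_map A N' M f (\<lambda>x. x)) (carrier (tensor_group A N M)))"

definition flat_right_module ::
  "'n itself \<Rightarrow> ('a, 'z) ring_scheme \<Rightarrow> ('a, 'm, 'y) module_scheme \<Rightarrow> bool"
  where "flat_right_module TYPE('n) A M \<longleftrightarrow> right_module A M \<and>
    (\<forall>(N :: ('a, 'n) module) (N' :: ('a, 'n) module) f.
      left_module A N \<and> left_module A N' \<and> f \<in> linear_maps A N N' \<and> inj_on f (carrier N) \<longrightarrow>
      inj_on (tensor_map A M N' (\<lambda>x. x) f) (carrier (tensor_group A M N)))"

definition ring_as_left_module ::
  "('a \<Rightarrow> 'b) \<Rightarrow> ('b, 'z) ring_scheme \<Rightarrow> ('a, 'b) module"
  where "ring_as_left_module \<phi> B =
    \<lparr>carrier = carrier B, monoid.mult = (\<otimes>\<^bsub>B\<^esub>), one = \<one>\<^bsub>B\<^esub>,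
     ring.zero = \<zero>\<^bsub>B\<^esub>, add = (\<oplus>\<^bsub>B\<^esub>),
     smult = \<lambda>a x. \<phi> a \<otimes>\<^bsub>B\<^esub> x\<rparr>"

definition ring_as_right_module ::
  "('a \<Rightarrow> 'b) \<Rightarrow> ('b, 'z) ring_scheme \<Rightarrow> ('a, 'b) module"
  where "ring_as_right_module \<phi> B =
    \<lparr>carrier = carrier B, monoid.mult = (\<otimes>\<^bsub>B\<^esub>), one = \<one>\<^bsub>B\<^esub>,
     ring.zero = \<zero>\<^bsub>B\<^esub>, add = (\<oplus>\<^bsub>B\<^esub>),
     smult = \<lambda>a x. x \<otimes>\<^bsub>B\<^esub> \<phi> a\<rparr>"


subsection \<open>Filtered algebras, associated graded rings and deformations\<close>

locale positively_filtered_algebra = assoc_algebra R U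
  for R :: "('a, 'z) ring_scheme" (structure) and U :: "('a, 'b, 'y) module_scheme" (structure) +
  fixes F :: "nat \<Rightarrow> 'b set"
  assumes filt_submodule: "submodule (F i) R U"
    and filt_mono: "F i \<subseteq> F (Suc i)"
    and filt_one: "\<one>\<^bsub>U\<^esub> \<in> F 0"
    and filt_mult: "\<lbrakk>x \<in> F i; y \<in> F j\<rbrakk> \<Longrightarrow> x \<otimes>\<^bsub>U\<^esub> y \<in> F (i + j)"
    and filt_exhaustive: "(\<Union>i. F i) = carrier U"

definition filt_below :: "('r, 'u, 'z) module_scheme \<Rightarrow> (nat \<Rightarrow> 'u set) \<Rightarrow> nat \<Rightarrow> 'u set" where
  "filt_below U F i = (if i = 0 then {\<zero>\<^bsub>U\<^esub>} else F (i - 1))"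

definition gr_piece :: "('r, 'u, 'z) module_scheme \<Rightarrow> (nat \<Rightarrow> 'u set) \<Rightarrow> nat \<Rightarrow> 'u set monoid" where
  "gr_piece U F i = (U\<lparr>carrier := F i\<rparr>) A_Mod (filt_below U F i)"

text \<open>Elements of the direct sum of the pieces are finitely supported families of cosets. The
  product of the cosets of \<open>x\<close> in degree \<open>i\<close> and of \<open>y\<close> in degree \<open>j\<close> is the coset of
  \<open>x \<otimes> y\<close> in degree \<open>i + j\<close>.\<close>

definition gr :: "('r, 'u, 'z) module_scheme \<Rightarrow> (nat \<Rightarrow> 'u set) \<Rightarrow> ('r, nat \<Rightarrow> 'u set) module" where
  "gr U F =
    \<lparr>carrier = {f. (\<forall>i. f i \<in> carrier (gr_piece U F i)) \<and> finite {i. f i \<noteq> filt_below U F i}},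
     monoid.mult = \<lambda>f g n. finprod (gr_piece U F n)
       (\<lambda>i. rcoset_mult U (filt_below U F n) (f i) (g (n - i))) {..n},
     one = \<lambda>i. if i = 0 then filt_below U F 0 +>\<^bsub>U\<^esub> \<one>\<^bsub>U\<^esub> else filt_below U F i,
     ring.zero = filt_below U F,
     add = \<lambda>f g i. f i <+>\<^bsub>U\<^esub> g i,
     smult = \<lambda>a f i. \<Union>x\<in>f i. filt_below U F i +>\<^bsub>U\<^esub> (a \<odot>\<^bsub>U\<^esub> x)\<rparr>"

definition deformable ::
  "('r, 'z) ring_scheme \<Rightarrow> ('r, 'u, 'y) module_scheme \<Rightarrow> (nat \<Rightarrow> 'u set) \<Rightarrow> bool"
  where "deformable R U F \<longleftrightarrow>
    positively_filtered_algebra R U F \<and> flat_left_module TYPE('r) R (gr U F)"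

definition deformation ::
  "('r, 'z) ring_scheme \<Rightarrow> 'r \<Rightarrow> ('r, 'u, 'y) module_scheme \<Rightarrow> (nat \<Rightarrow> 'u set) \<Rightarrow> nat \<Rightarrow>
    ('r, 'u, 'y) module_scheme"
  where "deformation R \<pi> U F n = U\<lparr>carrier :=
    {finsum U (\<lambda>i. (\<pi> [^]\<^bsub>R\<^esub> (i * n)) \<odot>\<^bsub>U\<^esub> x i) {..m} | x m. \<forall>i\<le>m. x i \<in> F i}\<rparr>"


subsection \<open>Completions\<close>

definition power_multiples ::
  "('r, 'z) ring_scheme \<Rightarrow> 'r \<Rightarrow> ('r, 'm, 'y) module_scheme \<Rightarrow> nat \<Rightarrow> 'm set"
  where "power_multiples R \<pi> M a = {(\<pi> [^]\<^bsub>R\<^esub> a) \<odot>\<^bsub>M\<^esub> x | x. x \<in> carrier M}"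

text \<open>The inverse limit over \<open>a\<close> of the quotients of \<open>M\<close> by its submodules of multiples of the
  \<open>a\<close>-th power of \<open>\<pi>\<close>; the transition maps enlarge cosets.\<close>

definition completion ::
  "('r, 'z) ring_scheme \<Rightarrow> 'r \<Rightarrow> ('r, 'm, 'y) module_scheme \<Rightarrow> ('r, nat \<Rightarrow> 'm set) module"
  where "completion R \<pi> M =
    \<lparr>carrier = {s. \<forall>a. s a \<in> a_rcosets\<^bsub>M\<^esub> (power_multiples R \<pi> M a) \<and>
                       power_multiples R \<pi> M a <+>\<^bsub>M\<^esub> s (Suc a) = s a},
     monoid.mult = \<lambda>s t a. rcoset_mult M (power_multiples R \<pi> M a) (s a) (t a),
     one = \<lambda>a. power_multiples R \<pi> M a +>\<^bsub>M\<^esub> \<one>\<^bsub>M\<^esub>,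
     ring.zero = power_multiples R \<pi> M,
     add = \<lambda>s t a. s a <+>\<^bsub>M\<^esub> t a,
     smult = \<lambda>r s a. \<Union>x\<in>s a. power_multiples R \<pi> M a +>\<^bsub>M\<^esub> (r \<odot>\<^bsub>M\<^esub> x)\<rparr>"

definition completion_map ::
  "('r, 'z) ring_scheme \<Rightarrow> 'r \<Rightarrow> ('r, 'n, 'y) module_scheme \<Rightarrow> ('m \<Rightarrow> 'n) \<Rightarrow>
    (nat \<Rightarrow> 'm set) \<Rightarrow> nat \<Rightarrow> 'n set"
  where "completion_map R \<pi> N f s = (\<lambda>a. \<Union>x\<in>s a. power_multiples R \<pi> N a +>\<^bsub>N\<^esub> f x)"

text \<open>\<open>completion_K K v \<pi> M\<close> is the completion of an algebra \<open>M\<close> over the valuation ring, tensored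
  with \<open>K\<close>.\<close>

definition completion_K ::
  "('k, 'z) ring_scheme \<Rightarrow> ('k \<Rightarrow> int) \<Rightarrow> 'k \<Rightarrow> ('k, 'm, 'y) module_scheme \<Rightarrow>
    ((nat \<Rightarrow> 'm set) \<times> 'k \<Rightarrow>\<^sub>0 int) set ring"
  where "completion_K K v \<pi> M =
    tensor_algebra (valuation_ring K v)
      (completion (valuation_ring K v) \<pi> M) (ring_as_left_module (\<lambda>a. a) K)"

definition completion_K_map ::
  "('k, 'z) ring_scheme \<Rightarrow> ('k \<Rightarrow> int) \<Rightarrow> 'k \<Rightarrow> ('k, 'n, 'y) module_scheme \<Rightarrow> ('m \<Rightarrow> 'n) \<Rightarrow>
    ((nat \<Rightarrow> 'm set) \<times> 'k \<Rightarrow>\<^sub>0 int) set \<Rightarrow> ((nat \<Rightarrow> 'n set) \<times> 'k \<Rightarrow>\<^sub>0 int) set"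
  where "completion_K_map K v \<pi> N f =
    tensor_map (valuation_ring K v)
      (completion (valuation_ring K v) \<pi> N) (ring_as_left_module (\<lambda>a. a) K)
      (completion_map (valuation_ring K v) \<pi> N f) (\<lambda>x. x)"

end

theory Submission
  imports Defs
begin

text \<open>Let \<open>A\<close> and \<open>M\<close> be the two Banach algebras, with \<open>D \<subseteq> A\<close> the image of the completion of \<open>U\<^sub>1\<close> and
  \<open>C \<subseteq> M\<close> that of the completion of \<open>U\<close>. Since \<open>\<pi>\<close> is invertible in \<open>A\<close>, all of \<open>U\<close> maps to \<open>A\<close>, and
  \<open>B = U + D\<close> is a subring with \<open>A = B[1/\<pi>]\<close> whose \<open>\<pi>\<close>-adic completion is \<open>C\<close>, because \<open>U\<close> is dense
  in \<open>C\<close> and \<open>U \<inter> \<pi> C = \<pi> U\<close>. Giving \<open>\<pi>\<^sup>a f\<close> with \<open>f \<in> F n\<close> the weight \<open>n - a\<close>, a right ideal of \<open>B\<close> has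
  leading terms that form an increasing sequence of ideals of \<open>gr U\<close>; as \<open>gr U\<close> is Noetherian,
  successive approximation in the complete ring \<open>D\<close> shows that the ideal is finitely generated.

  So \<open>M = C[1/\<pi>]\<close> is obtained from a Noetherian ring \<open>B\<close> by \<open>\<pi>\<close>-adic completion and localization, with
  \<open>\<pi>\<close> central. Its flatness is checked by the equational criterion: an element of \<open>M\<close> solving a
  finite linear system over \<open>B\<close> is approximated by vectors over \<open>B\<close>, and the bounded \<open>\<pi>\<close>-torsion of
  the cokernel of the system allows these to be corrected to exact solutions. Passing to opposite
  rings gives the statement on the other side.\<close>

subsection \<open>Tensor products\<close>

text \<open>The obstacle is that \<open>C\<close> is not the \<pi>-adic completion of
  \<open>D\<close>: an element of \<open>F n\<close> enters \<open>D\<close> only after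
  multiplication by the \<open>n\<close>-th power of \<pi>. The ring \<open>B\<close> separates the
  two difficulties, inverting \<pi> and completing. The weight \<open>n - a\<close> is forced by the
  topology: the closure of the elements of weight at most \<open>- k\<close> is exactly \<pi>^k
  \<open>D\<close>, so lowering the weight without end means convergence in \<open>D\<close>. Right
  ideals go with left flatness because the vectors over \<open>B\<close> that solve a system with
  coefficients on the left are stable under multiplication from the right. The bound on the torsion
  of the cokernel does the work of the Artin-Rees lemma: it tells how much precision makes an
  approximate solution correctable. The equational criterion speaks of \<open>A\<close> and
  \<open>M\<close> only, so it gives flatness against modules of every type at once. Flatness of
  \<open>gr U\<close> enters as the absence of \<pi>-torsion, first in \<open>gr U\<close> and then
  in \<open>U\<close>, which makes both completions embed in their localizations.\<close>

definition frag_pair_map :: "('m \<Rightarrow> 'p) \<Rightarrow> ('n \<Rightarrow> 'q) \<Rightarrow> ('m \<times> 'n \<Rightarrow>\<^sub>0 int) \<Rightarrow> ('p \<times> 'q \<Rightarrow>\<^sub>0 int)"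
  where "frag_pair_map f g = frag_extend (\<lambda>(x, y). frag_of (f x, g y))"

lemma frag_pair_map_simps [simp]:
  "frag_pair_map f g 0 = 0"
  "frag_pair_map f g (frag_of (x, y)) = frag_of (f x, g y)"
  "frag_pair_map f g (c + d) = frag_pair_map f g c + frag_pair_map f g d"
  "frag_pair_map f g (c - d) = frag_pair_map f g c - frag_pair_map f g d"
  "frag_pair_map f g (- c) = - frag_pair_map f g c"
  by (simp_all add: frag_pair_map_def frag_extend_add frag_extend_diff frag_extend_minus)

lemma keys_diff_subset:
  "\<lbrakk>Poly_Mapping.keys c \<subseteq> S; Poly_Mapping.keys d \<subseteq> S\<rbrakk> \<Longrightarrow> Poly_Mapping.keys (c - d :: 'a \<Rightarrow>\<^sub>0 int) \<subseteq> S"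
  using keys_diff[of c d] by blast

lemma keys_add_subset:
  "\<lbrakk>Poly_Mapping.keys c \<subseteq> S; Poly_Mapping.keys d \<subseteq> S\<rbrakk> \<Longrightarrow> Poly_Mapping.keys (c + d :: 'a \<Rightarrow>\<^sub>0 int) \<subseteq> S"
  using Poly_Mapping.keys_add[of c d] by blast

lemma keys_frag_extend_subset:
  assumes "Poly_Mapping.keys c \<subseteq> S" "\<And>x. x \<in> S \<Longrightarrow> Poly_Mapping.keys (f x) \<subseteq> T"
  shows "Poly_Mapping.keys (frag_extend f c) \<subseteq> T"
  using keys_frag_extend[of f c] assms by blast

lemma keys_frag_pair_map:
  assumes "Poly_Mapping.keys c \<subseteq> S \<times> T" "\<And>x. x \<in> S \<Longrightarrow> f x \<in> S'" "\<And>y. y \<in> T \<Longrightarrow> g y \<in> T'"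
  shows "Poly_Mapping.keys (frag_pair_map f g c) \<subseteq> S' \<times> T'"
  unfolding frag_pair_map_def
  by (rule keys_frag_extend_subset[OF assms(1)]) (use assms in auto)

text \<open>The assumptions are weak on purpose: they cover a right module with a left module over a
  noncommutative ring, two algebras over a commutative ring, and either pair with its factors
  exchanged.\<close>

locale tensor_factors = M?: abelian_group M + N?: abelian_group N
  for A :: "('a, 'z) ring_scheme" and M :: "('a, 'm, 'x) module_scheme" (structure)
    and N :: "('a, 'n, 'y) module_scheme" (structure) +
  assumes left_smult_closed: "\<lbrakk>a \<in> carrier A; x \<in> carrier M\<rbrakk> \<Longrightarrow> a \<odot>\<^bsub>M\<^esub> x \<in> carrier M"
    and right_smult_closed: "\<lbrakk>a \<in> carrier A; y \<in> carrier N\<rbrakk> \<Longrightarrow> a \<odot>\<^bsub>N\<^esub> y \<in> carrier N"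
begin

abbreviation (input) Ker where "Ker \<equiv> tensor_kernel A M N"
abbreviation (input) Cls where "Cls \<equiv> tensor_class A M N"

lemma tensor_relators_keys:
  "c \<in> tensor_relators A M N \<Longrightarrow> Poly_Mapping.keys c \<subseteq> carrier M \<times> carrier N"
  unfolding tensor_relators_def
  by (auto simp: left_smult_closed right_smult_closed dest!: subsetD[OF keys_diff])

lemma tensor_kernel_subgroup:
  "subgroup Ker (free_Abelian_group (carrier M \<times> carrier N))"
  unfolding tensor_kernel_def
  by (rule group.generate_is_subgroup) (use tensor_relators_keys in auto)

lemma tensor_kernel_keys: "c \<in> Ker \<Longrightarrow> Poly_Mapping.keys c \<subseteq> carrier M \<times> carrier N"
  by (rule iffD1[OF carrier_free_Abelian_group_iff], erule subsetD[OF subgroup.subset[OF tensor_kernel_subgroup]])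

lemma tensor_kernel_zero [simp]: "0 \<in> Ker"
  using subgroup.one_closed[OF tensor_kernel_subgroup] by simp

lemma tensor_kernel_add: "\<lbrakk>c \<in> Ker; d \<in> Ker\<rbrakk> \<Longrightarrow> c + d \<in> Ker"
  using subgroup.m_closed[OF tensor_kernel_subgroup] by simp

lemma tensor_kernel_minus: "c \<in> Ker \<Longrightarrow> - c \<in> Ker"
  using subgroup.m_inv_closed[OF tensor_kernel_subgroup] tensor_kernel_keys by fastforce

lemma tensor_kernel_diff: "\<lbrakk>c \<in> Ker; d \<in> Ker\<rbrakk> \<Longrightarrow> c - d \<in> Ker"
  using tensor_kernel_add[of c "- d"] tensor_kernel_minus by simp

lemma tensor_kernel_relators: "c \<in> tensor_relators A M N \<Longrightarrow> c \<in> Ker"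
  unfolding tensor_kernel_def by (rule generate.incl)

lemma tensor_kernel_add_left:
  "\<lbrakk>x \<in> carrier M; x' \<in> carrier M; y \<in> carrier N\<rbrakk>
    \<Longrightarrow> frag_of (x \<oplus>\<^bsub>M\<^esub> x', y) - frag_of (x, y) - frag_of (x', y) \<in> Ker"
  by (rule tensor_kernel_relators) (auto simp: tensor_relators_def)

lemma tensor_kernel_add_right:
  "\<lbrakk>x \<in> carrier M; y \<in> carrier N; y' \<in> carrier N\<rbrakk>
    \<Longrightarrow> frag_of (x, y \<oplus>\<^bsub>N\<^esub> y') - frag_of (x, y) - frag_of (x, y') \<in> Ker"
  by (rule tensor_kernel_relators) (auto simp: tensor_relators_def)

lemma tensor_kernel_smult:
  "\<lbrakk>a \<in> carrier A; x \<in> carrier M; y \<in> carrier N\<rbrakk>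
    \<Longrightarrow> frag_of (a \<odot>\<^bsub>M\<^esub> x, y) - frag_of (x, a \<odot>\<^bsub>N\<^esub> y) \<in> Ker"
  by (rule tensor_kernel_relators) (auto simp: tensor_relators_def)

text \<open>Differences are the only group operation in the rule: with 0 they yield inverses, and
  with inverses sums, so inverted relators need no case of their own.\<close>

lemma tensor_kernel_induct [consumes 1, case_names zero add_left add_right smult diff]:
  assumes "c \<in> Ker"
    and "P 0"
    and al: "\<And>x x' y. \<lbrakk>x \<in> carrier M; x' \<in> carrier M; y \<in> carrier N\<rbrakk>
          \<Longrightarrow> P (frag_of (x \<oplus>\<^bsub>M\<^esub> x', y) - frag_of (x, y) - frag_of (x', y))"
    and ar: "\<And>x y y'. \<lbrakk>x \<in> carrier M; y \<in> carrier N; y' \<in> carrier N\<rbrakk>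
          \<Longrightarrow> P (frag_of (x, y \<oplus>\<^bsub>N\<^esub> y') - frag_of (x, y) - frag_of (x, y'))"
    and sm: "\<And>a x y. \<lbrakk>a \<in> carrier A; x \<in> carrier M; y \<in> carrier N\<rbrakk>
          \<Longrightarrow> P (frag_of (a \<odot>\<^bsub>M\<^esub> x, y) - frag_of (x, a \<odot>\<^bsub>N\<^esub> y))"
    and df: "\<And>c d. \<lbrakk>c \<in> Ker; d \<in> Ker; P c; P d\<rbrakk> \<Longrightarrow> P (c - d)"
  shows "P c"
proof -
  have rel: "P c" if "c \<in> tensor_relators A M N" for c
    using that unfolding tensor_relators_def by (elim UnE CollectE exE conjE) (simp_all add: al ar sm)
  have neg: "P (- c)" if "c \<in> Ker" "P c" for c
    using df[of 0 c] that \<open>P 0\<close> by simp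
  have "c \<in> generate (free_Abelian_group (carrier M \<times> carrier N)) (tensor_relators A M N)"
    using assms(1) by (simp add: tensor_kernel_def)
  then have "c \<in> Ker \<and> P c"
  proof induct
    case one
    then show ?case using \<open>P 0\<close> by simp
  next
    case (incl h)
    then show ?case using rel tensor_kernel_relators by blast
  next
    case (inv h)
    then have "inv\<^bsub>free_Abelian_group (carrier M \<times> carrier N)\<^esub> h = - h"
      by (rule inv_free_Abelian_group[OF tensor_relators_keys])
    then show ?case
      using inv neg[of h] rel[of h] tensor_kernel_relators[of h] tensor_kernel_minus[of h] by simp
  next
    case (eng c d)
    then show ?case
      using df[of c "- d"] tensor_kernel_add tensor_kernel_minus neg by auto
  qed
  then show ?thesis by blast
qed

lemma tensor_class_eq: "Cls c = {k + c | k. k \<in> Ker}"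
  by (auto simp: tensor_class_def r_coset_def)

lemma tensor_class_self: "c \<in> Cls c"
  using tensor_kernel_zero by (force simp: tensor_class_eq)

lemma tensor_class_eq_iff: "Cls c = Cls d \<longleftrightarrow> c - d \<in> Ker"
proof
  assume "Cls c = Cls d"
  then have "c \<in> Cls d" using tensor_class_self by blast
  then show "c - d \<in> Ker" by (auto simp: tensor_class_eq)
next
  assume *: "c - d \<in> Ker"
  have "k + c = (k + (c - d)) + d" "k + d = (k - (c - d)) + c" for k by simp_all
  then show "Cls c = Cls d"
    unfolding tensor_class_eq
    using tensor_kernel_add[OF _ *] tensor_kernel_diff[OF _ *] by blast
qed

lemma tensor_class_mem_iff: "c \<in> Cls d \<longleftrightarrow> c - d \<in> Ker"
proof
  assume "c - d \<in> Ker"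
  moreover have "c = (c - d) + d" by simp
  ultimately show "c \<in> Cls d" unfolding tensor_class_eq by blast
qed (auto simp: tensor_class_eq)

lemma carrier_tensor_group:
  "carrier (tensor_group A M N) = Cls ` {c. Poly_Mapping.keys c \<subseteq> carrier M \<times> carrier N}"
  unfolding tensor_group_def tensor_class_def carrier_FactGroup
  by (rule image_cong) auto

lemma mult_tensor_group: "Cls c \<otimes>\<^bsub>tensor_group A M N\<^esub> Cls d = Cls (c + d)"
proof -
  have "Cls c \<otimes>\<^bsub>tensor_group A M N\<^esub> Cls d = {x + y | x y. x \<in> Cls c \<and> y \<in> Cls d}"
    by (auto simp: tensor_group_def FactGroup_def set_mult_def)
  also have "\<dots> = Cls (c + d)"
  proof (intro equalityI subsetI)
    fix z assume "z \<in> {x + y | x y. x \<in> Cls c \<and> y \<in> Cls d}"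
    then obtain x y where "z = x + y" "x - c \<in> Ker" "y - d \<in> Ker"
      by (auto simp: tensor_class_mem_iff)
    then show "z \<in> Cls (c + d)"
      using tensor_kernel_add[of "x - c" "y - d"]
      by (simp add: tensor_class_mem_iff algebra_simps)
  next
    fix z assume "z \<in> Cls (c + d)"
    then have "(z - d) - c \<in> Ker"
      by (simp add: tensor_class_mem_iff algebra_simps)
    then have "z - d \<in> Cls c" by (simp add: tensor_class_mem_iff)
    moreover have "z = (z - d) + d" by simp
    ultimately show "z \<in> {x + y | x y. x \<in> Cls c \<and> y \<in> Cls d}"
      using tensor_class_self by blast
  qed
  finally show ?thesis .
qed

lemma one_tensor_group: "\<one>\<^bsub>tensor_group A M N\<^esub> = Cls 0"
  by (auto simp: tensor_group_def tensor_class_eq FactGroup_def)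

lemma tensor_kernel_zero_left: "y \<in> carrier N \<Longrightarrow> frag_of (\<zero>\<^bsub>M\<^esub>, y) \<in> Ker"
  using tensor_kernel_minus[OF tensor_kernel_add_left[of "\<zero>\<^bsub>M\<^esub>" "\<zero>\<^bsub>M\<^esub>" y]] by simp

lemma tensor_kernel_zero_right: "x \<in> carrier M \<Longrightarrow> frag_of (x, \<zero>\<^bsub>N\<^esub>) \<in> Ker"
  using tensor_kernel_minus[OF tensor_kernel_add_right[of x "\<zero>\<^bsub>N\<^esub>" "\<zero>\<^bsub>N\<^esub>"]] by simp

end

text \<open>Linear maps send each relator to a relator of the same kind, so the union that defines
  \<open>tensor_map\<close> runs over one single coset.\<close>

lemma tensor_map_class:
  assumes "tensor_factors A M N" "tensor_factors A M' N'"
    and f: "f \<in> linear_maps A M M'" and g: "g \<in> linear_maps A N N'"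
  shows frag_pair_map_kernel: "c \<in> tensor_kernel A M N \<Longrightarrow> frag_pair_map f g c \<in> tensor_kernel A M' N'"
    and "tensor_map A M' N' f g (tensor_class A M N c) = tensor_class A M' N' (frag_pair_map f g c)"
proof -
  interpret S: tensor_factors A M N by fact
  interpret T: tensor_factors A M' N' by fact
  have fc: "f x \<in> carrier M'" if "x \<in> carrier M" for x
    using f that by (auto simp: linear_maps_def hom_def)
  have gc: "g x \<in> carrier N'" if "x \<in> carrier N" for x
    using g that by (auto simp: linear_maps_def hom_def)
  have fa: "f (x \<oplus>\<^bsub>M\<^esub> y) = f x \<oplus>\<^bsub>M'\<^esub> f y" if "x \<in> carrier M" "y \<in> carrier M" for x y
    using f that by (auto simp: linear_maps_def hom_def)
  have ga: "g (x \<oplus>\<^bsub>N\<^esub> y) = g x \<oplus>\<^bsub>N'\<^esub> g y" if "x \<in> carrier N" "y \<in> carrier N" for x y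
    using g that by (auto simp: linear_maps_def hom_def)
  show ker: "frag_pair_map f g c \<in> tensor_kernel A M' N'" if "c \<in> tensor_kernel A M N" for c
    using that
  proof (induct rule: S.tensor_kernel_induct)
    case (smult a x y)
    then show ?case
      using f g T.tensor_kernel_smult[of a "f x" "g y"]
      by (simp add: fc gc linear_maps_def)
  qed (simp_all add: fa ga fc gc T.tensor_kernel_add_left T.tensor_kernel_add_right T.tensor_kernel_diff)
  have "tensor_class A M' N' (frag_pair_map f g d) = tensor_class A M' N' (frag_pair_map f g c)"
    if "d \<in> tensor_class A M N c" for d
    using that ker[of "d - c"] by (simp add: S.tensor_class_mem_iff T.tensor_class_eq_iff)
  then show "tensor_map A M' N' f g (tensor_class A M N c) = tensor_class A M' N' (frag_pair_map f g c)"
    unfolding tensor_map_def frag_pair_map_def[symmetric]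
    using S.tensor_class_self[of c] by blast
qed

text \<open>Two classes are compared through the difference of their representatives, which is again
  in the free group. Flatness is used and proved in this form only, where no cosets remain.\<close>

lemma tensor_map_inj_on_iff:
  assumes "tensor_factors A M N" "tensor_factors A M' N'"
    and f: "f \<in> linear_maps A M M'" and g: "g \<in> linear_maps A N N'"
  shows "inj_on (tensor_map A M' N' f g) (carrier (tensor_group A M N)) \<longleftrightarrow>
    (\<forall>c. Poly_Mapping.keys c \<subseteq> carrier M \<times> carrier N \<longrightarrow>
      frag_pair_map f g c \<in> tensor_kernel A M' N' \<longrightarrow> c \<in> tensor_kernel A M N)"
proof -
  interpret S: tensor_factors A M N by fact
  interpret T: tensor_factors A M' N' by fact
  note map = tensor_map_class(2)[OF assms]
  show ?thesis
  proof (intro iffI allI impI)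
    fix c
    assume inj: "inj_on (tensor_map A M' N' f g) (carrier (tensor_group A M N))"
      and c: "Poly_Mapping.keys c \<subseteq> carrier M \<times> carrier N"
      and k: "frag_pair_map f g c \<in> tensor_kernel A M' N'"
    have "tensor_map A M' N' f g (tensor_class A M N c) = tensor_map A M' N' f g (tensor_class A M N 0)"
      using k by (simp add: map T.tensor_class_eq_iff)
    then have "tensor_class A M N c = tensor_class A M N 0"
      by (rule inj_onD[OF inj]) (use c in \<open>auto simp: S.carrier_tensor_group\<close>)
    then show "c \<in> tensor_kernel A M N" by (simp add: S.tensor_class_eq_iff)
  next
    assume *: "\<forall>c. Poly_Mapping.keys c \<subseteq> carrier M \<times> carrier N \<longrightarrow>
      frag_pair_map f g c \<in> tensor_kernel A M' N' \<longrightarrow> c \<in> tensor_kernel A M N"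
    show "inj_on (tensor_map A M' N' f g) (carrier (tensor_group A M N))"
    proof (rule inj_onI)
      fix P Q
      assume "P \<in> carrier (tensor_group A M N)" "Q \<in> carrier (tensor_group A M N)"
        and eq: "tensor_map A M' N' f g P = tensor_map A M' N' f g Q"
      then obtain c d where c: "P = tensor_class A M N c" "Poly_Mapping.keys c \<subseteq> carrier M \<times> carrier N"
        and d: "Q = tensor_class A M N d" "Poly_Mapping.keys d \<subseteq> carrier M \<times> carrier N"
        by (auto simp: S.carrier_tensor_group)
      have "frag_pair_map f g (c - d) \<in> tensor_kernel A M' N'"
        using eq by (simp add: c d map T.tensor_class_eq_iff)
      then have "c - d \<in> tensor_kernel A M N"
        using * keys_diff_subset[OF c(2) d(2)] by blast
      then show "P = Q" by (simp add: c d S.tensor_class_eq_iff)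
    qed
  qed
qed

lemma opposite_ring_simps [simp]:
  "carrier (opposite_ring R) = carrier R"
  "x \<otimes>\<^bsub>opposite_ring R\<^esub> y = y \<otimes>\<^bsub>R\<^esub> x"
  "\<one>\<^bsub>opposite_ring R\<^esub> = \<one>\<^bsub>R\<^esub>"
  "\<zero>\<^bsub>opposite_ring R\<^esub> = \<zero>\<^bsub>R\<^esub>"
  "x \<oplus>\<^bsub>opposite_ring R\<^esub> y = x \<oplus>\<^bsub>R\<^esub> y"
  "opposite_ring (opposite_ring R) = R"
  by (simp_all add: opposite_ring_def)

lemma opposite_ring_additive [simp]:
  "finsum (opposite_ring R) = finsum R"
  "a_inv (opposite_ring R) = a_inv R"
  "a_minus (opposite_ring R) = a_minus R"
  unfolding finsum_def[abs_def] a_inv_def[abs_def] a_minus_def[abs_def] opposite_ring_def by simp_all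

text \<open>Exchanging the factors interchanges the two kinds of additivity relators and sends a
  scalar relator to the negative of one.\<close>

lemma tensor_kernel_opposite:
  assumes "tensor_factors A M N" "c \<in> tensor_kernel A M N"
  shows "frag_extend (frag_of \<circ> prod.swap) c \<in> tensor_kernel (opposite_ring A) N M"
proof -
  interpret S: tensor_factors A M N by fact
  interpret T: tensor_factors "opposite_ring A" N M
    by unfold_locales (simp_all add: S.left_smult_closed S.right_smult_closed)
  show ?thesis
    using assms(2)
  proof (induct rule: S.tensor_kernel_induct)
    case (smult a x y)
    then show ?case
      using T.tensor_kernel_minus[OF T.tensor_kernel_smult[of a y x]]
      by (simp add: frag_extend_diff)
  qed (simp_all add: frag_extend_diff T.tensor_kernel_add_left T.tensor_kernel_add_right T.tensor_kernel_diff)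
qed

lemma frag_extend_swap_swap [simp]:
  "frag_extend (frag_of \<circ> prod.swap) (frag_extend (frag_of \<circ> prod.swap) c) = c"
  using frag_extend_compose[of "frag_of \<circ> prod.swap" prod.swap c] frag_expansion[of c]
  by (simp add: comp_assoc)

lemma linear_maps_id: "(\<lambda>x. x) \<in> linear_maps A M M"
  by (auto simp: linear_maps_def hom_def)

lemma tensor_factorsI:
  assumes "right_module A N" "left_module A M"
  shows "tensor_factors A N M"
proof -
  interpret N: left_module "opposite_ring A" N using assms by (simp add: right_module_def)
  interpret M: left_module A M by fact
  show ?thesis
    by unfold_locales (use N.smult_closed in auto)
qed

text \<open>The exchange of factors is an involution that commutes with induced maps, so injectivity
  passes from one side to the other. With this, all real work can be done for left modules.\<close>

lemma flat_right_module_opposite: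
  assumes "flat_left_module TYPE('n) (opposite_ring A) M"
  shows "flat_right_module TYPE('n) A M"
  unfolding flat_right_module_def
proof (intro conjI allI impI; (elim conjE)?)
  show M: "right_module A M"
    using assms by (simp add: flat_left_module_def right_module_def)
  fix N N' :: "('a, 'n) module" and f
  assume N: "left_module A N" and N': "left_module A N'"
    and f: "f \<in> linear_maps A N N'" and inj: "inj_on f (carrier N)"
  let ?sw = "\<lambda>c. frag_extend (frag_of \<circ> prod.swap) c"
  have f': "f \<in> linear_maps (opposite_ring A) N N'"
    using f by (simp add: linear_maps_def)
  have oM: "left_module (opposite_ring A) M" using M by (simp add: right_module_def)
  have oN: "right_module (opposite_ring A) N" "right_module (opposite_ring A) N'"
    using N N' by (simp_all add: right_module_def)
  have "inj_on (tensor_map (opposite_ring A) N' M f (\<lambda>x. x)) (carrier (tensor_group (opposite_ring A) N M))"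
    using assms f' oN inj unfolding flat_left_module_def by blast
  then have *: "\<And>c. \<lbrakk>Poly_Mapping.keys c \<subseteq> carrier N \<times> carrier M;
      frag_pair_map f (\<lambda>x. x) c \<in> tensor_kernel (opposite_ring A) N' M\<rbrakk> \<Longrightarrow> c \<in> tensor_kernel (opposite_ring A) N M"
    using tensor_map_inj_on_iff[OF tensor_factorsI[OF oN(1) oM] tensor_factorsI[OF oN(2) oM] f' linear_maps_id]
    by blast
  show "inj_on (tensor_map A M N' (\<lambda>x. x) f) (carrier (tensor_group A M N))"
    unfolding tensor_map_inj_on_iff[OF tensor_factorsI[OF M N] tensor_factorsI[OF M N'] linear_maps_id f]
  proof (intro allI impI)
    fix c
    assume c: "Poly_Mapping.keys c \<subseteq> carrier M \<times> carrier N"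
      and k: "frag_pair_map (\<lambda>x. x) f c \<in> tensor_kernel A M N'"
    have "?sw (frag_pair_map (\<lambda>x. x) f c) = frag_pair_map f (\<lambda>x. x) (?sw c)"
      using c by (induct c rule: frag_induction) (auto simp: frag_extend_diff)
    then have "frag_pair_map f (\<lambda>x. x) (?sw c) \<in> tensor_kernel (opposite_ring A) N' M"
      using tensor_kernel_opposite[OF tensor_factorsI[OF M N'] k] by simp
    moreover have "Poly_Mapping.keys (?sw c) \<subseteq> carrier N \<times> carrier M"
      by (rule keys_frag_extend_subset[OF c]) auto
    ultimately have "?sw c \<in> tensor_kernel (opposite_ring A) N M" using * by blast
    then have "?sw (?sw c) \<in> tensor_kernel (opposite_ring (opposite_ring A)) M N"
      by (rule tensor_kernel_opposite[OF tensor_factorsI[OF oN(1) oM]])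
    then show "c \<in> tensor_kernel A M N" by simp
  qed
qed

subsection \<open>The equational criterion for flatness\<close>

text \<open>A vector over \<open>M\<close> killed by a finite matrix over \<open>A\<close> is a
  combination of vectors over \<open>A\<close> killed by the same matrix. The vector is encoded as
  the set \<open>L\<close> of its entries, each entry being its own index; the rows in
  \<open>P\<close> and the solutions in \<open>G\<close> are functions on \<open>L\<close>. No
  auxiliary index types appear.\<close>

definition equationally_flat :: "('a, 'z) ring_scheme \<Rightarrow> ('a, 'm, 'y) module_scheme \<Rightarrow> bool"
  where "equationally_flat A M \<longleftrightarrow> (\<forall>L P. finite L \<and> L \<subseteq> carrier M \<and> finite P \<and>
     (\<forall>\<rho>\<in>P. \<rho> \<in> L \<rightarrow> carrier A \<and> (\<Oplus>\<^bsub>M\<^esub>l\<in>L. \<rho> l \<odot>\<^bsub>M\<^esub> l) = \<zero>\<^bsub>M\<^esub>) \<longrightarrow>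
     (\<exists>G t. finite G \<and>
        (\<forall>g\<in>G. g \<in> L \<rightarrow> carrier A \<and> (\<forall>\<rho>\<in>P. (\<Oplus>\<^bsub>A\<^esub>l\<in>L. \<rho> l \<otimes>\<^bsub>A\<^esub> g l) = \<zero>\<^bsub>A\<^esub>)) \<and>
        t \<in> G \<rightarrow> carrier M \<and> (\<forall>l\<in>L. l = (\<Oplus>\<^bsub>M\<^esub>g\<in>G. g l \<odot>\<^bsub>M\<^esub> t g))))"

context left_module
begin

lemma smult_zero_left [simp]: "x \<in> carrier M \<Longrightarrow> \<zero>\<^bsub>R\<^esub> \<odot>\<^bsub>M\<^esub> x = \<zero>\<^bsub>M\<^esub>"
  using smult_l_distr[of "\<zero>\<^bsub>R\<^esub>" "\<zero>\<^bsub>R\<^esub>" x] M.add.r_cancel_one by simp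

lemma smult_zero_right [simp]: "a \<in> carrier R \<Longrightarrow> a \<odot>\<^bsub>M\<^esub> \<zero>\<^bsub>M\<^esub> = \<zero>\<^bsub>M\<^esub>"
  using smult_r_distr[of a "\<zero>\<^bsub>M\<^esub>" "\<zero>\<^bsub>M\<^esub>"] M.add.r_cancel_one by simp

lemma smult_minus_left:
  "\<lbrakk>a \<in> carrier R; x \<in> carrier M\<rbrakk> \<Longrightarrow> (\<ominus>\<^bsub>R\<^esub> a) \<odot>\<^bsub>M\<^esub> x = \<ominus>\<^bsub>M\<^esub> (a \<odot>\<^bsub>M\<^esub> x)"
  using smult_l_distr[of "\<ominus>\<^bsub>R\<^esub> a" a x] by (simp add: R.l_neg M.minus_equality)

lemma smult_minus_right:
  "\<lbrakk>a \<in> carrier R; x \<in> carrier M\<rbrakk> \<Longrightarrow> a \<odot>\<^bsub>M\<^esub> (\<ominus>\<^bsub>M\<^esub> x) = \<ominus>\<^bsub>M\<^esub> (a \<odot>\<^bsub>M\<^esub> x)"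
  using smult_r_distr[of a "\<ominus>\<^bsub>M\<^esub> x" x] by (simp add: M.l_neg M.minus_equality)

end

lemmas free_induct = free_Abelian_group_induct[consumes 1, case_names zero diff one]

lemma (in abelian_group) finsum_indicator:
  assumes "finite L" "y \<in> L" "f \<in> L \<rightarrow> carrier G"
  shows "(\<Oplus>l\<in>L. if l = y then f l else \<zero>) = f y"
proof -
  have "(\<Oplus>l\<in>L. if l = y then f l else \<zero>) = (\<Oplus>l\<in>L. if y = l then f l else \<zero>)"
    by (rule finsum_cong') (use assms in auto)
  then show ?thesis using finsum_singleton[OF assms(2,1,3)] by simp
qed

lemma (in abelian_group) finsum_minus:
  assumes "finite L" "f \<in> L \<rightarrow> carrier G"
  shows "(\<Oplus>l\<in>L. \<ominus> f l) = \<ominus> (\<Oplus>l\<in>L. f l)"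
proof -
  have "(\<Oplus>l\<in>L. \<ominus> f l) \<oplus> (\<Oplus>l\<in>L. f l) = (\<Oplus>l\<in>L. \<ominus> f l \<oplus> f l)"
    by (subst finsum_addf) (use assms in auto)
  also have "\<dots> = \<zero>"
    using assms by (intro add.finprod_one_eqI) (auto simp: l_neg Pi_iff)
  finally show ?thesis
    using assms by (intro minus_equality[symmetric] finsum_closed) auto
qed

text \<open>A tensor vanishes only because of finitely many relations among the right-hand factors that
  occur in it; hence it is killed by every map that sends these factors to scalars satisfying the
  same relations.\<close>

lemma tensor_kernel_finitely_many_relations:
  assumes N: "right_module A N" and M: "left_module A M" and c: "c \<in> tensor_kernel A N M"
  shows "\<exists>L\<^sub>0 P. finite L\<^sub>0 \<and> L\<^sub>0 \<subseteq> carrier M \<and> finite P \<and> (\<forall>\<rho>\<in>P. \<rho> \<in> carrier M \<rightarrow> carrier A) \<and>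
    (\<forall>L. finite L \<and> L\<^sub>0 \<subseteq> L \<and> L \<subseteq> carrier M \<longrightarrow>
      (\<forall>\<rho>\<in>P. (\<Oplus>\<^bsub>M\<^esub>l\<in>L. \<rho> l \<odot>\<^bsub>M\<^esub> l) = \<zero>\<^bsub>M\<^esub>) \<and>
      Poly_Mapping.keys c \<subseteq> carrier N \<times> L \<and>
      (\<forall>g h. g \<in> L \<rightarrow> carrier A \<and> (\<forall>\<rho>\<in>P. (\<Oplus>\<^bsub>A\<^esub>l\<in>L. \<rho> l \<otimes>\<^bsub>A\<^esub> g l) = \<zero>\<^bsub>A\<^esub>) \<and>
         h \<in> hom (free_Abelian_group (carrier N \<times> L)) (add_monoid N) \<and>
         (\<forall>n\<in>carrier N. \<forall>l\<in>L. h (frag_of (n, l)) = g l \<odot>\<^bsub>N\<^esub> n) \<longrightarrow> h c = \<zero>\<^bsub>N\<^esub>))"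
    (is "\<exists>L\<^sub>0 P. ?Q L\<^sub>0 P c")
proof -
  interpret M: left_module A M by fact
  interpret N: left_module "opposite_ring A" N using N by (simp add: right_module_def)
  interpret T: tensor_factors A N M by (rule tensor_factorsI[OF N M])
  have Nsmult [simp]: "g \<odot>\<^bsub>N\<^esub> n \<in> carrier N" if "g \<in> carrier A" "n \<in> carrier N" for g n
    using N.smult_closed that by simp
  let ?\<delta> = "\<lambda>y l. if l = y then \<one>\<^bsub>A\<^esub> else \<zero>\<^bsub>A\<^esub>"
  have homdiff: "h (x - y) = h x \<ominus>\<^bsub>N\<^esub> h y" "h x \<in> carrier N" "h 0 = \<zero>\<^bsub>N\<^esub>"
    if h: "h \<in> hom (free_Abelian_group (carrier N \<times> L)) (add_monoid N)"
      and x: "Poly_Mapping.keys x \<subseteq> carrier N \<times> L" and y: "Poly_Mapping.keys y \<subseteq> carrier N \<times> L"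
    for h L x y
  proof -
    interpret h: group_hom "free_Abelian_group (carrier N \<times> L)" "add_monoid N" h
      by (intro group_hom.intro group_hom_axioms.intro h group_free_Abelian_group N.a_group)
    have xc: "h x \<in> carrier N" "h y \<in> carrier N"
      using h.hom_closed[of x] h.hom_closed[of y] x y by auto
    then show "h x \<in> carrier N" by simp
    show "h 0 = \<zero>\<^bsub>N\<^esub>" using h.hom_one by simp
    have "h (x + - y) = h x \<oplus>\<^bsub>N\<^esub> h (- y)"
      using h.hom_mult[of x "- y"] x y by simp
    moreover have "h (- y) = \<ominus>\<^bsub>N\<^esub> h y"
      using h.hom_inv[of y] y by (simp add: a_inv_def)
    ultimately show "h (x - y) = h x \<ominus>\<^bsub>N\<^esub> h y" by (simp add: a_minus_def)
  qed
  show ?thesis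
    using c
  proof (induct rule: T.tensor_kernel_induct)
    case zero
    have "?Q {} {} 0" by (auto intro: homdiff(3)[of _ _ 0 0])
    then show ?case by (intro exI)
  next
    case (add_left n n' l)
    \<comment> \<open>Additivity in the left factor says nothing about the right-hand factors, so
      there is no relation to record.\<close>
    have "?Q {l} {} (frag_of (n \<oplus>\<^bsub>N\<^esub> n', l) - frag_of (n, l) - frag_of (n', l))"
    proof (intro conjI allI impI ballI; (elim conjE)?)
      fix L g h
      assume L: "{l} \<subseteq> L" "L \<subseteq> carrier M" and g: "g \<in> L \<rightarrow> carrier A"
        and h: "h \<in> hom (free_Abelian_group (carrier N \<times> L)) (add_monoid N)"
        and eq: "\<forall>n\<in>carrier N. \<forall>l\<in>L. h (frag_of (n, l)) = g l \<odot>\<^bsub>N\<^esub> n"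
      have gl: "g l \<in> carrier A" "l \<in> L" using g L by auto
      show "h (frag_of (n \<oplus>\<^bsub>N\<^esub> n', l) - frag_of (n, l) - frag_of (n', l)) = \<zero>\<^bsub>N\<^esub>"
        using add_left gl L N.smult_r_distr[of "g l" n n'] eq
        by (simp add: homdiff(1)[OF h] keys_diff_subset)
           (simp add: a_minus_def N.M.minus_add N.M.a_ac N.M.r_neg N.M.r_neg1 N.M.r_neg2)
    qed (use add_left in \<open>auto dest!: subsetD[OF keys_diff]\<close>)
    then show ?case by (intro exI)
  next
    case (add_right n y y')
    \<comment> \<open>This is the relation (y + y') - y - y' = 0. Indicator functions are added
      rather than selected by cases, so that coincidences among the three elements do no
      harm.\<close>
    define \<rho> where "\<rho> = (\<lambda>l. ?\<delta> (y \<oplus>\<^bsub>M\<^esub> y') l \<oplus>\<^bsub>A\<^esub> ((\<ominus>\<^bsub>A\<^esub> ?\<delta> y l) \<oplus>\<^bsub>A\<^esub> (\<ominus>\<^bsub>A\<^esub> ?\<delta> y' l)))"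
    have "?Q {y \<oplus>\<^bsub>M\<^esub> y', y, y'} {\<rho>} (frag_of (n, y \<oplus>\<^bsub>M\<^esub> y') - frag_of (n, y) - frag_of (n, y'))"
    proof (intro conjI allI impI ballI; (elim conjE)?)
      fix L \<rho>'
      assume L: "finite L" "{y \<oplus>\<^bsub>M\<^esub> y', y, y'} \<subseteq> L" "L \<subseteq> carrier M" and "\<rho>' \<in> {\<rho>}"
      have "(\<Oplus>\<^bsub>M\<^esub>l\<in>L. \<rho> l \<odot>\<^bsub>M\<^esub> l) =
          (\<Oplus>\<^bsub>M\<^esub>l\<in>L. (if l = y \<oplus>\<^bsub>M\<^esub> y' then l else \<zero>\<^bsub>M\<^esub>) \<oplus>\<^bsub>M\<^esub>
             ((\<ominus>\<^bsub>M\<^esub> (if l = y then l else \<zero>\<^bsub>M\<^esub>)) \<oplus>\<^bsub>M\<^esub> (\<ominus>\<^bsub>M\<^esub> (if l = y' then l else \<zero>\<^bsub>M\<^esub>))))"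
      proof (intro M.M.finsum_cong' refl)
        fix l assume "l \<in> L"
        then have l: "l \<in> carrier M" using L by blast
        have \<delta>: "?\<delta> z l \<in> carrier A" "?\<delta> z l \<odot>\<^bsub>M\<^esub> l = (if l = z then l else \<zero>\<^bsub>M\<^esub>)" for z
          using l by (cases "l = z"; simp)+
        show "\<rho> l \<odot>\<^bsub>M\<^esub> l = (if l = y \<oplus>\<^bsub>M\<^esub> y' then l else \<zero>\<^bsub>M\<^esub>) \<oplus>\<^bsub>M\<^esub>
             ((\<ominus>\<^bsub>M\<^esub> (if l = y then l else \<zero>\<^bsub>M\<^esub>)) \<oplus>\<^bsub>M\<^esub> (\<ominus>\<^bsub>M\<^esub> (if l = y' then l else \<zero>\<^bsub>M\<^esub>)))"
          unfolding \<rho>_def by (simp only: M.smult_l_distr M.smult_minus_left \<delta> l M.R.a_closed M.R.a_inv_closed)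
      qed (intro Pi_I M.M.a_closed M.M.a_inv_closed; use L(3) in auto)
      also have "\<dots> = (y \<oplus>\<^bsub>M\<^esub> y') \<oplus>\<^bsub>M\<^esub> ((\<ominus>\<^bsub>M\<^esub> y) \<oplus>\<^bsub>M\<^esub> (\<ominus>\<^bsub>M\<^esub> y'))"
      proof -
        have "(\<lambda>l. l) \<in> L \<rightarrow> carrier M" using L by auto
        then show ?thesis
          using L add_right
          by (subst M.M.finsum_addf, force, force, subst M.M.finsum_addf, force, force,
              subst M.M.finsum_minus, simp, force, subst M.M.finsum_minus, simp, force)
             (simp add: M.M.finsum_indicator)
      qed
      also have "\<dots> = \<zero>\<^bsub>M\<^esub>"
        using add_right by (simp add: M.M.minus_add[symmetric] M.M.r_neg)
      finally show "(\<Oplus>\<^bsub>M\<^esub>l\<in>L. \<rho>' l \<odot>\<^bsub>M\<^esub> l) = \<zero>\<^bsub>M\<^esub>" using \<open>\<rho>' \<in> {\<rho>}\<close> by simp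
    next
      fix L g h
      assume L: "finite L" "{y \<oplus>\<^bsub>M\<^esub> y', y, y'} \<subseteq> L" "L \<subseteq> carrier M" and g: "g \<in> L \<rightarrow> carrier A"
        and h: "h \<in> hom (free_Abelian_group (carrier N \<times> L)) (add_monoid N)"
        and eq: "\<forall>n\<in>carrier N. \<forall>l\<in>L. h (frag_of (n, l)) = g l \<odot>\<^bsub>N\<^esub> n"
        and rel: "\<forall>\<rho>\<in>{\<rho>}. (\<Oplus>\<^bsub>A\<^esub>l\<in>L. \<rho> l \<otimes>\<^bsub>A\<^esub> g l) = \<zero>\<^bsub>A\<^esub>"
      have gl: "g y \<in> carrier A" "g y' \<in> carrier A" "g (y \<oplus>\<^bsub>M\<^esub> y') \<in> carrier A"
        using g L by auto
      have gL: "\<And>l. l \<in> L \<Longrightarrow> g l \<in> carrier A" using g by auto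
      have "\<zero>\<^bsub>A\<^esub> = (\<Oplus>\<^bsub>A\<^esub>l\<in>L. \<rho> l \<otimes>\<^bsub>A\<^esub> g l)"
        using rel by simp
      also have "\<dots> = (\<Oplus>\<^bsub>A\<^esub>l\<in>L. (if l = y \<oplus>\<^bsub>M\<^esub> y' then g l else \<zero>\<^bsub>A\<^esub>) \<oplus>\<^bsub>A\<^esub>
             ((\<ominus>\<^bsub>A\<^esub> (if l = y then g l else \<zero>\<^bsub>A\<^esub>)) \<oplus>\<^bsub>A\<^esub> (\<ominus>\<^bsub>A\<^esub> (if l = y' then g l else \<zero>\<^bsub>A\<^esub>))))"
      proof (intro M.R.finsum_cong' refl)
        fix l assume "l \<in> L"
        then have l: "g l \<in> carrier A" using gL by blast
        have \<delta>: "?\<delta> z l \<in> carrier A" "?\<delta> z l \<otimes>\<^bsub>A\<^esub> g l = (if l = z then g l else \<zero>\<^bsub>A\<^esub>)" for z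
          using l by (cases "l = z"; simp)+
        show "\<rho> l \<otimes>\<^bsub>A\<^esub> g l = (if l = y \<oplus>\<^bsub>M\<^esub> y' then g l else \<zero>\<^bsub>A\<^esub>) \<oplus>\<^bsub>A\<^esub>
             ((\<ominus>\<^bsub>A\<^esub> (if l = y then g l else \<zero>\<^bsub>A\<^esub>)) \<oplus>\<^bsub>A\<^esub> (\<ominus>\<^bsub>A\<^esub> (if l = y' then g l else \<zero>\<^bsub>A\<^esub>)))"
          unfolding \<rho>_def by (simp only: M.R.l_distr M.R.l_minus \<delta> l M.R.a_closed M.R.a_inv_closed)
      qed (intro Pi_I M.R.a_closed M.R.a_inv_closed; use gL in auto)
      also have "\<dots> = g (y \<oplus>\<^bsub>M\<^esub> y') \<oplus>\<^bsub>A\<^esub> ((\<ominus>\<^bsub>A\<^esub> g y) \<oplus>\<^bsub>A\<^esub> (\<ominus>\<^bsub>A\<^esub> g y'))"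
        using L gL g
        by (subst M.R.finsum_addf, force, force, subst M.R.finsum_addf, force, force,
            subst M.R.finsum_minus, simp, force, subst M.R.finsum_minus, simp, force)
           (simp add: M.R.finsum_indicator)
      finally have "g (y \<oplus>\<^bsub>M\<^esub> y') \<ominus>\<^bsub>A\<^esub> (g y \<oplus>\<^bsub>A\<^esub> g y') = \<zero>\<^bsub>A\<^esub>"
        using gl by (simp add: M.R.minus_eq M.R.minus_add)
      then have "g (y \<oplus>\<^bsub>M\<^esub> y') = g y \<oplus>\<^bsub>A\<^esub> g y'"
        using gl M.R.r_right_minus_eq by simp
      then show "h (frag_of (n, y \<oplus>\<^bsub>M\<^esub> y') - frag_of (n, y) - frag_of (n, y')) = \<zero>\<^bsub>N\<^esub>"
        using add_right gl L N.smult_l_distr[of "g y" "g y'" n] eq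
        by (simp add: homdiff(1)[OF h] keys_diff_subset)
           (simp add: a_minus_def N.M.minus_add N.M.a_ac N.M.r_neg N.M.r_neg1 N.M.r_neg2)
    qed (use add_right in \<open>auto simp: \<rho>_def dest!: subsetD[OF keys_diff]\<close>)
    then show ?case by (intro exI)
  next
    case (smult a n y)
    have aM: "a \<odot>\<^bsub>M\<^esub> y \<in> carrier M" using smult by simp
    \<comment> \<open>The relation is 1 (a y) - a y = 0, again as a sum of indicators because a y
      may equal y.\<close>
    define \<rho> where "\<rho> = (\<lambda>l. ?\<delta> (a \<odot>\<^bsub>M\<^esub> y) l \<oplus>\<^bsub>A\<^esub> (\<ominus>\<^bsub>A\<^esub> (if l = y then a else \<zero>\<^bsub>A\<^esub>)))"
    have "?Q {a \<odot>\<^bsub>M\<^esub> y, y} {\<rho>} (frag_of (a \<odot>\<^bsub>N\<^esub> n, y) - frag_of (n, a \<odot>\<^bsub>M\<^esub> y))"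
    proof (intro conjI allI impI ballI; (elim conjE)?)
      fix L \<rho>'
      assume L: "finite L" "{a \<odot>\<^bsub>M\<^esub> y, y} \<subseteq> L" "L \<subseteq> carrier M" and "\<rho>' \<in> {\<rho>}"
      have "(\<Oplus>\<^bsub>M\<^esub>l\<in>L. \<rho> l \<odot>\<^bsub>M\<^esub> l) =
          (\<Oplus>\<^bsub>M\<^esub>l\<in>L. (if l = a \<odot>\<^bsub>M\<^esub> y then l else \<zero>\<^bsub>M\<^esub>) \<oplus>\<^bsub>M\<^esub>
             (\<ominus>\<^bsub>M\<^esub> (if l = y then a \<odot>\<^bsub>M\<^esub> l else \<zero>\<^bsub>M\<^esub>)))"
        using L smult by (intro M.M.finsum_cong') (auto simp: \<rho>_def M.smult_l_distr M.smult_minus_left subset_iff)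
      also have "\<dots> = (a \<odot>\<^bsub>M\<^esub> y) \<oplus>\<^bsub>M\<^esub> (\<ominus>\<^bsub>M\<^esub> (a \<odot>\<^bsub>M\<^esub> y))"
      proof -
        have "(\<lambda>l. l) \<in> L \<rightarrow> carrier M" "(\<lambda>l. a \<odot>\<^bsub>M\<^esub> l) \<in> L \<rightarrow> carrier M" using L smult by auto
        then show ?thesis
          using L smult
          by (subst M.M.finsum_addf, force, force, subst M.M.finsum_minus, simp, force)
             (simp add: M.M.finsum_indicator)
      qed
      also have "\<dots> = \<zero>\<^bsub>M\<^esub>"
        using aM by (simp add: M.M.r_neg)
      finally show "(\<Oplus>\<^bsub>M\<^esub>l\<in>L. \<rho>' l \<odot>\<^bsub>M\<^esub> l) = \<zero>\<^bsub>M\<^esub>" using \<open>\<rho>' \<in> {\<rho>}\<close> by simp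
    next
      fix L g h
      assume L: "finite L" "{a \<odot>\<^bsub>M\<^esub> y, y} \<subseteq> L" "L \<subseteq> carrier M" and g: "g \<in> L \<rightarrow> carrier A"
        and h: "h \<in> hom (free_Abelian_group (carrier N \<times> L)) (add_monoid N)"
        and eq: "\<forall>n\<in>carrier N. \<forall>l\<in>L. h (frag_of (n, l)) = g l \<odot>\<^bsub>N\<^esub> n"
        and rel: "\<forall>\<rho>\<in>{\<rho>}. (\<Oplus>\<^bsub>A\<^esub>l\<in>L. \<rho> l \<otimes>\<^bsub>A\<^esub> g l) = \<zero>\<^bsub>A\<^esub>"
      have gl: "g y \<in> carrier A" "g (a \<odot>\<^bsub>M\<^esub> y) \<in> carrier A"
        using g L by auto
      have gL: "\<And>l. l \<in> L \<Longrightarrow> g l \<in> carrier A" using g by auto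
      have "\<zero>\<^bsub>A\<^esub> = (\<Oplus>\<^bsub>A\<^esub>l\<in>L. \<rho> l \<otimes>\<^bsub>A\<^esub> g l)"
        using rel by simp
      also have "\<dots> = (\<Oplus>\<^bsub>A\<^esub>l\<in>L. (if l = a \<odot>\<^bsub>M\<^esub> y then g l else \<zero>\<^bsub>A\<^esub>) \<oplus>\<^bsub>A\<^esub>
             (\<ominus>\<^bsub>A\<^esub> (if l = y then a \<otimes>\<^bsub>A\<^esub> g l else \<zero>\<^bsub>A\<^esub>)))"
        using gL smult by (intro M.R.finsum_cong') (auto simp: \<rho>_def M.R.l_distr M.R.l_minus)
      also have "\<dots> = g (a \<odot>\<^bsub>M\<^esub> y) \<oplus>\<^bsub>A\<^esub> (\<ominus>\<^bsub>A\<^esub> (a \<otimes>\<^bsub>A\<^esub> g y))"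
      proof -
        have "(\<lambda>l. a \<otimes>\<^bsub>A\<^esub> g l) \<in> L \<rightarrow> carrier A" using gL smult by auto
        then show ?thesis
          using L gL g smult
          by (subst M.R.finsum_addf, force, force, subst M.R.finsum_minus, simp, force)
             (simp add: M.R.finsum_indicator)
      qed
      finally have "g (a \<odot>\<^bsub>M\<^esub> y) \<ominus>\<^bsub>A\<^esub> (a \<otimes>\<^bsub>A\<^esub> g y) = \<zero>\<^bsub>A\<^esub>"
        by (simp add: M.R.minus_eq)
      then have "g (a \<odot>\<^bsub>M\<^esub> y) = a \<otimes>\<^bsub>A\<^esub> g y"
        using gl smult M.R.r_right_minus_eq by simp
      then show "h (frag_of (a \<odot>\<^bsub>N\<^esub> n, y) - frag_of (n, a \<odot>\<^bsub>M\<^esub> y)) = \<zero>\<^bsub>N\<^esub>"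
        using smult gl L N.smult_assoc1[of "g y" a n] eq
        by (simp add: homdiff(1)[OF h] keys_diff_subset) (simp add: a_minus_def N.M.r_neg)
    qed (use smult in \<open>auto simp: \<rho>_def dest!: subsetD[OF keys_diff]\<close>)
    then show ?case by (intro exI)
  next
    case (diff c d)
    then obtain L1 P1 L2 P2 where Q1: "?Q L1 P1 c" and Q2: "?Q L2 P2 d" by (elim exE)
    \<comment> \<open>Here it pays that the claim quantifies over all finite \<open>L\<close> above
      \<open>L\<^sub>0\<close>: both hypotheses apply to the same larger \<open>L\<close>.\<close>
    have "?Q (L1 \<union> L2) (P1 \<union> P2) (c - d)"
    proof (intro conjI allI impI ballI; (elim conjE)?)
      fix L
      assume L: "finite L" "L1 \<union> L2 \<subseteq> L" "L \<subseteq> carrier M"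
      then have k: "Poly_Mapping.keys c \<subseteq> carrier N \<times> L" "Poly_Mapping.keys d \<subseteq> carrier N \<times> L"
        using Q1 Q2 by simp_all
      then show "Poly_Mapping.keys (c - d) \<subseteq> carrier N \<times> L" by (rule keys_diff_subset)
      fix g h
      assume g: "g \<in> L \<rightarrow> carrier A"
        and h: "h \<in> hom (free_Abelian_group (carrier N \<times> L)) (add_monoid N)"
        and eq: "\<forall>n\<in>carrier N. \<forall>l\<in>L. h (frag_of (n, l)) = g l \<odot>\<^bsub>N\<^esub> n"
        and rel: "\<forall>\<rho>\<in>P1 \<union> P2. (\<Oplus>\<^bsub>A\<^esub>l\<in>L. \<rho> l \<otimes>\<^bsub>A\<^esub> g l) = \<zero>\<^bsub>A\<^esub>"
      have L1: "finite L \<and> L1 \<subseteq> L \<and> L \<subseteq> carrier M" "finite L \<and> L2 \<subseteq> L \<and> L \<subseteq> carrier M"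
        using L by auto
      note q1 = mp[OF spec[OF conjunct2[OF conjunct2[OF conjunct2[OF conjunct2[OF Q1]]]]] L1(1)]
      note q2 = mp[OF spec[OF conjunct2[OF conjunct2[OF conjunct2[OF conjunct2[OF Q2]]]]] L1(2)]
      have "h c = \<zero>\<^bsub>N\<^esub>"
        by (rule mp[OF spec[OF spec[OF conjunct2[OF conjunct2[OF q1]], of g], of h]])
           (intro conjI ballI; use g h eq rel in simp)
      moreover have "h d = \<zero>\<^bsub>N\<^esub>"
        by (rule mp[OF spec[OF spec[OF conjunct2[OF conjunct2[OF q2]], of g], of h]])
           (intro conjI ballI; use g h eq rel in simp)
      ultimately
      show "h (c - d) = \<zero>\<^bsub>N\<^esub>" using homdiff(1)[OF h k] by (simp add: a_minus_def)
    qed (use Q1 Q2 in auto)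
    then show ?case by (intro exI)
  qed
qed

text \<open>Each solution \<open>g\<close> defines a contraction \<open>H g\<close> sending n tensor
  l to g(l) n. Applied after \<open>f\<close>, it kills the image of \<open>c\<close>, because only
  finitely many relations made that image vanish; so \<open>H g c = 0\<close> by injectivity of
  \<open>f\<close>. Writing l as the sum of the g(l) t(g) shows that \<open>c\<close> is congruent
  to the sum of the \<open>H g c\<close> tensor t(g), which is zero.\<close>

lemma equationally_flat_imp_flat:
  assumes M: "left_module A M" and flat: "equationally_flat A M"
  shows "flat_left_module TYPE('n) A M"
  unfolding flat_left_module_def
proof (intro conjI M allI impI; (elim conjE)?)
  fix N N' :: "('a, 'n) module" and f
  assume N: "right_module A N" and N': "right_module A N'"
    and f: "f \<in> linear_maps A N N'" and inj: "inj_on f (carrier N)"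
  interpret M: left_module A M by fact
  interpret N: left_module "opposite_ring A" N using N by (simp add: right_module_def)
  interpret N': left_module "opposite_ring A" N' using N' by (simp add: right_module_def)
  interpret T: tensor_factors A N M by (rule tensor_factorsI[OF N M])
  interpret T': tensor_factors A N' M by (rule tensor_factorsI[OF N' M])
  have f_closed: "f n \<in> carrier N'" if "n \<in> carrier N" for n
    using f that by (auto simp: linear_maps_def hom_def)
  have f_add: "f (n \<oplus>\<^bsub>N\<^esub> n') = f n \<oplus>\<^bsub>N'\<^esub> f n'" if "n \<in> carrier N" "n' \<in> carrier N" for n n'
    using f that by (auto simp: linear_maps_def hom_def)
  have f_smult: "f (a \<odot>\<^bsub>N\<^esub> n) = a \<odot>\<^bsub>N'\<^esub> f n" if "a \<in> carrier A" "n \<in> carrier N" for a n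
    using f that by (auto simp: linear_maps_def)
  interpret f: abelian_group_hom N N' f
    by (intro abelian_group_homI N.abelian_group_axioms N'.abelian_group_axioms)
       (use f in \<open>auto simp: linear_maps_def group_hom_def group_hom_axioms_def N.a_group N'.a_group\<close>)
  show "inj_on (tensor_map A N' M f (\<lambda>x. x)) (carrier (tensor_group A N M))"
    unfolding tensor_map_inj_on_iff[OF T.tensor_factors_axioms T'.tensor_factors_axioms f linear_maps_id]
  proof (intro allI impI)
    fix c
    assume c: "Poly_Mapping.keys c \<subseteq> carrier N \<times> carrier M"
      and k: "frag_pair_map f (\<lambda>x. x) c \<in> tensor_kernel A N' M"
    from tensor_kernel_finitely_many_relations[OF N' M k] obtain L\<^sub>0 P where
      L0: "finite L\<^sub>0" "L\<^sub>0 \<subseteq> carrier M" and P: "finite P" "\<forall>\<rho>\<in>P. \<rho> \<in> carrier M \<rightarrow> carrier A"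
      and *: "\<forall>L. finite L \<and> L\<^sub>0 \<subseteq> L \<and> L \<subseteq> carrier M \<longrightarrow>
        (\<forall>\<rho>\<in>P. (\<Oplus>\<^bsub>M\<^esub>l\<in>L. \<rho> l \<odot>\<^bsub>M\<^esub> l) = \<zero>\<^bsub>M\<^esub>) \<and>
        Poly_Mapping.keys (frag_pair_map f (\<lambda>x. x) c) \<subseteq> carrier N' \<times> L \<and>
        (\<forall>g h. g \<in> L \<rightarrow> carrier A \<and> (\<forall>\<rho>\<in>P. (\<Oplus>\<^bsub>A\<^esub>l\<in>L. \<rho> l \<otimes>\<^bsub>A\<^esub> g l) = \<zero>\<^bsub>A\<^esub>) \<and>
         h \<in> hom (free_Abelian_group (carrier N' \<times> L)) (add_monoid N') \<and>
         (\<forall>n\<in>carrier N'. \<forall>l\<in>L. h (frag_of (n, l)) = g l \<odot>\<^bsub>N'\<^esub> n)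
           \<longrightarrow> h (frag_pair_map f (\<lambda>x. x) c) = \<zero>\<^bsub>N'\<^esub>)"
      by (elim exE conjE) (rule that)
    \<comment> \<open>The right-hand factors of \<open>c\<close> itself must be expressed through
      the solutions too, not only those occurring in the relations.\<close>
    define L where "L = L\<^sub>0 \<union> snd ` Poly_Mapping.keys c"
    have L: "finite L" "L\<^sub>0 \<subseteq> L" "L \<subseteq> carrier M"
      using L0 c by (auto simp: L_def)
    have ckeys: "Poly_Mapping.keys c \<subseteq> carrier N \<times> L" using c by (force simp: L_def)
    note ** = mp[OF spec[OF *] conjI[OF L(1) conjI[OF L(2,3)]]]
    have "\<forall>\<rho>\<in>P. \<rho> \<in> L \<rightarrow> carrier A \<and> (\<Oplus>\<^bsub>M\<^esub>l\<in>L. \<rho> l \<odot>\<^bsub>M\<^esub> l) = \<zero>\<^bsub>M\<^esub>"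
    proof (intro ballI conjI)
      fix \<rho> assume "\<rho> \<in> P"
      then show "\<rho> \<in> L \<rightarrow> carrier A" "(\<Oplus>\<^bsub>M\<^esub>l\<in>L. \<rho> l \<odot>\<^bsub>M\<^esub> l) = \<zero>\<^bsub>M\<^esub>"
        using P(2) L(3) conjunct1[OF **] by blast+
    qed
    then have prem: "finite L \<and> L \<subseteq> carrier M \<and> finite P \<and>
        (\<forall>\<rho>\<in>P. \<rho> \<in> L \<rightarrow> carrier A \<and> (\<Oplus>\<^bsub>M\<^esub>l\<in>L. \<rho> l \<odot>\<^bsub>M\<^esub> l) = \<zero>\<^bsub>M\<^esub>)"
      using L P(1) by blast
    obtain G t where G1: "finite G"
      and G2: "\<forall>g\<in>G. g \<in> L \<rightarrow> carrier A \<and> (\<forall>\<rho>\<in>P. (\<Oplus>\<^bsub>A\<^esub>l\<in>L. \<rho> l \<otimes>\<^bsub>A\<^esub> g l) = \<zero>\<^bsub>A\<^esub>)"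
      and t: "t \<in> G \<rightarrow> carrier M" and L1: "\<forall>l\<in>L. l = (\<Oplus>\<^bsub>M\<^esub>g\<in>G. g l \<odot>\<^bsub>M\<^esub> t g)"
      using mp[OF spec[OF spec[OF flat[unfolded equationally_flat_def], of L], of P] prem]
      by (elim exE conjE) (rule that)
    note G = G1 conjunct1[OF bspec[OF G2]] bspec[OF conjunct2[OF bspec[OF G2]]]
    note Lt = bspec[OF L1]
    \<comment> \<open>The contraction is prescribed on the basis of the free group; it need not
      respect the tensor relations.\<close>
    have "\<exists>h. h \<in> hom (free_Abelian_group (carrier N \<times> L)) (add_monoid N) \<and>
        (\<forall>n\<in>carrier N. \<forall>l\<in>L. h (frag_of (n, l)) = g l \<odot>\<^bsub>N\<^esub> n)" if "g \<in> G" for g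
    proof -
      have "(\<lambda>(n, l). g l \<odot>\<^bsub>N\<^esub> n) ` (carrier N \<times> L) \<subseteq> carrier (add_monoid N)"
        using G(2)[OF that] by (auto intro!: N.smult_closed)
      from comm_group.free_Abelian_group_universal[OF N.a_comm_group this]
      obtain h where "h \<in> hom (free_Abelian_group (carrier N \<times> L)) (add_monoid N)"
         "\<And>x. x \<in> carrier N \<times> L \<Longrightarrow> h (frag_of x) = (case x of (n, l) \<Rightarrow> g l \<odot>\<^bsub>N\<^esub> n)" by blast
      then show ?thesis by (intro exI[of _ h]) auto
    qed
    then obtain H where H: "\<And>g. g \<in> G \<Longrightarrow> H g \<in> hom (free_Abelian_group (carrier N \<times> L)) (add_monoid N)"
       "\<And>g n l. \<lbrakk>g \<in> G; n \<in> carrier N; l \<in> L\<rbrakk> \<Longrightarrow> H g (frag_of (n, l)) = g l \<odot>\<^bsub>N\<^esub> n"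
      by metis
    have Hhom: "group_hom (free_Abelian_group (carrier N \<times> L)) (add_monoid N) (H g)" if "g \<in> G" for g
      by (intro group_hom.intro group_hom_axioms.intro H that group_free_Abelian_group N.a_group)
    have H_closed: "H g x \<in> carrier N" if "g \<in> G" "Poly_Mapping.keys x \<subseteq> carrier N \<times> L" for g x
      using group_hom.hom_closed[OF Hhom[OF that(1)], of x] that by simp
    have H_zero: "H g 0 = \<zero>\<^bsub>N\<^esub>" if "g \<in> G" for g
      using group_hom.hom_one[OF Hhom[OF that]] by simp
    have H_diff: "H g (x - y) = H g x \<ominus>\<^bsub>N\<^esub> H g y" if "g \<in> G"
      "Poly_Mapping.keys x \<subseteq> carrier N \<times> L" "Poly_Mapping.keys y \<subseteq> carrier N \<times> L" for g x y
    proof -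
      have "H g (x + - y) = H g x \<oplus>\<^bsub>N\<^esub> H g (- y)"
        using group_hom.hom_mult[OF Hhom[OF that(1)], of x "- y"] that by simp
      moreover have "H g (- y) = \<ominus>\<^bsub>N\<^esub> H g y"
        using group_hom.hom_inv[OF Hhom[OF that(1)], of y] that by (simp add: a_inv_def)
      ultimately show ?thesis by (simp add: a_minus_def)
    qed
    have H_c: "H g c = \<zero>\<^bsub>N\<^esub>" if g: "g \<in> G" for g
    proof -
      have "(\<lambda>(n, l). g l \<odot>\<^bsub>N'\<^esub> n) ` (carrier N' \<times> L) \<subseteq> carrier (add_monoid N')"
        using G(2)[OF g] by (auto intro!: N'.smult_closed)
      from comm_group.free_Abelian_group_universal[OF N'.a_comm_group this]
      obtain h where h: "h \<in> hom (free_Abelian_group (carrier N' \<times> L)) (add_monoid N')"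
         "\<And>x. x \<in> carrier N' \<times> L \<Longrightarrow> h (frag_of x) = (case x of (n, l) \<Rightarrow> g l \<odot>\<^bsub>N'\<^esub> n)" by blast
      have "h (frag_pair_map f (\<lambda>x. x) c) = \<zero>\<^bsub>N'\<^esub>"
        by (rule mp[OF spec[OF spec[OF conjunct2[OF conjunct2[OF **]], of g], of h]])
           (intro conjI ballI; use G(2,3)[OF g] h in simp)
      moreover interpret h: group_hom "free_Abelian_group (carrier N' \<times> L)" "add_monoid N'" h
        by (intro group_hom.intro group_hom_axioms.intro h group_free_Abelian_group N'.a_group)
      have keys': "Poly_Mapping.keys (frag_pair_map f (\<lambda>x. x) x) \<subseteq> carrier N' \<times> L"
        if "Poly_Mapping.keys x \<subseteq> carrier N \<times> L" for x
        by (rule keys_frag_pair_map[OF that]) (auto simp: f_closed)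
      have "h (frag_pair_map f (\<lambda>x. x) c) = f (H g c)"
        using ckeys
      proof (induct c rule: free_induct)
        case zero
        then show ?case using h.hom_one by (simp add: H_zero[OF g])
      next
        case (diff x y)
        have "h (frag_pair_map f (\<lambda>x. x) x + - frag_pair_map f (\<lambda>x. x) y)
            = h (frag_pair_map f (\<lambda>x. x) x) \<oplus>\<^bsub>N'\<^esub> h (- frag_pair_map f (\<lambda>x. x) y)"
          using h.hom_mult[of "frag_pair_map f (\<lambda>x. x) x" "- frag_pair_map f (\<lambda>x. x) y"]
            keys'[OF diff(1)] keys'[OF diff(2)] by simp
        moreover have "h (- frag_pair_map f (\<lambda>x. x) y) = \<ominus>\<^bsub>N'\<^esub> h (frag_pair_map f (\<lambda>x. x) y)"
          using h.hom_inv[of "frag_pair_map f (\<lambda>x. x) y"] keys'[OF diff(2)] by (simp add: a_inv_def)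
        ultimately show ?case
          using diff H_closed[OF g] by (simp add: H_diff[OF g] a_minus_def)
      next
        case (one a)
        then show ?case using H(2)[OF g] h(2) G(2)[OF g]
          by (cases a) (auto simp: f_closed f_smult Pi_iff)
      qed
      ultimately have "f (H g c) = f \<zero>\<^bsub>N\<^esub>" by simp
      then show ?thesis using inj_onD[OF inj _ H_closed[OF g ckeys] N.zero_closed] by blast
    qed
    \<comment> \<open>Contracting and then rebuilding with \<open>t\<close> is the identity modulo
      the kernel. Both sides are additive modulo the kernel, so generators suffice.\<close>
    have "x - (\<Sum>g\<in>G. frag_of (H g x, t g)) \<in> tensor_kernel A N M"
      if "Poly_Mapping.keys x \<subseteq> carrier N \<times> L" for x
      using that
    proof (induct x rule: free_induct)
      case zero
      have "(\<Sum>g\<in>G'. frag_of (\<zero>\<^bsub>N\<^esub>, t g)) \<in> tensor_kernel A N M" if "G' \<subseteq> G" for G'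
        using finite_subset[OF that G(1)] that
        by (induct G' rule: finite_induct) (use t in \<open>auto intro!: T.tensor_kernel_add T.tensor_kernel_zero_left\<close>)
      then show ?case using T.tensor_kernel_minus by (auto simp: H_zero)
    next
      case (diff x y)
      have "(\<Sum>g\<in>G'. frag_of (H g (x - y), t g)) - (\<Sum>g\<in>G'. frag_of (H g x, t g))
          + (\<Sum>g\<in>G'. frag_of (H g y, t g)) \<in> tensor_kernel A N M" if "G' \<subseteq> G" for G'
        using finite_subset[OF that G(1)] that
      proof (induct G' rule: finite_induct)
        case (insert g G')
        then have g: "g \<in> G" "t g \<in> carrier M" using t by auto
        have Hc: "H g (x - y) \<in> carrier N" "H g x \<in> carrier N" "H g y \<in> carrier N"
          using diff H_closed[OF g(1)] by (simp_all add: keys_diff_subset)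
        have "H g x = H g (x - y) \<oplus>\<^bsub>N\<^esub> H g y"
          using Hc diff H_diff[OF g(1)] by (simp add: a_minus_def N.M.a_assoc N.M.l_neg)
        then have "frag_of (H g x, t g) - frag_of (H g (x - y), t g) - frag_of (H g y, t g) \<in> tensor_kernel A N M"
          using T.tensor_kernel_add_left[OF Hc(1,3) g(2)] by simp
        from T.tensor_kernel_diff[OF insert(3) this] insert
        show ?case by (simp add: algebra_simps)
      qed simp
      from T.tensor_kernel_diff[OF T.tensor_kernel_diff[OF diff(3,4)] this[OF order_refl]]
      have "(x - (\<Sum>g\<in>G. frag_of (H g x, t g))) - (y - (\<Sum>g\<in>G. frag_of (H g y, t g)))
         - ((\<Sum>g\<in>G. frag_of (H g (x - y), t g)) - (\<Sum>g\<in>G. frag_of (H g x, t g))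
          + (\<Sum>g\<in>G. frag_of (H g y, t g))) \<in> tensor_kernel A N M" .
      then show ?case by (simp add: algebra_simps)
    next
      case (one a)
      then obtain n l where a: "a = (n, l)" "n \<in> carrier N" "l \<in> L" by auto
      have gl: "g l \<in> carrier A" if "g \<in> G" for g using G(2)[OF that] a by auto
      have tg: "t g \<in> carrier M" if "g \<in> G" for g using t that by auto
      have "frag_of (n, \<Oplus>\<^bsub>M\<^esub>g\<in>G'. g l \<odot>\<^bsub>M\<^esub> t g) - (\<Sum>g\<in>G'. frag_of (H g (frag_of a), t g)) \<in> tensor_kernel A N M"
        if "G' \<subseteq> G" for G'
        using finite_subset[OF that G(1)] that
      proof (induct G' rule: finite_induct)
        case empty
        then show ?case using T.tensor_kernel_zero_right a by simp
      next
        case (insert g G')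
        then have g: "g \<in> G" and G': "G' \<subseteq> G" by auto
        let ?s = "\<Oplus>\<^bsub>M\<^esub>g\<in>G'. g l \<odot>\<^bsub>M\<^esub> t g"
        have s: "?s \<in> carrier M"
          by (rule M.M.finsum_closed) (use G' gl tg in auto)
        have ins: "(\<Oplus>\<^bsub>M\<^esub>g\<in>insert g G'. g l \<odot>\<^bsub>M\<^esub> t g) = g l \<odot>\<^bsub>M\<^esub> t g \<oplus>\<^bsub>M\<^esub> ?s"
          by (rule M.M.finsum_insert) (use insert G' gl tg in auto)
        have 1: "frag_of (n, g l \<odot>\<^bsub>M\<^esub> t g \<oplus>\<^bsub>M\<^esub> ?s) - frag_of (n, g l \<odot>\<^bsub>M\<^esub> t g) - frag_of (n, ?s) \<in> tensor_kernel A N M"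
          by (rule T.tensor_kernel_add_right) (use a s gl tg g in auto)
        have 2: "frag_of (g l \<odot>\<^bsub>N\<^esub> n, t g) - frag_of (n, g l \<odot>\<^bsub>M\<^esub> t g) \<in> tensor_kernel A N M"
          by (rule T.tensor_kernel_smult) (use a gl tg g in auto)
        from T.tensor_kernel_add[OF insert(3)[OF G'] T.tensor_kernel_diff[OF 1 2]]
        show ?case
          using insert H(2)[OF g a(2,3)] unfolding ins by (simp add: a algebra_simps)
      qed
      from this[OF order_refl] show ?case
        unfolding Lt[OF a(3), symmetric] by (simp add: a(1))
    qed
    from this[OF ckeys] have "c - (\<Sum>g\<in>G. frag_of (\<zero>\<^bsub>N\<^esub>, t g)) \<in> tensor_kernel A N M"
      by (simp add: H_c)
    moreover have "(\<Sum>g\<in>G'. frag_of (\<zero>\<^bsub>N\<^esub>, t g)) \<in> tensor_kernel A N M" if "G' \<subseteq> G" for G'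
      using finite_subset[OF that G(1)] that
      by (induct G' rule: finite_induct) (use t in \<open>auto intro!: T.tensor_kernel_add T.tensor_kernel_zero_left\<close>)
    ultimately show "c \<in> tensor_kernel A N M"
      using T.tensor_kernel_add[of "c - (\<Sum>g\<in>G. frag_of (\<zero>\<^bsub>N\<^esub>, t g))" "\<Sum>g\<in>G. frag_of (\<zero>\<^bsub>N\<^esub>, t g)"] by simp
  qed
qed

subsection \<open>Adically complete subrings\<close>

text \<open>The rules mention only the additive structure, so the span is the same in the opposite
  ring and is carried along by homomorphisms.\<close>

inductive_set additive_span :: "('a, 'z) ring_scheme \<Rightarrow> 'a set \<Rightarrow> 'a set"
  for R :: "('a, 'z) ring_scheme" and S :: "'a set"
  where zero: "\<zero>\<^bsub>R\<^esub> \<in> additive_span R S"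
  | gen: "x \<in> S \<Longrightarrow> x \<in> additive_span R S"
  | diff: "\<lbrakk>x \<in> additive_span R S; y \<in> additive_span R S\<rbrakk> \<Longrightarrow> x \<ominus>\<^bsub>R\<^esub> y \<in> additive_span R S"

lemma additive_span_mono: "S \<subseteq> S' \<Longrightarrow> additive_span R S \<subseteq> additive_span R S'"
proof
  fix x assume "S \<subseteq> S'" "x \<in> additive_span R S"
  from this(2,1) show "x \<in> additive_span R S'"
    by induct (auto intro: additive_span.intros)
qed

context abelian_group
begin

lemma additive_subgroup_diffI:
  assumes "H \<subseteq> carrier G" "\<zero> \<in> H" "\<And>x y. \<lbrakk>x \<in> H; y \<in> H\<rbrakk> \<Longrightarrow> x \<ominus> y \<in> H"
  shows "additive_subgroup H G"
proof -
  have neg: "\<ominus> x \<in> H" if "x \<in> H" for x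
    using assms(3)[OF assms(2) that] assms(1) that by (auto simp: minus_eq)
  have "x \<oplus> y \<in> H" if "x \<in> H" "y \<in> H" for x y
    using assms(3)[OF that(1) neg[OF that(2)]] assms(1) that by (auto simp: minus_eq)
  then show ?thesis
    using assms neg by (auto simp: additive_subgroup_def intro!: add.subgroupI simp flip: a_inv_def)
qed

lemma additive_subgroup_diff: "\<lbrakk>additive_subgroup H G; x \<in> H; y \<in> H\<rbrakk> \<Longrightarrow> x \<ominus> y \<in> H"
  unfolding minus_eq by (intro additive_subgroup.a_closed additive_subgroup.a_inv_closed)

lemma additive_span_subgroup:
  assumes "S \<subseteq> carrier G"
  shows "additive_subgroup (additive_span G S) G"
proof (rule additive_subgroup_diffI)
  show "additive_span G S \<subseteq> carrier G"
  proof
    fix x assume "x \<in> additive_span G S"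
    then show "x \<in> carrier G" by induct (use assms in auto)
  qed
qed (auto intro: additive_span.intros)

lemma additive_span_le:
  assumes "additive_subgroup H G" "S \<subseteq> H"
  shows "additive_span G S \<subseteq> H"
proof
  fix x assume "x \<in> additive_span G S"
  then show "x \<in> H"
    by induct (use assms additive_subgroup_diff additive_subgroup.zero_closed in auto)
qed

end

text \<open>\<open>D\<close> is complete and separated for the topology of multiples of powers of
  \<open>p\<close>; \<open>A\<close> will be either \<open>D\<close> with \<open>p\<close> inverted
  or \<open>D\<close> itself. Completeness is required for sequences whose \<open>n\<close>-th
  increment is divisible by \<open>p [^] n\<close>, and it gives a limit approached at the same
  rate.\<close>

locale adic_subring = ring A for A (structure) +
  fixes p :: 'a and D :: "'a set"
  assumes p_closed [simp]: "p \<in> carrier A"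
    and p_central: "x \<in> carrier A \<Longrightarrow> x \<otimes> p = p \<otimes> x"
    and p_cancel: "\<lbrakk>x \<in> carrier A; p \<otimes> x = \<zero>\<rbrakk> \<Longrightarrow> x = \<zero>"
    and D_subgroup: "additive_subgroup D A"
    and D_mult: "\<lbrakk>x \<in> D; y \<in> D\<rbrakk> \<Longrightarrow> x \<otimes> y \<in> D"
    and D_p: "p \<in> D" and D_one: "\<one> \<in> D"
    and D_complete: "\<lbrakk>\<And>n::nat. s n \<in> D; \<And>n. s (Suc n) \<ominus> s n \<in> (\<lambda>d. p [^] n \<otimes> d) ` D\<rbrakk>
      \<Longrightarrow> \<exists>l\<in>D. \<forall>n. s n \<ominus> l \<in> (\<lambda>d. p [^] n \<otimes> d) ` D"
    and D_separated: "(\<And>n::nat. x \<in> (\<lambda>d. p [^] n \<otimes> d) ` D) \<Longrightarrow> x = \<zero>"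
begin

definition nbhd :: "nat \<Rightarrow> 'a set" where "nbhd n = (\<lambda>d. p [^] n \<otimes> d) ` D"

lemma D_closed [simp]: "x \<in> D \<Longrightarrow> x \<in> carrier A"
  using additive_subgroup.a_subset[OF D_subgroup] by blast

lemma pp_central: "x \<in> carrier A \<Longrightarrow> x \<otimes> p [^] (n::nat) = p [^] n \<otimes> x"
proof (induct n)
  case (Suc n)
  then have "x \<otimes> (p [^] n \<otimes> p) = (p [^] n \<otimes> x) \<otimes> p" by (simp add: m_assoc[symmetric])
  also have "\<dots> = p [^] n \<otimes> p \<otimes> x" using Suc by (simp add: m_assoc p_central)
  finally show ?case by simp
qed simp

lemma pp_cancel: "\<lbrakk>x \<in> carrier A; y \<in> carrier A; p [^] (n::nat) \<otimes> x = p [^] n \<otimes> y\<rbrakk> \<Longrightarrow> x = y"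
proof -
  have zero: "\<lbrakk>x \<in> carrier A; p [^] n \<otimes> x = \<zero>\<rbrakk> \<Longrightarrow> x = \<zero>" for x
  proof (induct n arbitrary: x)
    case (Suc n)
    then have "p [^] n \<otimes> (p \<otimes> x) = \<zero>" by (simp add: m_assoc)
    then have "p \<otimes> x = \<zero>" by (rule Suc(1)[rotated]) (simp add: Suc)
    then show ?case by (rule p_cancel[OF Suc(2)])
  qed simp
  assume *: "x \<in> carrier A" "y \<in> carrier A" "p [^] n \<otimes> x = p [^] n \<otimes> y"
  then have "p [^] n \<otimes> (x \<ominus> y) = \<zero>"
    by (simp add: minus_eq r_distr r_minus r_neg)
  then have "x \<ominus> y = \<zero>" using zero[of "x \<ominus> y"] * by blast
  then show "x = y" using * by (simp add: r_right_minus_eq)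
qed

lemma pp_left_comm: "\<lbrakk>x \<in> carrier A; y \<in> carrier A\<rbrakk> \<Longrightarrow> x \<otimes> (p [^] (n::nat) \<otimes> y) = p [^] n \<otimes> (x \<otimes> y)"
  by (simp add: m_assoc[symmetric] pp_central)

lemma pp_add: "x \<in> carrier A \<Longrightarrow> p [^] (m::nat) \<otimes> (p [^] n \<otimes> x) = p [^] (m + n) \<otimes> x"
  by (simp add: m_assoc[symmetric] nat_pow_mult)

lemma D_pp: "p [^] (n::nat) \<in> D"
  by (induct n) (auto simp: D_one D_p D_mult)

lemma nbhdI: "d \<in> D \<Longrightarrow> p [^] n \<otimes> d \<in> nbhd n" by (simp add: nbhd_def)

lemma nbhd_subgroup: "additive_subgroup (nbhd n) A"
proof (rule additive_subgroup_diffI)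
  show "\<zero> \<in> nbhd n"
    using additive_subgroup.zero_closed[OF D_subgroup] by (force simp: nbhd_def)
next
  fix x y assume "x \<in> nbhd n" "y \<in> nbhd n"
  then obtain d e where "x = p [^] n \<otimes> d" "y = p [^] n \<otimes> e" "d \<in> D" "e \<in> D"
    by (auto simp: nbhd_def)
  then show "x \<ominus> y \<in> nbhd n"
    using nbhdI[OF additive_subgroup_diff[OF D_subgroup, of d e], of n]
    by (simp add: minus_eq r_distr r_minus)
qed (auto simp: nbhd_def)

lemma nbhd_closed: "x \<in> nbhd n \<Longrightarrow> x \<in> carrier A"
  using additive_subgroup.a_subset[OF nbhd_subgroup] by blast

lemmas nbhd_diff = additive_subgroup_diff[OF nbhd_subgroup]
lemmas nbhd_add = additive_subgroup.a_closed[OF nbhd_subgroup]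
lemmas nbhd_zero = additive_subgroup.zero_closed[OF nbhd_subgroup]

lemma nbhd_0: "nbhd 0 = D" by (auto simp: nbhd_def)

lemma nbhd_shift: "x \<in> nbhd n \<Longrightarrow> p [^] m \<otimes> x \<in> nbhd (m + n)"
  by (auto simp: nbhd_def pp_add)

lemma nbhd_antimono: "m \<le> n \<Longrightarrow> nbhd n \<subseteq> nbhd m"
proof
  fix x assume "m \<le> n" "x \<in> nbhd n"
  then obtain d where "x = p [^] n \<otimes> d" "d \<in> D" by (auto simp: nbhd_def)
  then have "x = p [^] m \<otimes> (p [^] (n - m) \<otimes> d)" using \<open>m \<le> n\<close> by (simp add: pp_add)
  then show "x \<in> nbhd m" using \<open>d \<in> D\<close> D_mult D_pp nbhdI by auto
qed

text \<open>The neighbourhoods are ideals of \<open>D\<close> but not of \<open>A\<close>: a factor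
  with denominator \<open>p [^] k\<close> costs \<open>k\<close> steps of precision.\<close>

lemma nbhd_mult_left:
  assumes "x \<in> carrier A" "p [^] k \<otimes> x \<in> D" "y \<in> nbhd (n + k)"
  shows "x \<otimes> y \<in> nbhd n"
proof -
  obtain d where d: "y = p [^] (n + k) \<otimes> d" "d \<in> D" using assms by (auto simp: nbhd_def)
  then have "x \<otimes> y = p [^] n \<otimes> ((p [^] k \<otimes> x) \<otimes> d)"
    using assms(1) pp_left_comm[of x d "n + k"] by (simp add: m_assoc pp_add)
  then show ?thesis using D_mult[OF assms(2) d(2)] nbhdI by simp
qed

lemma nbhd_mult_right:
  assumes "x \<in> carrier A" "p [^] k \<otimes> x \<in> D" "y \<in> nbhd (n + k)"
  shows "y \<otimes> x \<in> nbhd n"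
proof -
  obtain d where d: "y = p [^] (n + k) \<otimes> d" "d \<in> D" using assms by (auto simp: nbhd_def)
  then have "y \<otimes> x = p [^] n \<otimes> (d \<otimes> (p [^] k \<otimes> x))"
    using assms(1) pp_left_comm[of d x k] by (simp add: m_assoc pp_add)
  then show ?thesis using D_mult[OF d(2) assms(2)] nbhdI by simp
qed

lemma complete:
  assumes "\<And>n. s n \<in> D" "\<And>n. s (Suc n) \<ominus> s n \<in> nbhd n"
  obtains l where "l \<in> D" "\<And>n. s n \<ominus> l \<in> nbhd n"
  using D_complete[of s] assms unfolding nbhd_def by blast

lemma separated: "(\<And>n. x \<in> nbhd n) \<Longrightarrow> x = \<zero>"
  using D_separated unfolding nbhd_def by blast

text \<open>The closure is taken in \<open>A\<close>, for the topology in which \<pi>^n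
  \<open>D\<close> is a base at zero, and is phrased by approximants so that no sequences need to be
  chosen.\<close>

definition cl :: "'a set \<Rightarrow> 'a set" where
  "cl S = {x \<in> carrier A. \<forall>e. \<exists>s\<in>S. x \<ominus> s \<in> nbhd e}"

lemma cl_mono: "S \<subseteq> S' \<Longrightarrow> cl S \<subseteq> cl S'"
  unfolding cl_def by blast

lemma cl_incl: "S \<subseteq> carrier A \<Longrightarrow> S \<subseteq> cl S"
proof
  fix x assume "S \<subseteq> carrier A" "x \<in> S"
  then have "x \<ominus> x = \<zero>" by (auto simp: r_neg minus_eq)
  then show "x \<in> cl S"
    using \<open>x \<in> S\<close> \<open>S \<subseteq> carrier A\<close> nbhd_zero unfolding cl_def by (auto intro!: bexI[of _ x])
qed

lemma cl_subgroup:
  assumes "additive_subgroup S A"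
  shows "additive_subgroup (cl S) A"
proof (rule additive_subgroup_diffI)
  have S: "S \<subseteq> carrier A" using additive_subgroup.a_subset[OF assms] .
  show "\<zero> \<in> cl S" using cl_incl[OF S] additive_subgroup.zero_closed[OF assms] by blast
  fix x y assume xy: "x \<in> cl S" "y \<in> cl S"
  then have xyc: "x \<in> carrier A" "y \<in> carrier A" by (auto simp: cl_def)
  have "\<exists>s\<in>S. (x \<ominus> y) \<ominus> s \<in> nbhd e" for e
  proof -
    obtain s t where st: "s \<in> S" "t \<in> S" "x \<ominus> s \<in> nbhd e" "y \<ominus> t \<in> nbhd e"
      using xy unfolding cl_def by blast
    then have "s \<in> carrier A" "t \<in> carrier A" using S by auto
    then have "(x \<ominus> y) \<ominus> (s \<ominus> t) = (x \<ominus> s) \<ominus> (y \<ominus> t)"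
      using xyc by algebra
    then show ?thesis
      using nbhd_diff[OF st(3,4)] by (intro bexI[OF _ additive_subgroup_diff[OF assms st(1,2)]]) simp
  qed
  then show "x \<ominus> y \<in> cl S" using xyc by (auto simp: cl_def)
qed (auto simp: cl_def)

lemma cl_idem:
  assumes "S \<subseteq> carrier A" "x \<in> carrier A" "\<And>e. \<exists>y\<in>cl S. x \<ominus> y \<in> nbhd e"
  shows "x \<in> cl S"
proof -
  have "\<exists>s\<in>S. x \<ominus> s \<in> nbhd e" for e
  proof -
    obtain y where y: "y \<in> cl S" "x \<ominus> y \<in> nbhd e" using assms by blast
    then obtain s where s: "s \<in> S" "y \<ominus> s \<in> nbhd e" by (auto simp: cl_def)
    have c: "y \<in> carrier A" "s \<in> carrier A" using y s assms by (auto simp: cl_def)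
    then have "x \<ominus> s = (x \<ominus> y) \<oplus> (y \<ominus> s)" using assms(2) by algebra
    then show ?thesis using nbhd_add[OF y(2) s(2)] by (intro bexI[OF _ s(1)]) simp
  qed
  then show ?thesis using assms(2) by (auto simp: cl_def)
qed

text \<open>Multiplication by an element of bounded denominator is continuous: precision
  \<open>e\<close> of the product is obtained from precision \<open>e + k\<close> of the
  factor.\<close>

lemma cl_mult_right:
  assumes "S \<subseteq> carrier A" "x \<in> cl S" "y \<in> carrier A" "p [^] (k::nat) \<otimes> y \<in> D"
    and "\<And>s. s \<in> S \<Longrightarrow> s \<otimes> y \<in> S'"
  shows "x \<otimes> y \<in> cl S'"
proof -
  have "\<exists>s\<in>S'. x \<otimes> y \<ominus> s \<in> nbhd e" for e
  proof -
    obtain s where s: "s \<in> S" "x \<ominus> s \<in> nbhd (e + k)" using assms(2) by (auto simp: cl_def)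
    then have "x \<otimes> y \<ominus> s \<otimes> y = (x \<ominus> s) \<otimes> y"
      using assms by (auto simp: cl_def minus_eq l_distr l_minus)
    then show ?thesis
      using nbhd_mult_right[OF assms(3,4) s(2)] by (intro bexI[OF _ assms(5)[OF s(1)]]) simp
  qed
  then show ?thesis using assms by (auto simp: cl_def)
qed

lemma cl_mult_left:
  assumes "S \<subseteq> carrier A" "x \<in> cl S" "y \<in> carrier A" "p [^] (k::nat) \<otimes> y \<in> D"
    and "\<And>s. s \<in> S \<Longrightarrow> y \<otimes> s \<in> S'"
  shows "y \<otimes> x \<in> cl S'"
proof -
  have "\<exists>s\<in>S'. y \<otimes> x \<ominus> s \<in> nbhd e" for e
  proof -
    obtain s where s: "s \<in> S" "x \<ominus> s \<in> nbhd (e + k)" using assms(2) by (auto simp: cl_def)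
    then have "y \<otimes> x \<ominus> y \<otimes> s = y \<otimes> (x \<ominus> s)"
      using assms by (auto simp: cl_def minus_eq r_distr r_minus)
    then show ?thesis
      using nbhd_mult_left[OF assms(3,4) s(2)] by (intro bexI[OF _ assms(5)[OF s(1)]]) simp
  qed
  then show ?thesis using assms by (auto simp: cl_def)
qed

end

section \<open>A filtered ring inside an adically complete one\<close>

definition finitely_generated_right_ideals :: "('a, 'z) ring_scheme \<Rightarrow> 'a set \<Rightarrow> bool" where
  "finitely_generated_right_ideals A B \<longleftrightarrow>
    (\<forall>I. additive_subgroup I A \<and> I \<subseteq> B \<and> (\<forall>x\<in>I. \<forall>b\<in>B. x \<otimes>\<^bsub>A\<^esub> b \<in> I) \<longrightarrow>
      (\<exists>G. finite G \<and> G \<subseteq> I \<and> I \<subseteq> additive_span A {g \<otimes>\<^bsub>A\<^esub> b | g b. g \<in> G \<and> b \<in> B}))"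

text \<open>Unlike \<open>filt_below\<close> it is empty in degree 0. It mentions no ring and so
  commutes with images under maps, while additive spans supply the missing zero.\<close>

definition filt_lower :: "(nat \<Rightarrow> 'a set) \<Rightarrow> nat \<Rightarrow> 'a set" where
  "filt_lower F n = (if n = 0 then {} else F (n - 1))"

definition graded_family :: "('a, 'z) ring_scheme \<Rightarrow> (nat \<Rightarrow> 'a set) \<Rightarrow> (nat \<Rightarrow> 'a set) \<Rightarrow> bool" where
  "graded_family A F L \<longleftrightarrow>
    (\<forall>n. additive_subgroup (L n) A \<and> L n \<subseteq> F n \<and> filt_lower F n \<subseteq> L n) \<and>
    (\<forall>n m. \<forall>x\<in>L n. \<forall>y\<in>F m. x \<otimes>\<^bsub>A\<^esub> y \<in> L (n + m))"

text \<open>A graded family is the preimage in the filtration of a graded right ideal of the associated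
  graded ring, so this says that such ideals are finitely generated.\<close>

definition graded_noetherian :: "('a, 'z) ring_scheme \<Rightarrow> (nat \<Rightarrow> 'a set) \<Rightarrow> bool" where
  "graded_noetherian A F \<longleftrightarrow> (\<forall>L. graded_family A F L \<longrightarrow>
    (\<exists>J. finite J \<and> (\<forall>(m, g)\<in>J. g \<in> L m) \<and> (\<forall>n. L n \<subseteq> additive_span A
       ({g \<otimes>\<^bsub>A\<^esub> y | m g y. (m, g) \<in> J \<and> m \<le> n \<and> y \<in> F (n - m)} \<union> filt_lower F n))))"

text \<open>\<open>F\<close> will be the image in \<open>A\<close> of the filtration of
  \<open>U\<close>. The assumptions \<open>F_D\<close> and \<open>D_F\<close> express that
  \<open>D\<close> is the completion of the deformation: the elements \<open>p [^] n\<close> times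
  \<open>F n\<close> lie in \<open>D\<close>, and they span it modulo \<open>p\<close>.\<close>

locale filtered_adic = adic_subring A p D for A (structure) and p D +
  fixes F :: "nat \<Rightarrow> 'a set"
  assumes F_subgroup: "additive_subgroup (F n) A"
    and F_mono: "F n \<subseteq> F (Suc n)"
    and F_one: "\<one> \<in> F 0"
    and F_mult: "\<lbrakk>x \<in> F i; y \<in> F j\<rbrakk> \<Longrightarrow> x \<otimes> y \<in> F (i + j)"
    and F_p: "x \<in> F n \<Longrightarrow> p \<otimes> x \<in> F n"
    and F_D: "x \<in> F n \<Longrightarrow> p [^] n \<otimes> x \<in> D"
    and D_F: "d \<in> D \<Longrightarrow> \<exists>u\<in>additive_span A {p [^] n \<otimes> f | n f. f \<in> F n}. d \<ominus> u \<in> nbhd 1"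
begin

definition U where "U = (\<Union>n. F n)"
text \<open>This is the ring \<open>U + D\<close> of the overview, see \<open>U_B\<close>,
  \<open>D_B\<close> and \<open>B_decomp\<close>. As a closure it is shown to be a ring by
  continuity of multiplication.\<close>

definition B where "B = cl U"

text \<open>An element \<open>p\<^sup>a f\<close> with \<open>f \<in> F n\<close> has weight \<open>n - a\<close>. The \<open>W N i\<close> interpolate between \<open>T (i - 1)\<close>
  and \<open>T i\<close>, admitting the elements of weight \<open>i\<close> in the order of their degree \<open>n\<close>.\<close>

definition T :: "int \<Rightarrow> 'a set" where
  "T i = additive_span A {p [^] a \<otimes> f | (a::nat) n f. f \<in> F n \<and> int n - int a \<le> i}"
definition W :: "nat \<Rightarrow> int \<Rightarrow> 'a set" where
  "W N i = additive_span A {p [^] a \<otimes> f | (a::nat) n f. f \<in> F n \<and>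
      (int n - int a < i \<or> int n - int a = i \<and> n < N)}"

lemma F_closed [simp]: "x \<in> F n \<Longrightarrow> x \<in> carrier A"
  using additive_subgroup.a_subset[OF F_subgroup] by blast

lemma F_le: "m \<le> n \<Longrightarrow> F m \<subseteq> F n"
  by (rule lift_Suc_mono_le) (rule F_mono)

lemma F_pp: "x \<in> F n \<Longrightarrow> p [^] (k::nat) \<otimes> x \<in> F n"
proof (induct k)
  case (Suc k)
  have "p [^] Suc k \<otimes> x = p \<otimes> (p [^] k \<otimes> x)"
    using Suc(2) by (simp add: m_assoc[symmetric] p_central)
  then show ?case using F_p[OF Suc(1)[OF Suc(2)]] by simp
qed simp

lemma T_gen: "\<lbrakk>f \<in> F n; int n - int a \<le> i\<rbrakk> \<Longrightarrow> p [^] a \<otimes> f \<in> T i"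
  unfolding T_def by (rule additive_span.gen) blast

lemma W_gen: "\<lbrakk>f \<in> F n; int n - int a < i \<or> int n - int a = i \<and> n < N\<rbrakk> \<Longrightarrow> p [^] a \<otimes> f \<in> W N i"
  unfolding W_def by (rule additive_span.gen) blast

lemma T_subgroup: "additive_subgroup (T i) A"
  unfolding T_def by (rule additive_span_subgroup) auto

lemma W_subgroup: "additive_subgroup (W N i) A"
  unfolding W_def by (rule additive_span_subgroup) auto

lemma T_closed: "x \<in> T i \<Longrightarrow> x \<in> carrier A"
  using additive_subgroup.a_subset[OF T_subgroup] by blast

lemma W_closed: "x \<in> W N i \<Longrightarrow> x \<in> carrier A"
  using additive_subgroup.a_subset[OF W_subgroup] by blast

lemma W_0: "W 0 i = T (i - 1)"
  unfolding W_def T_def by (rule arg_cong[where f = "additive_span A"]) auto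

lemma W_mono: "M \<le> N \<Longrightarrow> W M i \<subseteq> W N i"
  unfolding W_def by (rule additive_span_mono) (blast intro: order_less_le_trans)

lemma U_subgroup: "additive_subgroup U A"
proof (rule additive_subgroup_diffI)
  show "\<zero> \<in> U" using additive_subgroup.zero_closed[OF F_subgroup] by (auto simp: U_def)
  fix x y assume "x \<in> U" "y \<in> U"
  then obtain m n where "x \<in> F m" "y \<in> F n" by (auto simp: U_def)
  then have "x \<in> F (max m n)" "y \<in> F (max m n)"
    using F_le[of m "max m n"] F_le[of n "max m n"] by auto
  then show "x \<ominus> y \<in> U"
    using additive_subgroup_diff[OF F_subgroup] by (auto simp: U_def)
qed (auto simp: U_def)

lemma U_closed: "U \<subseteq> carrier A" by (auto simp: U_def)

lemma F_U: "x \<in> F n \<Longrightarrow> x \<in> U" by (auto simp: U_def)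

lemma T_U: "T i \<subseteq> U"
  unfolding T_def by (rule additive_span_le[OF U_subgroup]) (auto intro: F_U F_pp)

text \<open>This is \<open>D_F\<close> multiplied by \<open>p [^] k\<close>: the generator
  \<open>p [^] n\<close> times f becomes \<open>p [^] (k + n)\<close> times f, of weight n - (k + n)
  = - k.\<close>

lemma nbhd_approx: "x \<in> nbhd k \<Longrightarrow> \<exists>u\<in>T (- int k). x \<ominus> u \<in> nbhd (Suc k)"
proof -
  have *: "p [^] k \<otimes> u \<in> T (- int k)" if "u \<in> additive_span A {p [^] n \<otimes> f | n f. f \<in> F n}" for u
    using that
  proof induct
    case zero
    then show ?case using additive_subgroup.zero_closed[OF T_subgroup] by simp
  next
    case (gen x)
    then obtain n f where "x = p [^] n \<otimes> f" "f \<in> F n" by blast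
    then show ?case using T_gen[of f n "k + n" "- int k"] by (simp add: pp_add)
  next
    case (diff x y)
    have "additive_span A {p [^] n \<otimes> f | n f. f \<in> F n} \<subseteq> carrier A"
      by (rule additive_subgroup.a_subset[OF additive_span_subgroup]) auto
    then have "x \<in> carrier A" "y \<in> carrier A" using diff by auto
    then show ?case
      using additive_subgroup_diff[OF T_subgroup diff(2,4)] by (simp add: minus_eq r_distr r_minus)
  qed
  assume "x \<in> nbhd k"
  then obtain d where d: "x = p [^] k \<otimes> d" "d \<in> D" by (auto simp: nbhd_def)
  then obtain u where u: "u \<in> additive_span A {p [^] n \<otimes> f | n f. f \<in> F n}" "d \<ominus> u \<in> nbhd 1"
    using D_F by blast
  have "additive_span A {p [^] n \<otimes> f | n f. f \<in> F n} \<subseteq> carrier A"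
    by (rule additive_subgroup.a_subset[OF additive_span_subgroup]) auto
  then have "x \<ominus> p [^] k \<otimes> u = p [^] k \<otimes> (d \<ominus> u)"
    using d u(1) by (auto simp: minus_eq r_distr r_minus)
  then show ?thesis
    using nbhd_shift[OF u(2), of k] by (intro bexI[OF _ *[OF u(1)]]) simp
qed

lemma T_mono: "i \<le> j \<Longrightarrow> T i \<subseteq> T j"
  unfolding T_def by (rule additive_span_mono) (blast intro: order_trans)

text \<open>In the repetition of \<open>nbhd_approx\<close> the later corrections have smaller
  weight, so all approximants stay in the same \<open>T (- int k)\<close>. With
  \<open>cl_T_nbhd\<close> this identifies the powers of \<open>p\<close> times \<open>D\<close>
  with the weight filtration.\<close>

lemma nbhd_cl_T: "nbhd k \<subseteq> cl (T (- int k))"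
proof
  fix x assume x: "x \<in> nbhd k"
  have "\<exists>u\<in>T (- int k). x \<ominus> u \<in> nbhd (k + j)" for j
  proof (induct j)
    case 0
    have "x \<ominus> \<zero> = x" using nbhd_closed[OF x] by (simp add: minus_eq)
    then show ?case
      using x additive_subgroup.zero_closed[OF T_subgroup] by (intro bexI[of _ \<zero>]) auto
  next
    case (Suc j)
    then obtain u where u: "u \<in> T (- int k)" "x \<ominus> u \<in> nbhd (k + j)" by blast
    then obtain w where w: "w \<in> T (- int (k + j))" "(x \<ominus> u) \<ominus> w \<in> nbhd (Suc (k + j))"
      using nbhd_approx by blast
    then have w': "w \<in> T (- int k)" using T_mono[of "- int (k + j)" "- int k"] by auto
    have "x \<ominus> (u \<oplus> w) = (x \<ominus> u) \<ominus> w"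
      using nbhd_closed[OF x] T_closed[OF u(1)] T_closed[OF w'] by algebra
    then show ?case
      using w(2) by (intro bexI[OF _ additive_subgroup.a_closed[OF T_subgroup u(1) w']]) simp
  qed
  then have "\<exists>u\<in>T (- int k). x \<ominus> u \<in> nbhd e" for e
    using nbhd_antimono[of e "k + e"] by (meson le_add2 subsetD)
  then show "x \<in> cl (T (- int k))" using nbhd_closed[OF x] by (auto simp: cl_def)
qed

lemma T_nbhd: "T (- int k) \<subseteq> nbhd k"
  unfolding T_def
proof (rule additive_span_le[OF nbhd_subgroup], clarify)
  fix a n f assume f: "f \<in> F n" "int n - int a \<le> - int k"
  then have "p [^] a \<otimes> f = p [^] (a - n) \<otimes> (p [^] n \<otimes> f)" by (simp add: pp_add)
  moreover have "\<dots> \<in> nbhd (a - n)" using F_D[OF f(1)] by (rule nbhdI)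
  moreover have "k \<le> a - n" using f(2) by linarith
  ultimately show "p [^] a \<otimes> f \<in> nbhd k" using nbhd_antimono[of k "a - n"] by auto
qed

lemma cl_T_nbhd: "cl (T (- int k)) \<subseteq> nbhd k"
proof
  fix x assume "x \<in> cl (T (- int k))"
  then obtain s where s: "s \<in> T (- int k)" "x \<ominus> s \<in> nbhd k" "x \<in> carrier A" by (auto simp: cl_def)
  then have "x = (x \<ominus> s) \<oplus> s" using T_closed[OF s(1)] by algebra
  then show "x \<in> nbhd k" using nbhd_add[OF s(2), of s] T_nbhd s(1) by auto
qed

lemma B_subgroup: "additive_subgroup B A"
  unfolding B_def by (rule cl_subgroup[OF U_subgroup])

lemma B_closed: "x \<in> B \<Longrightarrow> x \<in> carrier A"
  using additive_subgroup.a_subset[OF B_subgroup] by blast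

lemma U_B: "U \<subseteq> B"
  unfolding B_def by (rule cl_incl[OF U_closed])

lemma D_B: "D \<subseteq> B"
  using nbhd_cl_T[of 0] cl_mono[OF T_U] by (auto simp: nbhd_0 B_def)

lemma B_decomp: "x \<in> B \<Longrightarrow> \<exists>n. \<exists>u\<in>F n. \<exists>d\<in>D. x = u \<oplus> d"
proof -
  assume "x \<in> B"
  then obtain u where u: "u \<in> U" "x \<ominus> u \<in> nbhd 0" "x \<in> carrier A"
    unfolding B_def cl_def by blast
  then have "x \<ominus> u \<in> D" by (simp add: nbhd_0)
  have "u \<in> carrier A" using u U_closed by auto
  then have "x = u \<oplus> (x \<ominus> u)" using u(3) by algebra
  then show ?thesis using u \<open>x \<ominus> u \<in> D\<close> by (auto simp: U_def)
qed

lemma B_D: "x \<in> B \<Longrightarrow> \<exists>k::nat. p [^] k \<otimes> x \<in> D"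
proof -
  assume "x \<in> B"
  then obtain n u d where u: "u \<in> F n" "d \<in> D" "x = u \<oplus> d" using B_decomp by blast
  have "p [^] n \<otimes> u \<oplus> p [^] n \<otimes> d \<in> D"
    using additive_subgroup.a_closed[OF D_subgroup F_D[OF u(1)] D_mult[OF D_pp u(2)]] .
  then have "p [^] n \<otimes> x \<in> D" using u by (simp add: r_distr)
  then show ?thesis by blast
qed

text \<open>The left factor \<open>x\<close> is first replaced by an element \<open>s\<close> of
  \<open>U\<close>, so closely that the error times \<open>y\<close> is negligible given the
  denominator of \<open>y\<close>. Then \<open>s\<close> has a bounded denominator of its own, and
  \<open>s\<close> times \<open>y\<close> is a limit of elements of \<open>U\<close>.\<close>

lemma B_mult:
  assumes "x \<in> B" "y \<in> B"
  shows "x \<otimes> y \<in> B"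
  unfolding B_def
proof (rule cl_idem[OF U_closed])
  show "x \<otimes> y \<in> carrier A" using assms B_closed by simp
  fix e
  obtain k :: nat where k: "p [^] k \<otimes> y \<in> D" using B_D[OF assms(2)] by blast
  obtain s where s: "s \<in> U" "x \<ominus> s \<in> nbhd (e + k)"
    using assms(1) by (auto simp: B_def cl_def)
  then obtain n where n: "s \<in> F n" by (auto simp: U_def)
  have "s \<otimes> y \<in> cl U"
  proof (rule cl_mult_left[OF U_closed])
    show "y \<in> cl U" using assms by (simp add: B_def)
    show "p [^] n \<otimes> s \<in> D" by (rule F_D[OF n])
    show "\<And>u. u \<in> U \<Longrightarrow> s \<otimes> u \<in> U" using F_mult[OF n] by (auto simp: U_def)
  qed (use n in auto)
  moreover have "x \<otimes> y \<ominus> s \<otimes> y = (x \<ominus> s) \<otimes> y"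
    using assms B_closed n by (simp add: minus_eq l_distr l_minus)
  moreover have "(x \<ominus> s) \<otimes> y \<in> nbhd e"
    by (rule nbhd_mult_right[OF _ k s(2)]) (use assms B_closed in auto)
  ultimately show "\<exists>z\<in>cl U. x \<otimes> y \<ominus> z \<in> nbhd e" by (intro bexI[of _ "s \<otimes> y"]) simp
qed

text \<open>A given element involves finitely many degrees only. This makes an induction on the
  degree bound possible, although the degrees in \<open>T i\<close> as a whole are
  unbounded.\<close>

lemma T_split_W: "u \<in> T i \<Longrightarrow> \<exists>N. u \<in> W N i"
  unfolding T_def
proof (induct rule: additive_span.induct)
  case zero
  then show ?case using additive_subgroup.zero_closed[OF W_subgroup] by blast
next
  case (gen x)
  then obtain a n f where "x = p [^] a \<otimes> f" "f \<in> F n" "int n - int a \<le> i" by blast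
  then show ?case using W_gen[of f n a i "Suc n"] by (intro exI[of _ "Suc n"]) (simp add: le_less)
next
  case (diff x y)
  then obtain M N where "x \<in> W M i" "y \<in> W N i" by blast
  then have "x \<in> W (max M N) i" "y \<in> W (max M N) i"
    using W_mono[of M "max M N" i] W_mono[of N "max M N" i] by auto
  then show ?case using additive_subgroup_diff[OF W_subgroup] by blast
qed

text \<open>A new term would have degree \<open>N\<close> and weight \<open>i > N\<close>, hence a
  negative exponent of \<open>p\<close>.\<close>

lemma W_Suc_small: "int N < i \<Longrightarrow> W (Suc N) i = W N i"
  unfolding W_def by (rule arg_cong[where f = "additive_span A"]) (auto simp: less_Suc_eq)

text \<open>The new terms are those of degree \<open>N\<close> and weight \<open>i\<close>, so their
  exponent is forced to be \<open>N - i\<close>. As \<open>F N\<close> is a subgroup they combine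
  into one.\<close>

lemma W_Suc_split:
  assumes "i \<le> int N" "u \<in> W (Suc N) i"
  shows "\<exists>f\<in>F N. \<exists>x\<in>W N i. u = p [^] nat (int N - i) \<otimes> f \<oplus> x"
  using assms(2) unfolding W_def[of "Suc N"]
proof (induct rule: additive_span.induct)
  case zero
  then show ?case
    using additive_subgroup.zero_closed[OF W_subgroup] additive_subgroup.zero_closed[OF F_subgroup]
    by (intro bexI[of _ \<zero>]) auto
next
  case (gen x)
  then obtain a n f where x: "x = p [^] a \<otimes> f" "f \<in> F n"
    and "int n - int a < i \<or> int n - int a = i \<and> n < Suc N" by blast
  then consider "int n - int a < i \<or> int n - int a = i \<and> n < N" | "n = N" "a = nat (int N - i)"
    by (auto simp: less_Suc_eq)
  then show ?case
  proof cases
    case 1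
    have "x = p [^] nat (int N - i) \<otimes> \<zero> \<oplus> x" using x by simp
    then show ?thesis
      using W_gen[OF x(2) 1] additive_subgroup.zero_closed[OF F_subgroup] x(1) by blast
  next
    case 2
    have "x = p [^] nat (int N - i) \<otimes> f \<oplus> \<zero>" using x 2 by simp
    then show ?thesis
      using additive_subgroup.zero_closed[OF W_subgroup] x(2) 2 by blast
  qed
next
  case (diff x y)
  then obtain f g v w where *: "f \<in> F N" "v \<in> W N i" "x = p [^] nat (int N - i) \<otimes> f \<oplus> v"
    "g \<in> F N" "w \<in> W N i" "y = p [^] nat (int N - i) \<otimes> g \<oplus> w" by blast
  let ?p = "p [^] nat (int N - i)"
  have c: "f \<in> carrier A" "g \<in> carrier A" "v \<in> carrier A" "w \<in> carrier A" "?p \<in> carrier A"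
    using * W_closed by auto
  then have "x \<ominus> y = ?p \<otimes> (f \<ominus> g) \<oplus> (v \<ominus> w)" unfolding *(3,6) by algebra
  then show ?case
    using additive_subgroup_diff[OF F_subgroup *(1,4)] additive_subgroup_diff[OF W_subgroup *(2,5)] by blast
qed

text \<open>Weights and degrees both add, and a strict bound n < N on the degree becomes n + m < N +
  m.\<close>

lemma W_mult:
  assumes "x \<in> W N i" "y \<in> F m"
  shows "x \<otimes> (p [^] (b::nat) \<otimes> y) \<in> W (N + m) (i + (int m - int b))"
  using assms(1) unfolding W_def[of N]
proof (induct rule: additive_span.induct)
  case zero
  then show ?case using additive_subgroup.zero_closed[OF W_subgroup] assms(2) by simp
next
  case (gen x)
  then obtain a n f where x: "x = p [^] a \<otimes> f" "f \<in> F n"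
    and d: "int n - int a < i \<or> int n - int a = i \<and> n < N" by blast
  have "x \<otimes> (p [^] b \<otimes> y) = p [^] (a + b) \<otimes> (f \<otimes> y)"
    using x assms(2) pp_left_comm[of f y b] by (simp add: m_assoc pp_add)
  moreover have "p [^] (a + b) \<otimes> (f \<otimes> y) \<in> W (N + m) (i + (int m - int b))"
    by (rule W_gen[OF F_mult[OF x(2) assms(2)]]) (use d in auto)
  ultimately show ?case by simp
next
  case (diff x z)
  have "additive_span A {p [^] a \<otimes> f | (a::nat) n f. f \<in> F n \<and>
      (int n - int a < i \<or> int n - int a = i \<and> n < N)} \<subseteq> carrier A"
    by (rule additive_subgroup.a_subset[OF additive_span_subgroup]) auto
  then have "x \<in> carrier A" "z \<in> carrier A" using diff by auto
  then show ?case
    using additive_subgroup_diff[OF W_subgroup diff(2,4)] assms(2)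
    by (simp add: minus_eq l_distr l_minus)
qed

lemma W_subset: "W N i \<subseteq> carrier A" using W_closed by blast

lemma cl_W_mult:
  assumes "x \<in> cl (W N i)" "y \<in> F m"
  shows "x \<otimes> (p [^] (b::nat) \<otimes> y) \<in> cl (W (N + m) (i + (int m - int b)))"
proof (rule cl_mult_right[OF W_subset assms(1)])
  show "p [^] m \<otimes> (p [^] b \<otimes> y) \<in> D" by (rule F_D[OF F_pp[OF assms(2)]])
qed (use assms W_mult in auto)

end

subsection \<open>The Noetherian property of the closure of a filtered ring\<close>

lemma (in abelian_group) diff_add_swap:
  assumes "a \<in> carrier G" "b \<in> carrier G" "c \<in> carrier G"
  shows "(a \<ominus> b) \<oplus> (c \<oplus> b) = a \<oplus> c" "(a \<oplus> c) \<ominus> b = a \<oplus> (c \<oplus> \<ominus> b)"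
proof -
  have "(a \<ominus> b) \<oplus> (c \<oplus> b) = a \<oplus> (c \<oplus> (\<ominus> b \<oplus> b))"
    using assms by (simp add: minus_eq a_ac)
  then show "(a \<ominus> b) \<oplus> (c \<oplus> b) = a \<oplus> c" using assms by (simp add: l_neg)
qed (use assms in \<open>simp add: minus_eq a_assoc\<close>)

lemma (in abelian_group) finsum_in_subgroup:
  assumes "additive_subgroup H G" "\<And>i. i \<in> I \<Longrightarrow> f i \<in> H"
  shows "(\<Oplus>i\<in>I. f i) \<in> H"
proof (cases "finite I")
  case True
  have sub: "H \<subseteq> carrier G" using additive_subgroup.a_subset[OF assms(1)] .
  from True assms(2) show ?thesis
  proof induct
    case empty
    then show ?case using additive_subgroup.zero_closed[OF assms(1)] by simp
  next
    case (insert i I)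
    then have "(\<Oplus>j\<in>insert i I. f j) = f i \<oplus> (\<Oplus>j\<in>I. f j)"
      by (intro finsum_insert) (use sub in auto)
    then show ?case using additive_subgroup.a_closed[OF assms(1)] insert by simp
  qed
qed (use additive_subgroup.zero_closed[OF assms(1)] in \<open>simp add: finsum_infinite\<close>)

text \<open>Collecting the terms by generator is what later allows infinitely many steps of an
  approximation to be summed: each generator receives one series of coefficients.\<close>

lemma (in ring) additive_span_coefficients:
  assumes G: "finite G" "z \<in> G \<rightarrow> carrier R" and Y: "\<And>\<gamma>. \<gamma> \<in> G \<Longrightarrow> additive_subgroup (Y \<gamma>) R"
    and x: "x \<in> additive_span R {z \<gamma> \<otimes> y | \<gamma> y. \<gamma> \<in> G \<and> y \<in> Y \<gamma>}"
  shows "\<exists>c. (\<forall>\<gamma>\<in>G. c \<gamma> \<in> Y \<gamma>) \<and> x = (\<Oplus>\<gamma>\<in>G. z \<gamma> \<otimes> c \<gamma>)"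
  using x
proof induct
  have Yc: "y \<in> carrier R" if "\<gamma> \<in> G" "y \<in> Y \<gamma>" for \<gamma> y
    using additive_subgroup.a_subset[OF Y[OF that(1)]] that by blast
  have zc: "z \<gamma> \<in> carrier R" if "\<gamma> \<in> G" for \<gamma> using G that by auto
  {
    case zero
    have "(\<Oplus>\<gamma>\<in>G. z \<gamma> \<otimes> \<zero>) = \<zero>"
      by (rule add.finprod_one_eqI) (use zc in auto)
    then show ?case using Y additive_subgroup.zero_closed by (intro exI[of _ "\<lambda>_. \<zero>"]) auto
  next
    case (gen x)
    then obtain \<gamma> y where \<gamma>: "x = z \<gamma> \<otimes> y" "\<gamma> \<in> G" "y \<in> Y \<gamma>" by blast
    have "(\<Oplus>\<gamma>'\<in>G. z \<gamma>' \<otimes> (if \<gamma>' = \<gamma> then y else \<zero>)) = (\<Oplus>\<gamma>'\<in>G. if \<gamma>' = \<gamma> then z \<gamma>' \<otimes> y else \<zero>)"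
      by (rule finsum_cong') (use zc \<gamma> Yc in auto)
    also have "\<dots> = x"
      by (subst finsum_indicator) (use G \<gamma> zc Yc in auto)
    finally show ?case
      using \<gamma> Y additive_subgroup.zero_closed
      by (intro exI[of _ "\<lambda>\<gamma>'. if \<gamma>' = \<gamma> then y else \<zero>"]) auto
  next
    case (diff x y)
    then obtain c d where c: "\<forall>\<gamma>\<in>G. c \<gamma> \<in> Y \<gamma>" "x = (\<Oplus>\<gamma>\<in>G. z \<gamma> \<otimes> c \<gamma>)"
      and d: "\<forall>\<gamma>\<in>G. d \<gamma> \<in> Y \<gamma>" "y = (\<Oplus>\<gamma>\<in>G. z \<gamma> \<otimes> d \<gamma>)" by blast
    have "(\<Oplus>\<gamma>\<in>G. z \<gamma> \<otimes> (c \<gamma> \<ominus> d \<gamma>)) = (\<Oplus>\<gamma>\<in>G. z \<gamma> \<otimes> c \<gamma> \<oplus> (\<ominus> (z \<gamma> \<otimes> d \<gamma>)))"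
      by (rule finsum_cong') (use zc c(1) d(1) Yc in \<open>auto simp: minus_eq r_distr r_minus\<close>)
    also have "\<dots> = x \<oplus> (\<Oplus>\<gamma>\<in>G. \<ominus> (z \<gamma> \<otimes> d \<gamma>))"
      unfolding c(2) by (rule finsum_addf) (use zc c(1) d(1) Yc in auto)
    also have "(\<Oplus>\<gamma>\<in>G. \<ominus> (z \<gamma> \<otimes> d \<gamma>)) = \<ominus> y"
      unfolding d(2) by (rule finsum_minus) (use zc d(1) Yc G in auto)
    finally show ?case
      using c(1) d(1) Y additive_subgroup_diff
      by (intro exI[of _ "\<lambda>\<gamma>. c \<gamma> \<ominus> d \<gamma>"]) (auto simp: minus_eq)
  }
qed

context filtered_adic
begin

section \<open>Leading terms of a right ideal\<close>

context
  fixes I :: "'a set"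
  assumes I_subgroup: "additive_subgroup I A" and I_B: "I \<subseteq> B"
    and I_mult: "\<And>x b. \<lbrakk>x \<in> I; b \<in> B\<rbrakk> \<Longrightarrow> x \<otimes> b \<in> I"
begin

text \<open>Such an \<open>f\<close> is a leading coefficient at exponent \<open>a\<close> and
  degree \<open>n\<close>: some element of \<open>I\<close> equals \<open>p [^] a\<close> times f up
  to a limit of earlier terms, where earlier means smaller weight, or equal weight and smaller
  degree.\<close>

definition leading :: "nat \<Rightarrow> nat \<Rightarrow> 'a set" where
  "leading a n = {f \<in> F n. \<exists>z\<in>I. z \<ominus> p [^] a \<otimes> f \<in> cl (W n (int n - int a))}"

lemma leadingI:
  "\<lbrakk>f \<in> F n; z \<in> I; z \<ominus> p [^] a \<otimes> f \<in> cl (W n (int n - int a))\<rbrakk> \<Longrightarrow> f \<in> leading a n"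
  unfolding leading_def by blast

lemma leading_F: "leading a n \<subseteq> F n"
  unfolding leading_def by blast

lemma I_closed: "x \<in> I \<Longrightarrow> x \<in> carrier A"
  using I_B B_closed by blast

lemma clW_subgroup: "additive_subgroup (cl (W n i)) A"
  by (rule cl_subgroup[OF W_subgroup])

lemma W_clW: "x \<in> W n i \<Longrightarrow> x \<in> cl (W n i)"
  using cl_incl[OF W_subset] by blast

lemma leading_subgroup: "additive_subgroup (leading a n) A"
proof (rule additive_subgroup_diffI)
  show "\<zero> \<in> leading a n"
    using additive_subgroup.zero_closed[OF F_subgroup] additive_subgroup.zero_closed[OF I_subgroup]
      additive_subgroup.zero_closed[OF clW_subgroup]
    by (auto simp: leading_def minus_eq intro!: bexI[of _ \<zero>])
  fix f g assume "f \<in> leading a n" "g \<in> leading a n"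
  then obtain z w where *: "f \<in> F n" "g \<in> F n" "z \<in> I" "w \<in> I"
    "z \<ominus> p [^] a \<otimes> f \<in> cl (W n (int n - int a))" "w \<ominus> p [^] a \<otimes> g \<in> cl (W n (int n - int a))"
    by (auto simp: leading_def)
  then have "(z \<ominus> w) \<ominus> p [^] a \<otimes> (f \<ominus> g) = (z \<ominus> p [^] a \<otimes> f) \<ominus> (w \<ominus> p [^] a \<otimes> g)"
    using F_closed[OF *(1)] F_closed[OF *(2)] I_closed[OF *(3)] I_closed[OF *(4)] nat_pow_closed[OF p_closed, of a]
    by algebra
  then show "f \<ominus> g \<in> leading a n"
    using additive_subgroup_diff[OF clW_subgroup *(5,6)]
    by (intro leadingI[OF additive_subgroup_diff[OF F_subgroup *(1,2)] additive_subgroup_diff[OF I_subgroup *(3,4)]])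
       simp
qed (auto simp: leading_def)

lemma W_lower: "f \<in> filt_lower F n \<Longrightarrow> p [^] a \<otimes> f \<in> W n (int n - int a)"
  by (rule W_gen[of f "n - 1"]) (auto simp: filt_lower_def split: if_splits)

lemma filt_lower_F: "filt_lower F n \<subseteq> F n"
  using F_mono[of "n - 1"] by (auto simp: filt_lower_def)

lemma leading_lower: "filt_lower F n \<subseteq> leading a n"
proof
  fix f assume f: "f \<in> filt_lower F n"
  have "p [^] a \<otimes> f \<in> cl (W n (int n - int a))" using W_clW[OF W_lower[OF f]] .
  then have "\<zero> \<ominus> p [^] a \<otimes> f \<in> cl (W n (int n - int a))"
    by (intro additive_subgroup_diff[OF clW_subgroup] additive_subgroup.zero_closed[OF clW_subgroup])
  then show "f \<in> leading a n"
    using f filt_lower_F additive_subgroup.zero_closed[OF I_subgroup] by (auto simp: leading_def)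
qed

lemma leading_mult:
  assumes "f \<in> leading a n" "y \<in> F m"
  shows "f \<otimes> y \<in> leading a (n + m)"
proof -
  obtain z where z: "f \<in> F n" "z \<in> I" "z \<ominus> p [^] a \<otimes> f \<in> cl (W n (int n - int a))"
    using assms(1) by (auto simp: leading_def)
  have eq: "z \<otimes> y \<ominus> p [^] a \<otimes> (f \<otimes> y) = (z \<ominus> p [^] a \<otimes> f) \<otimes> (p [^] (0::nat) \<otimes> y)"
    using z(1,2) I_closed assms(2) by (simp add: minus_eq l_distr l_minus m_assoc)
  have e: "int n - int a + (int m - int 0) = int (n + m) - int a" by simp
  have "z \<otimes> y \<ominus> p [^] a \<otimes> (f \<otimes> y) \<in> cl (W (n + m) (int (n + m) - int a))"
    unfolding eq using cl_W_mult[OF z(3) assms(2), of 0] unfolding e .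
  moreover have "y \<in> B" using F_U[OF assms(2)] U_B by blast
  ultimately show ?thesis
    by (intro leadingI[OF F_mult[OF z(1) assms(2)] I_mult[OF z(2)]])
qed

text \<open>Multiplying the witness by \<open>p\<close> keeps the degree and lowers the weight by
  one. This makes the leading coefficients an increasing sequence in \<open>a\<close>.\<close>

lemma leading_Suc: "leading a n \<subseteq> leading (Suc a) n"
proof
  fix f assume "f \<in> leading a n"
  then obtain z where z: "f \<in> F n" "z \<in> I" "z \<ominus> p [^] a \<otimes> f \<in> cl (W n (int n - int a))"
    by (auto simp: leading_def)
  have c: "f \<in> carrier A" "z \<in> carrier A" "p [^] a \<in> carrier A" using z(1,2) I_closed by auto
  have "p [^] Suc a \<otimes> f = (p [^] a \<otimes> f) \<otimes> p" using c by (simp add: m_assoc p_central)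
  then have "z \<otimes> p \<ominus> p [^] Suc a \<otimes> f = (z \<ominus> p [^] a \<otimes> f) \<otimes> p"
    using c by (simp add: minus_eq l_distr l_minus)
  also have "\<dots> = (z \<ominus> p [^] a \<otimes> f) \<otimes> (p [^] (1::nat) \<otimes> \<one>)" by simp
  finally have "z \<otimes> p \<ominus> p [^] Suc a \<otimes> f = (z \<ominus> p [^] a \<otimes> f) \<otimes> (p [^] (1::nat) \<otimes> \<one>)" .
  moreover have e: "int n - int a + (int 0 - int 1) = int n - int (Suc a)" by simp
  have "(z \<ominus> p [^] a \<otimes> f) \<otimes> (p [^] (1::nat) \<otimes> \<one>) \<in> cl (W (n + 0) (int n - int (Suc a)))"
    using cl_W_mult[OF z(3) F_one, of 1] unfolding e .
  moreover have "p \<in> B" using D_p D_B by blast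
  ultimately show "f \<in> leading (Suc a) n"
    by (intro leadingI[OF z(1) I_mult[OF z(2)], of p]) (simp_all only: add_0_right)
qed

lemma leading_mono: "a \<le> b \<Longrightarrow> leading a n \<subseteq> leading b n"
  by (rule lift_Suc_mono_le) (rule leading_Suc)

text \<open>The union of the increasing sequence is finitely generated, and its generators already
  occur at some exponent \<open>K\<close>. They serve for all \<open>a \<ge> K\<close>, while each
  of the finitely many smaller exponents brings generators of its own. Each generator is tagged with
  the exponent \<open>b \<le> a\<close> at which it has a witness in \<open>I\<close>, because the
  missing factor \<open>p [^] (a - b)\<close> has to be restored.\<close>

lemma leading_generators:
  assumes "graded_noetherian A F"
  shows "\<exists>G. finite G \<and> (\<forall>(m, b, g)\<in>G. g \<in> leading b m) \<and> (\<forall>a n. leading a n \<subseteq> additive_span A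
    ({g \<otimes> y | m b g y. (m, b, g) \<in> G \<and> m \<le> n \<and> b \<le> a \<and> y \<in> F (n - m)} \<union> filt_lower F n))"
proof -
  define Lu where "Lu n = (\<Union>a. leading a n)" for n
  have fam: "graded_family A F (leading a)" for a
    unfolding graded_family_def using leading_subgroup leading_lower leading_mult leading_F by blast
  have famu: "graded_family A F Lu"
    unfolding graded_family_def
  proof (intro conjI allI ballI)
    fix n
    show "additive_subgroup (Lu n) A"
    proof (rule additive_subgroup_diffI)
      show "\<zero> \<in> Lu n" using additive_subgroup.zero_closed[OF leading_subgroup] by (auto simp: Lu_def)
      fix x y assume "x \<in> Lu n" "y \<in> Lu n"
      then obtain a b where "x \<in> leading a n" "y \<in> leading b n" by (auto simp: Lu_def)
      then have "x \<in> leading (max a b) n" "y \<in> leading (max a b) n"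
        using leading_mono[of a "max a b"] leading_mono[of b "max a b"] by auto
      from additive_subgroup_diff[OF leading_subgroup this] show "x \<ominus> y \<in> Lu n"
        unfolding Lu_def by blast
    qed (auto simp: Lu_def leading_def)
    show "Lu n \<subseteq> F n" by (auto simp: Lu_def leading_def)
    show "filt_lower F n \<subseteq> Lu n" using leading_lower by (auto simp: Lu_def)
    fix m x y assume "x \<in> Lu n" "y \<in> F m"
    then show "x \<otimes> y \<in> Lu (n + m)" unfolding Lu_def using leading_mult by blast
  qed
  have "\<forall>a. \<exists>J. finite J \<and> (\<forall>(m, g)\<in>J. g \<in> leading a m) \<and> (\<forall>n. leading a n \<subseteq> additive_span A
       ({g \<otimes> y | m g y. (m, g) \<in> J \<and> m \<le> n \<and> y \<in> F (n - m)} \<union> filt_lower F n))"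
    by (rule allI, rule mp[OF spec[OF assms[unfolded graded_noetherian_def]] fam])
  from choice[OF this]
  obtain J where J0: "\<forall>a. finite (J a) \<and> (\<forall>(m, g)\<in>J a. g \<in> leading a m) \<and> (\<forall>n. leading a n \<subseteq> additive_span A
       ({g \<otimes> y | m g y. (m, g) \<in> J a \<and> m \<le> n \<and> y \<in> F (n - m)} \<union> filt_lower F n))"
    by (elim exE)
  note J1 = J0[rule_format]
  have J2: "\<And>a m g. (m, g) \<in> J a \<Longrightarrow> g \<in> leading a m" using conjunct1[OF conjunct2[OF J1]] by blast
  note J = conjunct1[OF J1] J2 spec[OF conjunct2[OF conjunct2[OF J1]]]
  obtain Ju where Ju0: "finite Ju" "\<forall>(m, g)\<in>Ju. g \<in> Lu m"
    "\<forall>n. Lu n \<subseteq> additive_span A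
       ({g \<otimes> y | m g y. (m, g) \<in> Ju \<and> m \<le> n \<and> y \<in> F (n - m)} \<union> filt_lower F n)"
    using mp[OF spec[OF assms[unfolded graded_noetherian_def]] famu] by (elim exE conjE) (rule that)
  have Ju2: "\<And>m g. (m, g) \<in> Ju \<Longrightarrow> g \<in> Lu m" using Ju0(2) by blast
  note Ju = Ju0(1) Ju2 spec[OF Ju0(3)]
  have "\<exists>K. \<forall>(m, g)\<in>Ju'. g \<in> leading K m" if "finite Ju'" "Ju' \<subseteq> Ju" for Ju'
    using that
  proof induct
    case (insert j Ju')
    then obtain K where K: "\<forall>(m, g)\<in>Ju'. g \<in> leading K m" by blast
    obtain m g where j: "j = (m, g)" by (cases j)
    then obtain a where "g \<in> leading a m" using insert(4) Ju(2)[of m g] by (auto simp: Lu_def)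
    then have "\<forall>(m, g)\<in>insert j Ju'. g \<in> leading (max a K) m"
      using K j leading_mono[of a "max a K"] leading_mono[of K "max a K"] by fastforce
    then show ?case by blast
  qed simp
  then obtain K where K: "\<forall>(m, g)\<in>Ju. g \<in> leading K m" using Ju(1) by blast
  define G where "G = (\<Union>a<K. (\<lambda>(m, g). (m, a, g)) ` J a) \<union> (\<lambda>(m, g). (m, K, g)) ` Ju"
  have "finite G" using J(1) Ju(1) by (simp add: G_def)
  moreover have "\<forall>(m, b, g)\<in>G. g \<in> leading b m" using J(2) K by (auto simp: G_def)
  moreover have "leading a n \<subseteq> additive_span A
    ({g \<otimes> y | m b g y. (m, b, g) \<in> G \<and> m \<le> n \<and> b \<le> a \<and> y \<in> F (n - m)} \<union> filt_lower F n)" for a n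
  proof (cases "a < K")
    case True
    then have "(m, a, g) \<in> G" if "(m, g) \<in> J a" for m g using that by (force simp: G_def)
    then show ?thesis by (intro order_trans[OF J(3)] additive_span_mono) blast
  next
    case False
    have "(m, K, g) \<in> G" if "(m, g) \<in> Ju" for m g using that by (force simp: G_def)
    then have "Lu n \<subseteq> additive_span A
      ({g \<otimes> y | m b g y. (m, b, g) \<in> G \<and> m \<le> n \<and> b \<le> a \<and> y \<in> F (n - m)} \<union> filt_lower F n)"
      using False by (intro order_trans[OF Ju(3)] additive_span_mono) fastforce
    then show ?thesis by (auto simp: Lu_def)
  qed
  ultimately show ?thesis by blast
qed

section \<open>Successive approximation with the chosen generators\<close>

context
  fixes G :: "(nat \<times> nat \<times> 'a) set" and z :: "nat \<times> nat \<times> 'a \<Rightarrow> 'a"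
  assumes G_finite: "finite G"
    and G_leading: "\<And>m b g. (m, b, g) \<in> G \<Longrightarrow> g \<in> F m"
    and G_span: "\<And>a n. leading a n \<subseteq> additive_span A
      ({g \<otimes> y | m b g y. (m, b, g) \<in> G \<and> m \<le> n \<and> b \<le> a \<and> y \<in> F (n - m)} \<union> filt_lower F n)"
    and z_I: "\<And>\<gamma>. \<gamma> \<in> G \<Longrightarrow> z \<gamma> \<in> I"
    and z_leading: "\<And>m b g. (m, b, g) \<in> G \<Longrightarrow> z (m, b, g) \<ominus> p [^] b \<otimes> g \<in> cl (W m (int m - int b))"
begin

abbreviation (input) deg :: "nat \<times> nat \<times> 'a \<Rightarrow> int" where "deg \<gamma> \<equiv> int (fst \<gamma>) - int (fst (snd \<gamma>))"

text \<open>Combinations of the generators whose total weight is at most \<open>i\<close>: as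
  \<open>z \<gamma>\<close> has weight \<open>deg \<gamma>\<close>, its coefficient may have weight
  up to \<open>i - deg \<gamma>\<close>.\<close>

definition S :: "int \<Rightarrow> 'a set" where
  "S i = additive_span A {z \<gamma> \<otimes> y | \<gamma> y. \<gamma> \<in> G \<and> y \<in> T (i - deg \<gamma>)}"

lemma S_I: "S i \<subseteq> I"
  unfolding S_def by (rule additive_span_le[OF I_subgroup]) (use z_I I_mult T_U U_B in blast)

lemma S_subgroup: "additive_subgroup (S i) A"
  unfolding S_def by (rule additive_span_subgroup) (use I_closed z_I T_closed in blast)

lemma S_closed: "s \<in> S i \<Longrightarrow> s \<in> carrier A"
  using S_I I_closed by blast

text \<open>A summand g y of \<open>f\<close>, with witness \<open>z\<close> for g at exponent
  \<open>b\<close>, is matched by z times \<open>p [^] (a - b)\<close> y. The remainder is the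
  product of z - \<open>p [^] b\<close> g with that same factor, so it consists of earlier terms by
  \<open>cl_W_mult\<close>.\<close>

lemma leading_reduce:
  assumes "f \<in> leading a n"
  shows "\<exists>s\<in>S (int n - int a). p [^] a \<otimes> f \<ominus> s \<in> cl (W n (int n - int a))"
proof -
  have "f \<in> additive_span A
      ({g \<otimes> y | m b g y. (m, b, g) \<in> G \<and> m \<le> n \<and> b \<le> a \<and> y \<in> F (n - m)} \<union> filt_lower F n)"
    using assms G_span by blast
  then have "f \<in> carrier A \<and> ?thesis"
  proof induct
    case zero
    then show ?case
      using additive_subgroup.zero_closed[OF S_subgroup] additive_subgroup.zero_closed[OF clW_subgroup]
      by (auto simp: minus_eq intro!: bexI[of _ \<zero>])
  next
    case (gen f)
    then show ?case
    proof
      assume f: "f \<in> filt_lower F n"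
      have fc: "f \<in> carrier A" using f filt_lower_F F_closed by blast
      have "p [^] a \<otimes> f \<ominus> \<zero> = p [^] a \<otimes> f" using fc by (simp add: minus_eq)
      then show ?thesis
        using W_clW[OF W_lower[OF f]] additive_subgroup.zero_closed[OF S_subgroup] fc
        by (intro conjI bexI[of _ \<zero>]) simp_all
    next
      assume "f \<in> {g \<otimes> y | m b g y. (m, b, g) \<in> G \<and> m \<le> n \<and> b \<le> a \<and> y \<in> F (n - m)}"
      then obtain m b g y where f: "f = g \<otimes> y" and g: "(m, b, g) \<in> G" "m \<le> n" "b \<le> a" and y: "y \<in> F (n - m)"
        by blast
      let ?y = "p [^] (a - b) \<otimes> y" and ?z = "z (m, b, g)"
      have gc: "g \<in> carrier A" "y \<in> carrier A" "?y \<in> carrier A" "?z \<in> carrier A"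
        using G_leading[OF g(1)] F_closed y I_closed[OF z_I[OF g(1)]] by auto
      have "?y \<in> T (int n - int a - deg (m, b, g))"
        by (rule T_gen[OF y]) (use g in \<open>simp add: of_nat_diff\<close>)
      then have s: "?z \<otimes> ?y \<in> S (int n - int a)"
        unfolding S_def using g(1) by (intro additive_span.gen) blast
      have "p [^] a \<otimes> f = (p [^] b \<otimes> g) \<otimes> ?y"
        using gc pp_left_comm[of g y "a - b"] g(3) by (simp add: f m_assoc pp_add)
      then have "p [^] a \<otimes> f \<ominus> ?z \<otimes> ?y = \<zero> \<ominus> (?z \<ominus> p [^] b \<otimes> g) \<otimes> ?y"
        using gc nat_pow_closed[OF p_closed, of b] by (simp only:) algebra
      moreover have "(?z \<ominus> p [^] b \<otimes> g) \<otimes> ?y \<in>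
          cl (W (m + (n - m)) (int m - int b + (int (n - m) - int (a - b))))"
        by (rule cl_W_mult[OF z_leading[OF g(1)] y])
      moreover have "int m - int b + (int (n - m) - int (a - b)) = int n - int a" "m + (n - m) = n"
        using g by (simp_all add: of_nat_diff)
      ultimately have "p [^] a \<otimes> f \<ominus> ?z \<otimes> ?y \<in> cl (W n (int n - int a))"
        using additive_subgroup_diff[OF clW_subgroup additive_subgroup.zero_closed[OF clW_subgroup]] by simp
      then show ?thesis using s f gc by blast
    qed
  next
    case (diff f g)
    then obtain s t where s: "s \<in> S (int n - int a)" "p [^] a \<otimes> f \<ominus> s \<in> cl (W n (int n - int a))"
      and t: "t \<in> S (int n - int a)" "p [^] a \<otimes> g \<ominus> t \<in> cl (W n (int n - int a))" by blast
    have "p [^] a \<otimes> (f \<ominus> g) \<ominus> (s \<ominus> t) = (p [^] a \<otimes> f \<ominus> s) \<ominus> (p [^] a \<otimes> g \<ominus> t)"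
      using diff S_closed[OF s(1)] S_closed[OF t(1)] nat_pow_closed[OF p_closed, of a] by algebra
    then show ?case
      using diff additive_subgroup_diff[OF clW_subgroup s(2) t(2)]
      by (intro conjI bexI[OF _ additive_subgroup_diff[OF S_subgroup s(1) t(1)]]) simp_all
  qed
  then show ?thesis by blast
qed

text \<open>The exponent is the least natural k with - k at most \<open>i - 1\<close>, so that the
  neighbourhood lies in the closure of weight below \<open>i\<close>.\<close>

lemma nbhd_clW: "nbhd (nat (1 - i)) \<subseteq> cl (W N i)"
proof -
  have "nbhd (nat (1 - i)) \<subseteq> cl (T (- int (nat (1 - i))))" by (rule nbhd_cl_T)
  also have "\<dots> \<subseteq> cl (T (i - 1))" by (intro cl_mono T_mono) simp
  also have "\<dots> = cl (W 0 i)" by (simp add: W_0)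
  also have "\<dots> \<subseteq> cl (W N i)" by (intro cl_mono W_mono) simp
  finally show ?thesis .
qed

text \<open>Induction on the degree bound: the part of weight \<open>i\<close> and top degree
  \<open>N\<close> is a leading coefficient and can be removed by \<open>leading_reduce\<close>.
  After the last degree only weight at most \<open>i - 1\<close> is left.\<close>

lemma W_reduce:
  "\<lbrakk>x \<in> I; x \<in> cl (W N i)\<rbrakk> \<Longrightarrow> \<exists>s\<in>S i. x \<ominus> s \<in> I \<inter> cl (T (i - 1))"
proof (induct N arbitrary: x)
  case 0
  have "x \<ominus> \<zero> = x" using I_closed[OF 0(1)] by (simp add: minus_eq)
  then show ?case
    using 0 additive_subgroup.zero_closed[OF S_subgroup] by (intro bexI[of _ \<zero>]) (auto simp: W_0)
next
  case (Suc N)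
  show ?case
  proof (cases "i \<le> int N")
    case False
    then show ?thesis using Suc W_Suc_small by simp
  next
    case True
    define a where "a = nat (int N - i)"
    have ai: "int N - int a = i" using True by (simp add: a_def)
    have xc: "x \<in> carrier A" using Suc I_closed by blast
    \<comment> \<open>The precision is chosen so that the error has weight below \<open>i\<close>
      and may be moved into the remainder.\<close>
    obtain u where u: "u \<in> W (Suc N) i" "x \<ominus> u \<in> nbhd (nat (1 - i))"
      using Suc(3) by (auto simp: cl_def)
    obtain f x' where f: "f \<in> F N" "x' \<in> W N i" "u = p [^] a \<otimes> f \<oplus> x'"
      using W_Suc_split[OF True u(1)] by (auto simp: a_def)
    have c: "f \<in> carrier A" "x' \<in> carrier A" "p [^] a \<in> carrier A" "u \<in> carrier A"
      using f W_closed u(1) by auto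
    have "x \<ominus> p [^] a \<otimes> f = (x \<ominus> u) \<oplus> x'"
      unfolding f(3) using c xc by algebra
    also have "\<dots> \<in> cl (W N i)"
      using additive_subgroup.a_closed[OF clW_subgroup] u(2) nbhd_clW W_clW[OF f(2)] by blast
    finally have 1: "x \<ominus> p [^] a \<otimes> f \<in> cl (W N i)" .
    then have "f \<in> leading a N" using f(1) Suc(2) by (auto simp: leading_def ai)
    from leading_reduce[OF this] obtain s where s: "s \<in> S i" "p [^] a \<otimes> f \<ominus> s \<in> cl (W N i)"
      by (auto simp: ai)
    have sc: "s \<in> carrier A" by (rule S_closed[OF s(1)])
    have "x \<ominus> s = (x \<ominus> p [^] a \<otimes> f) \<oplus> (p [^] a \<otimes> f \<ominus> s)"
      using c xc sc by algebra
    also have "\<dots> \<in> cl (W N i)" by (rule additive_subgroup.a_closed[OF clW_subgroup 1 s(2)])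
    finally have "x \<ominus> s \<in> cl (W N i)" .
    moreover have "x \<ominus> s \<in> I" using additive_subgroup_diff[OF I_subgroup Suc(2)] s(1) S_I by blast
    ultimately obtain t where t: "t \<in> S i" "(x \<ominus> s) \<ominus> t \<in> I \<inter> cl (T (i - 1))" using Suc(1) by blast
    have "x \<ominus> (s \<oplus> t) = (x \<ominus> s) \<ominus> t" using xc sc S_closed[OF t(1)] by algebra
    then show ?thesis
      using t(2) by (intro bexI[OF _ additive_subgroup.a_closed[OF S_subgroup s(1) t(1)]]) simp
  qed
qed

lemma T_reduce:
  assumes "x \<in> I" "x \<in> cl (T i)"
  shows "\<exists>s\<in>S i. x \<ominus> s \<in> I \<inter> cl (T (i - 1))"
proof -
  obtain u where u: "u \<in> T i" "x \<ominus> u \<in> nbhd (nat (1 - i))" using assms(2) by (auto simp: cl_def)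
  then obtain N where N: "u \<in> W N i" using T_split_W by blast
  have "x = (x \<ominus> u) \<oplus> u" using I_closed[OF assms(1)] T_closed[OF u(1)] by algebra
  also have "\<dots> \<in> cl (W N i)"
    using additive_subgroup.a_closed[OF clW_subgroup] u(2) nbhd_clW W_clW[OF N] by blast
  finally show ?thesis by (rule W_reduce[OF assms(1)])
qed

text \<open>Each application of \<open>T_reduce\<close> lowers the weight of the remainder by one.
  The coefficients subtracted from one generator tend to zero, their sum exists because
  \<open>D\<close> is complete, and the final remainder lies in every neighbourhood, hence
  vanishes.\<close>

lemma I_generated:
  assumes "x \<in> I"
  shows "x \<in> additive_span A {g \<otimes> b | g b. g \<in> z ` G \<and> b \<in> B}"
proof -
  have xc: "x \<in> carrier A" using I_closed assms by blast
  obtain n u d where ud: "u \<in> F n" "d \<in> D" "x = u \<oplus> d" using B_decomp assms I_B by blast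
  define i where "i = int n"
  have "u \<in> T i" using T_gen[OF ud(1), of 0 i] ud(1) by (simp add: i_def)
  then have "u \<in> cl (T i)" using cl_incl T_closed by blast
  moreover have "d \<in> cl (T i)"
    using nbhd_cl_T[of 0] cl_mono[OF T_mono[of 0 i]] ud(2) by (auto simp: nbhd_0 i_def)
  ultimately have xi: "x \<in> cl (T i)"
    unfolding ud(3) by (intro additive_subgroup.a_closed cl_subgroup T_subgroup)
  have "\<forall>j y. \<exists>s. y \<in> I \<inter> cl (T j) \<longrightarrow> s \<in> S j \<and> y \<ominus> s \<in> I \<inter> cl (T (j - 1))"
    using T_reduce by blast
  then obtain \<sigma> where \<sigma>: "\<And>j y. y \<in> I \<inter> cl (T j) \<Longrightarrow> \<sigma> j y \<in> S j \<and> y \<ominus> \<sigma> j y \<in> I \<inter> cl (T (j - 1))"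
    by metis
  \<comment> \<open>The remainder after \<open>t\<close> steps, of weight at most
    \<open>i - t\<close> up to closure.\<close>
  define r where "r = rec_nat x (\<lambda>t y. y \<ominus> \<sigma> (i - int t) y)"
  have r_simps: "r 0 = x" "\<And>t. r (Suc t) = r t \<ominus> \<sigma> (i - int t) (r t)" by (simp_all add: r_def)
  have r: "r t \<in> I \<inter> cl (T (i - int t))" for t
  proof (induct t)
    case (Suc t)
    then show ?case using \<sigma>[OF Suc] by (simp add: r_simps algebra_simps)
  qed (use assms xi in \<open>simp add: r_simps\<close>)
  have rc: "r t \<in> carrier A" for t using r I_closed by blast
  have zc: "z \<gamma> \<in> carrier A" if "\<gamma> \<in> G" for \<gamma> using z_I I_closed that by blast
  have "\<exists>c. (\<forall>\<gamma>\<in>G. c \<gamma> \<in> T (i - int t - deg \<gamma>)) \<and> \<sigma> (i - int t) (r t) = (\<Oplus>\<gamma>\<in>G. z \<gamma> \<otimes> c \<gamma>)" for t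
    using \<sigma>[OF r[of t]] unfolding S_def
    by (intro additive_span_coefficients G_finite T_subgroup) (use zc in auto)
  then obtain c where c: "\<And>t \<gamma>. \<gamma> \<in> G \<Longrightarrow> c t \<gamma> \<in> T (i - int t - deg \<gamma>)"
    "\<And>t. \<sigma> (i - int t) (r t) = (\<Oplus>\<gamma>\<in>G. z \<gamma> \<otimes> c t \<gamma>)" by metis
  have cc: "c t \<gamma> \<in> carrier A" "c t \<gamma> \<in> U" if "\<gamma> \<in> G" for t \<gamma>
    using c(1)[OF that] T_closed T_U by blast+
  define C where "C = (\<lambda>t \<gamma>. rec_nat \<zero> (\<lambda>t y. y \<oplus> c t \<gamma>) t)"
  have C_simps: "C 0 \<gamma> = \<zero>" "C (Suc t) \<gamma> = C t \<gamma> \<oplus> c t \<gamma>" for t \<gamma> by (simp_all add: C_def)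
  have CU: "C t \<gamma> \<in> U" if "\<gamma> \<in> G" for t \<gamma>
    by (induct t) (use cc[OF that] additive_subgroup.zero_closed[OF U_subgroup]
      additive_subgroup.a_closed[OF U_subgroup] in \<open>auto simp: C_simps\<close>)
  then have Cc: "C t \<gamma> \<in> carrier A" if "\<gamma> \<in> G" for t \<gamma> using that U_closed by blast
  have xr: "x = r t \<oplus> (\<Oplus>\<gamma>\<in>G. z \<gamma> \<otimes> C t \<gamma>)" for t
  proof (induct t)
    case 0
    have "(\<Oplus>\<gamma>\<in>G. z \<gamma> \<otimes> C 0 \<gamma>) = \<zero>"
      by (rule add.finprod_one_eqI) (use zc in \<open>auto simp: C_simps\<close>)
    then show ?case using xc by (simp add: r_simps)
  next
    case (Suc t)
    have "(\<Oplus>\<gamma>\<in>G. z \<gamma> \<otimes> C (Suc t) \<gamma>) = (\<Oplus>\<gamma>\<in>G. z \<gamma> \<otimes> C t \<gamma> \<oplus> z \<gamma> \<otimes> c t \<gamma>)"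
      by (rule finsum_cong') (use zc cc Cc in \<open>auto simp: C_simps r_distr\<close>)
    also have "\<dots> = (\<Oplus>\<gamma>\<in>G. z \<gamma> \<otimes> C t \<gamma>) \<oplus> \<sigma> (i - int t) (r t)"
      unfolding c(2) by (rule finsum_addf) (use zc cc Cc in auto)
    finally have "r (Suc t) \<oplus> (\<Oplus>\<gamma>\<in>G. z \<gamma> \<otimes> C (Suc t) \<gamma>)
        = (r t \<ominus> \<sigma> (i - int t) (r t)) \<oplus> ((\<Oplus>\<gamma>\<in>G. z \<gamma> \<otimes> C t \<gamma>) \<oplus> \<sigma> (i - int t) (r t))"
      by (simp add: r_simps)
    also have "\<dots> = r t \<oplus> (\<Oplus>\<gamma>\<in>G. z \<gamma> \<otimes> C t \<gamma>)"
    proof -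
      have "\<sigma> (i - int t) (r t) \<in> carrier A" using \<sigma>[OF r] S_closed by blast
      moreover have "(\<Oplus>\<gamma>\<in>G. z \<gamma> \<otimes> C t \<gamma>) \<in> carrier A"
        by (rule finsum_closed) (use zc Cc in auto)
      ultimately show ?thesis using rc[of t] diff_add_swap by simp
    qed
    finally show ?case using Suc by simp
  qed
  \<comment> \<open>From step \<open>k\<close> on all coefficients have weight at most 0 and lie in
    \<open>D\<close>, so completeness can be applied to the tails. The sum of the positive parts is
    a crude common bound.\<close>
  obtain k :: nat where k: "\<And>\<gamma>. \<gamma> \<in> G \<Longrightarrow> i - deg \<gamma> \<le> int k"
  proof
    fix \<gamma> assume "\<gamma> \<in> G"
    then have "nat (i - deg \<gamma>) \<le> (\<Sum>\<gamma>\<in>G. nat (i - deg \<gamma>))"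
      by (rule member_le_sum) (use G_finite in auto)
    then show "i - deg \<gamma> \<le> int (\<Sum>\<gamma>\<in>G. nat (i - deg \<gamma>))" by linarith
  qed
  have cn: "c (k + n) \<gamma> \<in> nbhd n" if "\<gamma> \<in> G" for n \<gamma>
    using c(1)[OF that, of "k + n"] T_mono[of "i - int (k + n) - deg \<gamma>" "- int n"] k[OF that] T_nbhd[of n]
    by auto
  have "\<exists>l\<in>D. \<forall>n. (C (k + n) \<gamma> \<ominus> C k \<gamma>) \<ominus> l \<in> nbhd n" if g: "\<gamma> \<in> G" for \<gamma>
  proof -
    have "C (k + n) \<gamma> \<ominus> C k \<gamma> \<in> D" for n
    proof (induct n)
      case 0
      then show ?case
        using Cc[OF g] additive_subgroup.zero_closed[OF D_subgroup] by (simp add: minus_eq r_neg)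
    next
      case (Suc n)
      have "C (k + Suc n) \<gamma> \<ominus> C k \<gamma> = (C (k + n) \<gamma> \<ominus> C k \<gamma>) \<oplus> c (k + n) \<gamma>"
        using Cc[OF g, of k] Cc[OF g, of "k + n"] cc(1)[OF g, of "k + n"]
        by (simp only: add_Suc_right C_simps) algebra
      moreover have "c (k + n) \<gamma> \<in> D" using cn[OF g] nbhd_antimono[of 0 n] nbhd_0 by auto
      ultimately show ?case using additive_subgroup.a_closed[OF D_subgroup Suc] by simp
    qed
    moreover have "(C (k + Suc n) \<gamma> \<ominus> C k \<gamma>) \<ominus> (C (k + n) \<gamma> \<ominus> C k \<gamma>) \<in> nbhd n" for n
    proof -
      have "(C (k + Suc n) \<gamma> \<ominus> C k \<gamma>) \<ominus> (C (k + n) \<gamma> \<ominus> C k \<gamma>) = c (k + n) \<gamma>"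
        using Cc[OF g, of k] Cc[OF g, of "k + n"] cc(1)[OF g, of "k + n"]
        by (simp only: add_Suc_right C_simps) algebra
      then show ?thesis using cn[OF g] by simp
    qed
    ultimately show ?thesis using complete[of "\<lambda>n. C (k + n) \<gamma> \<ominus> C k \<gamma>"] by blast
  qed
  then obtain l where l: "\<And>\<gamma>. \<gamma> \<in> G \<Longrightarrow> l \<gamma> \<in> D"
    "\<And>\<gamma> n. \<gamma> \<in> G \<Longrightarrow> (C (k + n) \<gamma> \<ominus> C k \<gamma>) \<ominus> l \<gamma> \<in> nbhd n" by metis
  \<comment> \<open>The first \<open>k\<close> coefficients add up to an element of
    \<open>U\<close>, the others converge in \<open>D\<close>; so the limit is in
    \<open>B\<close>.\<close>
  define E where "E \<gamma> = C k \<gamma> \<oplus> l \<gamma>" for \<gamma>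
  have EB: "E \<gamma> \<in> B" if "\<gamma> \<in> G" for \<gamma>
    unfolding E_def using CU[OF that] l(1)[OF that] U_B D_B
    by (intro additive_subgroup.a_closed[OF B_subgroup]) blast+
  then have Ec: "E \<gamma> \<in> carrier A" if "\<gamma> \<in> G" for \<gamma> using that B_closed by blast
  have CE: "C (k + n) \<gamma> \<ominus> E \<gamma> \<in> nbhd n" if "\<gamma> \<in> G" for n \<gamma>
  proof -
    have "C (k + n) \<gamma> \<ominus> E \<gamma> = (C (k + n) \<gamma> \<ominus> C k \<gamma>) \<ominus> l \<gamma>"
      unfolding E_def using Cc[OF that, of k] Cc[OF that, of "k + n"] D_closed[OF l(1)[OF that]] by algebra
    then show ?thesis using l(2)[OF that] by simp
  qed
  \<comment> \<open>A common denominator of the generators, which bounds the precision lost when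
    they multiply the errors in the coefficients.\<close>
  have "\<exists>q::nat. \<forall>\<gamma>\<in>G. p [^] q \<otimes> z \<gamma> \<in> D"
  proof -
    have "\<forall>\<gamma>\<in>G. \<exists>q::nat. p [^] q \<otimes> z \<gamma> \<in> D" using B_D z_I I_B by blast
    then obtain q where q: "\<And>\<gamma>. \<gamma> \<in> G \<Longrightarrow> p [^] (q \<gamma> :: nat) \<otimes> z \<gamma> \<in> D" by metis
    have "p [^] (\<Sum>\<gamma>\<in>G. q \<gamma>) \<otimes> z \<gamma> \<in> D" if "\<gamma> \<in> G" for \<gamma>
    proof -
      have le: "q \<gamma> \<le> (\<Sum>\<gamma>\<in>G. q \<gamma>)" by (rule member_le_sum) (use that G_finite in auto)
      have "p [^] ((\<Sum>\<gamma>\<in>G. q \<gamma>) - q \<gamma>) \<otimes> (p [^] q \<gamma> \<otimes> z \<gamma>) \<in> D"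
        by (rule D_mult[OF D_pp q[OF that]])
      then show ?thesis using le zc[OF that] by (simp add: pp_add)
    qed
    then show ?thesis by blast
  qed
  then obtain q :: nat where q: "\<And>\<gamma>. \<gamma> \<in> G \<Longrightarrow> p [^] q \<otimes> z \<gamma> \<in> D" by blast
  let ?e = "\<Oplus>\<gamma>\<in>G. z \<gamma> \<otimes> E \<gamma>"
  have ec: "?e \<in> carrier A" by (rule finsum_closed) (use zc Ec in auto)
  have "x \<ominus> ?e \<in> nbhd n" for n
  proof -
    \<comment> \<open>The term \<open>q\<close> pays for the denominators of the generators, and
      \<open>nat i\<close> brings the weight of the remainder down to \<open>- n\<close>.\<close>
    define m where "m = n + q + nat i"
    let ?d = "\<Oplus>\<gamma>\<in>G. z \<gamma> \<otimes> (C (k + m) \<gamma> \<ominus> E \<gamma>)" and ?C = "\<Oplus>\<gamma>\<in>G. z \<gamma> \<otimes> C (k + m) \<gamma>"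
    have "?d = (\<Oplus>\<gamma>\<in>G. z \<gamma> \<otimes> C (k + m) \<gamma> \<oplus> (\<ominus> (z \<gamma> \<otimes> E \<gamma>)))"
      by (rule finsum_cong') (use zc Cc Ec in \<open>auto simp: minus_eq r_distr r_minus\<close>)
    also have "\<dots> = ?C \<oplus> (\<Oplus>\<gamma>\<in>G. \<ominus> (z \<gamma> \<otimes> E \<gamma>))"
      by (rule finsum_addf) (use zc Cc Ec in auto)
    also have "(\<Oplus>\<gamma>\<in>G. \<ominus> (z \<gamma> \<otimes> E \<gamma>)) = \<ominus> ?e"
      by (rule finsum_minus) (use zc Ec G_finite in auto)
    finally have d: "?d = ?C \<oplus> \<ominus> ?e" .
    have Cc': "?C \<in> carrier A" by (rule finsum_closed) (use zc Cc in auto)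
    have "x \<ominus> ?e = (r (k + m) \<oplus> ?C) \<ominus> ?e" using xr[of "k + m"] by simp
    also have "\<dots> = r (k + m) \<oplus> ?d"
      unfolding d using rc[of "k + m"] Cc' ec by (intro diff_add_swap)
    finally have "x \<ominus> ?e = r (k + m) \<oplus> ?d" .
    moreover have "?d \<in> nbhd n"
    proof (rule finsum_in_subgroup[OF nbhd_subgroup])
      fix \<gamma> assume g: "\<gamma> \<in> G"
      have "C (k + m) \<gamma> \<ominus> E \<gamma> \<in> nbhd (n + q)"
        using CE[OF g, of m] nbhd_antimono[of "n + q" m] by (auto simp: m_def)
      then show "z \<gamma> \<otimes> (C (k + m) \<gamma> \<ominus> E \<gamma>) \<in> nbhd n"
        by (rule nbhd_mult_left[OF zc[OF g] q[OF g]])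
    qed
    moreover have "r (k + m) \<in> nbhd n"
    proof -
      have "i - int (k + m) \<le> - int n" by (simp add: m_def)
      from cl_mono[OF T_mono[OF this]] show ?thesis using r[of "k + m"] cl_T_nbhd[of n] by blast
    qed
    ultimately show ?thesis using nbhd_add by simp
  qed
  then have "x \<ominus> ?e = \<zero>" by (rule separated)
  then have "x = ?e" using xc ec by (simp add: r_right_minus_eq)
  also have "\<dots> \<in> additive_span A {g \<otimes> b | g b. g \<in> z ` G \<and> b \<in> B}"
  proof (rule finsum_in_subgroup)
    show "additive_subgroup (additive_span A {g \<otimes> b | g b. g \<in> z ` G \<and> b \<in> B}) A"
      by (rule additive_span_subgroup) (use zc B_closed in auto)
    show "z \<gamma> \<otimes> E \<gamma> \<in> additive_span A {g \<otimes> b | g b. g \<in> z ` G \<and> b \<in> B}" if "\<gamma> \<in> G" for \<gamma>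
      using that EB by (intro additive_span.gen) blast
  qed
  finally show ?thesis .
qed

end

lemma I_finitely_generated:
  assumes "graded_noetherian A F"
  shows "\<exists>G. finite G \<and> G \<subseteq> I \<and> I \<subseteq> additive_span A {g \<otimes> b | g b. g \<in> G \<and> b \<in> B}"
proof -
  obtain G where G0: "finite G" "\<forall>(m, b, g)\<in>G. g \<in> leading b m"
    "\<forall>a n. leading a n \<subseteq> additive_span A
      ({g \<otimes> y | m b g y. (m, b, g) \<in> G \<and> m \<le> n \<and> b \<le> a \<and> y \<in> F (n - m)} \<union> filt_lower F n)"
    using leading_generators[OF assms] by (elim exE conjE) (rule that)
  have G2: "\<And>m b g. (m, b, g) \<in> G \<Longrightarrow> g \<in> leading b m" using G0(2) by blast
  note G = G0(1) G2 G0(3)[rule_format]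
  have "\<forall>\<gamma>\<in>G. \<exists>w. w \<in> I \<and> w \<ominus> p [^] fst (snd \<gamma>) \<otimes> snd (snd \<gamma>) \<in> cl (W (fst \<gamma>) (int (fst \<gamma>) - int (fst (snd \<gamma>))))"
    using G(2) by (fastforce simp: leading_def)
  from bchoice[OF this] obtain z where z: "\<And>\<gamma>. \<gamma> \<in> G \<Longrightarrow> z \<gamma> \<in> I"
    "\<And>m b g. (m, b, g) \<in> G \<Longrightarrow> z (m, b, g) \<ominus> p [^] b \<otimes> g \<in> cl (W m (int m - int b))"
    by fastforce
  have gF: "\<And>m b g. (m, b, g) \<in> G \<Longrightarrow> g \<in> F m" using G(2) by (auto simp: leading_def)
  have "I \<subseteq> additive_span A {g \<otimes> b | g b. g \<in> z ` G \<and> b \<in> B}"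
    by (rule subsetI, rule I_generated[OF G(1) gF G(3) z])
  then show ?thesis using G(1) z(1) by (intro exI[of _ "z ` G"]) auto
qed

end

theorem B_noetherian:
  assumes "graded_noetherian A F"
  shows "finitely_generated_right_ideals A B"
  unfolding finitely_generated_right_ideals_def
  using I_finitely_generated[OF _ _ _ assms] by blast

end

subsection \<open>Flatness of a completed localization\<close>

text \<open>Vectors of a finite free right module are functions on a whole type of which only the
  values on a finite set matter; accordingly equalities are claimed on that set only.\<close>

inductive_set function_span :: "('a, 'z) ring_scheme \<Rightarrow> 'a set \<Rightarrow> ('i \<Rightarrow> 'a) set \<Rightarrow> ('i \<Rightarrow> 'a) set"
  for A :: "('a, 'z) ring_scheme" and B :: "'a set" and Z :: "('i \<Rightarrow> 'a) set"
  where zero: "(\<lambda>_. \<zero>\<^bsub>A\<^esub>) \<in> function_span A B Z"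
  | gen: "\<lbrakk>z \<in> Z; b \<in> B\<rbrakk> \<Longrightarrow> (\<lambda>l. z l \<otimes>\<^bsub>A\<^esub> b) \<in> function_span A B Z"
  | diff: "\<lbrakk>x \<in> function_span A B Z; y \<in> function_span A B Z\<rbrakk>
      \<Longrightarrow> (\<lambda>l. x l \<ominus>\<^bsub>A\<^esub> y l) \<in> function_span A B Z"

definition function_submodule :: "('a, 'z) ring_scheme \<Rightarrow> 'a set \<Rightarrow> ('i \<Rightarrow> 'a) set \<Rightarrow> bool" where
  "function_submodule A B Z \<longleftrightarrow> (\<lambda>_. \<zero>\<^bsub>A\<^esub>) \<in> Z \<and> (\<forall>z\<in>Z. \<forall>b\<in>B. (\<lambda>l. z l \<otimes>\<^bsub>A\<^esub> b) \<in> Z) \<and>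
    (\<forall>x\<in>Z. \<forall>y\<in>Z. (\<lambda>l. x l \<ominus>\<^bsub>A\<^esub> y l) \<in> Z)"

lemma function_span_mono: "Z \<subseteq> Z' \<Longrightarrow> function_span A B Z \<subseteq> function_span A B Z'"
proof
  fix x assume "Z \<subseteq> Z'" "x \<in> function_span A B Z"
  from this(2,1) show "x \<in> function_span A B Z'"
    by induct (auto intro: function_span.intros)
qed

lemma function_span_le: "\<lbrakk>function_submodule A B Z'; Z \<subseteq> Z'\<rbrakk> \<Longrightarrow> function_span A B Z \<subseteq> Z'"
proof
  fix x assume *: "function_submodule A B Z'" "Z \<subseteq> Z'" "x \<in> function_span A B Z"
  from *(3) show "x \<in> Z'"
    by induct (use *(1,2) in \<open>auto simp: function_submodule_def\<close>)
qed

text \<open>Finite free modules over a Noetherian ring are Noetherian, by induction on the number of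
  coordinates. The values at one coordinate form a right ideal; after subtracting lifts of its
  generators that coordinate is zero, and the remaining ones are covered by the induction.\<close>

lemma (in ring) function_submodule_finitely_generated:
  assumes B: "additive_subgroup B R" "\<And>x y. \<lbrakk>x \<in> B; y \<in> B\<rbrakk> \<Longrightarrow> x \<otimes> y \<in> B" "\<one> \<in> B"
    and noeth: "finitely_generated_right_ideals R B"
    and "finite L"
    and "function_submodule R B Z" "\<And>z l. \<lbrakk>z \<in> Z; l \<in> L\<rbrakk> \<Longrightarrow> z l \<in> B"
  shows "\<exists>G. finite G \<and> G \<subseteq> Z \<and> (\<forall>z\<in>Z. \<exists>w\<in>function_span R B G. \<forall>l\<in>L. z l = w l)"
  using assms(5-7)
proof (induct L arbitrary: Z rule: finite_induct)
  case empty
  then show ?case by (intro exI[of _ "{}"]) (auto intro: function_span.zero)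
next
  case (insert i L)
  have Bc: "B \<subseteq> carrier R" using additive_subgroup.a_subset[OF B(1)] .
  have Z0: "(\<lambda>_. \<zero>) \<in> Z" and Zb: "\<And>z b. \<lbrakk>z \<in> Z; b \<in> B\<rbrakk> \<Longrightarrow> (\<lambda>l. z l \<otimes> b) \<in> Z"
    and Zd: "\<And>x y. \<lbrakk>x \<in> Z; y \<in> Z\<rbrakk> \<Longrightarrow> (\<lambda>l. x l \<ominus> y l) \<in> Z"
    using insert(4) by (auto simp: function_submodule_def)
  define J where "J = (\<lambda>z. z i) ` Z"
  have "additive_subgroup J R"
  proof (rule additive_subgroup_diffI)
    show "J \<subseteq> carrier R" using insert(5) Bc by (auto simp: J_def)
    show "\<zero> \<in> J" using Z0 by (force simp: J_def)
    show "x \<ominus> y \<in> J" if xy: "x \<in> J" "y \<in> J" for x y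
    proof -
      obtain z w where "z \<in> Z" "w \<in> Z" "x = z i" "y = w i" using xy by (auto simp: J_def)
      then show ?thesis using imageI[OF Zd, of z w "\<lambda>z. z i"] by (simp add: J_def)
    qed
  qed
  moreover have "J \<subseteq> B" using insert(5) by (auto simp: J_def)
  moreover have "x \<otimes> b \<in> J" if xb: "x \<in> J" "b \<in> B" for x b
  proof -
    obtain z where "z \<in> Z" "x = z i" using xb by (auto simp: J_def)
    then show ?thesis using imageI[OF Zb[of z b], of "\<lambda>z. z i"] xb by (simp add: J_def)
  qed
  ultimately have "additive_subgroup J R \<and> J \<subseteq> B \<and> (\<forall>x\<in>J. \<forall>b\<in>B. x \<otimes> b \<in> J)"
    by (intro conjI ballI)
  from mp[OF spec[OF noeth[unfolded finitely_generated_right_ideals_def]] this]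
  obtain G1 where G1: "finite G1" "G1 \<subseteq> J" "J \<subseteq> additive_span R {g \<otimes> b | g b. g \<in> G1 \<and> b \<in> B}"
    by (elim exE conjE) (rule that)
  from finite_subset_image[OF G1(1) G1(2)[unfolded J_def]]
  obtain H1 where H1: "H1 \<subseteq> Z" "finite H1" "G1 = (\<lambda>z. z i) ` H1" by (elim exE conjE) (rule that)
  define Z' where "Z' = {z \<in> Z. z i = \<zero>}"
  have sub': "function_submodule R B Z'"
    using Z0 Zb Zd Bc by (auto simp: function_submodule_def Z'_def minus_eq)
  have B': "z l \<in> B" if "z \<in> Z'" "l \<in> L" for z l using that insert(5) by (auto simp: Z'_def)
  have "\<exists>G. finite G \<and> G \<subseteq> Z' \<and> (\<forall>z\<in>Z'. \<exists>w\<in>function_span R B G. \<forall>l\<in>L. z l = w l)"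
    by (rule insert(3)[OF sub']) (rule B')
  then obtain G2 where G2: "finite G2" "G2 \<subseteq> Z'" "\<forall>z\<in>Z'. \<exists>w\<in>function_span R B G2. \<forall>l\<in>L. z l = w l"
    by (elim exE conjE) (rule that)
  have "\<exists>w\<in>function_span R B (H1 \<union> G2). \<forall>l\<in>insert i L. z l = w l" if z: "z \<in> Z" for z
  proof -
    have lift: "\<exists>w\<in>function_span R B H1. w i = x" if "x \<in> additive_span R {g \<otimes> b | g b. g \<in> G1 \<and> b \<in> B}" for x
      using that
    proof induct
      case zero
      then show ?case by (rule bexI[OF _ function_span.zero]) simp
    next
      case (gen x)
      then obtain h b where "h \<in> H1" "b \<in> B" "x = h i \<otimes> b" by (auto simp: H1(3))
      then show ?case by (intro bexI[OF _ function_span.gen]) auto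
    next
      case (diff x y)
      then obtain v w where vw: "v \<in> function_span R B H1" "w \<in> function_span R B H1" "v i = x" "w i = y" by blast
      then show ?case by (intro bexI[OF _ function_span.diff[OF vw(1,2)]]) simp
    qed
    have "z i \<in> J" using z by (simp add: J_def)
    then obtain v where v: "v \<in> function_span R B H1" "v i = z i" using lift G1(3) by blast
    have vZ: "v \<in> Z" using function_span_le[OF insert(4) H1(1)] v(1) by blast
    have "(\<lambda>l. z l \<ominus> v l) \<in> Z'"
      using Zd[OF z vZ] insert(5)[OF z, of i] Bc by (auto simp: Z'_def v(2) minus_eq r_neg)
    from bspec[OF G2(3) this]
    obtain w where w: "w \<in> function_span R B G2" "\<forall>l\<in>L. z l \<ominus> v l = w l" by (elim bexE) (rule that)
    have wZ': "w \<in> Z'" using function_span_le[OF sub' G2(2)] w(1) by blast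
    have v': "v \<in> function_span R B (H1 \<union> G2)" and w': "w \<in> function_span R B (H1 \<union> G2)"
      by (rule subsetD[OF function_span_mono v(1)], simp, rule subsetD[OF function_span_mono w(1)], simp)
    \<comment> \<open>This is v + w, written with the one operation that the span provides.\<close>
    have "(\<lambda>l. v l \<ominus> (\<zero> \<ominus> w l)) \<in> function_span R B (H1 \<union> G2)"
      using function_span.diff[OF v' function_span.diff[OF function_span.zero w']] .
    moreover have "z l = v l \<ominus> (\<zero> \<ominus> w l)" if l: "l \<in> insert i L" for l
    proof -
      have c: "z l \<in> carrier R" "v l \<in> carrier R" "w l \<in> carrier R"
        using insert(5)[OF z l] insert(5)[OF vZ l] insert(5)[of w l] wZ' l Bc by (auto simp: Z'_def)
      have "z l \<ominus> v l = w l"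
      proof (cases "l = i")
        case True
        then show ?thesis using c wZ' by (simp add: v(2) Z'_def minus_eq r_neg)
      next
        case False
        then show ?thesis using w(2) l by blast
      qed
      then have "v l \<ominus> (\<zero> \<ominus> w l) = v l \<ominus> (\<zero> \<ominus> (z l \<ominus> v l))" by simp
      also have "\<dots> = z l" using c by algebra
      finally show ?thesis by simp
    qed
    ultimately show ?thesis by (intro bexI) auto
  qed
  moreover have "finite (H1 \<union> G2)" "H1 \<union> G2 \<subseteq> Z" using H1 G1(1) G2(1,2) by (auto simp: Z'_def)
  ultimately show ?case by blast
qed

text \<open>Membership in the span remembers no coefficients. They are made explicit, one for each
  generator, since limits will be taken coefficient by coefficient.\<close>

lemma (in ring) function_span_coefficients:
  assumes B: "additive_subgroup B R" and G: "finite G" "\<And>g l. \<lbrakk>g \<in> G; l \<in> L\<rbrakk> \<Longrightarrow> g l \<in> B"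
    and "w \<in> function_span R B G"
  shows "\<exists>c. (\<forall>g\<in>G. c g \<in> B) \<and> (\<forall>l\<in>L. w l = (\<Oplus>g\<in>G. g l \<otimes> c g))"
  using assms(4)
proof induct
  have Bc: "b \<in> B \<Longrightarrow> b \<in> carrier R" for b using additive_subgroup.a_subset[OF B] by blast
  have gc: "g l \<in> carrier R" if "g \<in> G" "l \<in> L" for g l using G(2)[OF that] Bc by blast
  {
    case zero
    have "(\<Oplus>g\<in>G. g l \<otimes> \<zero>) = \<zero>" if "l \<in> L" for l
      by (rule add.finprod_one_eqI) (use gc that in auto)
    then show ?case using additive_subgroup.zero_closed[OF B] by (intro exI[of _ "\<lambda>_. \<zero>"]) auto
  next
    case (gen z b)
    have "(\<Oplus>g\<in>G. g l \<otimes> (if g = z then b else \<zero>)) = z l \<otimes> b" if "l \<in> L" for l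
    proof -
      have "(\<Oplus>g\<in>G. g l \<otimes> (if g = z then b else \<zero>)) = (\<Oplus>g\<in>G. if g = z then g l \<otimes> b else \<zero>)"
        by (rule finsum_cong') (use gc gen Bc that in auto)
      also have "\<dots> = z l \<otimes> b"
        by (subst finsum_indicator) (use G gen gc Bc that in auto)
      finally show ?thesis .
    qed
    then show ?case
      using gen additive_subgroup.zero_closed[OF B]
      by (intro exI[of _ "\<lambda>g. if g = z then b else \<zero>"]) auto
  next
    case (diff x y)
    then obtain c d where c: "\<forall>g\<in>G. c g \<in> B" "\<forall>l\<in>L. x l = (\<Oplus>g\<in>G. g l \<otimes> c g)"
      and d: "\<forall>g\<in>G. d g \<in> B" "\<forall>l\<in>L. y l = (\<Oplus>g\<in>G. g l \<otimes> d g)" by blast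
    have "(\<Oplus>g\<in>G. g l \<otimes> (c g \<ominus> d g)) = x l \<ominus> y l" if l: "l \<in> L" for l
    proof -
      have "(\<Oplus>g\<in>G. g l \<otimes> (c g \<ominus> d g)) = (\<Oplus>g\<in>G. g l \<otimes> c g \<oplus> (\<ominus> (g l \<otimes> d g)))"
        by (rule finsum_cong') (use gc l c(1) d(1) Bc in \<open>auto simp: minus_eq r_distr r_minus\<close>)
      also have "\<dots> = (\<Oplus>g\<in>G. g l \<otimes> c g) \<oplus> (\<Oplus>g\<in>G. \<ominus> (g l \<otimes> d g))"
        by (rule finsum_addf) (use gc l c(1) d(1) Bc in auto)
      also have "(\<Oplus>g\<in>G. \<ominus> (g l \<otimes> d g)) = \<ominus> (\<Oplus>g\<in>G. g l \<otimes> d g)"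
        by (rule finsum_minus) (use gc l d(1) Bc G in auto)
      finally show ?thesis using c(2) d(2) l by (simp add: minus_eq)
    qed
    then show ?case
      using c(1) d(1) additive_subgroup_diff[OF B]
      by (intro exI[of _ "\<lambda>g. c g \<ominus> d g"]) auto
  }
qed

lemma (in ring) uniform_power:
  assumes "finite S" "p \<in> carrier R" "S \<subseteq> carrier R"
    and X: "\<And>x. x \<in> Y \<Longrightarrow> p \<otimes> x \<in> Y" "\<And>s. s \<in> S \<Longrightarrow> \<exists>n::nat. p [^] n \<otimes> s \<in> Y"
  shows "\<exists>n::nat. \<forall>s\<in>S. p [^] n \<otimes> s \<in> Y"
  using assms(1,3,5)
proof induct
  case (insert s S)
  have "\<exists>n::nat. \<forall>s\<in>S. p [^] n \<otimes> s \<in> Y"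
    by (rule insert(3)) (use insert(4,5) in auto)
  then obtain n :: nat where n: "\<forall>s\<in>S. p [^] n \<otimes> s \<in> Y" by (elim exE)
  have "\<exists>m::nat. p [^] m \<otimes> s \<in> Y" by (rule insert(5)) simp
  then obtain m :: nat where m: "p [^] m \<otimes> s \<in> Y" by (elim exE)
  have mono: "p [^] (k + j :: nat) \<otimes> x \<in> Y" if "p [^] j \<otimes> x \<in> Y" "x \<in> carrier R" for k j :: nat and x
  proof (induct k)
    case (Suc k)
    have "p [^] (Suc k + j) \<otimes> x = p \<otimes> (p [^] (k + j) \<otimes> x)"
      unfolding add_Suc nat_pow_Suc2[OF assms(2)] by (rule m_assoc) (use assms(2) that in auto)
    then show ?case using X(1)[OF Suc] by simp
  qed (use that in simp)
  have "p [^] (n + m) \<otimes> s \<in> Y" by (rule mono[OF m]) (use insert(4) in blast)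
  moreover have "p [^] (n + m) \<otimes> x \<in> Y" if "x \<in> S" for x
    unfolding add.commute[of n m] by (rule mono) (use n insert(4) that in blast)+
  ultimately show ?case by (intro exI[of _ "n + m"]) blast
qed simp

lemma (in abelian_group) add_eq_imp_diff_eq:
  assumes "a \<oplus> b = c \<oplus> d" "a \<in> carrier G" "b \<in> carrier G" "c \<in> carrier G" "d \<in> carrier G"
  shows "a \<ominus> c = d \<ominus> b"
proof -
  have "(a \<oplus> b) \<ominus> (c \<oplus> b) = (a \<ominus> c) \<oplus> (b \<ominus> b)" using assms(2-) by (simp add: minus_eq minus_add a_ac)
  then have "a \<ominus> c = (a \<oplus> b) \<ominus> (c \<oplus> b)" using assms(2-) by (simp add: minus_eq r_neg)
  also have "\<dots> = (c \<oplus> d) \<ominus> (c \<oplus> b)" by (simp add: assms(1))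
  also have "\<dots> = (d \<ominus> b) \<oplus> (c \<ominus> c)" using assms(2-) by (simp add: minus_eq minus_add a_ac)
  also have "\<dots> = d \<ominus> b" using assms(2-) by (simp add: minus_eq r_neg)
  finally show ?thesis .
qed

section \<open>Linear combinations over a noncommutative ring\<close>

context ring
begin

lemma dot_closed:
  "\<lbrakk>\<And>l. l \<in> L \<Longrightarrow> r l \<in> carrier R; \<And>l. l \<in> L \<Longrightarrow> x l \<in> carrier R\<rbrakk> \<Longrightarrow> (\<Oplus>l\<in>L. r l \<otimes> x l) \<in> carrier R"
  by (rule finsum_closed) auto

lemma dot_add:
  assumes "\<And>l. l \<in> L \<Longrightarrow> r l \<in> carrier R" "\<And>l. l \<in> L \<Longrightarrow> x l \<in> carrier R" "\<And>l. l \<in> L \<Longrightarrow> y l \<in> carrier R"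
  shows "(\<Oplus>l\<in>L. r l \<otimes> (x l \<oplus> y l)) = (\<Oplus>l\<in>L. r l \<otimes> x l) \<oplus> (\<Oplus>l\<in>L. r l \<otimes> y l)"
proof -
  have "(\<Oplus>l\<in>L. r l \<otimes> (x l \<oplus> y l)) = (\<Oplus>l\<in>L. r l \<otimes> x l \<oplus> r l \<otimes> y l)"
    by (rule finsum_cong') (use assms in \<open>auto simp: r_distr\<close>)
  also have "\<dots> = (\<Oplus>l\<in>L. r l \<otimes> x l) \<oplus> (\<Oplus>l\<in>L. r l \<otimes> y l)"
    by (rule finsum_addf) (use assms in auto)
  finally show ?thesis .
qed

lemma dot_diff:
  assumes L: "finite L"
    and "\<And>l. l \<in> L \<Longrightarrow> r l \<in> carrier R" "\<And>l. l \<in> L \<Longrightarrow> x l \<in> carrier R" "\<And>l. l \<in> L \<Longrightarrow> y l \<in> carrier R"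
  shows "(\<Oplus>l\<in>L. r l \<otimes> (x l \<ominus> y l)) = (\<Oplus>l\<in>L. r l \<otimes> x l) \<ominus> (\<Oplus>l\<in>L. r l \<otimes> y l)"
proof -
  have "(\<Oplus>l\<in>L. r l \<otimes> (x l \<ominus> y l)) = (\<Oplus>l\<in>L. r l \<otimes> x l \<oplus> (\<ominus> (r l \<otimes> y l)))"
    by (rule finsum_cong') (use assms in \<open>auto simp: minus_eq r_distr r_minus\<close>)
  also have "\<dots> = (\<Oplus>l\<in>L. r l \<otimes> x l) \<oplus> (\<Oplus>l\<in>L. \<ominus> (r l \<otimes> y l))"
    by (rule finsum_addf) (use assms in auto)
  also have "(\<Oplus>l\<in>L. \<ominus> (r l \<otimes> y l)) = \<ominus> (\<Oplus>l\<in>L. r l \<otimes> y l)"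
    by (rule finsum_minus[OF L]) (use assms in auto)
  finally show ?thesis by (simp add: minus_eq)
qed

lemma dot_smult_right:
  assumes L: "finite L" and "b \<in> carrier R"
    and "\<And>l. l \<in> L \<Longrightarrow> r l \<in> carrier R" "\<And>l. l \<in> L \<Longrightarrow> x l \<in> carrier R"
  shows "(\<Oplus>l\<in>L. r l \<otimes> (x l \<otimes> b)) = (\<Oplus>l\<in>L. r l \<otimes> x l) \<otimes> b"
proof -
  have "(\<Oplus>l\<in>L. r l \<otimes> (x l \<otimes> b)) = (\<Oplus>l\<in>L. r l \<otimes> x l \<otimes> b)"
    by (rule finsum_cong') (use assms in \<open>auto simp: m_assoc\<close>)
  also have "\<dots> = (\<Oplus>l\<in>L. r l \<otimes> x l) \<otimes> b"
    by (rule finsum_ldistr[symmetric]) (use assms in auto)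
  finally show ?thesis .
qed

lemma dot_central:
  assumes L: "finite L" and b: "b \<in> carrier R" "\<And>x. x \<in> carrier R \<Longrightarrow> x \<otimes> b = b \<otimes> x"
    and "\<And>l. l \<in> L \<Longrightarrow> r l \<in> carrier R" "\<And>l. l \<in> L \<Longrightarrow> x l \<in> carrier R"
  shows "(\<Oplus>l\<in>L. r l \<otimes> (b \<otimes> x l)) = b \<otimes> (\<Oplus>l\<in>L. r l \<otimes> x l)"
proof -
  have "(\<Oplus>l\<in>L. r l \<otimes> (b \<otimes> x l)) = (\<Oplus>l\<in>L. r l \<otimes> (x l \<otimes> b))"
    by (rule finsum_cong') (use assms in auto)
  also have "\<dots> = (\<Oplus>l\<in>L. r l \<otimes> x l) \<otimes> b"
    by (rule dot_smult_right) (use assms in auto)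
  also have "\<dots> = b \<otimes> (\<Oplus>l\<in>L. r l \<otimes> x l)"
    by (rule b(2)) (use assms in \<open>auto intro: dot_closed\<close>)
  finally show ?thesis .
qed

end

lemma (in ring_hom_ring) hom_dot:
  assumes "finite L" "\<And>l. l \<in> L \<Longrightarrow> r l \<in> carrier R" "\<And>l. l \<in> L \<Longrightarrow> x l \<in> carrier R"
  shows "h (\<Oplus>l\<in>L. r l \<otimes> x l) = (\<Oplus>\<^bsub>S\<^esub>l\<in>L. h (r l) \<otimes>\<^bsub>S\<^esub> h (x l))"
  using assms
proof induct
  case (insert l L)
  have "h (\<Oplus>l\<in>insert l L. r l \<otimes> x l) = h (r l \<otimes> x l \<oplus> (\<Oplus>l\<in>L. r l \<otimes> x l))"
    by (subst R.finsum_insert) (use insert in auto)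
  also have "\<dots> = h (r l) \<otimes>\<^bsub>S\<^esub> h (x l) \<oplus>\<^bsub>S\<^esub> h (\<Oplus>l\<in>L. r l \<otimes> x l)"
    using insert R.dot_closed[of L r x] by simp
  also have "\<dots> = (\<Oplus>\<^bsub>S\<^esub>l\<in>insert l L. h (r l) \<otimes>\<^bsub>S\<^esub> h (x l))"
    by (subst S.finsum_insert) (use insert in auto)
  finally show ?case .
qed simp

lemma ring_as_left_module_simps [simp]:
  "carrier (ring_as_left_module \<phi> R) = carrier R"
  "\<zero>\<^bsub>ring_as_left_module \<phi> R\<^esub> = \<zero>\<^bsub>R\<^esub>"
  "(\<oplus>\<^bsub>ring_as_left_module \<phi> R\<^esub>) = (\<oplus>\<^bsub>R\<^esub>)"
  "a \<odot>\<^bsub>ring_as_left_module \<phi> R\<^esub> x = \<phi> a \<otimes>\<^bsub>R\<^esub> x"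
  "x \<otimes>\<^bsub>ring_as_left_module \<phi> R\<^esub> y = x \<otimes>\<^bsub>R\<^esub> y"
  "\<one>\<^bsub>ring_as_left_module \<phi> R\<^esub> = \<one>\<^bsub>R\<^esub>"
  by (simp_all add: ring_as_left_module_def)

lemma finsum_ring_as_left_module [simp]: "finsum (ring_as_left_module \<phi> R) = finsum R"
  by (intro ext) (simp add: finsum_def finprod_def)

lemma (in ring_hom_ring) ring_as_left_module: "left_module R (ring_as_left_module h S)"
proof -
  have "abelian_group (ring_as_left_module h S)"
    by (rule abelian_groupI) (auto simp: S.a_ac intro!: bexI[of _ "\<ominus>\<^bsub>S\<^esub> x" for x] S.l_neg)
  then show ?thesis
    by (intro left_module.intro R.ring_axioms left_module_axioms.intro)
       (auto simp: S.l_distr S.r_distr S.m_assoc)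
qed

text \<open>The last two assumptions say that \<open>B\<close> and \<open>C\<close> have the same reduction modulo \<open>p\<close>, so that \<open>C\<close> is the
  \<open>p\<close>-adic completion of \<open>B\<close>.\<close>

locale completed_localization = ring_hom_ring A M \<psi> + M: adic_subring M "\<psi> p" C
  for A :: "('a, 'x) ring_scheme" (structure) and M :: "('c, 'y) ring_scheme" (structure)
    and \<psi> p C +
  fixes B :: "'a set"
  assumes p_in_A: "p \<in> carrier A"
    and p_central_A: "x \<in> carrier A \<Longrightarrow> x \<otimes>\<^bsub>A\<^esub> p = p \<otimes>\<^bsub>A\<^esub> x"
    and p_cancel_A: "\<lbrakk>x \<in> carrier A; p \<otimes>\<^bsub>A\<^esub> x = \<zero>\<^bsub>A\<^esub>\<rbrakk> \<Longrightarrow> x = \<zero>\<^bsub>A\<^esub>"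
    and p_unit_M: "\<psi> p \<in> Units M"
    and B_subgroup: "additive_subgroup B A"
    and B_mult: "\<lbrakk>x \<in> B; y \<in> B\<rbrakk> \<Longrightarrow> x \<otimes>\<^bsub>A\<^esub> y \<in> B"
    and B_one: "\<one>\<^bsub>A\<^esub> \<in> B" and B_p: "p \<in> B"
    and B_noetherian: "finitely_generated_right_ideals A B"
    and A_local: "x \<in> carrier A \<Longrightarrow> \<exists>n::nat. p [^]\<^bsub>A\<^esub> n \<otimes>\<^bsub>A\<^esub> x \<in> B"
    and M_local: "c \<in> carrier M \<Longrightarrow> \<exists>n::nat. \<psi> p [^]\<^bsub>M\<^esub> n \<otimes>\<^bsub>M\<^esub> c \<in> C"
    and B_C: "x \<in> B \<Longrightarrow> \<psi> x \<in> C"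
    and dense: "c \<in> C \<Longrightarrow> \<exists>x\<in>B. \<exists>c'\<in>C. c = \<psi> x \<oplus>\<^bsub>M\<^esub> \<psi> p \<otimes>\<^bsub>M\<^esub> c'"
    and strict: "\<lbrakk>x \<in> B; c \<in> C; \<psi> x = \<psi> p \<otimes>\<^bsub>M\<^esub> c\<rbrakk> \<Longrightarrow> \<exists>x'\<in>B. x = p \<otimes>\<^bsub>A\<^esub> x'"
begin

abbreviation "\<pi> \<equiv> \<psi> p"

lemma B_closed [simp]: "x \<in> B \<Longrightarrow> x \<in> carrier A"
  using additive_subgroup.a_subset[OF B_subgroup] by blast

lemma p_A [simp]: "p \<in> carrier A" by (rule p_in_A)

lemma hom_pow_p: "\<psi> (p [^]\<^bsub>A\<^esub> (n::nat)) = \<pi> [^]\<^bsub>M\<^esub> n"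
  by (induct n) simp_all

lemma pp_central_A: "x \<in> carrier A \<Longrightarrow> x \<otimes>\<^bsub>A\<^esub> p [^]\<^bsub>A\<^esub> (n::nat) = p [^]\<^bsub>A\<^esub> n \<otimes>\<^bsub>A\<^esub> x"
proof (induct n)
  case (Suc n)
  then have "x \<otimes>\<^bsub>A\<^esub> (p [^]\<^bsub>A\<^esub> n \<otimes>\<^bsub>A\<^esub> p) = (p [^]\<^bsub>A\<^esub> n \<otimes>\<^bsub>A\<^esub> x) \<otimes>\<^bsub>A\<^esub> p" by (simp add: R.m_assoc[symmetric])
  also have "\<dots> = p [^]\<^bsub>A\<^esub> n \<otimes>\<^bsub>A\<^esub> p \<otimes>\<^bsub>A\<^esub> x" using Suc by (simp add: R.m_assoc p_central_A)
  finally show ?case by simp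
qed simp

lemma pp_cancel_A: "\<lbrakk>x \<in> carrier A; p [^]\<^bsub>A\<^esub> (n::nat) \<otimes>\<^bsub>A\<^esub> x = \<zero>\<^bsub>A\<^esub>\<rbrakk> \<Longrightarrow> x = \<zero>\<^bsub>A\<^esub>"
proof (induct n arbitrary: x)
  case (Suc n)
  then have "p [^]\<^bsub>A\<^esub> n \<otimes>\<^bsub>A\<^esub> (p \<otimes>\<^bsub>A\<^esub> x) = \<zero>\<^bsub>A\<^esub>" by (simp add: R.m_assoc)
  then have "p \<otimes>\<^bsub>A\<^esub> x = \<zero>\<^bsub>A\<^esub>" by (rule Suc(1)[rotated]) (simp add: Suc)
  then show ?case by (rule p_cancel_A[OF Suc(2)])
qed simp

lemma B_pp: "p [^]\<^bsub>A\<^esub> (n::nat) \<in> B"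
  by (induct n) (auto simp: B_one B_p B_mult)

lemma dense_pow: "y \<in> C \<Longrightarrow> \<exists>x\<in>B. \<exists>c\<in>C. y = \<psi> x \<oplus>\<^bsub>M\<^esub> \<pi> [^]\<^bsub>M\<^esub> (n::nat) \<otimes>\<^bsub>M\<^esub> c"
proof (induct n)
  case 0
  have "\<zero>\<^bsub>A\<^esub> \<in> B" using additive_subgroup.zero_closed[OF B_subgroup] .
  then show ?case using 0 by (intro bexI[of _ "\<zero>\<^bsub>A\<^esub>"] bexI[of _ y]) auto
next
  case (Suc n)
  then obtain x c where x: "x \<in> B" "c \<in> C" "y = \<psi> x \<oplus>\<^bsub>M\<^esub> \<pi> [^]\<^bsub>M\<^esub> n \<otimes>\<^bsub>M\<^esub> c" by blast
  obtain x' c' where x': "x' \<in> B" "c' \<in> C" "c = \<psi> x' \<oplus>\<^bsub>M\<^esub> \<pi> \<otimes>\<^bsub>M\<^esub> c'" using dense[OF x(2)] by blast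
  have "y = \<psi> x \<oplus>\<^bsub>M\<^esub> (\<pi> [^]\<^bsub>M\<^esub> n \<otimes>\<^bsub>M\<^esub> \<psi> x' \<oplus>\<^bsub>M\<^esub> \<pi> [^]\<^bsub>M\<^esub> Suc n \<otimes>\<^bsub>M\<^esub> c')"
    using x x' by (simp add: S.r_distr S.m_assoc)
  also have "\<dots> = \<psi> (x \<oplus>\<^bsub>A\<^esub> p [^]\<^bsub>A\<^esub> n \<otimes>\<^bsub>A\<^esub> x') \<oplus>\<^bsub>M\<^esub> \<pi> [^]\<^bsub>M\<^esub> Suc n \<otimes>\<^bsub>M\<^esub> c'"
    using x x' by (simp add: hom_pow_p S.a_assoc)
  finally show ?case
    using additive_subgroup.a_closed[OF B_subgroup x(1) B_mult[OF B_pp x'(1)]] x'(2) by blast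
qed

text \<open>One factor \<pi> at a time: after each division it is cancelled in \<open>M\<close>,
  where it is regular, and \<open>strict\<close> applies to the quotient.\<close>

lemma strict_pow:
  "\<lbrakk>x \<in> B; c \<in> C; \<psi> x = \<pi> [^]\<^bsub>M\<^esub> (n::nat) \<otimes>\<^bsub>M\<^esub> c\<rbrakk> \<Longrightarrow> \<exists>x'\<in>B. x = p [^]\<^bsub>A\<^esub> n \<otimes>\<^bsub>A\<^esub> x'"
proof (induct n arbitrary: x)
  case 0
  then show ?case by auto
next
  case (Suc n)
  have eq: "\<pi> [^]\<^bsub>M\<^esub> Suc n \<otimes>\<^bsub>M\<^esub> c = \<pi> \<otimes>\<^bsub>M\<^esub> (\<pi> [^]\<^bsub>M\<^esub> n \<otimes>\<^bsub>M\<^esub> c)"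
    using Suc(3) by (simp only: S.nat_pow_Suc2[OF M.p_closed]) (simp add: S.m_assoc)
  have "\<pi> [^]\<^bsub>M\<^esub> n \<otimes>\<^bsub>M\<^esub> c \<in> C" using M.D_mult[OF M.D_pp Suc(3)] .
  then obtain x1 where x1: "x1 \<in> B" "x = p \<otimes>\<^bsub>A\<^esub> x1" using strict[OF Suc(2)] Suc(4) eq by metis
  have c: "\<psi> x1 \<in> carrier M" "\<pi> [^]\<^bsub>M\<^esub> n \<otimes>\<^bsub>M\<^esub> c \<in> carrier M" using x1(1) Suc(3) by simp_all
  have "\<pi> \<otimes>\<^bsub>M\<^esub> \<psi> x1 = \<pi> \<otimes>\<^bsub>M\<^esub> (\<pi> [^]\<^bsub>M\<^esub> n \<otimes>\<^bsub>M\<^esub> c)"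
    using Suc(4) x1(1) unfolding eq x1(2) by simp
  then have "\<pi> [^]\<^bsub>M\<^esub> (1::nat) \<otimes>\<^bsub>M\<^esub> \<psi> x1 = \<pi> [^]\<^bsub>M\<^esub> (1::nat) \<otimes>\<^bsub>M\<^esub> (\<pi> [^]\<^bsub>M\<^esub> n \<otimes>\<^bsub>M\<^esub> c)"
    by simp
  then have "\<psi> x1 = \<pi> [^]\<^bsub>M\<^esub> n \<otimes>\<^bsub>M\<^esub> c" by (rule M.pp_cancel[OF c])
  from Suc(1)[OF x1(1) Suc(3) this] obtain x2 where x2: "x2 \<in> B" "x1 = p [^]\<^bsub>A\<^esub> n \<otimes>\<^bsub>A\<^esub> x2" by blast
  have "x = p [^]\<^bsub>A\<^esub> Suc n \<otimes>\<^bsub>A\<^esub> x2"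
    unfolding x1(2) x2(2) using x2(1) by (simp only: R.nat_pow_Suc2[OF p_A]) (simp add: R.m_assoc)
  then show ?case using x2(1) by blast
qed

section \<open>Solutions of a finite system over the Noetherian ring\<close>

context
  fixes L :: "'i set" and P :: "'j set" and r :: "'j \<Rightarrow> 'i \<Rightarrow> 'a" and m :: "'i \<Rightarrow> 'c"
  assumes L: "finite L" and P: "finite P"
    and r: "\<And>\<rho> l. \<lbrakk>\<rho> \<in> P; l \<in> L\<rbrakk> \<Longrightarrow> r \<rho> l \<in> B"
    and m: "\<And>l. l \<in> L \<Longrightarrow> m l \<in> C"
    and rel: "\<And>\<rho>. \<rho> \<in> P \<Longrightarrow> (\<Oplus>\<^bsub>M\<^esub>l\<in>L. \<psi> (r \<rho> l) \<otimes>\<^bsub>M\<^esub> m l) = \<zero>\<^bsub>M\<^esub>"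
begin

abbreviation "dot \<rho> b \<equiv> (\<Oplus>\<^bsub>A\<^esub>l\<in>L. r \<rho> l \<otimes>\<^bsub>A\<^esub> b l)"

text \<open>The coefficients of the system stand on the left, so the solutions form a right module
  over \<open>B\<close>. Only this submodule and its finite generation link the flatness claim to
  right ideals.\<close>

definition syzygies :: "('i \<Rightarrow> 'a) set" where
  "syzygies = {b. (\<forall>l\<in>L. b l \<in> B) \<and> (\<forall>\<rho>\<in>P. dot \<rho> b = \<zero>\<^bsub>A\<^esub>)}"

text \<open>Vectors whose class in the cokernel of the relation matrix is killed by
  \<open>p [^] n\<close>.\<close>

definition torsion_image :: "nat \<Rightarrow> ('j \<Rightarrow> 'a) set" where
  "torsion_image n = {y. (\<forall>\<rho>\<in>P. y \<rho> \<in> B) \<and>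
     (\<exists>b. (\<forall>l\<in>L. b l \<in> B) \<and> (\<forall>\<rho>\<in>P. p [^]\<^bsub>A\<^esub> n \<otimes>\<^bsub>A\<^esub> y \<rho> = dot \<rho> b))}"

lemma B_diff: "\<lbrakk>x \<in> B; y \<in> B\<rbrakk> \<Longrightarrow> x \<ominus>\<^bsub>A\<^esub> y \<in> B"
  by (rule R.additive_subgroup_diff[OF B_subgroup])

lemma B_zero: "\<zero>\<^bsub>A\<^esub> \<in> B" by (rule additive_subgroup.zero_closed[OF B_subgroup])

lemma dot_zero: "\<rho> \<in> P \<Longrightarrow> dot \<rho> (\<lambda>_. \<zero>\<^bsub>A\<^esub>) = \<zero>\<^bsub>A\<^esub>"
  by (rule R.add.finprod_one_eqI) (use r in auto)

lemma dot_minus: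
  "\<lbrakk>\<rho> \<in> P; x \<in> L \<rightarrow> B; y \<in> L \<rightarrow> B\<rbrakk>
    \<Longrightarrow> dot \<rho> (\<lambda>l. x l \<ominus>\<^bsub>A\<^esub> y l) = dot \<rho> x \<ominus>\<^bsub>A\<^esub> dot \<rho> y"
  by (rule R.dot_diff[OF L]) (use r in \<open>auto simp: Pi_iff\<close>)

lemma dot_mult:
  "\<lbrakk>\<rho> \<in> P; x \<in> L \<rightarrow> B; b \<in> B\<rbrakk> \<Longrightarrow> dot \<rho> (\<lambda>l. x l \<otimes>\<^bsub>A\<^esub> b) = dot \<rho> x \<otimes>\<^bsub>A\<^esub> b"
  by (rule R.dot_smult_right[OF L]) (use r in \<open>auto simp: Pi_iff\<close>)

lemma dot_pp:
  "\<lbrakk>\<rho> \<in> P; x \<in> L \<rightarrow> B\<rbrakk>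
    \<Longrightarrow> dot \<rho> (\<lambda>l. p [^]\<^bsub>A\<^esub> (n::nat) \<otimes>\<^bsub>A\<^esub> x l) = p [^]\<^bsub>A\<^esub> n \<otimes>\<^bsub>A\<^esub> dot \<rho> x"
  by (rule R.dot_central[OF L]) (use r pp_central_A in \<open>auto simp: Pi_iff\<close>)

lemma dot_closed: "\<lbrakk>\<rho> \<in> P; x \<in> L \<rightarrow> B\<rbrakk> \<Longrightarrow> dot \<rho> x \<in> B"
  by (rule R.finsum_in_subgroup[OF B_subgroup]) (use r B_mult in \<open>auto simp: Pi_iff\<close>)

lemma syzygies_submodule: "function_submodule A B syzygies"
  unfolding function_submodule_def
proof (intro conjI ballI)
  show "(\<lambda>_. \<zero>\<^bsub>A\<^esub>) \<in> syzygies" by (simp add: syzygies_def B_zero dot_zero del: R.r_null)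
  fix x assume x: "x \<in> syzygies"
  then have xB: "x \<in> L \<rightarrow> B" and x0: "\<And>\<rho>. \<rho> \<in> P \<Longrightarrow> dot \<rho> x = \<zero>\<^bsub>A\<^esub>"
    by (simp_all add: syzygies_def)
  show "(\<lambda>l. x l \<otimes>\<^bsub>A\<^esub> b) \<in> syzygies" if b: "b \<in> B" for b
    unfolding syzygies_def mem_Collect_eq
  proof (intro conjI ballI)
    fix \<rho> assume \<rho>: "\<rho> \<in> P"
    show "dot \<rho> (\<lambda>l. x l \<otimes>\<^bsub>A\<^esub> b) = \<zero>\<^bsub>A\<^esub>"
      unfolding dot_mult[of \<rho> x b, OF \<rho> xB b] x0[OF \<rho>] using b by simp
  qed (use xB B_mult b in blast)
  fix y assume y: "y \<in> syzygies"
  then have yB: "y \<in> L \<rightarrow> B" and y0: "\<And>\<rho>. \<rho> \<in> P \<Longrightarrow> dot \<rho> y = \<zero>\<^bsub>A\<^esub>"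
    by (simp_all add: syzygies_def)
  show "(\<lambda>l. x l \<ominus>\<^bsub>A\<^esub> y l) \<in> syzygies"
    unfolding syzygies_def mem_Collect_eq
  proof (intro conjI ballI)
    fix \<rho> assume \<rho>: "\<rho> \<in> P"
    show "dot \<rho> (\<lambda>l. x l \<ominus>\<^bsub>A\<^esub> y l) = \<zero>\<^bsub>A\<^esub>"
      unfolding dot_minus[of \<rho> x y, OF \<rho> xB yB] x0[OF \<rho>] y0[OF \<rho>] by (simp add: R.minus_eq)
  qed (use xB yB B_diff in blast)
qed

lemma torsion_image_submodule: "function_submodule A B (torsion_image n)"
  unfolding function_submodule_def
proof (intro conjI ballI)
  show "(\<lambda>_. \<zero>\<^bsub>A\<^esub>) \<in> torsion_image n"
    unfolding torsion_image_def using B_zero dot_zero by (auto intro!: exI[of _ "\<lambda>_. \<zero>\<^bsub>A\<^esub>"])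
  fix x assume "x \<in> torsion_image n"
  then obtain b where x: "\<And>\<rho>. \<rho> \<in> P \<Longrightarrow> x \<rho> \<in> B" "b \<in> L \<rightarrow> B"
    "\<And>\<rho>. \<rho> \<in> P \<Longrightarrow> p [^]\<^bsub>A\<^esub> n \<otimes>\<^bsub>A\<^esub> x \<rho> = dot \<rho> b" by (auto simp: torsion_image_def)
  show "(\<lambda>l. x l \<otimes>\<^bsub>A\<^esub> c) \<in> torsion_image n" if c: "c \<in> B" for c
    unfolding torsion_image_def mem_Collect_eq
  proof (intro conjI ballI exI[of _ "\<lambda>l. b l \<otimes>\<^bsub>A\<^esub> c"])
    fix \<rho> assume \<rho>: "\<rho> \<in> P"
    have "p [^]\<^bsub>A\<^esub> n \<otimes>\<^bsub>A\<^esub> (x \<rho> \<otimes>\<^bsub>A\<^esub> c) = (p [^]\<^bsub>A\<^esub> n \<otimes>\<^bsub>A\<^esub> x \<rho>) \<otimes>\<^bsub>A\<^esub> c"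
      using c x(1)[OF \<rho>] by (simp add: R.m_assoc)
    then show "p [^]\<^bsub>A\<^esub> n \<otimes>\<^bsub>A\<^esub> (x \<rho> \<otimes>\<^bsub>A\<^esub> c) = dot \<rho> (\<lambda>l. b l \<otimes>\<^bsub>A\<^esub> c)"
      unfolding dot_mult[of \<rho> b c, OF \<rho> x(2) c] x(3)[OF \<rho>] .
  qed (use x(1,2) c B_mult in \<open>auto simp: Pi_iff\<close>)
  fix y assume "y \<in> torsion_image n"
  then obtain d where y: "\<And>\<rho>. \<rho> \<in> P \<Longrightarrow> y \<rho> \<in> B" "d \<in> L \<rightarrow> B"
    "\<And>\<rho>. \<rho> \<in> P \<Longrightarrow> p [^]\<^bsub>A\<^esub> n \<otimes>\<^bsub>A\<^esub> y \<rho> = dot \<rho> d" by (auto simp: torsion_image_def)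
  show "(\<lambda>l. x l \<ominus>\<^bsub>A\<^esub> y l) \<in> torsion_image n"
    unfolding torsion_image_def mem_Collect_eq
  proof (intro conjI ballI exI[of _ "\<lambda>l. b l \<ominus>\<^bsub>A\<^esub> d l"])
    fix \<rho> assume \<rho>: "\<rho> \<in> P"
    have "p [^]\<^bsub>A\<^esub> n \<otimes>\<^bsub>A\<^esub> (x \<rho> \<ominus>\<^bsub>A\<^esub> y \<rho>) = p [^]\<^bsub>A\<^esub> n \<otimes>\<^bsub>A\<^esub> x \<rho> \<ominus>\<^bsub>A\<^esub> p [^]\<^bsub>A\<^esub> n \<otimes>\<^bsub>A\<^esub> y \<rho>"
      using x(1)[OF \<rho>] y(1)[OF \<rho>] by (simp add: R.minus_eq R.r_distr R.r_minus)
    then show "p [^]\<^bsub>A\<^esub> n \<otimes>\<^bsub>A\<^esub> (x \<rho> \<ominus>\<^bsub>A\<^esub> y \<rho>) = dot \<rho> (\<lambda>l. b l \<ominus>\<^bsub>A\<^esub> d l)"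
      unfolding dot_minus[of \<rho> b d, OF \<rho> x(2) y(2)] x(3)[OF \<rho>] y(3)[OF \<rho>] .
  qed (use x(1,2) y(1,2) B_diff in \<open>auto simp: Pi_iff\<close>)
qed

lemma torsion_image_mono: "n \<le> k \<Longrightarrow> torsion_image n \<subseteq> torsion_image k"
proof (rule lift_Suc_mono_le)
  fix n show "torsion_image n \<subseteq> torsion_image (Suc n)"
  proof
    fix x assume "x \<in> torsion_image n"
    then obtain b where x: "\<And>\<rho>. \<rho> \<in> P \<Longrightarrow> x \<rho> \<in> B" "b \<in> L \<rightarrow> B"
      "\<And>\<rho>. \<rho> \<in> P \<Longrightarrow> p [^]\<^bsub>A\<^esub> n \<otimes>\<^bsub>A\<^esub> x \<rho> = dot \<rho> b" by (auto simp: torsion_image_def)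
    show "x \<in> torsion_image (Suc n)"
      unfolding torsion_image_def mem_Collect_eq
    proof (intro conjI ballI exI[of _ "\<lambda>l. p [^]\<^bsub>A\<^esub> (1::nat) \<otimes>\<^bsub>A\<^esub> b l"])
      fix \<rho> assume \<rho>: "\<rho> \<in> P"
      have "p [^]\<^bsub>A\<^esub> Suc n \<otimes>\<^bsub>A\<^esub> x \<rho> = p [^]\<^bsub>A\<^esub> (1::nat) \<otimes>\<^bsub>A\<^esub> (p [^]\<^bsub>A\<^esub> n \<otimes>\<^bsub>A\<^esub> x \<rho>)"
        using x(1)[OF \<rho>] by (simp only: R.nat_pow_Suc2[OF p_A]) (simp add: R.m_assoc)
      then show "p [^]\<^bsub>A\<^esub> Suc n \<otimes>\<^bsub>A\<^esub> x \<rho> = dot \<rho> (\<lambda>l. p [^]\<^bsub>A\<^esub> (1::nat) \<otimes>\<^bsub>A\<^esub> b l)"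
        unfolding dot_pp[of \<rho> b, OF \<rho> x(2)] x(3)[OF \<rho>] .
    next
      fix l assume "l \<in> L"
      then show "p [^]\<^bsub>A\<^esub> (1::nat) \<otimes>\<^bsub>A\<^esub> b l \<in> B" using x(2) by (intro B_mult B_pp) auto
    qed (rule x(1))
  qed
qed

text \<open>The cokernel of the relation matrix is finitely generated, so its torsion is bounded.\<close>

lemma bounded_torsion: "\<exists>c. \<forall>n. \<forall>y\<in>torsion_image n. \<exists>w\<in>torsion_image c. \<forall>\<rho>\<in>P. y \<rho> = w \<rho>"
proof -
  \<comment> \<open>Torsion vectors of all orders together form one submodule, and its finitely many
    generators have a common order \<open>c\<close>.\<close>
  define Y where "Y = (\<Union>n. torsion_image n)"
  have "function_submodule A B Y"
    unfolding function_submodule_def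
  proof (intro conjI ballI)
    show "(\<lambda>_. \<zero>\<^bsub>A\<^esub>) \<in> Y" "\<And>y b. \<lbrakk>y \<in> Y; b \<in> B\<rbrakk> \<Longrightarrow> (\<lambda>l. y l \<otimes>\<^bsub>A\<^esub> b) \<in> Y"
      using torsion_image_submodule by (auto simp: Y_def function_submodule_def)
    fix x y assume "x \<in> Y" "y \<in> Y"
    then obtain i j where "x \<in> torsion_image i" "y \<in> torsion_image j" by (auto simp: Y_def)
    then have "x \<in> torsion_image (max i j)" "y \<in> torsion_image (max i j)"
      using torsion_image_mono[of i "max i j"] torsion_image_mono[of j "max i j"] by auto
    then have "(\<lambda>l. x l \<ominus>\<^bsub>A\<^esub> y l) \<in> torsion_image (max i j)"
      using torsion_image_submodule[of "max i j"] by (simp add: function_submodule_def)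
    then show "(\<lambda>l. x l \<ominus>\<^bsub>A\<^esub> y l) \<in> Y" by (auto simp: Y_def)
  qed
  then have "\<exists>G. finite G \<and> G \<subseteq> Y \<and> (\<forall>z\<in>Y. \<exists>w\<in>function_span A B G. \<forall>\<rho>\<in>P. z \<rho> = w \<rho>)"
    by (intro R.function_submodule_finitely_generated[OF B_subgroup _ B_one B_noetherian P] B_mult)
       (auto simp: Y_def torsion_image_def)
  then obtain G where G: "finite G" "G \<subseteq> Y" "\<forall>z\<in>Y. \<exists>w\<in>function_span A B G. \<forall>\<rho>\<in>P. z \<rho> = w \<rho>"
    by (elim exE conjE) (rule that)
  have "\<exists>c. G' \<subseteq> torsion_image c" if "G' \<subseteq> G" for G'
    using finite_subset[OF that G(1)] that
  proof induct
    case (insert g G')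
    then obtain c d where "G' \<subseteq> torsion_image c" "g \<in> torsion_image d" using G(2) by (auto simp: Y_def)
    then have "insert g G' \<subseteq> torsion_image (max c d)"
      using torsion_image_mono[of c "max c d"] torsion_image_mono[of d "max c d"] by auto
    then show ?case by blast
  qed simp
  then obtain c where c: "G \<subseteq> torsion_image c" by blast
  have "function_span A B G \<subseteq> torsion_image c"
    by (rule function_span_le[OF torsion_image_submodule c])
  then show ?thesis using G(3) by (intro exI[of _ c]) (fastforce simp: Y_def)
qed

text \<open>Approximate \<open>m\<close> by a vector \<open>b\<close> over \<open>B\<close> with
  precision \<open>a + c\<close>, where \<open>c\<close> bounds the torsion. The matrix sends
  \<open>b\<close> to \<open>p [^] (a + c)\<close> times some \<open>y\<close>, so \<open>y\<close>
  is a torsion vector and \<open>p [^] c\<close> times \<open>y\<close> is already the image of some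
  \<open>b'\<close>. Then b - \<open>p [^] a\<close> b' is an exact solution, still close to
  \<open>m\<close> with precision \<open>a\<close>.\<close>

lemma approximate_by_syzygies:
  "\<exists>z\<in>syzygies. \<exists>e. \<forall>l\<in>L. e l \<in> C \<and> m l = \<psi> (z l) \<oplus>\<^bsub>M\<^esub> \<pi> [^]\<^bsub>M\<^esub> (a::nat) \<otimes>\<^bsub>M\<^esub> e l"
proof -
  obtain c where c: "\<And>n y. y \<in> torsion_image n \<Longrightarrow> \<exists>w\<in>torsion_image c. \<forall>\<rho>\<in>P. y \<rho> = w \<rho>"
    using bounded_torsion by blast
  \<comment> \<open>The surplus \<open>c\<close> in the precision is what the later correction uses
    up.\<close>
  have "\<forall>l\<in>L. \<exists>x. x \<in> B \<and> (\<exists>e\<in>C. m l = \<psi> x \<oplus>\<^bsub>M\<^esub> \<pi> [^]\<^bsub>M\<^esub> (a + c) \<otimes>\<^bsub>M\<^esub> e)"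
    using dense_pow[OF m] by blast
  from bchoice[OF this] obtain b where b: "\<forall>l\<in>L. b l \<in> B \<and> (\<exists>e\<in>C. m l = \<psi> (b l) \<oplus>\<^bsub>M\<^esub> \<pi> [^]\<^bsub>M\<^esub> (a + c) \<otimes>\<^bsub>M\<^esub> e)" ..
  then have "\<forall>l\<in>L. \<exists>e. e \<in> C \<and> m l = \<psi> (b l) \<oplus>\<^bsub>M\<^esub> \<pi> [^]\<^bsub>M\<^esub> (a + c) \<otimes>\<^bsub>M\<^esub> e" by blast
  from bchoice[OF this] obtain e where e: "\<And>l. l \<in> L \<Longrightarrow> e l \<in> C"
    "\<And>l. l \<in> L \<Longrightarrow> m l = \<psi> (b l) \<oplus>\<^bsub>M\<^esub> \<pi> [^]\<^bsub>M\<^esub> (a + c) \<otimes>\<^bsub>M\<^esub> e l" by blast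
  have bB: "b l \<in> B" if "l \<in> L" for l using b that by blast
  then have bB': "b \<in> L \<rightarrow> B" by blast
  have "\<exists>y. y \<in> B \<and> dot \<rho> b = p [^]\<^bsub>A\<^esub> (a + c) \<otimes>\<^bsub>A\<^esub> y" if \<rho>: "\<rho> \<in> P" for \<rho>
  proof -
    let ?e = "\<Oplus>\<^bsub>M\<^esub>l\<in>L. \<psi> (r \<rho> l) \<otimes>\<^bsub>M\<^esub> e l"
    have eC: "?e \<in> C"
      by (rule S.finsum_in_subgroup[OF M.D_subgroup]) (use M.D_mult B_C r \<rho> e in auto)
    have rc: "\<And>l. l \<in> L \<Longrightarrow> \<psi> (r \<rho> l) \<in> carrier M" using r \<rho> by auto
    have "\<zero>\<^bsub>M\<^esub> = (\<Oplus>\<^bsub>M\<^esub>l\<in>L. \<psi> (r \<rho> l) \<otimes>\<^bsub>M\<^esub> (\<psi> (b l) \<oplus>\<^bsub>M\<^esub> \<pi> [^]\<^bsub>M\<^esub> (a + c) \<otimes>\<^bsub>M\<^esub> e l))"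
      unfolding rel[OF \<rho>, symmetric] by (rule S.finsum_cong') (use e bB rc in auto)
    also have "\<dots> = (\<Oplus>\<^bsub>M\<^esub>l\<in>L. \<psi> (r \<rho> l) \<otimes>\<^bsub>M\<^esub> \<psi> (b l)) \<oplus>\<^bsub>M\<^esub> (\<Oplus>\<^bsub>M\<^esub>l\<in>L. \<psi> (r \<rho> l) \<otimes>\<^bsub>M\<^esub> (\<pi> [^]\<^bsub>M\<^esub> (a + c) \<otimes>\<^bsub>M\<^esub> e l))"
      by (rule S.dot_add) (use rc bB e in auto)
    also have "(\<Oplus>\<^bsub>M\<^esub>l\<in>L. \<psi> (r \<rho> l) \<otimes>\<^bsub>M\<^esub> (\<pi> [^]\<^bsub>M\<^esub> (a + c) \<otimes>\<^bsub>M\<^esub> e l)) = \<pi> [^]\<^bsub>M\<^esub> (a + c) \<otimes>\<^bsub>M\<^esub> ?e"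
      by (rule S.dot_central[OF L]) (use rc e M.pp_central in auto)
    also have "(\<Oplus>\<^bsub>M\<^esub>l\<in>L. \<psi> (r \<rho> l) \<otimes>\<^bsub>M\<^esub> \<psi> (b l)) = \<psi> (dot \<rho> b)"
      by (rule hom_dot[OF L, symmetric]) (use r \<rho> bB in auto)
    finally have "\<zero>\<^bsub>M\<^esub> = \<psi> (dot \<rho> b) \<oplus>\<^bsub>M\<^esub> \<pi> [^]\<^bsub>M\<^esub> (a + c) \<otimes>\<^bsub>M\<^esub> ?e" .
    then have "\<psi> (dot \<rho> b) = \<ominus>\<^bsub>M\<^esub> (\<pi> [^]\<^bsub>M\<^esub> (a + c) \<otimes>\<^bsub>M\<^esub> ?e)"
      using eC dot_closed[of \<rho> b, OF \<rho> bB'] by (intro S.minus_equality[symmetric]) auto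
    then have "\<psi> (dot \<rho> b) = \<pi> [^]\<^bsub>M\<^esub> (a + c) \<otimes>\<^bsub>M\<^esub> (\<ominus>\<^bsub>M\<^esub> ?e)"
      using eC by (simp add: S.r_minus)
    moreover have "\<ominus>\<^bsub>M\<^esub> ?e \<in> C" by (rule additive_subgroup.a_inv_closed[OF M.D_subgroup eC])
    ultimately show ?thesis using strict_pow[OF dot_closed[of \<rho> b, OF \<rho> bB'], of "\<ominus>\<^bsub>M\<^esub> ?e" "a + c"] by blast
  qed
  then have "\<forall>\<rho>\<in>P. \<exists>y. y \<in> B \<and> dot \<rho> b = p [^]\<^bsub>A\<^esub> (a + c) \<otimes>\<^bsub>A\<^esub> y" by blast
  from bchoice[OF this] obtain y where y: "\<And>\<rho>. \<rho> \<in> P \<Longrightarrow> y \<rho> \<in> B"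
    "\<And>\<rho>. \<rho> \<in> P \<Longrightarrow> dot \<rho> b = p [^]\<^bsub>A\<^esub> (a + c) \<otimes>\<^bsub>A\<^esub> y \<rho>" by blast
  have "y \<in> torsion_image (a + c)" using y bB by (auto simp: torsion_image_def intro!: exI[of _ b])
  then obtain w where w: "w \<in> torsion_image c" "\<And>\<rho>. \<rho> \<in> P \<Longrightarrow> y \<rho> = w \<rho>" using c by blast
  from w(1)[unfolded torsion_image_def mem_Collect_eq]
  obtain b' where b0: "\<forall>l\<in>L. b' l \<in> B" "\<forall>\<rho>\<in>P. p [^]\<^bsub>A\<^esub> c \<otimes>\<^bsub>A\<^esub> w \<rho> = dot \<rho> b'"
    by (elim conjE exE) (rule that)
  have b'1: "b' l \<in> B" if "l \<in> L" for l using b0(1) that by blast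
  have b'2: "p [^]\<^bsub>A\<^esub> c \<otimes>\<^bsub>A\<^esub> y \<rho> = dot \<rho> b'" if "\<rho> \<in> P" for \<rho> using b0(2) w(2) that by simp
  note b' = b'1 b'2
  define z where "z l = b l \<ominus>\<^bsub>A\<^esub> p [^]\<^bsub>A\<^esub> a \<otimes>\<^bsub>A\<^esub> b' l" for l
  have pb': "p [^]\<^bsub>A\<^esub> a \<otimes>\<^bsub>A\<^esub> b' l \<in> B" if "l \<in> L" for l using B_mult[OF B_pp b'(1)[OF that]] .
  have pb'': "(\<lambda>l. p [^]\<^bsub>A\<^esub> a \<otimes>\<^bsub>A\<^esub> b' l) \<in> L \<rightarrow> B" using pb' by blast
  have b'': "b' \<in> L \<rightarrow> B" using b'(1) by blast
  have "z \<in> syzygies"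
    unfolding syzygies_def mem_Collect_eq
  proof (intro conjI ballI)
    fix l assume "l \<in> L"
    then show "z l \<in> B" unfolding z_def by (intro B_diff bB pb')
  next
    fix \<rho> assume \<rho>: "\<rho> \<in> P"
    have "dot \<rho> z = dot \<rho> b \<ominus>\<^bsub>A\<^esub> p [^]\<^bsub>A\<^esub> a \<otimes>\<^bsub>A\<^esub> (p [^]\<^bsub>A\<^esub> c \<otimes>\<^bsub>A\<^esub> y \<rho>)"
      unfolding z_def dot_minus[of \<rho> b "\<lambda>l. p [^]\<^bsub>A\<^esub> a \<otimes>\<^bsub>A\<^esub> b' l", OF \<rho> bB' pb''] dot_pp[of \<rho> b', OF \<rho> b''] b'(2)[OF \<rho>] ..
    also have "\<dots> = \<zero>\<^bsub>A\<^esub>"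
      using y[OF \<rho>] by (simp add: R.m_assoc[symmetric] R.nat_pow_mult R.r_right_minus_eq)
    finally show "dot \<rho> z = \<zero>\<^bsub>A\<^esub>" .
  qed
  moreover have "\<psi> (b' l) \<oplus>\<^bsub>M\<^esub> \<pi> [^]\<^bsub>M\<^esub> c \<otimes>\<^bsub>M\<^esub> e l \<in> C \<and>
      m l = \<psi> (z l) \<oplus>\<^bsub>M\<^esub> \<pi> [^]\<^bsub>M\<^esub> a \<otimes>\<^bsub>M\<^esub> (\<psi> (b' l) \<oplus>\<^bsub>M\<^esub> \<pi> [^]\<^bsub>M\<^esub> c \<otimes>\<^bsub>M\<^esub> e l)" if l: "l \<in> L" for l
  proof
    show "\<psi> (b' l) \<oplus>\<^bsub>M\<^esub> \<pi> [^]\<^bsub>M\<^esub> c \<otimes>\<^bsub>M\<^esub> e l \<in> C"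
      by (intro additive_subgroup.a_closed[OF M.D_subgroup] M.D_mult M.D_pp B_C b' e l)
    have cl: "\<psi> (b l) \<in> carrier M" "\<pi> [^]\<^bsub>M\<^esub> a \<otimes>\<^bsub>M\<^esub> \<psi> (b' l) \<in> carrier M"
      "\<pi> [^]\<^bsub>M\<^esub> (a + c) \<otimes>\<^bsub>M\<^esub> e l \<in> carrier M" using bB[OF l] b'(1)[OF l] e(1)[OF l] by auto
    have "\<psi> (z l) = \<psi> (b l) \<ominus>\<^bsub>M\<^esub> \<pi> [^]\<^bsub>M\<^esub> a \<otimes>\<^bsub>M\<^esub> \<psi> (b' l)"
      using bB[OF l] b'(1)[OF l] by (simp add: z_def R.minus_eq S.minus_eq hom_pow_p)
    moreover have "\<pi> [^]\<^bsub>M\<^esub> a \<otimes>\<^bsub>M\<^esub> (\<psi> (b' l) \<oplus>\<^bsub>M\<^esub> \<pi> [^]\<^bsub>M\<^esub> c \<otimes>\<^bsub>M\<^esub> e l)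
      = \<pi> [^]\<^bsub>M\<^esub> (a + c) \<otimes>\<^bsub>M\<^esub> e l \<oplus>\<^bsub>M\<^esub> \<pi> [^]\<^bsub>M\<^esub> a \<otimes>\<^bsub>M\<^esub> \<psi> (b' l)"
      using b'(1)[OF l] e(1)[OF l] by (simp add: S.r_distr M.pp_add S.a_comm)
    ultimately show "m l = \<psi> (z l) \<oplus>\<^bsub>M\<^esub> \<pi> [^]\<^bsub>M\<^esub> a \<otimes>\<^bsub>M\<^esub> (\<psi> (b' l) \<oplus>\<^bsub>M\<^esub> \<pi> [^]\<^bsub>M\<^esub> c \<otimes>\<^bsub>M\<^esub> e l)"
      using e(2)[OF l] S.diff_add_swap(1)[OF cl(1,2,3)] by simp
  qed
  ultimately show ?thesis by (intro bexI exI ballI)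
qed

text \<open>Exact solutions \<open>z a\<close> approach \<open>m\<close>, and consecutive ones
  differ by \<open>p [^] a\<close> times a solution. Expressed in finitely many generators, these
  differences have coefficients whose series converge in \<open>C\<close>.\<close>

lemma syzygy_factorization:
  "\<exists>G t. finite G \<and> (\<forall>g\<in>G. (\<forall>l\<in>L. g l \<in> B) \<and> (\<forall>\<rho>\<in>P. dot \<rho> g = \<zero>\<^bsub>A\<^esub>)) \<and> (\<forall>g\<in>G. t g \<in> C) \<and>
    (\<forall>l\<in>L. m l = (\<Oplus>\<^bsub>M\<^esub>g\<in>G. \<psi> (g l) \<otimes>\<^bsub>M\<^esub> t g))"
proof -
  have "\<exists>G. finite G \<and> G \<subseteq> syzygies \<and> (\<forall>z\<in>syzygies. \<exists>w\<in>function_span A B G. \<forall>l\<in>L. z l = w l)"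
    by (intro R.function_submodule_finitely_generated[OF B_subgroup _ B_one B_noetherian L syzygies_submodule] B_mult)
       (auto simp: syzygies_def)
  then obtain G where G: "finite G" "G \<subseteq> syzygies" "\<forall>z\<in>syzygies. \<exists>w\<in>function_span A B G. \<forall>l\<in>L. z l = w l"
    by (elim exE conjE) (rule that)
  have gB: "g l \<in> B" if "g \<in> G" "l \<in> L" for g l using G(2) that by (auto simp: syzygies_def)
  have gC: "\<psi> (g l) \<in> C" "\<psi> (g l) \<in> carrier M" if "g \<in> G" "l \<in> L" for g l using B_C gB[OF that] by auto
  have coeff: "\<exists>c. (\<forall>g\<in>G. c g \<in> B) \<and> (\<forall>l\<in>L. z l = (\<Oplus>\<^bsub>A\<^esub>g\<in>G. g l \<otimes>\<^bsub>A\<^esub> c g))" if "z \<in> syzygies" for z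
  proof -
    obtain w where w: "w \<in> function_span A B G" "\<forall>l\<in>L. z l = w l" using G(3) \<open>z \<in> syzygies\<close> by blast
    have "\<exists>c. (\<forall>g\<in>G. c g \<in> B) \<and> (\<forall>l\<in>L. w l = (\<Oplus>\<^bsub>A\<^esub>g\<in>G. g l \<otimes>\<^bsub>A\<^esub> c g))"
      by (rule R.function_span_coefficients[OF B_subgroup G(1) _ w(1)]) (rule gB)
    then show ?thesis using w(2) by simp
  qed
  have "\<forall>a::nat. \<exists>z. z \<in> syzygies \<and> (\<exists>e. \<forall>l\<in>L. e l \<in> C \<and> m l = \<psi> (z l) \<oplus>\<^bsub>M\<^esub> \<pi> [^]\<^bsub>M\<^esub> a \<otimes>\<^bsub>M\<^esub> e l)"
    using approximate_by_syzygies by blast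
  from choice[OF this] obtain z where z: "\<And>a. z a \<in> syzygies"
    and "\<And>a::nat. \<exists>e. \<forall>l\<in>L. e l \<in> C \<and> m l = \<psi> (z a l) \<oplus>\<^bsub>M\<^esub> \<pi> [^]\<^bsub>M\<^esub> a \<otimes>\<^bsub>M\<^esub> e l"
    by blast
  then have "\<forall>a::nat. \<exists>e. \<forall>l\<in>L. e l \<in> C \<and> m l = \<psi> (z a l) \<oplus>\<^bsub>M\<^esub> \<pi> [^]\<^bsub>M\<^esub> a \<otimes>\<^bsub>M\<^esub> e l" by blast
  from choice[OF this] obtain e where e: "\<And>a l. l \<in> L \<Longrightarrow> e a l \<in> C"
    "\<And>a l. l \<in> L \<Longrightarrow> m l = \<psi> (z a l) \<oplus>\<^bsub>M\<^esub> \<pi> [^]\<^bsub>M\<^esub> (a::nat) \<otimes>\<^bsub>M\<^esub> e a l" by blast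
  have zB: "z a l \<in> B" if "l \<in> L" for a l using z[of a] that by (auto simp: syzygies_def)
  \<comment> \<open>The difference is divisible by \<open>strict_pow\<close>, and the quotient is
    again a solution because powers of \<open>p\<close> cancel in \<open>A\<close>.\<close>
  have "\<exists>w\<in>syzygies. \<forall>l\<in>L. z (Suc a) l = z a l \<oplus>\<^bsub>A\<^esub> p [^]\<^bsub>A\<^esub> a \<otimes>\<^bsub>A\<^esub> w l" for a
  proof -
    have "\<exists>w. w \<in> B \<and> z (Suc a) l \<ominus>\<^bsub>A\<^esub> z a l = p [^]\<^bsub>A\<^esub> a \<otimes>\<^bsub>A\<^esub> w" if l: "l \<in> L" for l
    proof -
      have c: "\<psi> (z (Suc a) l) \<in> carrier M" "\<psi> (z a l) \<in> carrier M" "e a l \<in> carrier M"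
        "e (Suc a) l \<in> carrier M" "\<pi> [^]\<^bsub>M\<^esub> a \<in> carrier M" "\<pi> \<in> carrier M"
        using zB[OF l] e(1)[OF l] by auto
      have "\<psi> (z (Suc a) l) \<oplus>\<^bsub>M\<^esub> \<pi> [^]\<^bsub>M\<^esub> a \<otimes>\<^bsub>M\<^esub> (\<pi> \<otimes>\<^bsub>M\<^esub> e (Suc a) l) = \<psi> (z a l) \<oplus>\<^bsub>M\<^esub> \<pi> [^]\<^bsub>M\<^esub> a \<otimes>\<^bsub>M\<^esub> e a l"
        using e(2)[OF l, of a] e(2)[OF l, of "Suc a"] c by (simp add: S.m_assoc)
      then have "\<psi> (z (Suc a) l) \<ominus>\<^bsub>M\<^esub> \<psi> (z a l) = \<pi> [^]\<^bsub>M\<^esub> a \<otimes>\<^bsub>M\<^esub> e a l \<ominus>\<^bsub>M\<^esub> \<pi> [^]\<^bsub>M\<^esub> a \<otimes>\<^bsub>M\<^esub> (\<pi> \<otimes>\<^bsub>M\<^esub> e (Suc a) l)"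
        using c by (intro S.add_eq_imp_diff_eq) auto
      also have "\<dots> = \<pi> [^]\<^bsub>M\<^esub> a \<otimes>\<^bsub>M\<^esub> (e a l \<ominus>\<^bsub>M\<^esub> \<pi> \<otimes>\<^bsub>M\<^esub> e (Suc a) l)"
        using c by (simp add: S.minus_eq S.r_distr S.r_minus)
      finally have "\<psi> (z (Suc a) l \<ominus>\<^bsub>A\<^esub> z a l) = \<pi> [^]\<^bsub>M\<^esub> a \<otimes>\<^bsub>M\<^esub> (e a l \<ominus>\<^bsub>M\<^esub> \<pi> \<otimes>\<^bsub>M\<^esub> e (Suc a) l)"
        using zB[OF l] by (simp add: R.minus_eq S.minus_eq)
      moreover have "e a l \<ominus>\<^bsub>M\<^esub> \<pi> \<otimes>\<^bsub>M\<^esub> e (Suc a) l \<in> C"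
        by (intro S.additive_subgroup_diff[OF M.D_subgroup] M.D_mult M.D_p e(1) l)
      ultimately show ?thesis
        using strict_pow[OF B_diff[OF zB[OF l] zB[OF l]]] by blast
    qed
    then have "\<forall>l\<in>L. \<exists>w. w \<in> B \<and> z (Suc a) l \<ominus>\<^bsub>A\<^esub> z a l = p [^]\<^bsub>A\<^esub> a \<otimes>\<^bsub>A\<^esub> w" by blast
    from bchoice[OF this] obtain w where w: "\<And>l. l \<in> L \<Longrightarrow> w l \<in> B"
      "\<And>l. l \<in> L \<Longrightarrow> z (Suc a) l \<ominus>\<^bsub>A\<^esub> z a l = p [^]\<^bsub>A\<^esub> a \<otimes>\<^bsub>A\<^esub> w l" by blast
    have wB: "w \<in> L \<rightarrow> B" using w(1) by blast
    have zB': "z a \<in> L \<rightarrow> B" for a using zB by blast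
    have "dot \<rho> w = \<zero>\<^bsub>A\<^esub>" if \<rho>: "\<rho> \<in> P" for \<rho>
    proof -
      have "p [^]\<^bsub>A\<^esub> a \<otimes>\<^bsub>A\<^esub> dot \<rho> w = dot \<rho> (\<lambda>l. p [^]\<^bsub>A\<^esub> a \<otimes>\<^bsub>A\<^esub> w l)"
        by (rule dot_pp[of \<rho> w, OF \<rho> wB, symmetric])
      also have "\<dots> = dot \<rho> (\<lambda>l. z (Suc a) l \<ominus>\<^bsub>A\<^esub> z a l)"
        by (rule R.finsum_cong') (use w zB r[OF \<rho>] in auto)
      also have "\<dots> = dot \<rho> (z (Suc a)) \<ominus>\<^bsub>A\<^esub> dot \<rho> (z a)" by (rule dot_minus[of \<rho> "z (Suc a)" "z a", OF \<rho> zB' zB'])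
      also have "\<dots> = \<zero>\<^bsub>A\<^esub>" using z[of a] z[of "Suc a"] \<rho> by (simp add: syzygies_def R.minus_eq)
      finally show ?thesis by (rule pp_cancel_A[rotated]) (use dot_closed[of \<rho> w, OF \<rho> wB] in simp)
    qed
    then have "w \<in> syzygies" using w(1) by (simp add: syzygies_def)
    moreover have "z (Suc a) l = z a l \<oplus>\<^bsub>A\<^esub> p [^]\<^bsub>A\<^esub> a \<otimes>\<^bsub>A\<^esub> w l" if l: "l \<in> L" for l
    proof -
      have c: "z a l \<in> carrier A" "z (Suc a) l \<in> carrier A" using zB[OF l] by auto
      have "z (Suc a) l = z a l \<oplus>\<^bsub>A\<^esub> (z (Suc a) l \<ominus>\<^bsub>A\<^esub> z a l)" using c by algebra
      then show ?thesis using w(2)[OF l] by simp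
    qed
    ultimately show ?thesis by blast
  qed
  note step = this
  have "\<forall>a. \<exists>c. (\<forall>g\<in>G. c g \<in> B) \<and>
      (\<forall>l\<in>L. z (Suc a) l = z a l \<oplus>\<^bsub>A\<^esub> p [^]\<^bsub>A\<^esub> a \<otimes>\<^bsub>A\<^esub> (\<Oplus>\<^bsub>A\<^esub>g\<in>G. g l \<otimes>\<^bsub>A\<^esub> c g))"
  proof
    fix a
    obtain w where w: "w \<in> syzygies" "\<forall>l\<in>L. z (Suc a) l = z a l \<oplus>\<^bsub>A\<^esub> p [^]\<^bsub>A\<^esub> a \<otimes>\<^bsub>A\<^esub> w l"
      using step[of a] by (elim bexE) (rule that)
    obtain c where c: "\<forall>g\<in>G. c g \<in> B" "\<forall>l\<in>L. w l = (\<Oplus>\<^bsub>A\<^esub>g\<in>G. g l \<otimes>\<^bsub>A\<^esub> c g)"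
      using coeff[OF w(1)] by (elim exE conjE) (rule that)
    have "\<forall>l\<in>L. z (Suc a) l = z a l \<oplus>\<^bsub>A\<^esub> p [^]\<^bsub>A\<^esub> a \<otimes>\<^bsub>A\<^esub> (\<Oplus>\<^bsub>A\<^esub>g\<in>G. g l \<otimes>\<^bsub>A\<^esub> c g)"
      using w(2) c(2) by simp
    with c(1) show "\<exists>c. (\<forall>g\<in>G. c g \<in> B) \<and>
      (\<forall>l\<in>L. z (Suc a) l = z a l \<oplus>\<^bsub>A\<^esub> p [^]\<^bsub>A\<^esub> a \<otimes>\<^bsub>A\<^esub> (\<Oplus>\<^bsub>A\<^esub>g\<in>G. g l \<otimes>\<^bsub>A\<^esub> c g))" by (intro exI conjI)
  qed
  from choice[OF this] obtain c where c01: "\<forall>a. (\<forall>g\<in>G. c a g \<in> B) \<and>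
      (\<forall>l\<in>L. z (Suc a) l = z a l \<oplus>\<^bsub>A\<^esub> p [^]\<^bsub>A\<^esub> a \<otimes>\<^bsub>A\<^esub> (\<Oplus>\<^bsub>A\<^esub>g\<in>G. g l \<otimes>\<^bsub>A\<^esub> c a g))" by (elim exE)
  note c = bspec[OF conjunct1[OF spec[OF c01]]] bspec[OF conjunct2[OF spec[OF c01]]]
  obtain c0 where c0: "\<forall>g\<in>G. c0 g \<in> B" "\<forall>l\<in>L. z 0 l = (\<Oplus>\<^bsub>A\<^esub>g\<in>G. g l \<otimes>\<^bsub>A\<^esub> c0 g)"
    using coeff[OF z[of 0]] by (elim exE conjE) (rule that)
  \<comment> \<open>Independent choices of coefficients for the various \<open>z a\<close> need not
    converge. Summing chosen coefficients of the differences makes the sequence Cauchy by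
    construction.\<close>
  define s where "s = (\<lambda>a g. rec_nat (c0 g) (\<lambda>a x. x \<oplus>\<^bsub>A\<^esub> p [^]\<^bsub>A\<^esub> a \<otimes>\<^bsub>A\<^esub> c a g) a)"
  have s_simps: "s 0 g = c0 g" "s (Suc a) g = s a g \<oplus>\<^bsub>A\<^esub> p [^]\<^bsub>A\<^esub> a \<otimes>\<^bsub>A\<^esub> c a g" for a g
    by (simp_all add: s_def)
  have sB: "s a g \<in> B" if "g \<in> G" for a g
  proof (induct a)
    case (Suc a)
    then show ?case unfolding s_simps
      by (intro additive_subgroup.a_closed[OF B_subgroup] B_mult B_pp c(1) that)
  qed (use c0 that in \<open>simp add: s_simps\<close>)
  have zs: "z a l = (\<Oplus>\<^bsub>A\<^esub>g\<in>G. g l \<otimes>\<^bsub>A\<^esub> s a g)" if l: "l \<in> L" for a l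
  proof (induct a)
    case (Suc a)
    have "(\<Oplus>\<^bsub>A\<^esub>g\<in>G. g l \<otimes>\<^bsub>A\<^esub> s (Suc a) g) = (\<Oplus>\<^bsub>A\<^esub>g\<in>G. g l \<otimes>\<^bsub>A\<^esub> s a g) \<oplus>\<^bsub>A\<^esub> (\<Oplus>\<^bsub>A\<^esub>g\<in>G. g l \<otimes>\<^bsub>A\<^esub> (p [^]\<^bsub>A\<^esub> a \<otimes>\<^bsub>A\<^esub> c a g))"
      unfolding s_simps by (rule R.dot_add) (use gB l sB c in auto)
    also have "(\<Oplus>\<^bsub>A\<^esub>g\<in>G. g l \<otimes>\<^bsub>A\<^esub> (p [^]\<^bsub>A\<^esub> a \<otimes>\<^bsub>A\<^esub> c a g)) = p [^]\<^bsub>A\<^esub> a \<otimes>\<^bsub>A\<^esub> (\<Oplus>\<^bsub>A\<^esub>g\<in>G. g l \<otimes>\<^bsub>A\<^esub> c a g)"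
      by (rule R.dot_central[OF G(1)]) (use gB l c pp_central_A in auto)
    finally show ?case using Suc c(2)[OF l] by simp
  qed (use c0 l in \<open>simp add: s_simps\<close>)
  have "\<exists>t. t \<in> C \<and> (\<forall>a. \<psi> (s a g) \<ominus>\<^bsub>M\<^esub> t \<in> M.nbhd a)" if g: "g \<in> G" for g
  proof -
    have "\<psi> (s (Suc a) g) \<ominus>\<^bsub>M\<^esub> \<psi> (s a g) \<in> M.nbhd a" for a
    proof -
      have c': "\<psi> (s a g) \<in> carrier M" "\<pi> [^]\<^bsub>M\<^esub> a \<otimes>\<^bsub>M\<^esub> \<psi> (c a g) \<in> carrier M"
        using sB[OF g] c(1)[OF g] by auto
      have "\<psi> (s (Suc a) g) = \<psi> (s a g) \<oplus>\<^bsub>M\<^esub> \<pi> [^]\<^bsub>M\<^esub> a \<otimes>\<^bsub>M\<^esub> \<psi> (c a g)"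
        using sB[OF g] c(1)[OF g] by (simp add: s_simps hom_pow_p)
      then have "\<psi> (s (Suc a) g) \<ominus>\<^bsub>M\<^esub> \<psi> (s a g) = \<pi> [^]\<^bsub>M\<^esub> a \<otimes>\<^bsub>M\<^esub> \<psi> (c a g)"
        using c' by (simp add: S.minus_eq S.a_ac S.r_neg1 S.r_neg2 S.r_neg)
      then show ?thesis using M.nbhdI[OF B_C[OF c(1)[OF g]]] by simp
    qed
    note incr = this
    show ?thesis
    proof (rule M.complete[of "\<lambda>a. \<psi> (s a g)"])
      show "\<psi> (s a g) \<in> C" for a by (rule B_C[OF sB[OF g]])
      show "\<psi> (s (Suc a) g) \<ominus>\<^bsub>M\<^esub> \<psi> (s a g) \<in> M.nbhd a" for a by (rule incr)
    qed (intro exI conjI allI)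
  qed
  then have "\<forall>g\<in>G. \<exists>t. t \<in> C \<and> (\<forall>a. \<psi> (s a g) \<ominus>\<^bsub>M\<^esub> t \<in> M.nbhd a)" by blast
  from bchoice[OF this] obtain t where t: "\<And>g. g \<in> G \<Longrightarrow> t g \<in> C"
    "\<And>g a. g \<in> G \<Longrightarrow> \<psi> (s a g) \<ominus>\<^bsub>M\<^esub> t g \<in> M.nbhd a" by blast
  have "m l = (\<Oplus>\<^bsub>M\<^esub>g\<in>G. \<psi> (g l) \<otimes>\<^bsub>M\<^esub> t g)" if l: "l \<in> L" for l
  proof -
    let ?t = "\<Oplus>\<^bsub>M\<^esub>g\<in>G. \<psi> (g l) \<otimes>\<^bsub>M\<^esub> t g"
    have tc: "?t \<in> carrier M" by (rule S.dot_closed) (use gC l t in auto)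
    have "m l \<ominus>\<^bsub>M\<^esub> ?t \<in> M.nbhd a" for a
    proof -
      let ?s = "\<Oplus>\<^bsub>M\<^esub>g\<in>G. \<psi> (g l) \<otimes>\<^bsub>M\<^esub> \<psi> (s a g)"
      have sc: "?s \<in> carrier M" by (rule S.dot_closed) (use gC l sB in auto)
      have ec: "\<pi> [^]\<^bsub>M\<^esub> a \<otimes>\<^bsub>M\<^esub> e a l \<in> carrier M" using e(1)[OF l] by simp
      have "\<psi> (z a l) = ?s"
        unfolding zs[OF l] by (rule hom_dot[OF G(1)]) (use gB l sB in auto)
      then have "m l \<ominus>\<^bsub>M\<^esub> ?t = (\<pi> [^]\<^bsub>M\<^esub> a \<otimes>\<^bsub>M\<^esub> e a l \<oplus>\<^bsub>M\<^esub> ?s) \<ominus>\<^bsub>M\<^esub> ?t"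
        using e(2)[OF l, of a] sc ec by (simp add: S.a_comm)
      also have "\<dots> = \<pi> [^]\<^bsub>M\<^esub> a \<otimes>\<^bsub>M\<^esub> e a l \<oplus>\<^bsub>M\<^esub> (?s \<oplus>\<^bsub>M\<^esub> \<ominus>\<^bsub>M\<^esub> ?t)"
        by (rule S.diff_add_swap(2)[OF ec tc sc])
      also have "?s \<oplus>\<^bsub>M\<^esub> \<ominus>\<^bsub>M\<^esub> ?t = (\<Oplus>\<^bsub>M\<^esub>g\<in>G. \<psi> (g l) \<otimes>\<^bsub>M\<^esub> (\<psi> (s a g) \<ominus>\<^bsub>M\<^esub> t g))"
        unfolding S.minus_eq[symmetric] by (rule S.dot_diff[OF G(1), symmetric]) (use gC l sB t in auto)
      finally have "m l \<ominus>\<^bsub>M\<^esub> ?t = \<pi> [^]\<^bsub>M\<^esub> a \<otimes>\<^bsub>M\<^esub> e a l \<oplus>\<^bsub>M\<^esub> (\<Oplus>\<^bsub>M\<^esub>g\<in>G. \<psi> (g l) \<otimes>\<^bsub>M\<^esub> (\<psi> (s a g) \<ominus>\<^bsub>M\<^esub> t g))" .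
      also have "\<dots> \<in> M.nbhd a"
      proof (rule M.nbhd_add[OF M.nbhdI[OF e(1)[OF l]] S.finsum_in_subgroup[OF M.nbhd_subgroup]])
        fix g assume g: "g \<in> G"
        show "\<psi> (g l) \<otimes>\<^bsub>M\<^esub> (\<psi> (s a g) \<ominus>\<^bsub>M\<^esub> t g) \<in> M.nbhd a"
          by (rule M.nbhd_mult_left[of _ 0]) (use gC[OF g l] t(2)[OF g] in auto)
      qed
      finally show ?thesis .
    qed
    then have "m l \<ominus>\<^bsub>M\<^esub> ?t = \<zero>\<^bsub>M\<^esub>" by (rule M.separated)
    then show ?thesis using tc m[OF l] by (simp add: S.r_right_minus_eq)
  qed
  moreover have "\<forall>g\<in>G. (\<forall>l\<in>L. g l \<in> B) \<and> (\<forall>\<rho>\<in>P. dot \<rho> g = \<zero>\<^bsub>A\<^esub>)"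
    using G(2) unfolding syzygies_def by blast
  ultimately show ?thesis using G(1) t(1) by (intro exI[of _ G] exI[of _ t] conjI ballI) simp_all
qed

end

text \<open>Clear denominators: a power of \<open>p\<close> brings the coefficients into
  \<open>B\<close>, a power of \<pi> the vector into \<open>C\<close>. After
  \<open>syzygy_factorization\<close> the first power is cancelled in \<open>A\<close> and the
  second is inverted in \<open>M\<close>.\<close>

theorem equationally_flat: "equationally_flat A (ring_as_left_module \<psi> M)"
  unfolding equationally_flat_def
proof (intro allI impI; elim conjE)
  fix L P
  assume L: "finite L" "L \<subseteq> carrier (ring_as_left_module \<psi> M)" and P: "finite P"
    and "\<forall>\<rho>\<in>P. \<rho> \<in> L \<rightarrow> carrier A \<and> (\<Oplus>\<^bsub>ring_as_left_module \<psi> M\<^esub>l\<in>L. \<rho> l \<odot>\<^bsub>ring_as_left_module \<psi> M\<^esub> l)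
        = \<zero>\<^bsub>ring_as_left_module \<psi> M\<^esub>"
  then have rc: "\<And>\<rho> l. \<lbrakk>\<rho> \<in> P; l \<in> L\<rbrakk> \<Longrightarrow> \<rho> l \<in> carrier A" and LM: "\<And>l. l \<in> L \<Longrightarrow> l \<in> carrier M"
    and rel: "\<And>\<rho>. \<rho> \<in> P \<Longrightarrow> (\<Oplus>\<^bsub>M\<^esub>l\<in>L. \<psi> (\<rho> l) \<otimes>\<^bsub>M\<^esub> l) = \<zero>\<^bsub>M\<^esub>"
    by auto
  have "\<exists>n::nat. \<forall>x\<in>(\<lambda>(\<rho>, l). \<rho> l) ` (P \<times> L). p [^]\<^bsub>A\<^esub> n \<otimes>\<^bsub>A\<^esub> x \<in> B"
    by (rule R.uniform_power) (use L P rc A_local B_mult B_p in auto)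
  then obtain N :: nat where N: "\<And>\<rho> l. \<lbrakk>\<rho> \<in> P; l \<in> L\<rbrakk> \<Longrightarrow> p [^]\<^bsub>A\<^esub> N \<otimes>\<^bsub>A\<^esub> \<rho> l \<in> B" by auto
  have "\<exists>n::nat. \<forall>x\<in>L. \<pi> [^]\<^bsub>M\<^esub> n \<otimes>\<^bsub>M\<^esub> x \<in> C"
    by (rule S.uniform_power) (use L LM M_local M.D_mult M.D_p in auto)
  then obtain k :: nat where k: "\<And>l. l \<in> L \<Longrightarrow> \<pi> [^]\<^bsub>M\<^esub> k \<otimes>\<^bsub>M\<^esub> l \<in> C" by auto
  have rel': "(\<Oplus>\<^bsub>M\<^esub>l\<in>L. \<psi> (p [^]\<^bsub>A\<^esub> N \<otimes>\<^bsub>A\<^esub> \<rho> l) \<otimes>\<^bsub>M\<^esub> (\<pi> [^]\<^bsub>M\<^esub> k \<otimes>\<^bsub>M\<^esub> l)) = \<zero>\<^bsub>M\<^esub>" if \<rho>: "\<rho> \<in> P" for \<rho>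
  proof -
    have "(\<Oplus>\<^bsub>M\<^esub>l\<in>L. \<psi> (p [^]\<^bsub>A\<^esub> N \<otimes>\<^bsub>A\<^esub> \<rho> l) \<otimes>\<^bsub>M\<^esub> (\<pi> [^]\<^bsub>M\<^esub> k \<otimes>\<^bsub>M\<^esub> l))
        = (\<Oplus>\<^bsub>M\<^esub>l\<in>L. \<psi> (\<rho> l) \<otimes>\<^bsub>M\<^esub> (\<pi> [^]\<^bsub>M\<^esub> (N + k) \<otimes>\<^bsub>M\<^esub> l))"
    proof (rule S.finsum_cong')
      fix l assume l: "l \<in> L"
      have c: "\<psi> (\<rho> l) \<in> carrier M" "l \<in> carrier M" using rc[OF \<rho> l] LM[OF l] by auto
      have "\<psi> (p [^]\<^bsub>A\<^esub> N \<otimes>\<^bsub>A\<^esub> \<rho> l) \<otimes>\<^bsub>M\<^esub> (\<pi> [^]\<^bsub>M\<^esub> k \<otimes>\<^bsub>M\<^esub> l)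
          = \<pi> [^]\<^bsub>M\<^esub> N \<otimes>\<^bsub>M\<^esub> (\<psi> (\<rho> l) \<otimes>\<^bsub>M\<^esub> (\<pi> [^]\<^bsub>M\<^esub> k \<otimes>\<^bsub>M\<^esub> l))"
        using c rc[OF \<rho> l] by (simp add: hom_pow_p S.m_assoc)
      also have "\<dots> = \<psi> (\<rho> l) \<otimes>\<^bsub>M\<^esub> (\<pi> [^]\<^bsub>M\<^esub> N \<otimes>\<^bsub>M\<^esub> (\<pi> [^]\<^bsub>M\<^esub> k \<otimes>\<^bsub>M\<^esub> l))"
        by (rule M.pp_left_comm[symmetric]) (use c in auto)
      also have "\<pi> [^]\<^bsub>M\<^esub> N \<otimes>\<^bsub>M\<^esub> (\<pi> [^]\<^bsub>M\<^esub> k \<otimes>\<^bsub>M\<^esub> l) = \<pi> [^]\<^bsub>M\<^esub> (N + k) \<otimes>\<^bsub>M\<^esub> l"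
        by (rule M.pp_add[OF c(2)])
      finally show "\<psi> (p [^]\<^bsub>A\<^esub> N \<otimes>\<^bsub>A\<^esub> \<rho> l) \<otimes>\<^bsub>M\<^esub> (\<pi> [^]\<^bsub>M\<^esub> k \<otimes>\<^bsub>M\<^esub> l) = \<psi> (\<rho> l) \<otimes>\<^bsub>M\<^esub> (\<pi> [^]\<^bsub>M\<^esub> (N + k) \<otimes>\<^bsub>M\<^esub> l)" .
    qed (use rc[OF \<rho>] LM in auto)
    also have "\<dots> = \<pi> [^]\<^bsub>M\<^esub> (N + k) \<otimes>\<^bsub>M\<^esub> (\<Oplus>\<^bsub>M\<^esub>l\<in>L. \<psi> (\<rho> l) \<otimes>\<^bsub>M\<^esub> l)"
      by (rule S.dot_central[OF L(1)]) (use rc[OF \<rho>] LM M.pp_central in auto)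
    finally show ?thesis by (simp add: rel[OF \<rho>])
  qed
  have "\<exists>G t. finite G \<and> (\<forall>g\<in>G. (\<forall>l\<in>L. g l \<in> B) \<and>
      (\<forall>\<rho>\<in>P. (\<Oplus>\<^bsub>A\<^esub>l\<in>L. p [^]\<^bsub>A\<^esub> N \<otimes>\<^bsub>A\<^esub> \<rho> l \<otimes>\<^bsub>A\<^esub> g l) = \<zero>\<^bsub>A\<^esub>)) \<and> (\<forall>g\<in>G. t g \<in> C) \<and>
    (\<forall>l\<in>L. \<pi> [^]\<^bsub>M\<^esub> k \<otimes>\<^bsub>M\<^esub> l = (\<Oplus>\<^bsub>M\<^esub>g\<in>G. \<psi> (g l) \<otimes>\<^bsub>M\<^esub> t g))"
    by (rule syzygy_factorization[OF L(1) P]) (fact N k rel')+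
  then obtain G t where G: "finite G" "\<forall>g\<in>G. (\<forall>l\<in>L. g l \<in> B) \<and>
      (\<forall>\<rho>\<in>P. (\<Oplus>\<^bsub>A\<^esub>l\<in>L. p [^]\<^bsub>A\<^esub> N \<otimes>\<^bsub>A\<^esub> \<rho> l \<otimes>\<^bsub>A\<^esub> g l) = \<zero>\<^bsub>A\<^esub>)"
    and t: "\<forall>g\<in>G. t g \<in> C" and Lt: "\<forall>l\<in>L. \<pi> [^]\<^bsub>M\<^esub> k \<otimes>\<^bsub>M\<^esub> l = (\<Oplus>\<^bsub>M\<^esub>g\<in>G. \<psi> (g l) \<otimes>\<^bsub>M\<^esub> t g)"
    by (elim exE conjE) (rule that)
  have syz1: "g l \<in> B" if "g \<in> G" "l \<in> L" for g l using G(2) that by blast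
  have syz2: "(\<Oplus>\<^bsub>A\<^esub>l\<in>L. p [^]\<^bsub>A\<^esub> N \<otimes>\<^bsub>A\<^esub> \<rho> l \<otimes>\<^bsub>A\<^esub> g l) = \<zero>\<^bsub>A\<^esub>" if "g \<in> G" "\<rho> \<in> P" for g \<rho>
    using G(2) that by blast
  define u where "u = inv\<^bsub>M\<^esub> (\<pi> [^]\<^bsub>M\<^esub> k)"
  have unit: "\<pi> [^]\<^bsub>M\<^esub> k \<in> Units M" using p_unit_M by (rule S.Units_pow_closed)
  have u: "u \<in> carrier M" "\<pi> [^]\<^bsub>M\<^esub> k \<otimes>\<^bsub>M\<^esub> u = \<one>\<^bsub>M\<^esub>" unfolding u_def using unit by auto
  show "\<exists>G t. finite G \<and>
     (\<forall>g\<in>G. g \<in> L \<rightarrow> carrier A \<and> (\<forall>\<rho>\<in>P. (\<Oplus>\<^bsub>A\<^esub>l\<in>L. \<rho> l \<otimes>\<^bsub>A\<^esub> g l) = \<zero>\<^bsub>A\<^esub>)) \<and>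
     t \<in> G \<rightarrow> carrier (ring_as_left_module \<psi> M) \<and>
     (\<forall>l\<in>L. l = (\<Oplus>\<^bsub>ring_as_left_module \<psi> M\<^esub>g\<in>G. g l \<odot>\<^bsub>ring_as_left_module \<psi> M\<^esub> t g))"
  proof (intro exI[of _ G] exI[of _ "\<lambda>g. u \<otimes>\<^bsub>M\<^esub> t g"] conjI ballI)
    fix g assume g: "g \<in> G"
    show "g \<in> L \<rightarrow> carrier A" using syz1[OF g] by auto
    fix \<rho> assume \<rho>: "\<rho> \<in> P"
    have "p [^]\<^bsub>A\<^esub> N \<otimes>\<^bsub>A\<^esub> (\<Oplus>\<^bsub>A\<^esub>l\<in>L. \<rho> l \<otimes>\<^bsub>A\<^esub> g l) = (\<Oplus>\<^bsub>A\<^esub>l\<in>L. p [^]\<^bsub>A\<^esub> N \<otimes>\<^bsub>A\<^esub> (\<rho> l \<otimes>\<^bsub>A\<^esub> g l))"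
      by (rule R.finsum_rdistr) (use L(1) syz1[OF g] rc[OF \<rho>] in auto)
    also have "\<dots> = (\<Oplus>\<^bsub>A\<^esub>l\<in>L. p [^]\<^bsub>A\<^esub> N \<otimes>\<^bsub>A\<^esub> \<rho> l \<otimes>\<^bsub>A\<^esub> g l)"
      by (rule R.finsum_cong') (use syz1[OF g] rc[OF \<rho>] in \<open>auto simp: R.m_assoc\<close>)
    also have "\<dots> = \<zero>\<^bsub>A\<^esub>" by (rule syz2[OF g \<rho>])
    finally show "(\<Oplus>\<^bsub>A\<^esub>l\<in>L. \<rho> l \<otimes>\<^bsub>A\<^esub> g l) = \<zero>\<^bsub>A\<^esub>"
      by (rule pp_cancel_A[rotated]) (rule R.dot_closed; use syz1[OF g] rc[OF \<rho>] in auto)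
  next
    show "(\<lambda>g. u \<otimes>\<^bsub>M\<^esub> t g) \<in> G \<rightarrow> carrier (ring_as_left_module \<psi> M)" using t u by auto
  next
    fix l assume l: "l \<in> L"
    let ?x = "\<Oplus>\<^bsub>M\<^esub>g\<in>G. \<psi> (g l) \<otimes>\<^bsub>M\<^esub> (u \<otimes>\<^bsub>M\<^esub> t g)"
    have gc: "\<psi> (g l) \<in> carrier M" "t g \<in> carrier M" if "g \<in> G" for g using syz1[OF that l] t that by auto
    have "\<pi> [^]\<^bsub>M\<^esub> k \<otimes>\<^bsub>M\<^esub> ?x = (\<Oplus>\<^bsub>M\<^esub>g\<in>G. \<psi> (g l) \<otimes>\<^bsub>M\<^esub> (\<pi> [^]\<^bsub>M\<^esub> k \<otimes>\<^bsub>M\<^esub> (u \<otimes>\<^bsub>M\<^esub> t g)))"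
      by (rule S.dot_central[OF G(1), symmetric]) (use gc u M.pp_central in auto)
    also have "\<dots> = (\<Oplus>\<^bsub>M\<^esub>g\<in>G. \<psi> (g l) \<otimes>\<^bsub>M\<^esub> t g)"
      by (rule S.finsum_cong') (use gc u in \<open>auto simp: S.m_assoc[symmetric]\<close>)
    also have "\<dots> = \<pi> [^]\<^bsub>M\<^esub> k \<otimes>\<^bsub>M\<^esub> l" using Lt l by simp
    finally have eq: "\<pi> [^]\<^bsub>M\<^esub> k \<otimes>\<^bsub>M\<^esub> ?x = \<pi> [^]\<^bsub>M\<^esub> k \<otimes>\<^bsub>M\<^esub> l" .
    have "?x \<in> carrier M" by (rule S.dot_closed) (use gc u in auto)
    from M.pp_cancel[OF this LM[OF l] eq] have "?x = l" .
    then show "l = (\<Oplus>\<^bsub>ring_as_left_module \<psi> M\<^esub>g\<in>G. g l \<odot>\<^bsub>ring_as_left_module \<psi> M\<^esub> (u \<otimes>\<^bsub>M\<^esub> t g))"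
      by simp
  qed (rule G(1))
qed

end

subsection \<open>Tensor products of algebras\<close>

text \<open>The product of \<open>tensor_algebra\<close> on representatives. Associativity, units
  and distributivity already hold in the free group, before any passage to classes.\<close>

definition frag_mult ::
  "('m, 'x) monoid_scheme \<Rightarrow> ('n, 'y) monoid_scheme \<Rightarrow> ('m \<times> 'n \<Rightarrow>\<^sub>0 int) \<Rightarrow> ('m \<times> 'n \<Rightarrow>\<^sub>0 int) \<Rightarrow> ('m \<times> 'n \<Rightarrow>\<^sub>0 int)"
  where "frag_mult S T c d =
    frag_extend (\<lambda>(x, y). frag_extend (\<lambda>(x', y'). frag_of (x \<otimes>\<^bsub>S\<^esub> x', y \<otimes>\<^bsub>T\<^esub> y')) d) c"

lemma frag_extend_diff_fun: "frag_extend (\<lambda>x. f x - g x) c = frag_extend f c - frag_extend g c"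
proof -
  have "Poly_Mapping.keys c \<subseteq> UNIV" by simp
  then show ?thesis by (induct c rule: frag_induction) (simp_all add: frag_extend_diff)
qed

lemma frag_mult_diff_left: "frag_mult S T (c - c') d = frag_mult S T c d - frag_mult S T c' d"
  by (simp add: frag_mult_def frag_extend_diff)

lemma frag_mult_diff_right: "frag_mult S T c (d - d') = frag_mult S T c d - frag_mult S T c d'"
  by (simp add: frag_mult_def frag_extend_diff case_prod_unfold frag_extend_diff_fun)

lemma frag_mult_zero [simp]: "frag_mult S T 0 d = 0" "frag_mult S T c 0 = 0"
  by (simp_all add: frag_mult_def case_prod_unfold frag_extend_eq_0)

lemma frag_mult_add_left: "frag_mult S T (c + c') d = frag_mult S T c d + frag_mult S T c' d"
  by (simp add: frag_mult_def frag_extend_add)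

lemma frag_mult_add_right: "frag_mult S T c (d + d') = frag_mult S T c d + frag_mult S T c d'"
  using frag_mult_diff_right[of S T c "d + d'" d'] by (simp add: algebra_simps)

lemma frag_mult_of_left: "frag_mult S T (frag_of (x, y)) d = frag_pair_map (\<lambda>x'. x \<otimes>\<^bsub>S\<^esub> x') (\<lambda>y'. y \<otimes>\<^bsub>T\<^esub> y') d"
  by (simp add: frag_mult_def frag_pair_map_def)

lemma frag_mult_of_right: "frag_mult S T c (frag_of (x, y)) = frag_pair_map (\<lambda>x'. x' \<otimes>\<^bsub>S\<^esub> x) (\<lambda>y'. y' \<otimes>\<^bsub>T\<^esub> y) c"
  by (simp add: frag_mult_def frag_pair_map_def case_prod_unfold)

locale tensor_of_algebras = S: assoc_algebra R S + T: assoc_algebra R T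
  for R :: "('a, 'z) ring_scheme" and S :: "('a, 'm, 'x) module_scheme" and T :: "('a, 'n, 'y) module_scheme"
begin

sublocale F: tensor_factors R S T
  by unfold_locales auto

abbreviation "cls \<equiv> tensor_class R S T"
abbreviation "ker \<equiv> tensor_kernel R S T"
abbreviation "free \<equiv> {c. Poly_Mapping.keys c \<subseteq> carrier S \<times> carrier T}"
abbreviation "A \<equiv> tensor_algebra R S T"
abbreviation fmult (infixl "\<star>" 70) where "c \<star> d \<equiv> frag_mult S T c d"

lemma mult_linear_left: "x \<in> carrier S \<Longrightarrow> (\<lambda>x'. x \<otimes>\<^bsub>S\<^esub> x') \<in> linear_maps R S S"
  by (auto simp: linear_maps_def hom_def S.U.r_distr S.smult_mult_right)

lemma mult_linear_right: "x \<in> carrier S \<Longrightarrow> (\<lambda>x'. x' \<otimes>\<^bsub>S\<^esub> x) \<in> linear_maps R S S"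
  by (auto simp: linear_maps_def hom_def S.U.l_distr S.smult_mult_left)

lemma mult_linear_left': "x \<in> carrier T \<Longrightarrow> (\<lambda>x'. x \<otimes>\<^bsub>T\<^esub> x') \<in> linear_maps R T T"
  by (auto simp: linear_maps_def hom_def T.U.r_distr T.smult_mult_right)

lemma mult_linear_right': "x \<in> carrier T \<Longrightarrow> (\<lambda>x'. x' \<otimes>\<^bsub>T\<^esub> x) \<in> linear_maps R T T"
  by (auto simp: linear_maps_def hom_def T.U.l_distr T.smult_mult_left)

lemma fmult_free: "\<lbrakk>c \<in> free; d \<in> free\<rbrakk> \<Longrightarrow> c \<star> d \<in> free"
  unfolding mem_Collect_eq frag_mult_def
proof (rule keys_frag_extend_subset, assumption)
  fix z
  assume d: "Poly_Mapping.keys d \<subseteq> carrier S \<times> carrier T" and "z \<in> carrier S \<times> carrier T"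
  then obtain x y where z: "z = (x, y)" "x \<in> carrier S" "y \<in> carrier T" by auto
  have "Poly_Mapping.keys (frag_extend (\<lambda>(x', y'). frag_of (x \<otimes>\<^bsub>S\<^esub> x', y \<otimes>\<^bsub>T\<^esub> y')) d) \<subseteq> carrier S \<times> carrier T"
    by (rule keys_frag_extend_subset[OF d]) (use z in auto)
  then show "Poly_Mapping.keys (case z of (x, y) \<Rightarrow> frag_extend (\<lambda>(x', y'). frag_of (x \<otimes>\<^bsub>S\<^esub> x', y \<otimes>\<^bsub>T\<^esub> y')) d)
      \<subseteq> carrier S \<times> carrier T"
    by (simp add: z(1))
qed

text \<open>Multiplication by a pure tensor is induced by two linear maps and hence preserves the
  kernel; the general factor follows by additivity.\<close>

lemma fmult_kernel_left:
  assumes "c \<in> ker" "d \<in> free"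
  shows "c \<star> d \<in> ker"
proof -
  have "Poly_Mapping.keys d \<subseteq> carrier S \<times> carrier T" using assms(2) by simp
  then show ?thesis
  proof (induct d rule: free_induct)
    case (one a)
    then show ?case
      using frag_pair_map_kernel[OF F.tensor_factors_axioms F.tensor_factors_axioms
          mult_linear_right mult_linear_right' assms(1)]
      by (cases a) (simp add: frag_mult_of_right)
  qed (auto simp: frag_mult_diff_right F.tensor_kernel_diff)
qed

lemma fmult_kernel_right:
  assumes "c \<in> free" "d \<in> ker"
  shows "c \<star> d \<in> ker"
proof -
  have "Poly_Mapping.keys c \<subseteq> carrier S \<times> carrier T" using assms(1) by simp
  then show ?thesis
  proof (induct c rule: free_induct)
    case (one a)
    then show ?case
      using frag_pair_map_kernel[OF F.tensor_factors_axioms F.tensor_factors_axioms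
          mult_linear_left mult_linear_left' assms(2)]
      by (cases a) (simp add: frag_mult_of_left)
  qed (auto simp: frag_mult_diff_left F.tensor_kernel_diff)
qed

lemma carrier_A: "carrier A = cls ` free"
  by (simp add: tensor_algebra_def F.carrier_tensor_group)

lemma zero_A: "\<zero>\<^bsub>A\<^esub> = cls 0"
  by (simp add: tensor_algebra_def F.one_tensor_group)

lemma one_A: "\<one>\<^bsub>A\<^esub> = cls (frag_of (\<one>\<^bsub>S\<^esub>, \<one>\<^bsub>T\<^esub>))"
  by (simp add: tensor_algebra_def)

lemma add_A: "cls c \<oplus>\<^bsub>A\<^esub> cls d = cls (c + d)"
  by (simp add: tensor_algebra_def F.mult_tensor_group)

lemma class_free: "\<lbrakk>c \<in> free; c' \<in> cls c\<rbrakk> \<Longrightarrow> c' \<in> free"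
  using keys_add_subset[OF F.tensor_kernel_keys] by (auto simp: F.tensor_class_eq)

text \<open>Changing both representatives alters the product by (c' - c) d' + c (d' - d), and the
  kernel is a two-sided ideal.\<close>

lemma mult_A:
  assumes "c \<in> free" "d \<in> free"
  shows "cls c \<otimes>\<^bsub>A\<^esub> cls d = cls (c \<star> d)"
proof -
  have *: "cls (c' \<star> d') = cls (c \<star> d)" if "c' \<in> cls c" "d' \<in> cls d" for c' d'
  proof -
    have d': "d' \<in> free" by (rule class_free[OF assms(2) that(2)])
    have "(c' - c) \<star> d' \<in> ker" by (rule fmult_kernel_left[OF _ d']) (use that in \<open>simp add: F.tensor_class_mem_iff\<close>)
    moreover have "c \<star> (d' - d) \<in> ker"
      by (rule fmult_kernel_right[OF assms(1)]) (use that in \<open>simp add: F.tensor_class_mem_iff\<close>)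
    moreover have "c' \<star> d' - c \<star> d = (c' - c) \<star> d' + c \<star> (d' - d)"
      by (simp add: frag_mult_diff_left frag_mult_diff_right)
    ultimately show ?thesis unfolding F.tensor_class_eq_iff by (simp add: F.tensor_kernel_add)
  qed
  have "cls c \<otimes>\<^bsub>A\<^esub> cls d = (\<Union>c'\<in>cls c. \<Union>d'\<in>cls d. cls (c' \<star> d'))"
    by (simp add: tensor_algebra_def frag_mult_def)
  also have "\<dots> = (\<Union>c'\<in>cls c. \<Union>d'\<in>cls d. cls (c \<star> d))"
    using * by simp
  also have "\<dots> = cls (c \<star> d)"
    using F.tensor_class_self[of c] F.tensor_class_self[of d] by blast
  finally show ?thesis .
qed

lemma fmult_assoc:
  assumes "c \<in> free" "d \<in> free" "e \<in> free"
  shows "(c \<star> d) \<star> e = c \<star> (d \<star> e)"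
proof -
  have 1: "frag_pair_map (\<lambda>u. x \<otimes>\<^bsub>S\<^esub> u) (\<lambda>w. y \<otimes>\<^bsub>T\<^esub> w) d \<star> e
      = frag_pair_map (\<lambda>u. x \<otimes>\<^bsub>S\<^esub> u) (\<lambda>w. y \<otimes>\<^bsub>T\<^esub> w) (d \<star> e)"
    if x: "x \<in> carrier S" "y \<in> carrier T" for x y
  proof -
    have "Poly_Mapping.keys d \<subseteq> carrier S \<times> carrier T" using assms(2) by simp
    then show ?thesis
    proof (induct d rule: free_induct)
      case (one a)
      then obtain x' y' where a: "a = (x', y')" "x' \<in> carrier S" "y' \<in> carrier T" by auto
      have "Poly_Mapping.keys e \<subseteq> carrier S \<times> carrier T" using assms(3) by simp
      then show ?case
        unfolding a frag_pair_map_simps frag_mult_of_left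
        by (induct e rule: free_induct) (use x a in \<open>auto simp: S.U.m_assoc T.U.m_assoc\<close>)
    qed (simp_all add: frag_mult_diff_left)
  qed
  have "Poly_Mapping.keys c \<subseteq> carrier S \<times> carrier T" using assms(1) by simp
  then show ?thesis
  proof (induct c rule: free_induct)
    case (one a)
    then show ?case by (cases a) (simp add: frag_mult_of_left 1)
  qed (simp_all add: frag_mult_diff_left)
qed

lemma one_free: "frag_of (\<one>\<^bsub>S\<^esub>, \<one>\<^bsub>T\<^esub>) \<in> free" by simp

lemma fmult_one:
  assumes "c \<in> free"
  shows "frag_of (\<one>\<^bsub>S\<^esub>, \<one>\<^bsub>T\<^esub>) \<star> c = c" "c \<star> frag_of (\<one>\<^bsub>S\<^esub>, \<one>\<^bsub>T\<^esub>) = c"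
proof -
  have c: "Poly_Mapping.keys c \<subseteq> carrier S \<times> carrier T" using assms by simp
  show "frag_of (\<one>\<^bsub>S\<^esub>, \<one>\<^bsub>T\<^esub>) \<star> c = c" unfolding frag_mult_of_left
    using c by (induct c rule: free_induct) auto
  show "c \<star> frag_of (\<one>\<^bsub>S\<^esub>, \<one>\<^bsub>T\<^esub>) = c" unfolding frag_mult_of_right
    using c by (induct c rule: free_induct) auto
qed

lemma ring_A: "ring A"
proof (rule ringI)
  show "abelian_group A"
  proof (rule abelian_groupI)
    fix x assume "x \<in> carrier A"
    then obtain c where c: "x = cls c" "c \<in> free" by (auto simp: carrier_A)
    have "cls (- c) \<in> carrier A" using c by (auto simp: carrier_A keys_minus)
    then show "\<exists>y\<in>carrier A. y \<oplus>\<^bsub>A\<^esub> x = \<zero>\<^bsub>A\<^esub>"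
      by (rule bexI[rotated]) (simp add: c add_A zero_A)
  next
    fix x y assume "x \<in> carrier A" "y \<in> carrier A"
    then obtain c d where c: "x = cls c" "c \<in> free" "y = cls d" "d \<in> free" by (auto simp: carrier_A)
    have "c + d \<in> free" using c keys_add_subset by blast
    then show "x \<oplus>\<^bsub>A\<^esub> y \<in> carrier A" unfolding c add_A carrier_A by (rule imageI)
  qed (auto simp: carrier_A add_A zero_A algebra_simps)
  show "monoid A"
  proof (rule monoidI)
    fix x y assume "x \<in> carrier A" "y \<in> carrier A"
    then obtain c d where "x = cls c" "c \<in> free" "y = cls d" "d \<in> free" by (auto simp: carrier_A)
    then show "x \<otimes>\<^bsub>A\<^esub> y \<in> carrier A"
      unfolding carrier_A using mult_A[of c d] imageI[OF fmult_free[of c d], of cls] by simp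
  next
    show "\<one>\<^bsub>A\<^esub> \<in> carrier A" unfolding one_A carrier_A using one_free by (rule imageI)
  next
    fix x y z assume "x \<in> carrier A" "y \<in> carrier A" "z \<in> carrier A"
    then obtain c d e where "x = cls c" "c \<in> free" "y = cls d" "d \<in> free" "z = cls e" "e \<in> free"
      by (auto simp: carrier_A)
    then show "x \<otimes>\<^bsub>A\<^esub> y \<otimes>\<^bsub>A\<^esub> z = x \<otimes>\<^bsub>A\<^esub> (y \<otimes>\<^bsub>A\<^esub> z)"
      using mult_A[of c d] mult_A[of d e] mult_A[OF fmult_free, of c d e] mult_A[OF _ fmult_free, of c d e]
        fmult_assoc[of c d e] by simp
  next
    fix x assume "x \<in> carrier A"
    then obtain c where c: "x = cls c" "c \<in> free" by (auto simp: carrier_A)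
    show "\<one>\<^bsub>A\<^esub> \<otimes>\<^bsub>A\<^esub> x = x" "x \<otimes>\<^bsub>A\<^esub> \<one>\<^bsub>A\<^esub> = x"
      unfolding one_A c(1) mult_A[OF one_free c(2)] mult_A[OF c(2) one_free] fmult_one[OF c(2)] by simp_all
  qed
  fix x y z assume "x \<in> carrier A" "y \<in> carrier A" "z \<in> carrier A"
  then obtain c d e where c: "x = cls c" "c \<in> free" "y = cls d" "d \<in> free" "z = cls e" "e \<in> free"
    by (auto simp: carrier_A)
  then have "c + d \<in> free" using keys_add_subset[of c _ d] by blast
  then show "(x \<oplus>\<^bsub>A\<^esub> y) \<otimes>\<^bsub>A\<^esub> z = x \<otimes>\<^bsub>A\<^esub> z \<oplus>\<^bsub>A\<^esub> y \<otimes>\<^bsub>A\<^esub> z"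
    "z \<otimes>\<^bsub>A\<^esub> (x \<oplus>\<^bsub>A\<^esub> y) = z \<otimes>\<^bsub>A\<^esub> x \<oplus>\<^bsub>A\<^esub> z \<otimes>\<^bsub>A\<^esub> y"
    unfolding c add_A
    using c mult_A[of c e] mult_A[of d e] mult_A[of "c + d" e] mult_A[of e c] mult_A[of e d] mult_A[of e "c + d"]
    by (simp_all add: add_A frag_mult_add_left frag_mult_add_right)
qed

end

lemma tensor_map_ring_hom:
  assumes "tensor_of_algebras R S T" "tensor_of_algebras R S' T'"
    and f: "f \<in> ring_hom S S'" "f \<in> linear_maps R S S'"
    and g: "g \<in> ring_hom T T'" "g \<in> linear_maps R T T'"
  shows "tensor_map R S' T' f g \<in> ring_hom (tensor_algebra R S T) (tensor_algebra R S' T')"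
proof -
  interpret S: tensor_of_algebras R S T by fact
  interpret T: tensor_of_algebras R S' T' by fact
  note map = tensor_map_class(2)[OF S.F.tensor_factors_axioms T.F.tensor_factors_axioms f(2) g(2)]
  let ?f = "frag_pair_map f g"
  have free: "?f c \<in> T.free" if "c \<in> S.free" for c
    using that keys_frag_pair_map[of c "carrier S" "carrier T" f "carrier S'" g "carrier T'"]
      ring_hom_closed[OF f(1)] ring_hom_closed[OF g(1)] by simp
  have mult: "?f (frag_mult S T c d) = frag_mult S' T' (?f c) (?f d)" if "c \<in> S.free" "d \<in> S.free" for c d
  proof -
    have c: "Poly_Mapping.keys c \<subseteq> carrier S \<times> carrier T" and d: "Poly_Mapping.keys d \<subseteq> carrier S \<times> carrier T"
      using that by simp_all
    show ?thesis using c
    proof (induct c rule: free_induct)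
      case (one a)
      then obtain x y where a: "a = (x, y)" "x \<in> carrier S" "y \<in> carrier T" by auto
      show ?case unfolding a frag_pair_map_simps frag_mult_of_left
        using d by (induct d rule: free_induct)
          (use a ring_hom_mult[OF f(1)] ring_hom_mult[OF g(1)] in auto)
    qed (simp_all add: frag_mult_diff_left)
  qed
  show ?thesis
  proof (rule ring_hom_memI)
    fix x assume "x \<in> carrier S.A"
    then show "tensor_map R S' T' f g x \<in> carrier T.A"
      using free by (auto simp: S.carrier_A T.carrier_A map)
  next
    fix x y assume "x \<in> carrier S.A" "y \<in> carrier S.A"
    then obtain c d where c: "x = S.cls c" "c \<in> S.free" "y = S.cls d" "d \<in> S.free" by (auto simp: S.carrier_A)
    show "tensor_map R S' T' f g (x \<otimes>\<^bsub>S.A\<^esub> y) = tensor_map R S' T' f g x \<otimes>\<^bsub>T.A\<^esub> tensor_map R S' T' f g y"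
      unfolding c(1,3) S.mult_A[OF c(2,4)] map T.mult_A[OF free[OF c(2)] free[OF c(4)]] mult[OF c(2,4)] ..
    show "tensor_map R S' T' f g (x \<oplus>\<^bsub>S.A\<^esub> y) = tensor_map R S' T' f g x \<oplus>\<^bsub>T.A\<^esub> tensor_map R S' T' f g y"
      unfolding c(1,3) S.add_A map T.add_A by simp
  next
    show "tensor_map R S' T' f g \<one>\<^bsub>S.A\<^esub> = \<one>\<^bsub>T.A\<^esub>"
      by (simp add: S.one_A T.one_A map ring_hom_one[OF f(1)] ring_hom_one[OF g(1)])
  qed
qed

section \<open>Extension of scalars to a field of fractions\<close>

lemma (in ring) ring_ring_as_left_module: "ring (ring_as_left_module \<phi> R)"
proof -
  have "abelian_group (ring_as_left_module \<phi> R)"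
    by (rule abelian_groupI) (auto simp: a_ac intro!: bexI[of _ "\<ominus> x" for x] l_neg)
  then show ?thesis
    by (rule ringI, unfold_locales) (simp_all add: m_assoc l_distr r_distr)
qed

lemma subring_assoc_algebra:
  assumes "cring K" "cring R" "carrier R \<subseteq> carrier K"
    and ops: "\<And>x y. x \<otimes>\<^bsub>R\<^esub> y = x \<otimes>\<^bsub>K\<^esub> y" "\<And>x y. x \<oplus>\<^bsub>R\<^esub> y = x \<oplus>\<^bsub>K\<^esub> y" "\<one>\<^bsub>R\<^esub> = \<one>\<^bsub>K\<^esub>"
  shows "assoc_algebra R (ring_as_left_module (\<lambda>a. a) K)"
proof -
  interpret K: cring K by fact
  have c: "a \<in> carrier K" if "a \<in> carrier R" for a using assms(3) that by blast
  have "left_module R (ring_as_left_module (\<lambda>a. a) K)"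
    by (intro left_module.intro cring.axioms(1)[OF assms(2)] ring.is_abelian_group[OF K.ring_ring_as_left_module]
        left_module_axioms.intro) (simp_all add: ops c K.m_assoc K.l_distr K.r_distr)
  then show ?thesis
    by (intro assoc_algebra.intro assoc_algebra_axioms.intro assms(2) K.ring_ring_as_left_module)
       (simp_all add: c K.m_assoc K.m_lcomm)
qed

text \<open>The tensor product of \<open>S\<close> with \<open>K\<close>, where \<open>K\<close>
  arises from \<open>R\<close> by inverting \<pi>. In \<open>fraction\<close> all large exponents
  must work, not just one, so that finitely many elements of \<open>K\<close> have a common
  exponent.\<close>

locale fraction_tensor = assoc_algebra R S + K?: cring K
  for R :: "('k, 'z) ring_scheme" (structure) and S :: "('k, 'm, 'x) module_scheme" (structure)
    and K :: "('k, 'z) ring_scheme" (structure) and \<pi> :: 'k +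
  assumes R_K: "carrier R \<subseteq> carrier K" "R = K\<lparr>carrier := carrier R\<rparr>"
    and \<pi>_R: "\<pi> \<in> carrier R" and \<pi>_unit: "\<pi> \<in> Units K"
    and fraction: "k \<in> carrier K \<Longrightarrow> \<exists>N::nat. \<forall>n\<ge>N. \<pi> [^]\<^bsub>K\<^esub> n \<otimes>\<^bsub>K\<^esub> k \<in> carrier R"
    and torsion_free: "\<lbrakk>x \<in> carrier S; \<pi> \<odot>\<^bsub>S\<^esub> x = \<zero>\<^bsub>S\<^esub>\<rbrakk> \<Longrightarrow> x = \<zero>\<^bsub>S\<^esub>"
begin

lemma R_ops: "x \<otimes>\<^bsub>R\<^esub> y = x \<otimes>\<^bsub>K\<^esub> y" "\<one>\<^bsub>R\<^esub> = \<one>\<^bsub>K\<^esub>" "x \<oplus>\<^bsub>R\<^esub> y = x \<oplus>\<^bsub>K\<^esub> y" "\<zero>\<^bsub>R\<^esub> = \<zero>\<^bsub>K\<^esub>"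
proof -
  have "monoid.mult R = monoid.mult (K\<lparr>carrier := carrier R\<rparr>)" "one R = one (K\<lparr>carrier := carrier R\<rparr>)"
    "add R = add (K\<lparr>carrier := carrier R\<rparr>)" "ring.zero R = ring.zero (K\<lparr>carrier := carrier R\<rparr>)"
    using R_K(2) by (rule arg_cong)+
  then show "x \<otimes>\<^bsub>R\<^esub> y = x \<otimes>\<^bsub>K\<^esub> y" "\<one>\<^bsub>R\<^esub> = \<one>\<^bsub>K\<^esub>" "x \<oplus>\<^bsub>R\<^esub> y = x \<oplus>\<^bsub>K\<^esub> y" "\<zero>\<^bsub>R\<^esub> = \<zero>\<^bsub>K\<^esub>"
    by simp_all
qed

lemma R_closed: "a \<in> carrier R \<Longrightarrow> a \<in> carrier K" using R_K(1) by blast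

abbreviation "KR \<equiv> ring_as_left_module (\<lambda>a. a) K"

lemma pow_R: "x [^]\<^bsub>R\<^esub> (n::nat) = x [^]\<^bsub>K\<^esub> n"
  by (simp add: nat_pow_def R_ops)

lemma KR_algebra: "assoc_algebra R KR"
  by (rule subring_assoc_algebra[OF K.is_cring R.is_cring R_K(1)]) (simp_all add: R_ops)

sublocale TA: tensor_of_algebras R S KR
  by (intro tensor_of_algebras.intro assoc_algebra_axioms KR_algebra)

abbreviation "A \<equiv> tensor_algebra R S KR"
definition \<iota> where "\<iota> x = TA.cls (frag_of (x, \<one>\<^bsub>K\<^esub>))"
definition p where "p = \<iota> (\<pi> \<odot>\<^bsub>S\<^esub> \<one>\<^bsub>S\<^esub>)"

sublocale A: ring A by (rule TA.ring_A)

lemma \<iota>_free: "x \<in> carrier S \<Longrightarrow> frag_of (x, \<one>\<^bsub>K\<^esub>) \<in> TA.free" by simp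

sublocale \<iota>: ring_hom_ring S A \<iota>
proof (rule ring_hom_ringI2[OF U.ring_axioms A.ring_axioms ring_hom_memI])
  fix x y assume x: "x \<in> carrier S" and y: "y \<in> carrier S"
  show "\<iota> x \<in> carrier A" unfolding \<iota>_def TA.carrier_A using x by simp
  show "\<iota> (x \<otimes>\<^bsub>S\<^esub> y) = \<iota> x \<otimes>\<^bsub>A\<^esub> \<iota> y"
    unfolding \<iota>_def TA.mult_A[OF \<iota>_free[OF x] \<iota>_free[OF y]] by (simp add: frag_mult_of_left)
  show "\<iota> (x \<oplus>\<^bsub>S\<^esub> y) = \<iota> x \<oplus>\<^bsub>A\<^esub> \<iota> y"
    unfolding \<iota>_def TA.add_A TA.F.tensor_class_eq_iff
    using TA.F.tensor_kernel_add_left[of x y "\<one>\<^bsub>K\<^esub>"] x y by (simp add: algebra_simps)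
next
  show "\<iota> \<one>\<^bsub>S\<^esub> = \<one>\<^bsub>A\<^esub>" by (simp add: \<iota>_def TA.one_A)
qed

lemma cls_smult:
  "\<lbrakk>a \<in> carrier R; x \<in> carrier S; k \<in> carrier K\<rbrakk> \<Longrightarrow> TA.cls (frag_of (a \<odot>\<^bsub>S\<^esub> x, k)) = TA.cls (frag_of (x, a \<otimes>\<^bsub>K\<^esub> k))"
  using TA.F.tensor_kernel_smult[of a x k] by (simp add: TA.F.tensor_class_eq_iff)

lemma p_eq: "p = TA.cls (frag_of (\<one>\<^bsub>S\<^esub>, \<pi>))"
  unfolding p_def \<iota>_def using cls_smult[OF \<pi>_R, of "\<one>\<^bsub>S\<^esub>" "\<one>\<^bsub>K\<^esub>"] R_closed[OF \<pi>_R] by simp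

lemma p_closed: "p \<in> carrier A"
  unfolding p_def using \<pi>_R by simp

lemma scalar_central:
  assumes "k \<in> carrier K" "x \<in> carrier A"
  shows "x \<otimes>\<^bsub>A\<^esub> TA.cls (frag_of (\<one>\<^bsub>S\<^esub>, k)) = TA.cls (frag_of (\<one>\<^bsub>S\<^esub>, k)) \<otimes>\<^bsub>A\<^esub> x"
proof -
  obtain c where c: "x = TA.cls c" "c \<in> TA.free" using assms(2) by (auto simp: TA.carrier_A)
  then have "Poly_Mapping.keys c \<subseteq> carrier S \<times> carrier KR" by simp
  then have "frag_mult S KR c (frag_of (\<one>\<^bsub>S\<^esub>, k)) = frag_mult S KR (frag_of (\<one>\<^bsub>S\<^esub>, k)) c"
    unfolding frag_mult_of_left frag_mult_of_right
    by (induct c rule: free_induct) (use assms(1) in \<open>auto simp: K.m_comm\<close>)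
  moreover have "frag_of (\<one>\<^bsub>S\<^esub>, k) \<in> TA.free" using assms(1) by simp
  ultimately show ?thesis using c TA.mult_A[of c "frag_of (\<one>\<^bsub>S\<^esub>, k)"] TA.mult_A[of "frag_of (\<one>\<^bsub>S\<^esub>, k)" c] by simp
qed

lemma p_central: "x \<in> carrier A \<Longrightarrow> x \<otimes>\<^bsub>A\<^esub> p = p \<otimes>\<^bsub>A\<^esub> x"
  unfolding p_eq by (rule scalar_central[OF R_closed[OF \<pi>_R]])

lemma p_unit: "p \<in> Units A"
proof -
  let ?i = "inv\<^bsub>K\<^esub> \<pi>" and ?q = "TA.cls (frag_of (\<one>\<^bsub>S\<^esub>, inv\<^bsub>K\<^esub> \<pi>))"
  have \<pi>: "\<pi> \<in> carrier K" "?i \<in> carrier K" using \<pi>_unit by auto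
  have q: "?q \<in> carrier A" unfolding TA.carrier_A using \<pi> by simp
  have "p \<otimes>\<^bsub>A\<^esub> ?q = \<one>\<^bsub>A\<^esub>"
    unfolding p_eq TA.one_A using \<pi> \<pi>_unit TA.mult_A[of "frag_of (\<one>\<^bsub>S\<^esub>, \<pi>)" "frag_of (\<one>\<^bsub>S\<^esub>, ?i)"]
    by (simp add: frag_mult_of_left)
  then show ?thesis
    using p_central[OF q] q p_closed unfolding Units_def by (auto intro!: bexI[of _ ?q])
qed

lemma p_pow: "p [^]\<^bsub>A\<^esub> (n::nat) = \<iota> ((\<pi> [^]\<^bsub>R\<^esub> n) \<odot>\<^bsub>S\<^esub> \<one>\<^bsub>S\<^esub>)"
proof (induct n)
  case 0
  then show ?case by simp
next
  case (Suc n)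
  have "((\<pi> [^]\<^bsub>R\<^esub> n) \<odot>\<^bsub>S\<^esub> \<one>\<^bsub>S\<^esub>) \<otimes>\<^bsub>S\<^esub> (\<pi> \<odot>\<^bsub>S\<^esub> \<one>\<^bsub>S\<^esub>) = (\<pi> [^]\<^bsub>R\<^esub> Suc n) \<odot>\<^bsub>S\<^esub> \<one>\<^bsub>S\<^esub>"
    using \<pi>_R by (simp add: smult_mult_left smult_assoc1)
  then show ?case
    using Suc \<iota>.hom_mult[of "(\<pi> [^]\<^bsub>R\<^esub> n) \<odot>\<^bsub>S\<^esub> \<one>\<^bsub>S\<^esub>" "\<pi> \<odot>\<^bsub>S\<^esub> \<one>\<^bsub>S\<^esub>"] \<pi>_R by (simp add: p_def)
qed

lemma p_mult_\<iota>: "x \<in> carrier S \<Longrightarrow> p [^]\<^bsub>A\<^esub> (n::nat) \<otimes>\<^bsub>A\<^esub> \<iota> x = \<iota> ((\<pi> [^]\<^bsub>R\<^esub> n) \<odot>\<^bsub>S\<^esub> x)"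
  unfolding p_pow using \<pi>_R \<iota>.hom_mult[of "(\<pi> [^]\<^bsub>R\<^esub> n) \<odot>\<^bsub>S\<^esub> \<one>\<^bsub>S\<^esub>" x]
  by (simp add: smult_mult_left)

text \<open>A tensor is a finite combination of pure ones; a high power of \<pi> makes all second
  factors integral, and integral scalars move to the first factor.\<close>

lemma \<iota>_localizes:
  assumes "x \<in> carrier A"
  shows "\<exists>n::nat. p [^]\<^bsub>A\<^esub> n \<otimes>\<^bsub>A\<^esub> x \<in> \<iota> ` carrier S"
proof -
  have mono: "p [^]\<^bsub>A\<^esub> (k + n :: nat) \<otimes>\<^bsub>A\<^esub> y \<in> \<iota> ` carrier S"
    if *: "p [^]\<^bsub>A\<^esub> n \<otimes>\<^bsub>A\<^esub> y \<in> \<iota> ` carrier S" "y \<in> carrier A" for k n :: nat and y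
  proof -
    obtain s where s: "p [^]\<^bsub>A\<^esub> n \<otimes>\<^bsub>A\<^esub> y = \<iota> s" "s \<in> carrier S" using *(1) by (rule imageE)
    have "p [^]\<^bsub>A\<^esub> (k + n) \<otimes>\<^bsub>A\<^esub> y = p [^]\<^bsub>A\<^esub> k \<otimes>\<^bsub>A\<^esub> (p [^]\<^bsub>A\<^esub> n \<otimes>\<^bsub>A\<^esub> y)"
      using *(2) p_closed by (simp add: A.m_assoc[symmetric] A.nat_pow_mult)
    then show ?thesis unfolding s(1) p_mult_\<iota>[OF s(2)] using s(2) \<pi>_R by simp
  qed
  obtain c where c: "x = TA.cls c" "c \<in> TA.free" using assms by (auto simp: TA.carrier_A)
  then have "Poly_Mapping.keys c \<subseteq> carrier S \<times> carrier KR" by simp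
  then have "\<exists>n::nat. p [^]\<^bsub>A\<^esub> n \<otimes>\<^bsub>A\<^esub> TA.cls c \<in> \<iota> ` carrier S"
  proof (induct c rule: free_induct)
    case zero
    have "\<zero>\<^bsub>A\<^esub> \<in> \<iota> ` carrier S" by (rule image_eqI[of _ _ "\<zero>\<^bsub>S\<^esub>"]) simp_all
    then show ?case unfolding TA.zero_A[symmetric] by (intro exI[of _ 0]) simp
  next
    case (diff c d)
    then obtain m n :: nat where mn: "p [^]\<^bsub>A\<^esub> m \<otimes>\<^bsub>A\<^esub> TA.cls c \<in> \<iota> ` carrier S" "p [^]\<^bsub>A\<^esub> n \<otimes>\<^bsub>A\<^esub> TA.cls d \<in> \<iota> ` carrier S"
      by blast
    have cA: "TA.cls c \<in> carrier A" "TA.cls d \<in> carrier A" "TA.cls (c - d) \<in> carrier A"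
      using diff keys_diff_subset[OF diff(1,2)] by (auto simp: TA.carrier_A)
    obtain s t where s: "p [^]\<^bsub>A\<^esub> (n + m) \<otimes>\<^bsub>A\<^esub> TA.cls c = \<iota> s" "s \<in> carrier S"
      and t: "p [^]\<^bsub>A\<^esub> (n + m) \<otimes>\<^bsub>A\<^esub> TA.cls d = \<iota> t" "t \<in> carrier S"
      using mono[OF mn(1) cA(1), of n] mono[OF mn(2) cA(2), of m] by (auto simp: add.commute)
    have "TA.cls c = TA.cls (c - d) \<oplus>\<^bsub>A\<^esub> TA.cls d" by (simp add: TA.add_A)
    then have "TA.cls (c - d) = TA.cls c \<ominus>\<^bsub>A\<^esub> TA.cls d"
      using cA by (simp add: A.minus_eq A.a_assoc A.r_neg)
    then have "p [^]\<^bsub>A\<^esub> (n + m) \<otimes>\<^bsub>A\<^esub> TA.cls (c - d) = \<iota> s \<ominus>\<^bsub>A\<^esub> \<iota> t"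
      using cA p_closed by (simp add: A.minus_eq A.r_distr A.r_minus s t)
    also have "\<dots> = \<iota> (s \<ominus>\<^bsub>S\<^esub> t)" using s t by (simp add: A.minus_eq M.minus_eq)
    finally show ?case using s t by (intro exI[of _ "n + m"]) simp
  next
    case (one a)
    then obtain y k where a: "a = (y, k)" "y \<in> carrier S" "k \<in> carrier K" by auto
    obtain n :: nat where "\<forall>m\<ge>n. \<pi> [^]\<^bsub>K\<^esub> m \<otimes>\<^bsub>K\<^esub> k \<in> carrier R" using fraction[OF a(3)] by (elim exE)
    then have n: "\<pi> [^]\<^bsub>K\<^esub> n \<otimes>\<^bsub>K\<^esub> k \<in> carrier R" by simp
    have \<pi>n: "\<pi> [^]\<^bsub>K\<^esub> n \<in> carrier R" "\<pi> [^]\<^bsub>K\<^esub> n \<in> carrier K" using R.nat_pow_closed[OF \<pi>_R, of n] R_closed by (simp_all add: pow_R)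
    have "p [^]\<^bsub>A\<^esub> n = TA.cls (frag_of (\<one>\<^bsub>S\<^esub>, \<pi> [^]\<^bsub>K\<^esub> n))"
      unfolding p_pow \<iota>_def using cls_smult[OF \<pi>n(1), of "\<one>\<^bsub>S\<^esub>" "\<one>\<^bsub>K\<^esub>"] \<pi>n by (simp add: pow_R)
    then have "p [^]\<^bsub>A\<^esub> n \<otimes>\<^bsub>A\<^esub> TA.cls (frag_of a) = TA.cls (frag_of (y, \<pi> [^]\<^bsub>K\<^esub> n \<otimes>\<^bsub>K\<^esub> k))"
      using TA.mult_A[of "frag_of (\<one>\<^bsub>S\<^esub>, \<pi> [^]\<^bsub>K\<^esub> n)" "frag_of a"] a \<pi>n by (simp add: frag_mult_of_left)
    also have "\<dots> = \<iota> ((\<pi> [^]\<^bsub>K\<^esub> n \<otimes>\<^bsub>K\<^esub> k) \<odot>\<^bsub>S\<^esub> y)"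
      unfolding \<iota>_def using cls_smult[OF n a(2), of "\<one>\<^bsub>K\<^esub>"] R_closed[OF n] by simp
    finally show ?case using n a by (intro exI[of _ n]) simp
  qed
  then show ?thesis unfolding c .
qed

lemma torsion_free_pow: "\<lbrakk>x \<in> carrier S; (\<pi> [^]\<^bsub>R\<^esub> (n::nat)) \<odot>\<^bsub>S\<^esub> x = \<zero>\<^bsub>S\<^esub>\<rbrakk> \<Longrightarrow> x = \<zero>\<^bsub>S\<^esub>"
proof (induct n arbitrary: x)
  case (Suc n)
  then have "(\<pi> [^]\<^bsub>R\<^esub> n) \<odot>\<^bsub>S\<^esub> (\<pi> \<odot>\<^bsub>S\<^esub> x) = \<zero>\<^bsub>S\<^esub>" using \<pi>_R by (simp add: smult_assoc1)
  then have "\<pi> \<odot>\<^bsub>S\<^esub> x = \<zero>\<^bsub>S\<^esub>" by (rule Suc(1)[rotated]) (use Suc \<pi>_R in simp)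
  then show ?case by (rule torsion_free[OF Suc(2)])
qed simp

text \<open>Multiplying the second factors by a high power of \<open>\<pi>\<close> moves the finitely many relations that
  make a tensor vanish into the submodule \<open>S\<close>.\<close>

lemma \<iota>_inj: "\<lbrakk>x \<in> carrier S; \<iota> x = \<zero>\<^bsub>A\<^esub>\<rbrakk> \<Longrightarrow> x = \<zero>\<^bsub>S\<^esub>"
proof -
  \<comment> \<open>The intended map sends (x, k) to (\<pi>^n k) x, which makes sense only when
    \<pi>^n k is integral. Any values on a basis extend to the free group, so zero serves as
    default, and for large \<open>n\<close> a given relator never meets it.\<close>
  let ?h = "\<lambda>n (x, k). if \<pi> [^]\<^bsub>K\<^esub> (n::nat) \<otimes>\<^bsub>K\<^esub> k \<in> carrier R then (\<pi> [^]\<^bsub>K\<^esub> n \<otimes>\<^bsub>K\<^esub> k) \<odot>\<^bsub>S\<^esub> x else \<zero>\<^bsub>S\<^esub>"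
  have "\<exists>h. h \<in> hom (free_Abelian_group (carrier S \<times> carrier K)) (add_monoid S) \<and>
      (\<forall>z \<in> carrier S \<times> carrier K. h (frag_of z) = ?h n z)" for n
  proof -
    have "?h n ` (carrier S \<times> carrier K) \<subseteq> carrier (add_monoid S)" by auto
    from comm_group.free_Abelian_group_universal[OF M.a_comm_group this]
    obtain h where "h \<in> hom (free_Abelian_group (carrier S \<times> carrier K)) (add_monoid S)"
       "\<And>z. z \<in> carrier S \<times> carrier K \<Longrightarrow> h (frag_of z) = ?h n z" by blast
    then show ?thesis by (intro exI[of _ h]) simp
  qed
  then have "\<forall>n. \<exists>h. h \<in> hom (free_Abelian_group (carrier S \<times> carrier K)) (add_monoid S) \<and>
      (\<forall>z \<in> carrier S \<times> carrier K. h (frag_of z) = ?h n z)" ..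
  from choice[OF this] obtain h where h0: "\<forall>n. h n \<in> hom (free_Abelian_group (carrier S \<times> carrier K)) (add_monoid S) \<and>
      (\<forall>z \<in> carrier S \<times> carrier K. h n (frag_of z) = ?h n z)" by (elim exE)
  note h01 = conjunct1[OF spec[OF h0]]
  have h02: "h n (frag_of (x, k)) = (\<pi> [^]\<^bsub>K\<^esub> n \<otimes>\<^bsub>K\<^esub> k) \<odot>\<^bsub>S\<^esub> x"
    if "x \<in> carrier S" "k \<in> carrier K" "\<pi> [^]\<^bsub>K\<^esub> n \<otimes>\<^bsub>K\<^esub> k \<in> carrier R" for n x k
    using bspec[OF conjunct2[OF spec[OF h0]], of "(x, k)" n] that by simp
  note h = h01 h02
  have hom: "group_hom (free_Abelian_group (carrier S \<times> carrier K)) (add_monoid S) (h n)" for n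
    by (intro group_hom.intro group_hom_axioms.intro h group_free_Abelian_group M.a_group)
  have h_zero: "h n 0 = \<zero>\<^bsub>S\<^esub>" for n using group_hom.hom_one[OF hom] by simp
  have h_diff: "h n (c - d) = h n c \<ominus>\<^bsub>S\<^esub> h n d"
    if "Poly_Mapping.keys c \<subseteq> carrier S \<times> carrier K" "Poly_Mapping.keys d \<subseteq> carrier S \<times> carrier K" for n c d
  proof -
    have "h n (c + - d) = h n c \<oplus>\<^bsub>S\<^esub> h n (- d)"
      using group_hom.hom_mult[OF hom, of c "- d" n] that by simp
    moreover have "h n (- d) = \<ominus>\<^bsub>S\<^esub> h n d"
      using group_hom.hom_inv[OF hom, of d n] that by (simp add: a_inv_def)
    ultimately show ?thesis by (simp add: a_minus_def)
  qed
  have \<pi>K: "\<pi> [^]\<^bsub>K\<^esub> (n::nat) \<in> carrier K" for n using R_closed[OF \<pi>_R] by simp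
  \<comment> \<open>How large \<open>n\<close> must be depends on the relators involved. Vanishing
    for all large \<open>n\<close> is the form of the claim that survives differences.\<close>
  have "\<exists>N. \<forall>n\<ge>N. h n c = \<zero>\<^bsub>S\<^esub>" if "c \<in> TA.ker" for c
    using that
  proof (induct rule: TA.F.tensor_kernel_induct)
    case zero
    then show ?case by (simp add: h_zero)
  next
    case (add_left x x' k)
    then have k: "k \<in> carrier K" by simp
    obtain N :: nat where "\<forall>n\<ge>N. \<pi> [^]\<^bsub>K\<^esub> n \<otimes>\<^bsub>K\<^esub> k \<in> carrier R" using fraction[OF k] by (elim exE)
    note N = this[rule_format]
    have "h n (frag_of (x \<oplus>\<^bsub>S\<^esub> x', k) - frag_of (x, k) - frag_of (x', k)) = \<zero>\<^bsub>S\<^esub>" if "n \<ge> N" for n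
      using add_left k N[OF that]
      by (simp add: h_diff keys_diff_subset h(2) smult_r_distr)
         (simp add: a_minus_def M.minus_add M.a_ac M.r_neg M.r_neg1 M.r_neg2)
    then show ?case by (intro exI allI impI)
  next
    case (add_right x k k')
    then have k: "k \<in> carrier K" "k' \<in> carrier K" by simp_all
    obtain N1 :: nat where N1: "\<forall>n\<ge>N1. \<pi> [^]\<^bsub>K\<^esub> n \<otimes>\<^bsub>K\<^esub> k \<in> carrier R" using fraction[OF k(1)] by (elim exE)
    obtain N2 :: nat where N2: "\<forall>n\<ge>N2. \<pi> [^]\<^bsub>K\<^esub> n \<otimes>\<^bsub>K\<^esub> k' \<in> carrier R" using fraction[OF k(2)] by (elim exE)
    note N = N1[rule_format] N2[rule_format]
    have "h n (frag_of (x, k \<oplus>\<^bsub>K\<^esub> k') - frag_of (x, k) - frag_of (x, k')) = \<zero>\<^bsub>S\<^esub>" if "n \<ge> max N1 N2" for n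
    proof -
      have n: "\<pi> [^]\<^bsub>K\<^esub> n \<otimes>\<^bsub>K\<^esub> k \<in> carrier R" "\<pi> [^]\<^bsub>K\<^esub> n \<otimes>\<^bsub>K\<^esub> k' \<in> carrier R" using N that by auto
      have e: "\<pi> [^]\<^bsub>K\<^esub> n \<otimes>\<^bsub>K\<^esub> (k \<oplus>\<^bsub>K\<^esub> k') = \<pi> [^]\<^bsub>K\<^esub> n \<otimes>\<^bsub>K\<^esub> k \<oplus>\<^bsub>R\<^esub> \<pi> [^]\<^bsub>K\<^esub> n \<otimes>\<^bsub>K\<^esub> k'"
        using k \<pi>K by (simp add: K.r_distr R_ops)
      have n': "\<pi> [^]\<^bsub>K\<^esub> n \<otimes>\<^bsub>K\<^esub> (k \<oplus>\<^bsub>K\<^esub> k') \<in> carrier R" unfolding e using n by simp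
      show ?thesis
        using add_right k n n' h(2)[OF _ _ n', of x] smult_l_distr[OF n, of x]
        by (simp add: h_diff keys_diff_subset h(2) e)
           (simp add: a_minus_def M.minus_add M.a_ac M.r_neg M.r_neg1 M.r_neg2)
    qed
    then show ?case by (intro exI[of _ "max N1 N2"] allI impI) simp
  next
    case (smult a x k)
    then have k: "k \<in> carrier K" "a \<in> carrier K" "a \<otimes>\<^bsub>K\<^esub> k \<in> carrier K" using R_closed by simp_all
    obtain N :: nat where "\<forall>n\<ge>N. \<pi> [^]\<^bsub>K\<^esub> n \<otimes>\<^bsub>K\<^esub> k \<in> carrier R" using fraction[OF k(1)] by (elim exE)
    note N = this[rule_format]
    have "h n (frag_of (a \<odot>\<^bsub>S\<^esub> x, k) - frag_of (x, a \<otimes>\<^bsub>K\<^esub> k)) = \<zero>\<^bsub>S\<^esub>" if "n \<ge> N" for n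
    proof -
      have e: "\<pi> [^]\<^bsub>K\<^esub> n \<otimes>\<^bsub>K\<^esub> (a \<otimes>\<^bsub>K\<^esub> k) = (\<pi> [^]\<^bsub>K\<^esub> n \<otimes>\<^bsub>K\<^esub> k) \<otimes>\<^bsub>R\<^esub> a"
        using k \<pi>K by (simp add: R_ops K.m_ac)
      have n': "\<pi> [^]\<^bsub>K\<^esub> n \<otimes>\<^bsub>K\<^esub> (a \<otimes>\<^bsub>K\<^esub> k) \<in> carrier R" unfolding e using N[OF that] smult by simp
      have "h n (frag_of (x, a \<otimes>\<^bsub>K\<^esub> k)) = (\<pi> [^]\<^bsub>K\<^esub> n \<otimes>\<^bsub>K\<^esub> k) \<odot>\<^bsub>S\<^esub> (a \<odot>\<^bsub>S\<^esub> x)"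
        using h(2)[OF smult(2) k(3) n'] smult N[OF that] unfolding e by (simp add: smult_assoc1)
      moreover have "h n (frag_of (a \<odot>\<^bsub>S\<^esub> x, k)) = (\<pi> [^]\<^bsub>K\<^esub> n \<otimes>\<^bsub>K\<^esub> k) \<odot>\<^bsub>S\<^esub> (a \<odot>\<^bsub>S\<^esub> x)"
        by (rule h(2)) (use smult k N[OF that] in simp_all)
      ultimately show ?thesis
        using smult k N[OF that] by (simp add: h_diff M.minus_eq M.r_neg)
    qed
    then show ?case unfolding ring_as_left_module_simps by (intro exI allI impI)
  next
    case (diff c d)
    then obtain N1 N2 :: nat where "\<forall>n\<ge>N1. h n c = \<zero>\<^bsub>S\<^esub>" "\<forall>n\<ge>N2. h n d = \<zero>\<^bsub>S\<^esub>" by blast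
    then have "\<forall>n\<ge>max N1 N2. h n (c - d) = \<zero>\<^bsub>S\<^esub>"
      using TA.F.tensor_kernel_keys[OF diff(1)] TA.F.tensor_kernel_keys[OF diff(2)]
      by (simp add: h_diff M.minus_eq)
    then show ?case by (rule exI)
  qed
  moreover assume x: "x \<in> carrier S" and "\<iota> x = \<zero>\<^bsub>A\<^esub>"
  then have "frag_of (x, \<one>\<^bsub>K\<^esub>) \<in> TA.ker"
    by (simp add: \<iota>_def TA.zero_A TA.F.tensor_class_eq_iff)
  ultimately obtain N where N: "\<forall>n\<ge>N. h n (frag_of (x, \<one>\<^bsub>K\<^esub>)) = \<zero>\<^bsub>S\<^esub>" by blast
  \<comment> \<open>On x tensor 1 the map takes the value \<pi>^N x, and \<open>S\<close> has no
    torsion.\<close>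
  have "\<pi> [^]\<^bsub>K\<^esub> N \<otimes>\<^bsub>K\<^esub> \<one>\<^bsub>K\<^esub> \<in> carrier R" using \<pi>K \<pi>_R by (simp flip: pow_R)
  then have "h N (frag_of (x, \<one>\<^bsub>K\<^esub>)) = (\<pi> [^]\<^bsub>R\<^esub> N) \<odot>\<^bsub>S\<^esub> x"
    using h(2)[OF x, of "\<one>\<^bsub>K\<^esub>" N] \<pi>K by (simp add: pow_R)
  then show "x = \<zero>\<^bsub>S\<^esub>" using N torsion_free_pow[OF x] by auto
qed

end

subsection \<open>Completion of a torsion-free algebra\<close>

lemma (in abelian_group) coset_eq_iff:
  assumes H: "additive_subgroup H G" and "x \<in> carrier G" "y \<in> carrier G"
  shows "H +> x = H +> y \<longleftrightarrow> x \<ominus> y \<in> H"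
proof
  interpret H: abelian_subgroup H G by (rule abelian_subgroupI3[OF H abelian_group_axioms])
  {
    assume "H +> x = H +> y"
    then have "x \<in> H +> y" using H.a_rcos_self[OF assms(2)] by simp
    then obtain h where h: "h \<in> H" "x = h \<oplus> y" by (auto simp: a_r_coset_def')
    then have "x \<ominus> y = h"
      using assms(3) H.a_subset by (auto simp: minus_eq a_assoc r_neg)
    then show "x \<ominus> y \<in> H" using h by simp
  next
    assume "x \<ominus> y \<in> H"
    moreover have "x = (x \<ominus> y) \<oplus> y" using assms by (simp add: minus_eq a_assoc l_neg)
    ultimately have "x \<in> H +> y" by (auto simp: a_r_coset_def')
    then show "H +> x = H +> y"
      by (rule a_repr_independence[OF _ assms(3) additive_subgroup.a_subgroup[OF H], symmetric])
  }
qed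

lemma (in abelian_group) coset_set_add:
  assumes H: "additive_subgroup H G" and x: "x \<in> carrier G" "y \<in> carrier G"
  shows "(H +> x) <+> (H +> y) = H +> (x \<oplus> y)"
proof -
  interpret H: abelian_subgroup H G by (rule abelian_subgroupI3[OF H abelian_group_axioms])
  show ?thesis by (rule H.a_rcos_sum[OF x])
qed

lemma (in abelian_group) mem_coset_iff:
  assumes H: "additive_subgroup H G" and "y \<in> carrier G"
  shows "x \<in> H +> y \<longleftrightarrow> x \<in> carrier G \<and> x \<ominus> y \<in> H"
proof
  have sub: "H \<subseteq> carrier G" by (rule additive_subgroup.a_subset[OF H])
  assume "x \<in> H +> y"
  then obtain h where h: "h \<in> H" "x = h \<oplus> y" by (auto simp: a_r_coset_def')
  then show "x \<in> carrier G \<and> x \<ominus> y \<in> H"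
    using assms(2) sub by (auto simp: minus_eq a_assoc r_neg)
next
  assume *: "x \<in> carrier G \<and> x \<ominus> y \<in> H"
  then have "x = (x \<ominus> y) \<oplus> y" using assms by (simp add: minus_eq a_assoc l_neg)
  then show "x \<in> H +> y" using * by (auto simp: a_r_coset_def')
qed

locale torsion_free_algebra = assoc_algebra R S
  for R :: "('k, 'z) ring_scheme" (structure) and S :: "('k, 'm, 'x) module_scheme" (structure) +
  fixes \<pi> :: 'k
  assumes \<pi>_R [simp]: "\<pi> \<in> carrier R"
    and torsion_free: "\<lbrakk>x \<in> carrier S; \<pi> \<odot>\<^bsub>S\<^esub> x = \<zero>\<^bsub>S\<^esub>\<rbrakk> \<Longrightarrow> x = \<zero>\<^bsub>S\<^esub>"
begin

abbreviation "P \<equiv> power_multiples R \<pi> S"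
abbreviation \<pi>p :: "nat \<Rightarrow> 'k" where "\<pi>p n \<equiv> \<pi> [^]\<^bsub>R\<^esub> n"

lemma P_iff: "x \<in> P n \<longleftrightarrow> (\<exists>y\<in>carrier S. x = \<pi>p n \<odot>\<^bsub>S\<^esub> y)"
  by (auto simp: power_multiples_def)

lemma P_subgroup: "additive_subgroup (P n) S"
proof (rule M.additive_subgroup_diffI)
  show "P n \<subseteq> carrier S" by (auto simp: P_iff)
  show "\<zero>\<^bsub>S\<^esub> \<in> P n" unfolding P_iff by (rule bexI[of _ "\<zero>\<^bsub>S\<^esub>"]) simp_all
  fix x y assume "x \<in> P n" "y \<in> P n"
  then obtain x' y' where *: "x = \<pi>p n \<odot>\<^bsub>S\<^esub> x'" "y = \<pi>p n \<odot>\<^bsub>S\<^esub> y'" "x' \<in> carrier S" "y' \<in> carrier S"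
    by (auto simp: P_iff)
  then have "x \<ominus>\<^bsub>S\<^esub> y = \<pi>p n \<odot>\<^bsub>S\<^esub> (x' \<ominus>\<^bsub>S\<^esub> y')"
    by (simp add: M.minus_eq smult_r_distr smult_minus_right)
  then show "x \<ominus>\<^bsub>S\<^esub> y \<in> P n" using * by (auto simp: P_iff)
qed

lemma P_closed: "x \<in> P n \<Longrightarrow> x \<in> carrier S" by (auto simp: P_iff)

lemma P_ideal: "ideal (P n) S"
proof (rule idealI[OF U.ring_axioms])
  show "subgroup (P n) (add_monoid S)" using P_subgroup by (rule additive_subgroup.a_subgroup)
  fix a x assume "a \<in> P n" and x: "x \<in> carrier S"
  then obtain b where b: "a = \<pi>p n \<odot>\<^bsub>S\<^esub> b" "b \<in> carrier S" by (auto simp: P_iff)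
  show "x \<otimes>\<^bsub>S\<^esub> a \<in> P n" unfolding b P_iff using b x
    by (intro bexI[of _ "x \<otimes>\<^bsub>S\<^esub> b"]) (simp_all add: smult_mult_right)
  show "a \<otimes>\<^bsub>S\<^esub> x \<in> P n" unfolding b P_iff using b x
    by (intro bexI[of _ "b \<otimes>\<^bsub>S\<^esub> x"]) (simp_all add: smult_mult_left)
qed

lemma \<pi>p_add: "x \<in> carrier S \<Longrightarrow> \<pi>p m \<odot>\<^bsub>S\<^esub> (\<pi>p n \<odot>\<^bsub>S\<^esub> x) = \<pi>p (m + n) \<odot>\<^bsub>S\<^esub> x"
  by (simp add: smult_assoc1[symmetric] R.nat_pow_mult)

lemma P_antimono: "m \<le> n \<Longrightarrow> P n \<subseteq> P m"
proof
  fix x assume "m \<le> n" "x \<in> P n"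
  then obtain y where y: "x = \<pi>p n \<odot>\<^bsub>S\<^esub> y" "y \<in> carrier S" by (auto simp: P_iff)
  then have "x = \<pi>p m \<odot>\<^bsub>S\<^esub> (\<pi>p (n - m) \<odot>\<^bsub>S\<^esub> y)" using \<open>m \<le> n\<close> by (simp add: \<pi>p_add)
  then show "x \<in> P m" using y by (auto simp: P_iff)
qed

lemma torsion_free_pow: "\<lbrakk>x \<in> carrier S; \<pi>p n \<odot>\<^bsub>S\<^esub> x = \<zero>\<^bsub>S\<^esub>\<rbrakk> \<Longrightarrow> x = \<zero>\<^bsub>S\<^esub>"
proof (induct n arbitrary: x)
  case (Suc n)
  then have "\<pi>p n \<odot>\<^bsub>S\<^esub> (\<pi> \<odot>\<^bsub>S\<^esub> x) = \<zero>\<^bsub>S\<^esub>" by (simp add: smult_assoc1)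
  then have "\<pi> \<odot>\<^bsub>S\<^esub> x = \<zero>\<^bsub>S\<^esub>" by (rule Suc(1)[rotated]) (use Suc in simp)
  then show ?case by (rule torsion_free[OF Suc(2)])
qed simp

lemma \<pi>p_cancel: "\<lbrakk>x \<in> carrier S; y \<in> carrier S; \<pi>p n \<odot>\<^bsub>S\<^esub> x = \<pi>p n \<odot>\<^bsub>S\<^esub> y\<rbrakk> \<Longrightarrow> x = y"
proof -
  assume *: "x \<in> carrier S" "y \<in> carrier S" "\<pi>p n \<odot>\<^bsub>S\<^esub> x = \<pi>p n \<odot>\<^bsub>S\<^esub> y"
  then have "\<pi>p n \<odot>\<^bsub>S\<^esub> (x \<ominus>\<^bsub>S\<^esub> y) = \<zero>\<^bsub>S\<^esub>"
    by (simp add: M.minus_eq smult_r_distr smult_minus_right M.r_neg)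
  then have "x \<ominus>\<^bsub>S\<^esub> y = \<zero>\<^bsub>S\<^esub>" using * torsion_free_pow[of "x \<ominus>\<^bsub>S\<^esub> y" n] by blast
  then show "x = y" using * by (simp add: U.r_right_minus_eq)
qed

text \<open>Freeness from torsion turns divisibility of \<pi>^n x into divisibility of x itself.
  This is why completing does not create torsion.\<close>

lemma P_cancel: "\<lbrakk>x \<in> carrier S; \<pi>p n \<odot>\<^bsub>S\<^esub> x \<in> P (n + k)\<rbrakk> \<Longrightarrow> x \<in> P k"
proof -
  assume x: "x \<in> carrier S" "\<pi>p n \<odot>\<^bsub>S\<^esub> x \<in> P (n + k)"
  then obtain y where y: "\<pi>p n \<odot>\<^bsub>S\<^esub> x = \<pi>p n \<odot>\<^bsub>S\<^esub> (\<pi>p k \<odot>\<^bsub>S\<^esub> y)" "y \<in> carrier S" by (auto simp: P_iff \<pi>p_add)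
  have "x = \<pi>p k \<odot>\<^bsub>S\<^esub> y" by (rule \<pi>p_cancel[OF x(1) _ y(1)]) (use y(2) in simp)
  then show "x \<in> P k" using y(2) by (auto simp: P_iff)
qed

text \<open>Sequences of representatives for elements of the inverse limit: entry \<open>a\<close>
  matters modulo \<pi>^a only. They replace cosets in all computations with the completion.\<close>

definition coherent :: "(nat \<Rightarrow> 'm) \<Rightarrow> bool" where
  "coherent x \<longleftrightarrow> (\<forall>a. x a \<in> carrier S \<and> x (Suc a) \<ominus>\<^bsub>S\<^esub> x a \<in> P a)"

definition lim :: "(nat \<Rightarrow> 'm) \<Rightarrow> nat \<Rightarrow> 'm set" where
  "lim x = (\<lambda>a. P a +>\<^bsub>S\<^esub> x a)"

abbreviation "Sh \<equiv> completion R \<pi> S"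

lemma coherent_closed: "coherent x \<Longrightarrow> x a \<in> carrier S" by (simp add: coherent_def)

lemma lim_eq_iff: "\<lbrakk>coherent x; coherent y\<rbrakk> \<Longrightarrow> lim x = lim y \<longleftrightarrow> (\<forall>a. x a \<ominus>\<^bsub>S\<^esub> y a \<in> P a)"
  by (simp add: lim_def fun_eq_iff M.coset_eq_iff[OF P_subgroup] coherent_closed)

lemma lim_cong: "(\<And>a. x a = y a) \<Longrightarrow> lim x = lim y" by (simp add: lim_def)

lemma P_set_add: "x \<in> carrier S \<Longrightarrow> P a <+>\<^bsub>S\<^esub> (P (Suc a) +>\<^bsub>S\<^esub> x) = P a +>\<^bsub>S\<^esub> x"
proof (intro equalityI subsetI)
  assume x: "x \<in> carrier S"
  fix z
  {
    assume "z \<in> P a <+>\<^bsub>S\<^esub> (P (Suc a) +>\<^bsub>S\<^esub> x)"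
    then obtain g h where gh: "g \<in> P a" "h \<in> P (Suc a)" "z = g \<oplus>\<^bsub>S\<^esub> (h \<oplus>\<^bsub>S\<^esub> x)"
      by (auto simp: set_add_def' a_r_coset_def')
    then have "z = (g \<oplus>\<^bsub>S\<^esub> h) \<oplus>\<^bsub>S\<^esub> x" using x P_closed by (simp add: M.a_assoc)
    moreover have "g \<oplus>\<^bsub>S\<^esub> h \<in> P a"
      using gh P_antimono[of a "Suc a"] additive_subgroup.a_closed[OF P_subgroup] by auto
    ultimately show "z \<in> P a +>\<^bsub>S\<^esub> x" by (auto simp: a_r_coset_def')
  next
    assume "z \<in> P a +>\<^bsub>S\<^esub> x"
    then obtain g where g: "g \<in> P a" "z = g \<oplus>\<^bsub>S\<^esub> x" by (auto simp: a_r_coset_def')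
    then have "z = g \<oplus>\<^bsub>S\<^esub> (\<zero>\<^bsub>S\<^esub> \<oplus>\<^bsub>S\<^esub> x)" using x by simp
    moreover have "\<zero>\<^bsub>S\<^esub> \<oplus>\<^bsub>S\<^esub> x \<in> P (Suc a) +>\<^bsub>S\<^esub> x"
      unfolding a_r_coset_def' using additive_subgroup.zero_closed[OF P_subgroup] by blast
    ultimately show "z \<in> P a <+>\<^bsub>S\<^esub> (P (Suc a) +>\<^bsub>S\<^esub> x)" using g(1) unfolding set_add_def' by blast
  }
qed

lemma lim_closed: "coherent x \<Longrightarrow> lim x \<in> carrier Sh"
proof -
  assume x: "coherent x"
  have "P a +>\<^bsub>S\<^esub> x a \<in> a_rcosets\<^bsub>S\<^esub> (P a)" for a
    using coherent_closed[OF x] by (auto simp: A_RCOSETS_def' a_r_coset_def')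
  moreover have "P a <+>\<^bsub>S\<^esub> (P (Suc a) +>\<^bsub>S\<^esub> x (Suc a)) = P a +>\<^bsub>S\<^esub> x a" for a
    unfolding P_set_add[OF coherent_closed[OF x]] using x
    by (simp add: M.coset_eq_iff[OF P_subgroup] coherent_def)
  ultimately show ?thesis by (simp add: completion_def lim_def)
qed

lemma carrier_completion_lim:
  assumes "s \<in> carrier Sh"
  obtains x where "coherent x" "s = lim x"
proof -
  have s: "s a \<in> a_rcosets\<^bsub>S\<^esub> (P a)" "P a <+>\<^bsub>S\<^esub> s (Suc a) = s a" for a
    using assms by (auto simp: completion_def)
  have "\<forall>a. \<exists>x. x \<in> carrier S \<and> s a = P a +>\<^bsub>S\<^esub> x"
  proof
    fix a
    have "\<exists>x\<in>carrier S. s a = P a +>\<^bsub>S\<^esub> x" using s(1)[of a] by (auto simp: A_RCOSETS_def' a_r_coset_def')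
    then show "\<exists>x. x \<in> carrier S \<and> s a = P a +>\<^bsub>S\<^esub> x" by blast
  qed
  from choice[OF this] obtain x where x: "\<And>a. x a \<in> carrier S" "\<And>a. s a = P a +>\<^bsub>S\<^esub> x a" by blast
  have "P a +>\<^bsub>S\<^esub> x (Suc a) = P a +>\<^bsub>S\<^esub> x a" for a
    using s(2)[of a] unfolding x(2) P_set_add[OF x(1)] .
  then have "coherent x" using x(1) by (simp add: coherent_def M.coset_eq_iff[OF P_subgroup])
  moreover have "s = lim x" using x(2) by (simp add: lim_def fun_eq_iff)
  ultimately show ?thesis by (rule that)
qed

lemma coherent_const: "x \<in> carrier S \<Longrightarrow> coherent (\<lambda>_. x)"
  using additive_subgroup.zero_closed[OF P_subgroup] by (simp add: coherent_def M.minus_eq M.r_neg)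

lemma coherent_diff_mem:
  assumes "coherent x" "m \<le> n"
  shows "x n \<ominus>\<^bsub>S\<^esub> x m \<in> P m"
  using assms(2)
proof (induct n rule: dec_induct)
  case base
  then show ?case
    using assms(1) additive_subgroup.zero_closed[OF P_subgroup] by (simp add: coherent_def M.minus_eq M.r_neg)
next
  case (step n)
  have c: "x (Suc n) \<in> carrier S" "x n \<in> carrier S" "x m \<in> carrier S" using assms(1) by (simp_all add: coherent_def)
  have "x (Suc n) \<ominus>\<^bsub>S\<^esub> x n \<in> P m"
    using assms(1) P_antimono[OF step(1)] by (auto simp: coherent_def)
  from additive_subgroup.a_closed[OF P_subgroup this step(3)]
  have "(x (Suc n) \<ominus>\<^bsub>S\<^esub> x n) \<oplus>\<^bsub>S\<^esub> (x n \<ominus>\<^bsub>S\<^esub> x m) \<in> P m" .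
  also have "(x (Suc n) \<ominus>\<^bsub>S\<^esub> x n) \<oplus>\<^bsub>S\<^esub> (x n \<ominus>\<^bsub>S\<^esub> x m) = x (Suc n) \<ominus>\<^bsub>S\<^esub> x m"
    using c by (simp add: M.minus_eq M.a_assoc M.r_neg1)
  finally show ?case .
qed

lemma coherent_add:
  assumes "coherent x" "coherent y"
  shows "coherent (\<lambda>a. x a \<oplus>\<^bsub>S\<^esub> y a)"
  unfolding coherent_def
proof (intro allI conjI)
  fix a
  have c: "x a \<in> carrier S" "y a \<in> carrier S" "x (Suc a) \<in> carrier S" "y (Suc a) \<in> carrier S"
    using assms by (simp_all add: coherent_def)
  then show "x a \<oplus>\<^bsub>S\<^esub> y a \<in> carrier S" by simp
  have "(x (Suc a) \<oplus>\<^bsub>S\<^esub> y (Suc a)) \<ominus>\<^bsub>S\<^esub> (x a \<oplus>\<^bsub>S\<^esub> y a) = (x (Suc a) \<ominus>\<^bsub>S\<^esub> x a) \<oplus>\<^bsub>S\<^esub> (y (Suc a) \<ominus>\<^bsub>S\<^esub> y a)"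
    using c by (simp add: M.minus_eq M.minus_add M.a_ac)
  then show "(x (Suc a) \<oplus>\<^bsub>S\<^esub> y (Suc a)) \<ominus>\<^bsub>S\<^esub> (x a \<oplus>\<^bsub>S\<^esub> y a) \<in> P a"
    using assms additive_subgroup.a_closed[OF P_subgroup] by (simp add: coherent_def)
qed

lemma coherent_mult:
  assumes "coherent x" "coherent y"
  shows "coherent (\<lambda>a. x a \<otimes>\<^bsub>S\<^esub> y a)"
  unfolding coherent_def
proof (intro allI conjI)
  fix a
  interpret P: ideal "P a" S by (rule P_ideal)
  have c: "x a \<in> carrier S" "y a \<in> carrier S" "x (Suc a) \<in> carrier S" "y (Suc a) \<in> carrier S"
    using assms by (simp_all add: coherent_def)
  then show "x a \<otimes>\<^bsub>S\<^esub> y a \<in> carrier S" by simp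
  have "x (Suc a) \<otimes>\<^bsub>S\<^esub> y (Suc a) \<ominus>\<^bsub>S\<^esub> x a \<otimes>\<^bsub>S\<^esub> y a
      = (x (Suc a) \<ominus>\<^bsub>S\<^esub> x a) \<otimes>\<^bsub>S\<^esub> y (Suc a) \<oplus>\<^bsub>S\<^esub> x a \<otimes>\<^bsub>S\<^esub> (y (Suc a) \<ominus>\<^bsub>S\<^esub> y a)"
    using c by (simp add: M.minus_eq U.l_distr U.r_distr U.l_minus U.r_minus M.a_assoc M.r_neg1 M.r_neg2)
  moreover have "(x (Suc a) \<ominus>\<^bsub>S\<^esub> x a) \<otimes>\<^bsub>S\<^esub> y (Suc a) \<in> P a" "x a \<otimes>\<^bsub>S\<^esub> (y (Suc a) \<ominus>\<^bsub>S\<^esub> y a) \<in> P a"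
    using assms c by (simp_all add: coherent_def P.I_l_closed P.I_r_closed)
  ultimately show "x (Suc a) \<otimes>\<^bsub>S\<^esub> y (Suc a) \<ominus>\<^bsub>S\<^esub> x a \<otimes>\<^bsub>S\<^esub> y a \<in> P a"
    using additive_subgroup.a_closed[OF P_subgroup] by simp
qed

lemma coherent_smult:
  assumes "coherent x" "r \<in> carrier R"
  shows "coherent (\<lambda>a. r \<odot>\<^bsub>S\<^esub> x a)"
proof -
  have "coherent (\<lambda>a. (r \<odot>\<^bsub>S\<^esub> \<one>\<^bsub>S\<^esub>) \<otimes>\<^bsub>S\<^esub> x a)"
    by (rule coherent_mult[OF coherent_const assms(1)]) (use assms(2) in simp)
  then show ?thesis using assms by (simp add: smult_mult_left coherent_closed)
qed

lemma lim_add: "\<lbrakk>coherent x; coherent y\<rbrakk> \<Longrightarrow> lim x \<oplus>\<^bsub>Sh\<^esub> lim y = lim (\<lambda>a. x a \<oplus>\<^bsub>S\<^esub> y a)"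
  by (simp add: completion_def lim_def M.coset_set_add[OF P_subgroup] coherent_closed)

lemma lim_mult: "\<lbrakk>coherent x; coherent y\<rbrakk> \<Longrightarrow> lim x \<otimes>\<^bsub>Sh\<^esub> lim y = lim (\<lambda>a. x a \<otimes>\<^bsub>S\<^esub> y a)"
  by (simp add: completion_def lim_def ideal.rcoset_mult_add[OF P_ideal] coherent_closed)

lemma lim_smult:
  assumes "coherent x" "r \<in> carrier R"
  shows "r \<odot>\<^bsub>Sh\<^esub> lim x = lim (\<lambda>a. r \<odot>\<^bsub>S\<^esub> x a)"
proof -
  have "(\<Union>z\<in>P a +>\<^bsub>S\<^esub> x a. P a +>\<^bsub>S\<^esub> (r \<odot>\<^bsub>S\<^esub> z)) = P a +>\<^bsub>S\<^esub> (r \<odot>\<^bsub>S\<^esub> x a)" for a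
  proof -
    have xc: "x a \<in> carrier S" using assms coherent_closed by blast
    have "P a +>\<^bsub>S\<^esub> (r \<odot>\<^bsub>S\<^esub> z) = P a +>\<^bsub>S\<^esub> (r \<odot>\<^bsub>S\<^esub> x a)" if "z \<in> P a +>\<^bsub>S\<^esub> x a" for z
    proof -
      have z: "z \<in> carrier S" "z \<ominus>\<^bsub>S\<^esub> x a \<in> P a"
        using that by (simp_all add: M.mem_coset_iff[OF P_subgroup xc])
      then obtain y where y: "z \<ominus>\<^bsub>S\<^esub> x a = \<pi>p a \<odot>\<^bsub>S\<^esub> y" "y \<in> carrier S" by (auto simp: P_iff)
      have "r \<odot>\<^bsub>S\<^esub> z \<ominus>\<^bsub>S\<^esub> r \<odot>\<^bsub>S\<^esub> x a = r \<odot>\<^bsub>S\<^esub> (z \<ominus>\<^bsub>S\<^esub> x a)"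
        using z xc assms(2) by (simp add: M.minus_eq smult_r_distr smult_minus_right)
      also have "\<dots> = \<pi>p a \<odot>\<^bsub>S\<^esub> (r \<odot>\<^bsub>S\<^esub> y)"
        unfolding y(1) using y(2) assms(2) by (simp add: smult_assoc1[symmetric] R.m_comm)
      finally have "r \<odot>\<^bsub>S\<^esub> z \<ominus>\<^bsub>S\<^esub> r \<odot>\<^bsub>S\<^esub> x a \<in> P a" using y(2) assms(2) by (auto simp: P_iff)
      then show ?thesis using z xc assms(2) by (simp add: M.coset_eq_iff[OF P_subgroup])
    qed
    moreover have "x a \<in> P a +>\<^bsub>S\<^esub> x a"
      using xc additive_subgroup.zero_closed[OF P_subgroup]
      by (simp add: M.mem_coset_iff[OF P_subgroup] M.minus_eq M.r_neg)
    ultimately show ?thesis by blast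
  qed
  then show ?thesis by (simp add: completion_def lim_def)
qed

lemma lim_zero: "\<zero>\<^bsub>Sh\<^esub> = lim (\<lambda>_. \<zero>\<^bsub>S\<^esub>)"
  using P_closed by (simp add: completion_def lim_def fun_eq_iff M.a_coset_add_zero subset_iff)

lemma lim_one: "\<one>\<^bsub>Sh\<^esub> = lim (\<lambda>_. \<one>\<^bsub>S\<^esub>)"
  by (simp add: completion_def lim_def)

lemma coherent_minus: "coherent x \<Longrightarrow> coherent (\<lambda>a. \<ominus>\<^bsub>S\<^esub> x a)"
  using coherent_smult[of x "\<ominus>\<^bsub>R\<^esub> \<one>\<^bsub>R\<^esub>"] by (simp add: smult_minus_left coherent_closed)

lemma ring_completion: "ring Sh"
proof (rule ringI)
  show "abelian_group Sh"
  proof (rule abelian_groupI)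
    fix x y assume "x \<in> carrier Sh" "y \<in> carrier Sh"
    then obtain a b where a: "coherent a" "x = lim a" "coherent b" "y = lim b"
      by (elim carrier_completion_lim)
    show "x \<oplus>\<^bsub>Sh\<^esub> y \<in> carrier Sh"
      unfolding a(2,4) lim_add[OF a(1,3)] by (rule lim_closed[OF coherent_add[OF a(1,3)]])
    show "x \<oplus>\<^bsub>Sh\<^esub> y = y \<oplus>\<^bsub>Sh\<^esub> x"
      unfolding a(2,4) lim_add[OF a(1,3)] lim_add[OF a(3,1)]
      by (rule lim_cong) (simp add: M.a_comm coherent_closed a)
  next
    fix x y z assume "x \<in> carrier Sh" "y \<in> carrier Sh" "z \<in> carrier Sh"
    then obtain a b c where a: "coherent a" "x = lim a" "coherent b" "y = lim b" "coherent c" "z = lim c"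
      by (elim carrier_completion_lim)
    show "x \<oplus>\<^bsub>Sh\<^esub> y \<oplus>\<^bsub>Sh\<^esub> z = x \<oplus>\<^bsub>Sh\<^esub> (y \<oplus>\<^bsub>Sh\<^esub> z)"
      unfolding a(2,4,6) lim_add[OF a(1,3)] lim_add[OF a(3,5)]
        lim_add[OF coherent_add[OF a(1,3)] a(5)] lim_add[OF a(1) coherent_add[OF a(3,5)]]
      by (rule lim_cong) (simp add: M.a_assoc coherent_closed a)
  next
    show "\<zero>\<^bsub>Sh\<^esub> \<in> carrier Sh" unfolding lim_zero by (rule lim_closed[OF coherent_const]) simp
  next
    fix x assume "x \<in> carrier Sh"
    then obtain a where a: "coherent a" "x = lim a" by (rule carrier_completion_lim)
    show "\<zero>\<^bsub>Sh\<^esub> \<oplus>\<^bsub>Sh\<^esub> x = x"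
      unfolding a(2) lim_zero lim_add[OF coherent_const[OF M.zero_closed] a(1)]
      by (rule lim_cong) (simp add: coherent_closed a)
    show "\<exists>y\<in>carrier Sh. y \<oplus>\<^bsub>Sh\<^esub> x = \<zero>\<^bsub>Sh\<^esub>"
    proof (rule bexI)
      show "lim (\<lambda>n. \<ominus>\<^bsub>S\<^esub> a n) \<in> carrier Sh" by (rule lim_closed[OF coherent_minus[OF a(1)]])
      show "lim (\<lambda>n. \<ominus>\<^bsub>S\<^esub> a n) \<oplus>\<^bsub>Sh\<^esub> x = \<zero>\<^bsub>Sh\<^esub>"
        unfolding a(2) lim_zero lim_add[OF coherent_minus[OF a(1)] a(1)]
        by (rule lim_cong) (simp add: M.l_neg coherent_closed a)
    qed
  qed
  show "monoid Sh"
  proof (rule monoidI)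
    fix x y assume "x \<in> carrier Sh" "y \<in> carrier Sh"
    then obtain a b where a: "coherent a" "x = lim a" "coherent b" "y = lim b"
      by (elim carrier_completion_lim)
    show "x \<otimes>\<^bsub>Sh\<^esub> y \<in> carrier Sh"
      unfolding a(2,4) lim_mult[OF a(1,3)] by (rule lim_closed[OF coherent_mult[OF a(1,3)]])
  next
    show "\<one>\<^bsub>Sh\<^esub> \<in> carrier Sh" unfolding lim_one by (rule lim_closed[OF coherent_const]) simp
  next
    fix x y z assume "x \<in> carrier Sh" "y \<in> carrier Sh" "z \<in> carrier Sh"
    then obtain a b c where a: "coherent a" "x = lim a" "coherent b" "y = lim b" "coherent c" "z = lim c"
      by (elim carrier_completion_lim)
    show "x \<otimes>\<^bsub>Sh\<^esub> y \<otimes>\<^bsub>Sh\<^esub> z = x \<otimes>\<^bsub>Sh\<^esub> (y \<otimes>\<^bsub>Sh\<^esub> z)"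
      unfolding a(2,4,6) lim_mult[OF a(1,3)] lim_mult[OF a(3,5)]
        lim_mult[OF coherent_mult[OF a(1,3)] a(5)] lim_mult[OF a(1) coherent_mult[OF a(3,5)]]
      by (rule lim_cong) (simp add: U.m_assoc coherent_closed a)
  next
    fix x assume "x \<in> carrier Sh"
    then obtain a where a: "coherent a" "x = lim a" by (rule carrier_completion_lim)
    show "\<one>\<^bsub>Sh\<^esub> \<otimes>\<^bsub>Sh\<^esub> x = x" "x \<otimes>\<^bsub>Sh\<^esub> \<one>\<^bsub>Sh\<^esub> = x"
      unfolding a(2) lim_one lim_mult[OF coherent_const[OF U.one_closed] a(1)]
        lim_mult[OF a(1) coherent_const[OF U.one_closed]]
      by (rule lim_cong, simp add: coherent_closed a)+
  qed
  fix x y z assume "x \<in> carrier Sh" "y \<in> carrier Sh" "z \<in> carrier Sh"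
  then obtain a b c where a: "coherent a" "x = lim a" "coherent b" "y = lim b" "coherent c" "z = lim c"
    by (elim carrier_completion_lim)
  note m = coherent_mult[OF a(1,5)] coherent_mult[OF a(3,5)] coherent_mult[OF a(5,1)] coherent_mult[OF a(5,3)]
  show "(x \<oplus>\<^bsub>Sh\<^esub> y) \<otimes>\<^bsub>Sh\<^esub> z = x \<otimes>\<^bsub>Sh\<^esub> z \<oplus>\<^bsub>Sh\<^esub> y \<otimes>\<^bsub>Sh\<^esub> z"
    unfolding a(2,4,6) lim_add[OF a(1,3)] lim_mult[OF coherent_add[OF a(1,3)] a(5)]
      lim_mult[OF a(1,5)] lim_mult[OF a(3,5)] lim_add[OF m(1,2)]
    by (rule lim_cong) (simp add: U.l_distr coherent_closed a)
  show "z \<otimes>\<^bsub>Sh\<^esub> (x \<oplus>\<^bsub>Sh\<^esub> y) = z \<otimes>\<^bsub>Sh\<^esub> x \<oplus>\<^bsub>Sh\<^esub> z \<otimes>\<^bsub>Sh\<^esub> y"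
    unfolding a(2,4,6) lim_add[OF a(1,3)] lim_mult[OF a(5) coherent_add[OF a(1,3)]]
      lim_mult[OF a(5,1)] lim_mult[OF a(5,3)] lim_add[OF m(3,4)]
    by (rule lim_cong) (simp add: U.r_distr coherent_closed a)
qed

sublocale Sh: ring Sh by (rule ring_completion)

lemma completion_algebra: "assoc_algebra R Sh"
proof -
  have "left_module R Sh"
  proof (intro left_module.intro R.ring_axioms Sh.is_abelian_group left_module_axioms.intro)
    fix r q x y assume r: "r \<in> carrier R" and q: "q \<in> carrier R" and "x \<in> carrier Sh" "y \<in> carrier Sh"
    then obtain a b where a: "coherent a" "x = lim a" "coherent b" "y = lim b" by (elim carrier_completion_lim)
    note c = coherent_smult[OF a(1) r] coherent_smult[OF a(1) q] coherent_smult[OF a(3) r]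
    have rq: "r \<oplus>\<^bsub>R\<^esub> q \<in> carrier R" "r \<otimes>\<^bsub>R\<^esub> q \<in> carrier R" using r q by simp_all
    show "(r \<oplus>\<^bsub>R\<^esub> q) \<odot>\<^bsub>Sh\<^esub> x = r \<odot>\<^bsub>Sh\<^esub> x \<oplus>\<^bsub>Sh\<^esub> q \<odot>\<^bsub>Sh\<^esub> x"
      unfolding a(2) lim_smult[OF a(1) r] lim_smult[OF a(1) q] lim_smult[OF a(1) rq(1)] lim_add[OF c(1,2)]
      by (rule lim_cong) (simp add: smult_l_distr coherent_closed a r q)
    show "(r \<otimes>\<^bsub>R\<^esub> q) \<odot>\<^bsub>Sh\<^esub> x = r \<odot>\<^bsub>Sh\<^esub> (q \<odot>\<^bsub>Sh\<^esub> x)"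
      unfolding a(2) lim_smult[OF a(1) q] lim_smult[OF c(2) r] lim_smult[OF a(1) rq(2)]
      by (rule lim_cong) (simp add: smult_assoc1 coherent_closed a r q)
    show "r \<odot>\<^bsub>Sh\<^esub> (x \<oplus>\<^bsub>Sh\<^esub> y) = r \<odot>\<^bsub>Sh\<^esub> x \<oplus>\<^bsub>Sh\<^esub> r \<odot>\<^bsub>Sh\<^esub> y"
      unfolding a(2,4) lim_smult[OF a(1) r] lim_smult[OF a(3) r] lim_add[OF a(1,3)] lim_add[OF c(1,3)]
        lim_smult[OF coherent_add[OF a(1,3)] r]
      by (rule lim_cong) (simp add: smult_r_distr coherent_closed a r)
  next
    fix r x assume r: "r \<in> carrier R" and "x \<in> carrier Sh"
    then obtain a where a: "coherent a" "x = lim a" by (elim carrier_completion_lim)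
    show "r \<odot>\<^bsub>Sh\<^esub> x \<in> carrier Sh"
      unfolding a(2) lim_smult[OF a(1) r] by (rule lim_closed[OF coherent_smult[OF a(1) r]])
  next
    fix x assume "x \<in> carrier Sh"
    then obtain a where a: "coherent a" "x = lim a" by (elim carrier_completion_lim)
    show "\<one>\<^bsub>R\<^esub> \<odot>\<^bsub>Sh\<^esub> x = x"
      unfolding a(2) lim_smult[OF a(1) R.one_closed] by (rule lim_cong) (simp add: coherent_closed a)
  qed
  then show ?thesis
  proof (intro assoc_algebra.intro R.is_cring Sh.ring_axioms assoc_algebra_axioms.intro)
    fix r x y assume r: "r \<in> carrier R" and "x \<in> carrier Sh" "y \<in> carrier Sh"
    then obtain a b where a: "coherent a" "x = lim a" "coherent b" "y = lim b" by (elim carrier_completion_lim)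
    note m = coherent_mult[OF a(1,3)]
    show "(r \<odot>\<^bsub>Sh\<^esub> x) \<otimes>\<^bsub>Sh\<^esub> y = r \<odot>\<^bsub>Sh\<^esub> (x \<otimes>\<^bsub>Sh\<^esub> y)"
      unfolding a(2,4) lim_smult[OF a(1) r] lim_mult[OF a(1,3)] lim_smult[OF m r] lim_mult[OF coherent_smult[OF a(1) r] a(3)]
      by (rule lim_cong) (simp add: smult_mult_left coherent_closed a r)
    show "x \<otimes>\<^bsub>Sh\<^esub> (r \<odot>\<^bsub>Sh\<^esub> y) = r \<odot>\<^bsub>Sh\<^esub> (x \<otimes>\<^bsub>Sh\<^esub> y)"
      unfolding a(2,4) lim_smult[OF a(3) r] lim_mult[OF a(1,3)] lim_smult[OF m r] lim_mult[OF a(1) coherent_smult[OF a(3) r]]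
      by (rule lim_cong) (simp add: smult_mult_right coherent_closed a r)
  qed
qed

sublocale Sh: assoc_algebra R Sh by (rule completion_algebra)

lemma lim_diff:
  assumes "coherent x" "coherent y"
  shows "lim x \<ominus>\<^bsub>Sh\<^esub> lim y = lim (\<lambda>a. x a \<ominus>\<^bsub>S\<^esub> y a)" "coherent (\<lambda>a. x a \<ominus>\<^bsub>S\<^esub> y a)"
proof -
  have "\<ominus>\<^bsub>Sh\<^esub> lim y = lim (\<lambda>a. \<ominus>\<^bsub>S\<^esub> y a)"
    using Sh.smult_minus_left[OF R.one_closed lim_closed[OF assms(2)]] lim_smult[OF assms(2), of "\<ominus>\<^bsub>R\<^esub> \<one>\<^bsub>R\<^esub>"]
      lim_closed[OF assms(2)]
    by (simp add: smult_minus_left coherent_closed[OF assms(2)])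
  then show "lim x \<ominus>\<^bsub>Sh\<^esub> lim y = lim (\<lambda>a. x a \<ominus>\<^bsub>S\<^esub> y a)"
    by (simp add: Sh.minus_eq lim_add[OF assms(1) coherent_minus[OF assms(2)]] M.minus_eq)
  show "coherent (\<lambda>a. x a \<ominus>\<^bsub>S\<^esub> y a)"
    using coherent_add[OF assms(1) coherent_minus[OF assms(2)]] by (simp add: M.minus_eq)
qed

definition emb :: "'m \<Rightarrow> nat \<Rightarrow> 'm set" where "emb x = lim (\<lambda>_. x)"

lemma emb_closed: "x \<in> carrier S \<Longrightarrow> emb x \<in> carrier Sh"
  unfolding emb_def by (rule lim_closed[OF coherent_const])

lemma emb_ring_hom: "emb \<in> ring_hom S Sh"
  by (rule ring_hom_memI)
     (simp_all add: emb_closed, simp_all add: emb_def lim_mult lim_add coherent_const lim_one)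

lemma emb_smult: "\<lbrakk>x \<in> carrier S; r \<in> carrier R\<rbrakk> \<Longrightarrow> emb (r \<odot>\<^bsub>S\<^esub> x) = r \<odot>\<^bsub>Sh\<^esub> emb x"
  by (simp add: emb_def lim_smult coherent_const)

text \<open>The component of index \<open>n\<close> decides divisibility by \<pi>^n. The quotient is
  read off the shifted sequence x(a + n), since dividing by \<pi>^n costs \<open>n\<close> steps of
  precision.\<close>

lemma lim_divisible:
  assumes "coherent x"
  shows "(\<exists>y\<in>carrier Sh. lim x = \<pi>p n \<odot>\<^bsub>Sh\<^esub> y) \<longleftrightarrow> x n \<in> P n"
proof
  assume "\<exists>y\<in>carrier Sh. lim x = \<pi>p n \<odot>\<^bsub>Sh\<^esub> y"
  then obtain y where y: "y \<in> carrier Sh" "lim x = \<pi>p n \<odot>\<^bsub>Sh\<^esub> y" ..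
  then obtain b where b: "coherent b" "y = lim b" by (elim carrier_completion_lim)
  have pc: "\<pi>p n \<in> carrier R" by simp
  have "lim x = lim (\<lambda>a. \<pi>p n \<odot>\<^bsub>S\<^esub> b a)" using y b lim_smult[OF b(1) pc] by simp
  then have 1: "x n \<ominus>\<^bsub>S\<^esub> \<pi>p n \<odot>\<^bsub>S\<^esub> b n \<in> P n"
    using lim_eq_iff[OF assms coherent_smult[OF b(1) pc]] by simp
  have 2: "\<pi>p n \<odot>\<^bsub>S\<^esub> b n \<in> P n" using coherent_closed[OF b(1)] by (auto simp: P_iff)
  from additive_subgroup.a_closed[OF P_subgroup 1 2] show "x n \<in> P n"
    using coherent_closed[OF b(1), of n] coherent_closed[OF assms, of n] by (simp add: M.minus_eq M.a_assoc M.l_neg)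
next
  assume xn: "x n \<in> P n"
  have xc: "x a \<in> carrier S" for a using coherent_closed[OF assms] .
  have "\<exists>y. y \<in> carrier S \<and> x (a + n) = \<pi>p n \<odot>\<^bsub>S\<^esub> y" for a
  proof -
    have "(x (a + n) \<ominus>\<^bsub>S\<^esub> x n) \<oplus>\<^bsub>S\<^esub> x n \<in> P n"
      by (rule additive_subgroup.a_closed[OF P_subgroup coherent_diff_mem[OF assms] xn]) simp
    then have "x (a + n) \<in> P n" using xc by (simp add: M.minus_eq M.a_assoc M.l_neg)
    then show ?thesis by (auto simp: P_iff)
  qed
  then have "\<forall>a. \<exists>y. y \<in> carrier S \<and> x (a + n) = \<pi>p n \<odot>\<^bsub>S\<^esub> y" ..
  from choice[OF this] obtain y where y0: "\<forall>a. y a \<in> carrier S \<and> x (a + n) = \<pi>p n \<odot>\<^bsub>S\<^esub> y a" by (elim exE)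
  have y: "y a \<in> carrier S" "x (a + n) = \<pi>p n \<odot>\<^bsub>S\<^esub> y a" for a using y0 by simp_all
  have cy: "coherent y"
    unfolding coherent_def
  proof (intro allI conjI y(1))
    fix a
    have "\<pi>p n \<odot>\<^bsub>S\<^esub> (y (Suc a) \<ominus>\<^bsub>S\<^esub> y a) = x (Suc (a + n)) \<ominus>\<^bsub>S\<^esub> x (a + n)"
      using y(1) y(2)[of "Suc a"] y(2)[of a] by (simp add: M.minus_eq smult_r_distr smult_minus_right)
    moreover have "x (Suc (a + n)) \<ominus>\<^bsub>S\<^esub> x (a + n) \<in> P (n + a)"
      using assms by (simp add: coherent_def add.commute)
    ultimately have e: "\<pi>p n \<odot>\<^bsub>S\<^esub> (y (Suc a) \<ominus>\<^bsub>S\<^esub> y a) \<in> P (n + a)" by simp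
    show "y (Suc a) \<ominus>\<^bsub>S\<^esub> y a \<in> P a" by (rule P_cancel[OF _ e]) (simp add: y(1))
  qed
  have pc: "\<pi>p n \<in> carrier R" by simp
  have "lim x = lim (\<lambda>a. \<pi>p n \<odot>\<^bsub>S\<^esub> y a)"
    unfolding lim_eq_iff[OF assms coherent_smult[OF cy pc]]
  proof
    fix a
    have "\<ominus>\<^bsub>S\<^esub> (x (a + n) \<ominus>\<^bsub>S\<^esub> x a) \<in> P a"
      by (rule additive_subgroup.a_inv_closed[OF P_subgroup coherent_diff_mem[OF assms]]) simp
    also have "\<ominus>\<^bsub>S\<^esub> (x (a + n) \<ominus>\<^bsub>S\<^esub> x a) = x a \<ominus>\<^bsub>S\<^esub> x (a + n)"
      using xc by (simp add: M.minus_eq M.minus_add M.a_comm)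
    finally show "x a \<ominus>\<^bsub>S\<^esub> \<pi>p n \<odot>\<^bsub>S\<^esub> y a \<in> P a" by (simp add: y(2))
  qed
  then show "\<exists>y\<in>carrier Sh. lim x = \<pi>p n \<odot>\<^bsub>Sh\<^esub> y"
    using lim_smult[OF cy pc] by (intro bexI[OF _ lim_closed[OF cy]]) simp
qed

lemma emb_divisible: "x \<in> carrier S \<Longrightarrow> (\<exists>y\<in>carrier Sh. emb x = \<pi>p n \<odot>\<^bsub>Sh\<^esub> y) \<longleftrightarrow> x \<in> P n"
  unfolding emb_def by (rule lim_divisible[OF coherent_const])

text \<open>Dividing by \<pi> costs one step of precision, so component \<open>a\<close> of the
  sequence is controlled through component \<open>a + 1\<close>.\<close>

lemma completion_torsion_free:
  assumes "s \<in> carrier Sh" "\<pi> \<odot>\<^bsub>Sh\<^esub> s = \<zero>\<^bsub>Sh\<^esub>"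
  shows "s = \<zero>\<^bsub>Sh\<^esub>"
proof -
  obtain x where x: "coherent x" "s = lim x" using assms(1) by (rule carrier_completion_lim)
  have z: "coherent (\<lambda>_. \<zero>\<^bsub>S\<^esub>)" by (rule coherent_const) simp
  have xc: "x a \<in> carrier S" for a using coherent_closed[OF x(1)] .
  have "lim (\<lambda>a. \<pi> \<odot>\<^bsub>S\<^esub> x a) = lim (\<lambda>_. \<zero>\<^bsub>S\<^esub>)"
    using assms(2) lim_smult[OF x(1) \<pi>_R] by (simp add: x(2) lim_zero)
  then have \<pi>x: "\<pi> \<odot>\<^bsub>S\<^esub> x a \<in> P a" for a
    using lim_eq_iff[OF coherent_smult[OF x(1) \<pi>_R] z] xc by (simp add: M.minus_eq)
  have "x a \<ominus>\<^bsub>S\<^esub> \<zero>\<^bsub>S\<^esub> \<in> P a" for a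
  proof -
    have e: "\<pi>p 1 \<odot>\<^bsub>S\<^esub> x (Suc a) \<in> P (1 + a)" using \<pi>x[of "Suc a"] by simp
    have "x (Suc a) \<in> P a" by (rule P_cancel[OF xc e])
    moreover have "x (Suc a) \<ominus>\<^bsub>S\<^esub> x a \<in> P a" using x(1) by (simp add: coherent_def)
    ultimately have "x (Suc a) \<ominus>\<^bsub>S\<^esub> (x (Suc a) \<ominus>\<^bsub>S\<^esub> x a) \<in> P a"
      by (rule M.additive_subgroup_diff[OF P_subgroup])
    then show ?thesis using xc by (simp add: M.minus_eq M.minus_add M.r_neg1 M.r_neg2)
  qed
  then show ?thesis unfolding x(2) lim_zero lim_eq_iff[OF x(1) z] by blast
qed

text \<open>Component 1 of a representing sequence serves as approximant: the difference vanishes at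
  index 1 and is divisible by \<pi> by \<open>lim_divisible\<close>.\<close>

lemma completion_dense: "s \<in> carrier Sh \<Longrightarrow> \<exists>x\<in>carrier S. \<exists>y\<in>carrier Sh. s = emb x \<oplus>\<^bsub>Sh\<^esub> \<pi> \<odot>\<^bsub>Sh\<^esub> y"
proof -
  assume "s \<in> carrier Sh"
  then obtain x where x: "coherent x" "s = lim x" by (rule carrier_completion_lim)
  have xc: "x 1 \<in> carrier S" using coherent_closed[OF x(1)] .
  note cc = coherent_const[OF xc]
  have "x 1 \<ominus>\<^bsub>S\<^esub> x 1 \<in> P 1" using xc additive_subgroup.zero_closed[OF P_subgroup] by (simp add: M.minus_eq M.r_neg)
  then obtain y where y: "y \<in> carrier Sh" "lim x \<ominus>\<^bsub>Sh\<^esub> emb (x 1) = \<pi>p 1 \<odot>\<^bsub>Sh\<^esub> y"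
    using lim_divisible[OF lim_diff(2)[OF x(1) cc], of 1] lim_diff(1)[OF x(1) cc] by (auto simp: emb_def)
  have "lim x = emb (x 1) \<oplus>\<^bsub>Sh\<^esub> (lim x \<ominus>\<^bsub>Sh\<^esub> emb (x 1))"
    using lim_closed[OF x(1)] emb_closed[OF xc] by (simp add: Sh.minus_eq Sh.a_lcomm Sh.r_neg)
  then show ?thesis unfolding x(2) using xc y by (intro bexI[of _ "x 1"] bexI[of _ y]) simp_all
qed

lemma completion_pow: "x \<in> carrier Sh \<Longrightarrow> (\<pi> \<odot>\<^bsub>Sh\<^esub> \<one>\<^bsub>Sh\<^esub>) [^]\<^bsub>Sh\<^esub> (n::nat) \<otimes>\<^bsub>Sh\<^esub> x = \<pi>p n \<odot>\<^bsub>Sh\<^esub> x"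
proof (induct n)
  case (Suc n)
  have "(\<pi> \<odot>\<^bsub>Sh\<^esub> \<one>\<^bsub>Sh\<^esub>) [^]\<^bsub>Sh\<^esub> Suc n \<otimes>\<^bsub>Sh\<^esub> x = (\<pi> \<odot>\<^bsub>Sh\<^esub> \<one>\<^bsub>Sh\<^esub>) \<otimes>\<^bsub>Sh\<^esub> ((\<pi> \<odot>\<^bsub>Sh\<^esub> \<one>\<^bsub>Sh\<^esub>) [^]\<^bsub>Sh\<^esub> n \<otimes>\<^bsub>Sh\<^esub> x)"
    unfolding Sh.nat_pow_Suc2[OF Sh.smult_closed[OF \<pi>_R Sh.one_closed]]
    by (rule Sh.m_assoc) (use Suc in simp_all)
  also have "\<dots> = \<pi>p (Suc n) \<odot>\<^bsub>Sh\<^esub> x"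
    using Suc by (simp add: Sh.smult_mult_left Sh.smult_assoc1[symmetric] R.m_comm)
  finally show ?case .
qed simp

text \<open>The inverse limit is treated as an adic subring of itself. By
  \<open>lim_divisible\<close> the abstract neighbourhoods become conditions on single components,
  so completeness reduces to a diagonal argument.\<close>

lemma completion_adic: "adic_subring Sh (\<pi> \<odot>\<^bsub>Sh\<^esub> \<one>\<^bsub>Sh\<^esub>) (carrier Sh)"
proof (intro adic_subring.intro Sh.ring_axioms adic_subring_axioms.intro)
  let ?p = "\<pi> \<odot>\<^bsub>Sh\<^esub> \<one>\<^bsub>Sh\<^esub>"
  have im: "z \<in> (\<lambda>d. ?p [^]\<^bsub>Sh\<^esub> (n::nat) \<otimes>\<^bsub>Sh\<^esub> d) ` carrier Sh \<longleftrightarrow> (\<exists>y\<in>carrier Sh. z = \<pi>p n \<odot>\<^bsub>Sh\<^esub> y)" for z n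
    by (auto simp: completion_pow image_iff)
  show "?p \<in> carrier Sh" "?p \<in> carrier Sh" "\<one>\<^bsub>Sh\<^esub> \<in> carrier Sh" by simp_all
  show "x \<otimes>\<^bsub>Sh\<^esub> ?p = ?p \<otimes>\<^bsub>Sh\<^esub> x" if "x \<in> carrier Sh" for x
    using that by (simp add: Sh.smult_mult_left Sh.smult_mult_right)
  show "x = \<zero>\<^bsub>Sh\<^esub>" if "x \<in> carrier Sh" "?p \<otimes>\<^bsub>Sh\<^esub> x = \<zero>\<^bsub>Sh\<^esub>" for x
    using that completion_torsion_free by (simp add: Sh.smult_mult_left)
  show "additive_subgroup (carrier Sh) Sh"
    by (rule Sh.additive_subgroup_diffI) auto
  show "x \<otimes>\<^bsub>Sh\<^esub> y \<in> carrier Sh" if "x \<in> carrier Sh" "y \<in> carrier Sh" for x y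
    using that by simp
  show "\<exists>l\<in>carrier Sh. \<forall>n. s n \<ominus>\<^bsub>Sh\<^esub> l \<in> (\<lambda>d. ?p [^]\<^bsub>Sh\<^esub> n \<otimes>\<^bsub>Sh\<^esub> d) ` carrier Sh"
    if s: "\<And>n::nat. s n \<in> carrier Sh"
      and incr: "\<And>n. s (Suc n) \<ominus>\<^bsub>Sh\<^esub> s n \<in> (\<lambda>d. ?p [^]\<^bsub>Sh\<^esub> n \<otimes>\<^bsub>Sh\<^esub> d) ` carrier Sh" for s
  proof -
    have "\<forall>n. \<exists>x. coherent x \<and> s n = lim x" using carrier_completion_lim[OF s] by metis
    from choice[OF this] obtain x where x0: "\<forall>n. coherent (x n) \<and> s n = lim (x n)" by (elim exE)
    have x: "coherent (x n)" "s n = lim (x n)" for n using x0 by simp_all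
    have xc: "x n a \<in> carrier S" for n a using coherent_closed[OF x(1)] .
    have d: "x (Suc n) n \<ominus>\<^bsub>S\<^esub> x n n \<in> P n" for n
      using incr[of n] lim_divisible[OF lim_diff(2)[OF x(1)[of "Suc n"] x(1)[of n]], of n]
      unfolding im x(2) lim_diff(1)[OF x(1) x(1)] by blast
    \<comment> \<open>The diagonal is coherent because the \<open>a\<close>-th increment of the
      sequence vanishes modulo \<pi>^a in component \<open>a\<close>.\<close>
    define l where "l a = x a a" for a
    have l: "coherent l"
      unfolding coherent_def l_def
    proof (intro allI conjI xc)
      fix a
      have "x (Suc a) (Suc a) \<ominus>\<^bsub>S\<^esub> x (Suc a) a \<in> P a" using x(1)[of "Suc a"] by (simp add: coherent_def)
      from additive_subgroup.a_closed[OF P_subgroup this d[of a]]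
      show "x (Suc a) (Suc a) \<ominus>\<^bsub>S\<^esub> x a a \<in> P a"
        using xc by (simp add: M.minus_eq M.a_assoc M.r_neg1)
    qed
    have "x n n \<ominus>\<^bsub>S\<^esub> l n \<in> P n" for n
      using xc additive_subgroup.zero_closed[OF P_subgroup] by (simp add: l_def M.minus_eq M.r_neg)
    then show ?thesis
      using lim_divisible[OF lim_diff(2)[OF x(1) l]]
      by (intro bexI[OF _ lim_closed[OF l]]) (simp add: im x(2) lim_diff(1)[OF x(1) l])
  qed
  show "x = \<zero>\<^bsub>Sh\<^esub>" if *: "\<And>n::nat. x \<in> (\<lambda>d. ?p [^]\<^bsub>Sh\<^esub> n \<otimes>\<^bsub>Sh\<^esub> d) ` carrier Sh" for x
  proof -
    have div: "\<exists>y\<in>carrier Sh. x = \<pi>p n \<odot>\<^bsub>Sh\<^esub> y" for n using *[of n] by (simp only: im)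
    have "x \<in> carrier Sh" using div[of 0] by auto
    then obtain a where a: "coherent a" "x = lim a" by (rule carrier_completion_lim)
    have z: "coherent (\<lambda>_. \<zero>\<^bsub>S\<^esub>)" by (rule coherent_const) simp
    have "a n \<in> P n" for n using div[of n] lim_divisible[OF a(1), of n] a(2) by simp
    then show ?thesis
      unfolding a(2) lim_zero lim_eq_iff[OF a(1) z] using coherent_closed[OF a(1)] by (simp add: M.minus_eq)
  qed
qed

end

section \<open>Functoriality of the completion\<close>

lemma completion_map_lim:
  assumes "torsion_free_algebra R S \<pi>" "torsion_free_algebra R S' \<pi>"
    and f: "f \<in> linear_maps R S S'" and x: "torsion_free_algebra.coherent R S \<pi> x"
  shows "torsion_free_algebra.coherent R S' \<pi> (\<lambda>a. f (x a))"
    and "completion_map R \<pi> S' f (torsion_free_algebra.lim R S \<pi> x) = torsion_free_algebra.lim R S' \<pi> (\<lambda>a. f (x a))"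
proof -
  interpret S: torsion_free_algebra R S \<pi> by fact
  interpret T: torsion_free_algebra R S' \<pi> by fact
  have fc: "f x \<in> carrier S'" if "x \<in> carrier S" for x
    using f that by (auto simp: linear_maps_def hom_def)
  have fa: "f (x \<oplus>\<^bsub>S\<^esub> y) = f x \<oplus>\<^bsub>S'\<^esub> f y" if "x \<in> carrier S" "y \<in> carrier S" for x y
    using f that by (auto simp: linear_maps_def hom_def)
  have fs: "f (a \<odot>\<^bsub>S\<^esub> x) = a \<odot>\<^bsub>S'\<^esub> f x" if "a \<in> carrier R" "x \<in> carrier S" for a x
    using f that by (auto simp: linear_maps_def)
  have fP: "f z \<ominus>\<^bsub>S'\<^esub> f y \<in> T.P a" if *: "z \<ominus>\<^bsub>S\<^esub> y \<in> S.P a" "z \<in> carrier S" "y \<in> carrier S" for z y a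
  proof -
    obtain w where w: "z \<ominus>\<^bsub>S\<^esub> y = S.\<pi>p a \<odot>\<^bsub>S\<^esub> w" "w \<in> carrier S" using *(1) by (auto simp: S.P_iff)
    have "z = S.\<pi>p a \<odot>\<^bsub>S\<^esub> w \<oplus>\<^bsub>S\<^esub> y"
      unfolding w(1)[symmetric] using * by (simp add: S.M.minus_eq S.M.a_assoc S.M.l_neg)
    then have "f z = S.\<pi>p a \<odot>\<^bsub>S'\<^esub> f w \<oplus>\<^bsub>S'\<^esub> f y" using w(2) * by (simp add: fa fs)
    then have "f z \<ominus>\<^bsub>S'\<^esub> f y = S.\<pi>p a \<odot>\<^bsub>S'\<^esub> f w"
      using fc[OF w(2)] fc[OF *(3)] by (simp add: T.M.minus_eq T.M.a_assoc T.M.r_neg)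
    then show ?thesis using fc[OF w(2)] by (auto simp: T.P_iff)
  qed
  have xc: "x a \<in> carrier S" for a using S.coherent_closed[OF x] .
  show c: "T.coherent (\<lambda>a. f (x a))"
    using x fP xc fc unfolding T.coherent_def S.coherent_def by blast
  have "(\<Union>z\<in>S.P a +>\<^bsub>S\<^esub> x a. T.P a +>\<^bsub>S'\<^esub> f z) = T.P a +>\<^bsub>S'\<^esub> f (x a)" for a
  proof -
    have "T.P a +>\<^bsub>S'\<^esub> f z = T.P a +>\<^bsub>S'\<^esub> f (x a)" if "z \<in> S.P a +>\<^bsub>S\<^esub> x a" for z
    proof -
      have "z \<in> carrier S" "z \<ominus>\<^bsub>S\<^esub> x a \<in> S.P a"
        using that by (simp_all add: S.M.mem_coset_iff[OF S.P_subgroup xc])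
      then show ?thesis using fP[of z "x a" a] fc xc by (simp add: T.M.coset_eq_iff[OF T.P_subgroup])
    qed
    moreover have "x a \<in> S.P a +>\<^bsub>S\<^esub> x a"
      using xc additive_subgroup.zero_closed[OF S.P_subgroup]
      by (simp add: S.M.mem_coset_iff[OF S.P_subgroup] S.M.minus_eq S.M.r_neg)
    ultimately show ?thesis by blast
  qed
  then show "completion_map R \<pi> S' f (S.lim x) = T.lim (\<lambda>a. f (x a))"
    by (simp add: completion_map_def S.lim_def T.lim_def)
qed

lemma completion_map_hom:
  assumes "torsion_free_algebra R S \<pi>" "torsion_free_algebra R S' \<pi>"
    and f: "f \<in> linear_maps R S S'" "f \<in> ring_hom S S'"
  shows "completion_map R \<pi> S' f \<in> ring_hom (completion R \<pi> S) (completion R \<pi> S')"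
    and "completion_map R \<pi> S' f \<in> linear_maps R (completion R \<pi> S) (completion R \<pi> S')"
    and "x \<in> carrier S \<Longrightarrow> completion_map R \<pi> S' f (torsion_free_algebra.emb R S \<pi> x)
      = torsion_free_algebra.emb R S' \<pi> (f x)"
proof -
  interpret S: torsion_free_algebra R S \<pi> by fact
  interpret T: torsion_free_algebra R S' \<pi> by fact
  note map = completion_map_lim[OF assms(1-3)]
  let ?f = "completion_map R \<pi> S' f"
  have fa: "f (x \<oplus>\<^bsub>S\<^esub> y) = f x \<oplus>\<^bsub>S'\<^esub> f y" if "x \<in> carrier S" "y \<in> carrier S" for x y
    using f that by (auto simp: linear_maps_def hom_def)
  have fs: "f (a \<odot>\<^bsub>S\<^esub> x) = a \<odot>\<^bsub>S'\<^esub> f x" if "a \<in> carrier R" "x \<in> carrier S" for a x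
    using f that by (auto simp: linear_maps_def)
  have closed: "?f s \<in> carrier T.Sh" if s: "s \<in> carrier S.Sh" for s
    using s by (rule S.carrier_completion_lim) (simp add: map(2) T.lim_closed[OF map(1)])
  have add: "?f (s \<oplus>\<^bsub>S.Sh\<^esub> t) = ?f s \<oplus>\<^bsub>T.Sh\<^esub> ?f t" if st: "s \<in> carrier S.Sh" "t \<in> carrier S.Sh" for s t
  proof -
    from st obtain x y where x: "S.coherent x" "s = S.lim x" "S.coherent y" "t = S.lim y"
      by (elim S.carrier_completion_lim)
    show ?thesis
      unfolding x(2,4) S.lim_add[OF x(1,3)] map(2)[OF S.coherent_add[OF x(1,3)]] map(2)[OF x(1)] map(2)[OF x(3)]
        T.lim_add[OF map(1)[OF x(1)] map(1)[OF x(3)]]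
      by (rule T.lim_cong) (simp add: fa S.coherent_closed x)
  qed
  show "?f \<in> ring_hom S.Sh T.Sh"
  proof (rule ring_hom_memI)
    fix s t assume st: "s \<in> carrier S.Sh" "t \<in> carrier S.Sh"
    from st obtain x y where x: "S.coherent x" "s = S.lim x" "S.coherent y" "t = S.lim y"
      by (elim S.carrier_completion_lim)
    show "?f (s \<otimes>\<^bsub>S.Sh\<^esub> t) = ?f s \<otimes>\<^bsub>T.Sh\<^esub> ?f t"
      unfolding x(2,4) S.lim_mult[OF x(1,3)] map(2)[OF S.coherent_mult[OF x(1,3)]] map(2)[OF x(1)] map(2)[OF x(3)]
        T.lim_mult[OF map(1)[OF x(1)] map(1)[OF x(3)]]
      by (rule T.lim_cong) (simp add: ring_hom_mult[OF f(2)] S.coherent_closed x)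
  next
    show "?f \<one>\<^bsub>S.Sh\<^esub> = \<one>\<^bsub>T.Sh\<^esub>"
      unfolding S.lim_one T.lim_one map(2)[OF S.coherent_const[OF S.U.one_closed]]
      by (simp add: ring_hom_one[OF f(2)])
  qed (simp_all add: closed add)
  show "?f \<in> linear_maps R S.Sh T.Sh"
    unfolding linear_maps_def mem_Collect_eq
  proof (intro conjI ballI homI)
    fix r s assume r: "r \<in> carrier R" and "s \<in> carrier S.Sh"
    from this(2) obtain x where x: "S.coherent x" "s = S.lim x" by (rule S.carrier_completion_lim)
    show "?f (r \<odot>\<^bsub>S.Sh\<^esub> s) = r \<odot>\<^bsub>T.Sh\<^esub> ?f s"
      unfolding x(2) S.lim_smult[OF x(1) r] map(2)[OF S.coherent_smult[OF x(1) r]] map(2)[OF x(1)]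
        T.lim_smult[OF map(1)[OF x(1)] r]
      by (rule T.lim_cong) (simp add: fs S.coherent_closed x r)
  qed (simp_all add: closed add)
  assume x: "x \<in> carrier S"
  show "?f (S.emb x) = T.emb (f x)"
    unfolding S.emb_def T.emb_def by (rule map(2)[OF S.coherent_const[OF x]])
qed

subsection \<open>The associated graded ring\<close>

lemma additive_span_opposite: "additive_span (opposite_ring R) S = additive_span R S"
proof (intro equalityI subsetI)
  show "x \<in> additive_span R S" if "x \<in> additive_span (opposite_ring R) S" for x
    using that by induct (auto intro: additive_span.intros)
  show "x \<in> additive_span (opposite_ring R) S" if "x \<in> additive_span R S" for x
    using that
  proof induct
    case zero
    show ?case using additive_span.zero[of "opposite_ring R"] by simp
  next
    case (gen x)
    then show ?case by (rule additive_span.gen)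
  next
    case (diff x y)
    then show ?case using additive_span.diff[of x "opposite_ring R" S y] by simp
  qed
qed

context positively_filtered_algebra
begin

abbreviation "Fb \<equiv> filt_below U F"
abbreviation "coset n x \<equiv> Fb n +>\<^bsub>U\<^esub> x"
abbreviation "G \<equiv> gr U F"

lemma F_subgroup: "additive_subgroup (F n) U"
  using submodule.axioms(1)[OF filt_submodule] by (simp add: additive_subgroup_def)

lemma F_closed: "x \<in> F n \<Longrightarrow> x \<in> carrier U"
  using additive_subgroup.a_subset[OF F_subgroup] by blast

lemma F_smult: "\<lbrakk>r \<in> carrier R; x \<in> F n\<rbrakk> \<Longrightarrow> r \<odot>\<^bsub>U\<^esub> x \<in> F n"
  using submodule.smult_closed[OF filt_submodule] .

lemma zero_F: "\<zero>\<^bsub>U\<^esub> \<in> F n" by (rule additive_subgroup.zero_closed[OF F_subgroup])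

lemma Fb_subgroup: "additive_subgroup (Fb n) U"
proof (cases "n = 0")
  case True
  have "additive_subgroup {\<zero>\<^bsub>U\<^esub>} U" by (rule M.additive_subgroup_diffI) (auto simp: M.minus_eq)
  then show ?thesis using True by (simp add: filt_below_def)
qed (simp add: filt_below_def F_subgroup)

lemma zero_Fb: "\<zero>\<^bsub>U\<^esub> \<in> Fb n" by (rule additive_subgroup.zero_closed[OF Fb_subgroup])

lemma Fb_F: "Fb n \<subseteq> F n"
  using zero_F filt_mono[of "n - 1"] by (auto simp: filt_below_def)

lemma Fb_closed: "x \<in> Fb n \<Longrightarrow> x \<in> carrier U" using Fb_F F_closed by blast

lemma Fb_mult_right: "\<lbrakk>x \<in> Fb n; y \<in> F m\<rbrakk> \<Longrightarrow> x \<otimes>\<^bsub>U\<^esub> y \<in> Fb (n + m)"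
proof (cases "n = 0")
  case True
  assume "x \<in> Fb n" "y \<in> F m"
  then show ?thesis using True F_closed zero_Fb by (simp add: filt_below_def[of U F 0])
next
  case False
  assume "x \<in> Fb n" "y \<in> F m"
  then show ?thesis using False filt_mult[of x "n - 1" y m] by (simp add: filt_below_def)
qed

lemma Fb_mult_left: "\<lbrakk>x \<in> Fb n; y \<in> F m\<rbrakk> \<Longrightarrow> y \<otimes>\<^bsub>U\<^esub> x \<in> Fb (m + n)"
proof (cases "n = 0")
  case True
  assume "x \<in> Fb n" "y \<in> F m"
  then show ?thesis using True F_closed zero_Fb by (simp add: filt_below_def[of U F 0])
next
  case False
  assume "x \<in> Fb n" "y \<in> F m"
  then show ?thesis using False filt_mult[of y m x "n - 1"] by (simp add: filt_below_def)
qed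

lemma coset_eq_iff: "\<lbrakk>x \<in> carrier U; y \<in> carrier U\<rbrakk> \<Longrightarrow> coset n x = coset n y \<longleftrightarrow> x \<ominus>\<^bsub>U\<^esub> y \<in> Fb n"
  by (rule M.coset_eq_iff[OF Fb_subgroup])

lemma coset_add: "\<lbrakk>x \<in> carrier U; y \<in> carrier U\<rbrakk> \<Longrightarrow> coset n x <+>\<^bsub>U\<^esub> coset n y = coset n (x \<oplus>\<^bsub>U\<^esub> y)"
  by (rule M.coset_set_add[OF Fb_subgroup])

lemma coset_zero: "coset n \<zero>\<^bsub>U\<^esub> = Fb n"
  using M.a_coset_add_zero[of "Fb n"] additive_subgroup.a_subset[OF Fb_subgroup] by blast

lemma coset_self: "x \<in> carrier U \<Longrightarrow> x \<in> coset n x"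
  using zero_Fb by (simp add: M.mem_coset_iff[OF Fb_subgroup] M.minus_eq M.r_neg)

lemma coset_subset:
  assumes "additive_subgroup L U" "Fb n \<subseteq> L" "x \<in> carrier U"
  shows "coset n x \<subseteq> L \<longleftrightarrow> x \<in> L"
proof
  assume "x \<in> L"
  then show "coset n x \<subseteq> L"
    using assms additive_subgroup.a_closed[OF assms(1)] by (auto simp: a_r_coset_def')
qed (use coset_self[OF assms(3)] in blast)

lemma carrier_gr_piece: "carrier (gr_piece U F n) = coset n ` F n"
  by (auto simp: gr_piece_def A_FactGroup_def' A_RCOSETS_def' a_r_coset_def')

lemma mult_gr_piece: "x \<otimes>\<^bsub>gr_piece U F n\<^esub> y = x <+>\<^bsub>U\<^esub> y"
  by (simp add: gr_piece_def A_FactGroup_def' set_add_def')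

lemma one_gr_piece: "\<one>\<^bsub>gr_piece U F n\<^esub> = Fb n"
  by (simp add: gr_piece_def A_FactGroup_def')

text \<open>The product of \<open>gr\<close> is a \<open>finprod\<close> in these pieces, so each
  must be known to be a commutative monoid.\<close>

lemma comm_monoid_gr_piece: "comm_monoid (gr_piece U F n)"
proof (rule comm_monoidI)
  fix x y z
  assume "x \<in> carrier (gr_piece U F n)" "y \<in> carrier (gr_piece U F n)" "z \<in> carrier (gr_piece U F n)"
  then obtain a b c where a: "x = coset n a" "a \<in> F n" "y = coset n b" "b \<in> F n" "z = coset n c" "c \<in> F n"
    by (auto simp: carrier_gr_piece)
  then have cc: "a \<in> carrier U" "b \<in> carrier U" "c \<in> carrier U" using F_closed by auto
  show "x \<otimes>\<^bsub>gr_piece U F n\<^esub> y \<otimes>\<^bsub>gr_piece U F n\<^esub> z = x \<otimes>\<^bsub>gr_piece U F n\<^esub> (y \<otimes>\<^bsub>gr_piece U F n\<^esub> z)"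
    using cc by (simp add: mult_gr_piece a coset_add M.a_assoc)
next
  fix x y
  assume "x \<in> carrier (gr_piece U F n)" "y \<in> carrier (gr_piece U F n)"
  then obtain a b where a: "x = coset n a" "a \<in> F n" "y = coset n b" "b \<in> F n"
    by (auto simp: carrier_gr_piece)
  then have cc: "a \<in> carrier U" "b \<in> carrier U" using F_closed by auto
  show "x \<otimes>\<^bsub>gr_piece U F n\<^esub> y \<in> carrier (gr_piece U F n)"
    unfolding carrier_gr_piece using cc additive_subgroup.a_closed[OF F_subgroup a(2,4)]
    by (simp add: mult_gr_piece a coset_add)
  show "x \<otimes>\<^bsub>gr_piece U F n\<^esub> y = y \<otimes>\<^bsub>gr_piece U F n\<^esub> x"
    using cc by (simp add: mult_gr_piece a coset_add M.a_comm)
next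
  show "\<one>\<^bsub>gr_piece U F n\<^esub> \<in> carrier (gr_piece U F n)"
    using imageI[OF zero_F[of n], of "coset n"] unfolding one_gr_piece carrier_gr_piece coset_zero .
next
  fix x
  assume "x \<in> carrier (gr_piece U F n)"
  then obtain a where a: "x = coset n a" "a \<in> F n" by (auto simp: carrier_gr_piece)
  have "\<one>\<^bsub>gr_piece U F n\<^esub> \<otimes>\<^bsub>gr_piece U F n\<^esub> x = coset n \<zero>\<^bsub>U\<^esub> <+>\<^bsub>U\<^esub> coset n a"
    by (simp add: mult_gr_piece one_gr_piece coset_zero a)
  also have "\<dots> = x" using F_closed[OF a(2)] by (simp add: coset_add a)
  finally show "\<one>\<^bsub>gr_piece U F n\<^esub> \<otimes>\<^bsub>gr_piece U F n\<^esub> x = x" .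
qed

lemma coset_mult:
  assumes "x \<in> F i" "y \<in> F j"
  shows "rcoset_mult U (Fb (i + j)) (coset i x) (coset j y) = coset (i + j) (x \<otimes>\<^bsub>U\<^esub> y)"
proof -
  have c: "x \<in> carrier U" "y \<in> carrier U" using assms F_closed by auto
  have "coset (i + j) (a \<otimes>\<^bsub>U\<^esub> b) = coset (i + j) (x \<otimes>\<^bsub>U\<^esub> y)" if ab: "a \<in> coset i x" "b \<in> coset j y" for a b
  proof -
    obtain g h where g: "g \<in> Fb i" "a = g \<oplus>\<^bsub>U\<^esub> x" and h: "h \<in> Fb j" "b = h \<oplus>\<^bsub>U\<^esub> y"
      using ab by (auto simp: a_r_coset_def')
    have gc: "g \<in> carrier U" "h \<in> carrier U" "b \<in> carrier U" using g h c Fb_closed by auto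
    have bF: "b \<in> F j" unfolding h(2) using h(1) Fb_F additive_subgroup.a_closed[OF F_subgroup] assms(2) by blast
    have "a \<otimes>\<^bsub>U\<^esub> b \<ominus>\<^bsub>U\<^esub> x \<otimes>\<^bsub>U\<^esub> y = (g \<otimes>\<^bsub>U\<^esub> b \<oplus>\<^bsub>U\<^esub> x \<otimes>\<^bsub>U\<^esub> h) \<oplus>\<^bsub>U\<^esub> (x \<otimes>\<^bsub>U\<^esub> y \<ominus>\<^bsub>U\<^esub> x \<otimes>\<^bsub>U\<^esub> y)"
      unfolding g(2) using c gc by (simp add: M.minus_eq U.l_distr M.a_assoc) (simp add: h(2) gc c U.r_distr M.a_assoc)
    also have "\<dots> = g \<otimes>\<^bsub>U\<^esub> b \<oplus>\<^bsub>U\<^esub> x \<otimes>\<^bsub>U\<^esub> h" using c gc by (simp add: M.minus_eq M.r_neg)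
    also have "\<dots> \<in> Fb (i + j)"
      by (rule additive_subgroup.a_closed[OF Fb_subgroup Fb_mult_right[OF g(1) bF] Fb_mult_left[OF h(1) assms(1)]])
    finally show ?thesis using c gc g(2) by (simp add: coset_eq_iff)
  qed
  then have "rcoset_mult U (Fb (i + j)) (coset i x) (coset j y)
      = (\<Union>a\<in>coset i x. \<Union>b\<in>coset j y. coset (i + j) (x \<otimes>\<^bsub>U\<^esub> y))"
    by (simp add: rcoset_mult_def)
  also have "\<dots> = coset (i + j) (x \<otimes>\<^bsub>U\<^esub> y)"
    using coset_self[OF c(1)] coset_self[OF c(2)] by blast
  finally show ?thesis .
qed

lemma coset_smult:
  assumes "x \<in> F n" "r \<in> carrier R"
  shows "(\<Union>z\<in>coset n x. coset n (r \<odot>\<^bsub>U\<^esub> z)) = coset n (r \<odot>\<^bsub>U\<^esub> x)"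
proof -
  have c: "x \<in> carrier U" using assms F_closed by auto
  have "coset n (r \<odot>\<^bsub>U\<^esub> z) = coset n (r \<odot>\<^bsub>U\<^esub> x)" if z: "z \<in> coset n x" for z
  proof -
    obtain g where g: "g \<in> Fb n" "z = g \<oplus>\<^bsub>U\<^esub> x" using z by (auto simp: a_r_coset_def')
    have gc: "g \<in> carrier U" using g Fb_closed by auto
    have "r \<odot>\<^bsub>U\<^esub> z \<ominus>\<^bsub>U\<^esub> r \<odot>\<^bsub>U\<^esub> x = r \<odot>\<^bsub>U\<^esub> g"
      using c gc assms(2) by (simp add: g smult_r_distr M.minus_eq M.a_assoc M.r_neg)
    moreover have "r \<odot>\<^bsub>U\<^esub> g \<in> Fb n"
      using g(1) F_smult[OF assms(2)] assms(2) by (auto simp: filt_below_def split: if_splits)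
    ultimately show ?thesis using c gc g(2) assms(2) by (simp add: coset_eq_iff)
  qed
  then show ?thesis using coset_self[OF c] by blast
qed

lemma carrier_gr: "f \<in> carrier G \<longleftrightarrow> (\<forall>i. f i \<in> coset i ` F i) \<and> finite {i. f i \<noteq> Fb i}"
  by (simp add: gr_def carrier_gr_piece)

lemma gr_component:
  assumes "f \<in> carrier G"
  obtains x where "x \<in> F i" "f i = coset i x"
  using assms unfolding carrier_gr by blast

lemma gr_mult_component: "(f \<otimes>\<^bsub>G\<^esub> g) n =
    finprod (gr_piece U F n) (\<lambda>i. rcoset_mult U (Fb n) (f i) (g (n - i))) {..n}"
  by (simp add: gr_def)

lemma gr_add_component: "(f \<oplus>\<^bsub>G\<^esub> g) n = f n <+>\<^bsub>U\<^esub> g n"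
  by (simp add: gr_def)

lemma gr_zero: "\<zero>\<^bsub>G\<^esub> = Fb"
  by (simp add: gr_def)

section \<open>Homogeneous elements and graded ideals\<close>

definition homogeneous :: "nat \<Rightarrow> 'b \<Rightarrow> nat \<Rightarrow> 'b set" where
  "homogeneous n x = (\<lambda>i. if i = n then coset n x else Fb i)"

lemma homogeneous_closed: "x \<in> F n \<Longrightarrow> homogeneous n x \<in> carrier G"
  unfolding carrier_gr
proof
  assume "x \<in> F n"
  then show "\<forall>i. homogeneous n x i \<in> coset i ` F i"
    using zero_F by (auto simp: homogeneous_def image_iff coset_zero intro: bexI[of _ "\<zero>\<^bsub>U\<^esub>"])
  show "finite {i. homogeneous n x i \<noteq> Fb i}"
    by (rule finite_subset[of _ "{n}"]) (auto simp: homogeneous_def)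
qed

text \<open>In the convolution every summand other than \<open>i = n\<close> has the zero coset as
  its first factor.\<close>

lemma homogeneous_mult:
  assumes "x \<in> F n" "y \<in> F m"
  shows "(homogeneous n x \<otimes>\<^bsub>G\<^esub> homogeneous m y) (n + m) = coset (n + m) (x \<otimes>\<^bsub>U\<^esub> y)"
proof -
  interpret P: comm_monoid "gr_piece U F (n + m)" by (rule comm_monoid_gr_piece)
  have "rcoset_mult U (Fb (n + m)) (homogeneous n x i) (homogeneous m y (n + m - i))
      = (if n = i then coset (n + m) (x \<otimes>\<^bsub>U\<^esub> y) else \<one>\<^bsub>gr_piece U F (n + m)\<^esub>)" if i: "i \<le> n + m" for i
  proof (cases "i = n")
    case True
    then show ?thesis using coset_mult[OF assms] by (simp add: homogeneous_def)
  next
    case False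
    then have "homogeneous n x i = coset i \<zero>\<^bsub>U\<^esub>" by (simp add: homogeneous_def coset_zero)
    moreover obtain y' where y': "y' \<in> F (n + m - i)" "homogeneous m y (n + m - i) = coset (n + m - i) y'"
      using gr_component[OF homogeneous_closed[OF assms(2)]] .
    ultimately show ?thesis
      using coset_mult[OF zero_F y'(1), of i] i False F_closed[OF y'(1)] by (simp add: one_gr_piece coset_zero)
  qed
  moreover have xy: "coset (n + m) (x \<otimes>\<^bsub>U\<^esub> y) \<in> carrier (gr_piece U F (n + m))"
    unfolding carrier_gr_piece by (rule imageI[OF filt_mult[OF assms]])
  ultimately have "(homogeneous n x \<otimes>\<^bsub>G\<^esub> homogeneous m y) (n + m)
      = finprod (gr_piece U F (n + m)) (\<lambda>i. if n = i then coset (n + m) (x \<otimes>\<^bsub>U\<^esub> y) else \<one>\<^bsub>gr_piece U F (n + m)\<^esub>) {..n + m}"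
    unfolding gr_mult_component by (intro P.finprod_cong') auto
  also have "\<dots> = coset (n + m) (x \<otimes>\<^bsub>U\<^esub> y)"
    by (rule P.finprod_singleton) (use xy in auto)
  finally show ?thesis .
qed

text \<open>It is applied to families with \<open>Fb n\<close> inside \<open>L n\<close>; there a
  coset is contained in \<open>L n\<close> as soon as its representative is, by
  \<open>coset_subset\<close>, so nothing is lost between families in \<open>U\<close> and ideals of
  \<open>gr\<close>.\<close>

definition graded_ideal :: "(nat \<Rightarrow> 'b set) \<Rightarrow> (nat \<Rightarrow> 'b set) set" where
  "graded_ideal L = {f \<in> carrier G. \<forall>n. f n \<subseteq> L n}"

context
  assumes cring_gr: "cring G"
begin

interpretation G: cring G by (rule cring_gr)

text \<open>Commutativity of the graded ring, seen in \<open>U\<close>: exchanging two factors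
  changes a product by a term of lower degree.\<close>

lemma commutator_lower:
  assumes "x \<in> F n" "y \<in> F m"
  shows "x \<otimes>\<^bsub>U\<^esub> y \<ominus>\<^bsub>U\<^esub> y \<otimes>\<^bsub>U\<^esub> x \<in> Fb (n + m)"
proof -
  have "coset (n + m) (x \<otimes>\<^bsub>U\<^esub> y) = coset (n + m) (y \<otimes>\<^bsub>U\<^esub> x)"
    using homogeneous_mult[OF assms] homogeneous_mult[OF assms(2,1)]
      G.m_comm[OF homogeneous_closed[OF assms(1)] homogeneous_closed[OF assms(2)]]
    by (simp add: add.commute)
  then show ?thesis using assms F_closed by (simp add: coset_eq_iff)
qed

text \<open>Stability under right multiplication is checked summand by summand in the convolution;
  stability on the left then follows because the graded ring is commutative.\<close>

lemma graded_ideal_ideal: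
  assumes sub: "\<And>n. additive_subgroup (L n) U" and le: "\<And>n. L n \<subseteq> F n" and lo: "\<And>n. Fb n \<subseteq> L n"
    and mult: "\<And>n m x y. \<lbrakk>x \<in> L n; y \<in> F m\<rbrakk> \<Longrightarrow> x \<otimes>\<^bsub>U\<^esub> y \<in> L (n + m)"
  shows "ideal (graded_ideal L) G"
proof -
  have comp: "coset n x \<subseteq> L n \<longleftrightarrow> x \<in> L n" if "x \<in> F n" for n x
    by (rule coset_subset[OF sub lo F_closed[OF that]])
  have right: "f \<otimes>\<^bsub>G\<^esub> g \<in> graded_ideal L" if f: "f \<in> graded_ideal L" and g: "g \<in> carrier G" for f g
  proof -
    have fG: "f \<in> carrier G" using f by (simp add: graded_ideal_def)
    have "(f \<otimes>\<^bsub>G\<^esub> g) n \<subseteq> L n" for n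
    proof -
      interpret P: comm_monoid "gr_piece U F n" by (rule comm_monoid_gr_piece)
      have fac: "rcoset_mult U (Fb n) (f i) (g (n - i)) \<in> {c \<in> carrier (gr_piece U F n). c \<subseteq> L n}" if i: "i \<le> n" for i
      proof -
        obtain x where x: "x \<in> F i" "f i = coset i x" using gr_component[OF fG] .
        obtain y where y: "y \<in> F (n - i)" "g (n - i) = coset (n - i) y" using gr_component[OF g] .
        have xL: "x \<in> L i" using f x comp[OF x(1)] by (auto simp: graded_ideal_def)
        have "rcoset_mult U (Fb n) (f i) (g (n - i)) = coset n (x \<otimes>\<^bsub>U\<^esub> y)"
          using coset_mult[OF x(1) y(1)] i x y by simp
        moreover have "x \<otimes>\<^bsub>U\<^esub> y \<in> L n" "x \<otimes>\<^bsub>U\<^esub> y \<in> F n"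
          using mult[OF xL y(1)] filt_mult[OF x(1) y(1)] i by simp_all
        ultimately show ?thesis using comp by (simp add: carrier_gr_piece)
      qed
      have "finprod (gr_piece U F n) (\<lambda>i. rcoset_mult U (Fb n) (f i) (g (n - i))) I
          \<in> {c \<in> carrier (gr_piece U F n). c \<subseteq> L n}" if "I \<subseteq> {..n}" for I
        using finite_subset[OF that finite_atMost] that
      proof (induct I rule: finite_induct)
        case empty
        then show ?case using lo by (simp add: one_gr_piece[symmetric])
      next
        case (insert i I)
        let ?c = "rcoset_mult U (Fb n) (f i) (g (n - i))"
        let ?r = "finprod (gr_piece U F n) (\<lambda>i. rcoset_mult U (Fb n) (f i) (g (n - i))) I"
        have c: "?c \<in> carrier (gr_piece U F n)" "?c \<subseteq> L n" using fac[of i] insert by auto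
        have r: "?r \<in> carrier (gr_piece U F n)" "?r \<subseteq> L n" using insert by auto
        have "finprod (gr_piece U F n) (\<lambda>i. rcoset_mult U (Fb n) (f i) (g (n - i))) (insert i I)
            = ?c \<otimes>\<^bsub>gr_piece U F n\<^esub> ?r"
          by (rule P.finprod_insert) (use insert fac in auto)
        moreover have "?c <+>\<^bsub>U\<^esub> ?r \<subseteq> L n"
          unfolding set_add_def'
          using additive_subgroup.a_closed[OF sub subsetD[OF c(2)] subsetD[OF r(2)]] by blast
        ultimately show ?case using P.m_closed[OF c(1) r(1)] by (simp add: mult_gr_piece)
      qed
      from this[OF order_refl] show ?thesis by (simp add: gr_mult_component)
    qed
    then show ?thesis using fG g by (simp add: graded_ideal_def)
  qed
  show ?thesis
  proof (rule idealI[OF G.ring_axioms])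
    show "subgroup (graded_ideal L) (add_monoid G)"
    proof (rule G.add.subgroupI)
      show "graded_ideal L \<subseteq> carrier G" by (auto simp: graded_ideal_def)
      have "\<zero>\<^bsub>G\<^esub> \<in> graded_ideal L" unfolding graded_ideal_def using lo G.zero_closed by (simp add: gr_zero)
      then show "graded_ideal L \<noteq> {}" by blast
    next
      fix f assume f: "f \<in> graded_ideal L"
      then have fG: "f \<in> carrier G" by (simp add: graded_ideal_def)
      have nG: "\<ominus>\<^bsub>G\<^esub> f \<in> carrier G" using fG by simp
      \<comment> \<open>The additive inverse in \<open>gr\<close> is accessible only through f +
        (-f) = 0, so its representative is compared with one of \<open>f\<close>.\<close>
      have "(\<ominus>\<^bsub>G\<^esub> f) n \<subseteq> L n" for n
      proof -
        obtain x where x: "x \<in> F n" "f n = coset n x" using gr_component[OF fG] .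
        obtain y where y: "y \<in> F n" "(\<ominus>\<^bsub>G\<^esub> f) n = coset n y" using gr_component[OF nG] .
        have c: "x \<in> carrier U" "y \<in> carrier U" using x y F_closed by auto
        have "(f \<oplus>\<^bsub>G\<^esub> \<ominus>\<^bsub>G\<^esub> f) n = coset n \<zero>\<^bsub>U\<^esub>" using fG by (simp add: G.r_neg gr_zero coset_zero)
        then have "coset n (x \<oplus>\<^bsub>U\<^esub> y) = coset n \<zero>\<^bsub>U\<^esub>" using c by (simp add: gr_add_component x y coset_add)
        then have "x \<oplus>\<^bsub>U\<^esub> y \<in> Fb n" using c by (simp add: coset_eq_iff M.minus_eq)
        then have "x \<oplus>\<^bsub>U\<^esub> y \<in> L n" using lo by blast
        moreover have "x \<in> L n" using f x comp[OF x(1)] by (auto simp: graded_ideal_def)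
        ultimately have "(x \<oplus>\<^bsub>U\<^esub> y) \<ominus>\<^bsub>U\<^esub> x \<in> L n" by (rule M.additive_subgroup_diff[OF sub])
        moreover have "(x \<oplus>\<^bsub>U\<^esub> y) \<ominus>\<^bsub>U\<^esub> x = y \<oplus>\<^bsub>U\<^esub> (x \<ominus>\<^bsub>U\<^esub> x)" using c by (simp add: M.minus_eq M.a_ac)
        ultimately show ?thesis using c y comp[OF y(1)] by (simp add: M.minus_eq M.r_neg)
      qed
      then show "\<ominus>\<^bsub>G\<^esub> f \<in> graded_ideal L" using nG by (simp add: graded_ideal_def)
    next
      fix f g assume f: "f \<in> graded_ideal L" and g: "g \<in> graded_ideal L"
      then have "(f \<oplus>\<^bsub>G\<^esub> g) n \<subseteq> L n" for n
        unfolding gr_add_component set_add_def' graded_ideal_def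
        using additive_subgroup.a_closed[OF sub] by blast
      then show "f \<oplus>\<^bsub>G\<^esub> g \<in> graded_ideal L"
        using f g by (simp add: graded_ideal_def)
    qed
  next
    fix f g assume f: "f \<in> graded_ideal L" and g: "g \<in> carrier G"
    show "f \<otimes>\<^bsub>G\<^esub> g \<in> graded_ideal L" by (rule right[OF f g])
    moreover have "f \<in> carrier G" using f by (simp add: graded_ideal_def)
    ultimately show "g \<otimes>\<^bsub>G\<^esub> f \<in> graded_ideal L" using G.m_comm[OF _ g] by metis
  qed
qed

text \<open>The generators \<open>Y\<close> of the ideal need not be homogeneous, so
  \<open>J\<close> collects representatives of their nonzero components. The family \<open>S\<close>
  spanned by \<open>J\<close> is again graded, hence defines an ideal; it contains \<open>Y\<close>
  and therefore the ideal of \<open>L\<close>. Minimality of the generated ideal replaces any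
  calculation with its elements.\<close>

lemma graded_family_generators:
  assumes noeth: "noetherian_ring G"
    and sub: "\<And>n. additive_subgroup (L n) U" and le: "\<And>n. L n \<subseteq> F n" and lo: "\<And>n. Fb n \<subseteq> L n"
    and mult: "\<And>n m x y. \<lbrakk>x \<in> L n; y \<in> F m\<rbrakk> \<Longrightarrow> x \<otimes>\<^bsub>U\<^esub> y \<in> L (n + m)"
  shows "\<exists>J. finite J \<and> (\<forall>(m, g)\<in>J. g \<in> L m) \<and> (\<forall>n. L n \<subseteq> additive_span U
       ({g \<otimes>\<^bsub>U\<^esub> y | m g y. (m, g) \<in> J \<and> m \<le> n \<and> y \<in> F (n - m)} \<union> Fb n))"
proof -
  have id: "ideal (graded_ideal L) G" by (rule graded_ideal_ideal[OF sub le lo mult])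
  obtain Y where Y: "Y \<subseteq> carrier G" "finite Y" "graded_ideal L = genideal G Y"
    using noetherian_ring.finetely_gen[OF noeth id] by blast
  have YL: "Y \<subseteq> graded_ideal L" unfolding Y(3) by (rule G.genideal_self[OF Y(1)])
  define rep where "rep f n = (SOME x. x \<in> F n \<and> f n = coset n x)" for f :: "nat \<Rightarrow> 'b set" and n
  have rep: "rep f n \<in> F n \<and> f n = coset n (rep f n)" if "f \<in> carrier G" for f n
    unfolding rep_def by (rule someI_ex, rule gr_component[OF that, of n], intro exI conjI)
  define J where "J = (\<Union>f\<in>Y. (\<lambda>n. (n, rep f n)) ` {n. f n \<noteq> Fb n})"
  have Jfin: "finite J"
    unfolding J_def by (rule finite_UN_I[OF Y(2)]) (use Y(1) carrier_gr in blast)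
  have JL: "g \<in> L m" if mg: "(m, g) \<in> J" for m g
  proof -
    obtain f where f: "f \<in> Y" "g = rep f m" using mg by (auto simp: J_def)
    have fG: "f \<in> carrier G" using f Y(1) by blast
    have "f m \<subseteq> L m" using f(1) YL by (auto simp: graded_ideal_def)
    then show ?thesis using rep[OF fG, of m] coset_subset[OF sub lo F_closed, of g m] f(2) by auto
  qed
  define Q where "Q n = {g \<otimes>\<^bsub>U\<^esub> y | m g y. (m, g) \<in> J \<and> m \<le> n \<and> y \<in> F (n - m)} \<union> Fb n" for n
  define S where "S n = additive_span U (Q n)" for n
  have QL: "Q n \<subseteq> L n" for n
  proof
    fix q assume "q \<in> Q n"
    then consider "q \<in> Fb n" | m g y where "q = g \<otimes>\<^bsub>U\<^esub> y" "(m, g) \<in> J" "m \<le> n" "y \<in> F (n - m)"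
      unfolding Q_def by blast
    then show "q \<in> L n"
    proof cases
      case 2
      then show ?thesis using mult[OF JL[OF 2(2)] 2(4)] by simp
    qed (use lo in blast)
  qed
  have QF: "Q n \<subseteq> F n" for n using QL le by blast
  have Ssub: "additive_subgroup (S n) U" for n
    unfolding S_def by (rule M.additive_span_subgroup) (use QF F_closed in blast)
  have SF: "S n \<subseteq> F n" for n
    unfolding S_def by (rule M.additive_span_le[OF F_subgroup QF])
  have Slo: "Fb n \<subseteq> S n" for n unfolding S_def Q_def by (auto intro: additive_span.gen)
  have Smult: "x \<otimes>\<^bsub>U\<^esub> y \<in> S (n + m)" if x: "x \<in> S n" and y: "y \<in> F m" for n m x y
    using x unfolding S_def[of n]
  proof induct
    case zero
    then show ?case using additive_subgroup.zero_closed[OF Ssub] F_closed[OF y] by simp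
  next
    case (gen x)
    then consider "x \<in> Fb n" | k g w where "x = g \<otimes>\<^bsub>U\<^esub> w" "(k, g) \<in> J" "k \<le> n" "w \<in> F (n - k)"
      unfolding Q_def by blast
    then show ?case
    proof cases
      case 1
      then show ?thesis using Fb_mult_right[OF 1 y] Slo by blast
    next
      case 2
      have c: "g \<in> carrier U" "w \<in> carrier U" "y \<in> carrier U"
        using JL[OF 2(2)] le 2(4) y F_closed by blast+
      have "x \<otimes>\<^bsub>U\<^esub> y = g \<otimes>\<^bsub>U\<^esub> (w \<otimes>\<^bsub>U\<^esub> y)" using c by (simp add: 2(1) U.m_assoc)
      moreover have "w \<otimes>\<^bsub>U\<^esub> y \<in> F (n + m - k)" using filt_mult[OF 2(4) y] 2(3) by simp
      ultimately have "x \<otimes>\<^bsub>U\<^esub> y \<in> Q (n + m)"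
        unfolding Q_def using 2(2,3) trans_le_add1[OF 2(3), of m] by blast
      then show ?thesis unfolding S_def by (rule additive_span.gen)
    qed
  next
    case (diff a b)
    have "additive_span U (Q n) \<subseteq> carrier U" using SF F_closed unfolding S_def by blast
    then have "a \<in> carrier U" "b \<in> carrier U" using diff by auto
    then show ?case
      using M.additive_subgroup_diff[OF Ssub diff(2,4)] F_closed[OF y]
      by (simp add: M.minus_eq U.l_distr U.l_minus)
  qed
  have "ideal (graded_ideal S) G" by (rule graded_ideal_ideal[OF Ssub SF Slo Smult])
  moreover have "Y \<subseteq> graded_ideal S"
  proof
    fix f assume f: "f \<in> Y"
    then have fG: "f \<in> carrier G" using Y(1) by blast
    have "f n \<subseteq> S n" for n
    proof (cases "f n = Fb n")
      case False
      then have j: "(n, rep f n) \<in> J" using f by (auto simp: J_def)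
      have rF: "rep f n \<in> F n" "f n = coset n (rep f n)" using rep[OF fG] by auto
      \<comment> \<open>The generator itself appears in the span with coefficient 1 in degree
        0.\<close>
      have "rep f n \<otimes>\<^bsub>U\<^esub> \<one>\<^bsub>U\<^esub> \<in> Q n" unfolding Q_def using j filt_one by force
      then have "rep f n \<in> S n" unfolding S_def using F_closed[OF rF(1)] by (auto intro: additive_span.gen)
      then show ?thesis using coset_subset[OF Ssub Slo F_closed[OF rF(1)]] rF(2) by simp
    qed (use Slo in simp)
    then show "f \<in> graded_ideal S" using fG by (simp add: graded_ideal_def)
  qed
  ultimately have LS: "graded_ideal L \<subseteq> graded_ideal S" unfolding Y(3) by (rule G.genideal_minimal)
  have "L n \<subseteq> S n" for n
  proof
    fix x assume x: "x \<in> L n"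
    then have xF: "x \<in> F n" using le by blast
    have "homogeneous n x k \<subseteq> L k" for k
      using lo coset_subset[OF sub lo F_closed[OF xF]] x by (simp add: homogeneous_def)
    then have "homogeneous n x \<in> graded_ideal L"
      unfolding graded_ideal_def using homogeneous_closed[OF xF] by simp
    then have "homogeneous n x \<in> graded_ideal S" by (rule subsetD[OF LS])
    then have "homogeneous n x n \<subseteq> S n" by (simp add: graded_ideal_def)
    then show "x \<in> S n" using coset_subset[OF Ssub Slo F_closed[OF xF]] by (simp add: homogeneous_def)
  qed
  then show ?thesis using Jfin JL unfolding S_def Q_def by (intro exI[of _ J]) blast
qed

lemma span_lower_le:
  assumes "\<And>n. L n \<subseteq> additive_span U (Q n \<union> Fb n)" "\<And>n. Q n \<subseteq> carrier U"
    and "\<And>n q. q \<in> Q n \<Longrightarrow> q \<in> additive_span U (Q' n \<union> filt_lower F n)" "\<And>n. Q' n \<subseteq> carrier U"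
  shows "L n \<subseteq> additive_span U (Q' n \<union> filt_lower F n)"
proof -
  have "filt_lower F n \<subseteq> carrier U" by (auto simp: filt_lower_def F_closed)
  then have sub: "additive_subgroup (additive_span U (Q' n \<union> filt_lower F n)) U"
    using assms(4) by (intro M.additive_span_subgroup) blast
  have "Fb n \<subseteq> additive_span U (Q' n \<union> filt_lower F n)"
    by (auto simp: filt_below_def filt_lower_def intro: additive_span.intros)
  then have "additive_span U (Q n \<union> Fb n) \<subseteq> additive_span U (Q' n \<union> filt_lower F n)"
    using assms(3) by (intro M.additive_span_le[OF sub]) blast
  then show ?thesis using assms(1) by blast
qed

lemma filt_lower_Fb: "Fb n \<subseteq> L \<longleftrightarrow> filt_lower F n \<subseteq> L" if "additive_subgroup L U"
  using additive_subgroup.zero_closed[OF that] by (auto simp: filt_below_def filt_lower_def)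

lemma graded_noetherian_right:
  assumes "noetherian_ring G"
  shows "graded_noetherian U F"
  unfolding graded_noetherian_def
proof (intro allI impI)
  fix L assume L: "graded_family U F L"
  then have sub: "\<And>n. additive_subgroup (L n) U" and le: "\<And>n. L n \<subseteq> F n" and lo: "\<And>n. filt_lower F n \<subseteq> L n"
    and mult: "\<And>n m x y. \<lbrakk>x \<in> L n; y \<in> F m\<rbrakk> \<Longrightarrow> x \<otimes>\<^bsub>U\<^esub> y \<in> L (n + m)"
    unfolding graded_family_def by blast+
  have lo': "Fb n \<subseteq> L n" for n using lo filt_lower_Fb[OF sub] by blast
  have "\<exists>J. finite J \<and> (\<forall>(m, g)\<in>J. g \<in> L m) \<and> (\<forall>n. L n \<subseteq> additive_span U
       ({g \<otimes>\<^bsub>U\<^esub> y | m g y. (m, g) \<in> J \<and> m \<le> n \<and> y \<in> F (n - m)} \<union> Fb n))"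
    by (rule graded_family_generators[OF assms sub le lo' mult])
  then obtain J where J: "finite J" "\<forall>(m, g)\<in>J. g \<in> L m" "\<forall>n. L n \<subseteq> additive_span U
       ({g \<otimes>\<^bsub>U\<^esub> y | m g y. (m, g) \<in> J \<and> m \<le> n \<and> y \<in> F (n - m)} \<union> Fb n)"
    by (elim exE conjE) (rule that)
  have JF: "g \<in> carrier U" if "(m, g) \<in> J" for m g using J(2) that le F_closed by blast
  have "L n \<subseteq> additive_span U
       ({g \<otimes>\<^bsub>U\<^esub> y | m g y. (m, g) \<in> J \<and> m \<le> n \<and> y \<in> F (n - m)} \<union> filt_lower F n)" for n
    by (rule span_lower_le[OF spec[OF J(3)]]) (auto simp: JF F_closed intro: additive_span.gen)
  then show "\<exists>J. finite J \<and> (\<forall>(m, g)\<in>J. g \<in> L m) \<and> (\<forall>n. L n \<subseteq> additive_span U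
       ({g \<otimes>\<^bsub>U\<^esub> y | m g y. (m, g) \<in> J \<and> m \<le> n \<and> y \<in> F (n - m)} \<union> filt_lower F n))"
    using J(1,2) by (intro exI[of _ J] conjI allI)
qed

text \<open>Left and right products differ by commutators, which lie in the lower part contained in
  every graded family. So a left family is also a right one, and right generators become left
  generators.\<close>

lemma graded_noetherian_left:
  assumes "noetherian_ring G"
  shows "graded_noetherian (opposite_ring U) F"
  unfolding graded_noetherian_def
proof (intro allI impI)
  fix L assume L: "graded_family (opposite_ring U) F L"
  have sub: "additive_subgroup (L n) U" for n
    using L by (simp add: graded_family_def additive_subgroup_def opposite_ring_def)
  from L have le: "\<And>n. L n \<subseteq> F n" and lo: "\<And>n. filt_lower F n \<subseteq> L n"
    and mult0: "\<And>n m x y. \<lbrakk>x \<in> L n; y \<in> F m\<rbrakk> \<Longrightarrow> y \<otimes>\<^bsub>U\<^esub> x \<in> L (n + m)"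
    unfolding graded_family_def by auto
  have lo': "Fb n \<subseteq> L n" for n using lo filt_lower_Fb[OF sub] by blast
  have mult: "x \<otimes>\<^bsub>U\<^esub> y \<in> L (n + m)" if x: "x \<in> L n" and y: "y \<in> F m" for n m x y
  proof -
    have xF: "x \<in> F n" using x le by blast
    have c: "x \<in> carrier U" "y \<in> carrier U" using xF y F_closed by auto
    have "x \<otimes>\<^bsub>U\<^esub> y = (x \<otimes>\<^bsub>U\<^esub> y \<ominus>\<^bsub>U\<^esub> y \<otimes>\<^bsub>U\<^esub> x) \<oplus>\<^bsub>U\<^esub> y \<otimes>\<^bsub>U\<^esub> x"
      using c by (simp add: M.minus_eq M.a_assoc M.l_neg)
    also have "\<dots> \<in> L (n + m)"
      using commutator_lower[OF xF y] lo' by (intro additive_subgroup.a_closed[OF sub] mult0[OF x y]) blast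
    finally show ?thesis .
  qed
  have "\<exists>J. finite J \<and> (\<forall>(m, g)\<in>J. g \<in> L m) \<and> (\<forall>n. L n \<subseteq> additive_span U
       ({g \<otimes>\<^bsub>U\<^esub> y | m g y. (m, g) \<in> J \<and> m \<le> n \<and> y \<in> F (n - m)} \<union> Fb n))"
    by (rule graded_family_generators[OF assms sub le lo' mult])
  then obtain J where J: "finite J" "\<forall>(m, g)\<in>J. g \<in> L m" "\<forall>n. L n \<subseteq> additive_span U
       ({g \<otimes>\<^bsub>U\<^esub> y | m g y. (m, g) \<in> J \<and> m \<le> n \<and> y \<in> F (n - m)} \<union> Fb n)"
    by (elim exE conjE) (rule that)
  have JF: "g \<in> F m" if "(m, g) \<in> J" for m g using J(2) that le by blast
  have JFc: "g \<in> carrier U" if "(m, g) \<in> J" for m g using JF[OF that] F_closed by blast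
  define Q where "Q n = {y \<otimes>\<^bsub>U\<^esub> g | m g y. (m, g) \<in> J \<and> m \<le> n \<and> y \<in> F (n - m)}" for n
  have span: "L n \<subseteq> additive_span U (Q n \<union> filt_lower F n)" for n
  proof (rule span_lower_le[OF spec[OF J(3)]])
    show "{g \<otimes>\<^bsub>U\<^esub> y | m g y. (m, g) \<in> J \<and> m \<le> n \<and> y \<in> F (n - m)} \<subseteq> carrier U" for n
      by (auto simp: JFc F_closed)
    show "Q n \<subseteq> carrier U" for n by (auto simp: Q_def JFc F_closed)
    fix n q assume "q \<in> {g \<otimes>\<^bsub>U\<^esub> y | m g y. (m, g) \<in> J \<and> m \<le> n \<and> y \<in> F (n - m)}"
    then obtain m g y where q: "q = g \<otimes>\<^bsub>U\<^esub> y" "(m, g) \<in> J" "m \<le> n" "y \<in> F (n - m)" by blast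
    have c: "g \<in> carrier U" "y \<in> carrier U" using JFc[OF q(2)] F_closed[OF q(4)] by auto
    have "y \<otimes>\<^bsub>U\<^esub> g \<ominus>\<^bsub>U\<^esub> g \<otimes>\<^bsub>U\<^esub> y \<in> Fb n"
      using commutator_lower[OF q(4) JF[OF q(2)]] q(3) by simp
    then have "y \<otimes>\<^bsub>U\<^esub> g \<ominus>\<^bsub>U\<^esub> g \<otimes>\<^bsub>U\<^esub> y \<in> additive_span U (Q n \<union> filt_lower F n)"
      by (auto simp: filt_below_def filt_lower_def intro: additive_span.intros split: if_splits)
    moreover have "y \<otimes>\<^bsub>U\<^esub> g \<in> additive_span U (Q n \<union> filt_lower F n)"
      by (rule additive_span.gen) (use q in \<open>auto simp: Q_def\<close>)
    \<comment> \<open>This difference is g y, rebuilt from y g and the commutator.\<close>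
    ultimately have "y \<otimes>\<^bsub>U\<^esub> g \<ominus>\<^bsub>U\<^esub> (y \<otimes>\<^bsub>U\<^esub> g \<ominus>\<^bsub>U\<^esub> g \<otimes>\<^bsub>U\<^esub> y) \<in> additive_span U (Q n \<union> filt_lower F n)"
      by - (rule additive_span.diff)
    then show "q \<in> additive_span U (Q n \<union> filt_lower F n)"
      using c by (simp add: q(1) M.minus_eq M.minus_add M.r_neg1 M.r_neg2)
  qed
  show "\<exists>J. finite J \<and> (\<forall>(m, g)\<in>J. g \<in> L m) \<and> (\<forall>n. L n \<subseteq> additive_span (opposite_ring U)
       ({g \<otimes>\<^bsub>opposite_ring U\<^esub> y | m g y. (m, g) \<in> J \<and> m \<le> n \<and> y \<in> F (n - m)} \<union> filt_lower F n))"
    using J(1,2) span unfolding Q_def additive_span_opposite opposite_ring_simps by (intro exI[of _ J] conjI allI)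
qed

end

section \<open>Torsion in the graded and in the filtered ring\<close>

lemma gr_smult_component:
  assumes "x \<in> F n" "r \<in> carrier R"
  shows "r \<odot>\<^bsub>G\<^esub> homogeneous n x = homogeneous n (r \<odot>\<^bsub>U\<^esub> x)"
proof
  fix i
  have "(\<Union>z\<in>coset i \<zero>\<^bsub>U\<^esub>. coset i (r \<odot>\<^bsub>U\<^esub> z)) = coset i \<zero>\<^bsub>U\<^esub>"
    using coset_smult[OF zero_F assms(2), of i] assms(2) by simp
  then show "(r \<odot>\<^bsub>G\<^esub> homogeneous n x) i = homogeneous n (r \<odot>\<^bsub>U\<^esub> x) i"
    using coset_smult[OF assms] by (simp add: gr_def homogeneous_def coset_zero)
qed

text \<open>If \<open>r\<close> kills \<open>x\<close> in \<open>F n\<close>, it kills the class of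
  \<open>x\<close> in degree \<open>n\<close>, so that class is zero and \<open>x\<close> lies one
  step lower. The descent ends below degree 0, where only zero is left.\<close>

lemma torsion_free_of_gr:
  assumes r: "r \<in> carrier R" and tf: "\<And>f. \<lbrakk>f \<in> carrier G; r \<odot>\<^bsub>G\<^esub> f = \<zero>\<^bsub>G\<^esub>\<rbrakk> \<Longrightarrow> f = \<zero>\<^bsub>G\<^esub>"
    and x: "x \<in> carrier U" "r \<odot>\<^bsub>U\<^esub> x = \<zero>\<^bsub>U\<^esub>"
  shows "x = \<zero>\<^bsub>U\<^esub>"
proof -
  have lower: "x \<in> Fb n" if n: "x \<in> F n" for n
  proof -
    have "homogeneous n (r \<odot>\<^bsub>U\<^esub> x) = \<zero>\<^bsub>G\<^esub>" by (auto simp: homogeneous_def x(2) coset_zero gr_zero fun_eq_iff)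
    then have "homogeneous n x = \<zero>\<^bsub>G\<^esub>"
      using tf[OF homogeneous_closed[OF n]] gr_smult_component[OF n r] by simp
    then have "homogeneous n x n = Fb n" by (simp add: gr_zero)
    then show ?thesis using coset_self[OF x(1), of n] by (simp add: homogeneous_def)
  qed
  have "x \<in> F n \<Longrightarrow> x = \<zero>\<^bsub>U\<^esub>" for n
  proof (induct n)
    case 0
    then show ?case using lower[of 0] by (simp add: filt_below_def)
  next
    case (Suc n)
    then show ?case using lower[of "Suc n"] by (simp add: filt_below_def)
  qed
  then show ?thesis using x(1) filt_exhaustive by blast
qed

end

text \<open>Flatness is applied to the injective endomorphism of \<open>R\<close> given by multiplication by \<open>\<pi>\<close>.\<close>

lemma flat_torsion_free:
  fixes R :: "('r, 'z) ring_scheme"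
  assumes "cring R" and flat: "flat_left_module TYPE('r) R M" and \<pi>: "\<pi> \<in> carrier R"
    and inj: "\<And>a. \<lbrakk>a \<in> carrier R; \<pi> \<otimes>\<^bsub>R\<^esub> a = \<zero>\<^bsub>R\<^esub>\<rbrakk> \<Longrightarrow> a = \<zero>\<^bsub>R\<^esub>"
    and m: "m \<in> carrier M" "\<pi> \<odot>\<^bsub>M\<^esub> m = \<zero>\<^bsub>M\<^esub>"
  shows "m = \<zero>\<^bsub>M\<^esub>"
proof -
  interpret R: cring R by fact
  have LM: "left_module R M" using flat by (simp add: flat_left_module_def)
  interpret M: left_module R M by (rule LM)
  let ?N = "ring_as_left_module (\<lambda>a. a) R"
  have LN: "left_module R ?N"
    using subring_assoc_algebra[of R R] R.is_cring by (simp add: assoc_algebra_def)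
  interpret N: left_module R ?N by (rule LN)
  have RN: "right_module R ?N"
    unfolding right_module_def
  proof (intro left_module.intro N.abelian_group_axioms left_module_axioms.intro)
    have "opposite_ring R = opposite_ring R" ..
    show "ring (opposite_ring R)"
    proof (rule ringI)
      show "abelian_group (opposite_ring R)"
        by (rule abelian_groupI) (auto simp: R.a_ac intro!: bexI[of _ "\<ominus>\<^bsub>R\<^esub> x" for x] R.l_neg)
      show "monoid (opposite_ring R)" by unfold_locales (auto simp: R.m_assoc)
    qed (auto simp: R.l_distr R.r_distr)
  qed (auto simp: R.m_assoc R.m_lcomm R.l_distr R.r_distr R.m_comm)
  interpret T: tensor_factors R ?N M by (rule tensor_factorsI[OF RN LM])
  let ?f = "\<lambda>a. \<pi> \<otimes>\<^bsub>R\<^esub> a"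
  have f: "?f \<in> linear_maps R ?N ?N"
    using \<pi> by (auto simp: linear_maps_def hom_def R.r_distr R.m_lcomm)
  have "inj_on ?f (carrier ?N)"
  proof (rule inj_onI)
    fix a b assume ab: "a \<in> carrier ?N" "b \<in> carrier ?N" "\<pi> \<otimes>\<^bsub>R\<^esub> a = \<pi> \<otimes>\<^bsub>R\<^esub> b"
    then have "\<pi> \<otimes>\<^bsub>R\<^esub> (a \<ominus>\<^bsub>R\<^esub> b) = \<zero>\<^bsub>R\<^esub>" using \<pi> by (simp add: R.minus_eq R.r_distr R.r_minus R.r_neg)
    then have "a \<ominus>\<^bsub>R\<^esub> b = \<zero>\<^bsub>R\<^esub>" using inj[of "a \<ominus>\<^bsub>R\<^esub> b"] ab by simp
    then show "a = b" using ab by (simp add: R.r_right_minus_eq)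
  qed
  then have "inj_on (tensor_map R ?N M ?f (\<lambda>x. x)) (carrier (tensor_group R ?N M))"
    using flat RN f unfolding flat_left_module_def by blast
  then have inj': "c \<in> tensor_kernel R ?N M"
    if "Poly_Mapping.keys c \<subseteq> carrier ?N \<times> carrier M" "frag_pair_map ?f (\<lambda>x. x) c \<in> tensor_kernel R ?N M" for c
    using that tensor_map_inj_on_iff[OF T.tensor_factors_axioms T.tensor_factors_axioms f linear_maps_id] by blast
  \<comment> \<open>The tensor \<pi> tensor m equals 1 tensor \<pi> m, which is zero. It is the
    image of 1 tensor m under an injective map.\<close>
  have "frag_of (\<pi> \<odot>\<^bsub>?N\<^esub> \<one>\<^bsub>R\<^esub>, m) - frag_of (\<one>\<^bsub>R\<^esub>, \<pi> \<odot>\<^bsub>M\<^esub> m) \<in> tensor_kernel R ?N M"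
    by (rule T.tensor_kernel_smult) (use \<pi> m in simp_all)
  moreover have "frag_of (\<one>\<^bsub>R\<^esub>, \<pi> \<odot>\<^bsub>M\<^esub> m) \<in> tensor_kernel R ?N M"
    unfolding m(2) by (rule T.tensor_kernel_zero_right) simp
  ultimately have "frag_of (\<pi> \<otimes>\<^bsub>R\<^esub> \<one>\<^bsub>R\<^esub>, m) \<in> tensor_kernel R ?N M"
    using T.tensor_kernel_add by fastforce
  then have ker: "frag_of (\<one>\<^bsub>R\<^esub>, m) \<in> tensor_kernel R ?N M"
    by - (rule inj', use m in simp_all)
  \<comment> \<open>The action of \<open>R\<close> on \<open>M\<close> induces a map from the tensor
    product that sends 1 tensor m to m; it is built on the free group and shown to vanish on the
    kernel.\<close>
  have "(\<lambda>(a, x). a \<odot>\<^bsub>M\<^esub> x) ` (carrier ?N \<times> carrier M) \<subseteq> carrier (add_monoid M)" by auto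
  from comm_group.free_Abelian_group_universal[OF M.a_comm_group this]
  obtain h where h: "h \<in> hom (free_Abelian_group (carrier ?N \<times> carrier M)) (add_monoid M)"
    "\<And>z. z \<in> carrier ?N \<times> carrier M \<Longrightarrow> h (frag_of z) = (case z of (a, x) \<Rightarrow> a \<odot>\<^bsub>M\<^esub> x)" by blast
  interpret h: group_hom "free_Abelian_group (carrier ?N \<times> carrier M)" "add_monoid M" h
    by (intro group_hom.intro group_hom_axioms.intro h group_free_Abelian_group M.a_group)
  have h_diff: "h (c - d) = h c \<ominus>\<^bsub>M\<^esub> h d"
    if "Poly_Mapping.keys c \<subseteq> carrier ?N \<times> carrier M" "Poly_Mapping.keys d \<subseteq> carrier ?N \<times> carrier M" for c d
  proof -
    have "h (c + - d) = h c \<oplus>\<^bsub>M\<^esub> h (- d)" using h.hom_mult[of c "- d"] that by simp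
    moreover have "h (- d) = \<ominus>\<^bsub>M\<^esub> h d" using h.hom_inv[of d] that by (simp add: a_inv_def)
    ultimately show ?thesis by (simp add: a_minus_def)
  qed
  have cancel: "p \<oplus>\<^bsub>M\<^esub> q \<ominus>\<^bsub>M\<^esub> p \<ominus>\<^bsub>M\<^esub> q = \<zero>\<^bsub>M\<^esub>" if "p \<in> carrier M" "q \<in> carrier M" for p q
    using that M.M.r_neg[of "p \<oplus>\<^bsub>M\<^esub> q"] by (simp add: a_minus_def M.M.minus_add M.M.a_assoc)
  have "h c = \<zero>\<^bsub>M\<^esub>" if "c \<in> tensor_kernel R ?N M" for c
    using that
  proof (induct rule: T.tensor_kernel_induct)
    case zero
    then show ?case using h.hom_one by simp
  next
    case (add_left a b x)
    then show ?case
      by (simp add: h_diff keys_diff_subset h(2) M.smult_l_distr cancel)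
  next
    case (add_right a x y)
    then show ?case
      by (simp add: h_diff keys_diff_subset h(2) M.smult_r_distr cancel)
  next
    case (smult a b x)
    then show ?case
      using M.smult_assoc1[of b a x] R.m_comm[of a b] by (simp add: h_diff h(2) a_minus_def M.M.r_neg)
  next
    case (diff c d)
    then show ?case
      using T.tensor_kernel_keys[OF diff(1)] T.tensor_kernel_keys[OF diff(2)] by (simp add: h_diff a_minus_def)
  qed
  from this[OF ker] show ?thesis using h(2)[of "(\<one>\<^bsub>R\<^esub>, m)"] m by simp
qed

subsection \<open>A filtered ring and the completion of its deformation\<close>

lemma (in ring_hom_ring) hom_minus: "\<lbrakk>x \<in> carrier R; y \<in> carrier R\<rbrakk> \<Longrightarrow> h (x \<ominus> y) = h x \<ominus>\<^bsub>S\<^esub> h y"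
  by (simp add: R.minus_eq S.minus_eq)

lemma (in ring_hom_ring) hom_additive_span:
  assumes "x \<in> additive_span R T" "T \<subseteq> carrier R"
  shows "h x \<in> additive_span S (h ` T)"
  using assms(1)
proof induct
  case (diff x y)
  have "additive_span R T \<subseteq> carrier R"
    using additive_subgroup.a_subset[OF R.additive_span_subgroup[OF assms(2)]] .
  then show ?case using diff additive_span.diff by (simp add: hom_minus subset_eq)
qed (auto intro: additive_span.intros)

lemma (in ring_hom_ring) image_additive_subgroup:
  assumes "additive_subgroup H R"
  shows "additive_subgroup (h ` H) S"
proof (rule S.additive_subgroup_diffI)
  have H: "H \<subseteq> carrier R" by (rule additive_subgroup.a_subset[OF assms])
  show "h ` H \<subseteq> carrier S" using H by auto
  show "\<zero>\<^bsub>S\<^esub> \<in> h ` H" by (rule image_eqI[of _ h "\<zero>"]) (simp_all add: additive_subgroup.zero_closed[OF assms])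
  fix x y assume "x \<in> h ` H" "y \<in> h ` H"
  then obtain a b where ab: "x = h a" "y = h b" "a \<in> H" "b \<in> H" by blast
  then have "a \<in> carrier R" "b \<in> carrier R" using H by auto
  with ab show "x \<ominus>\<^bsub>S\<^esub> y \<in> h ` H"
    using R.additive_subgroup_diff[OF assms, of a b] hom_minus[of a b] by (intro image_eqI[of _ h "a \<ominus> b"]) auto
qed

text \<open>Here \<open>q\<close> is the image of \<open>\<pi>\<close> in \<open>U\<close>, the additive span that occurs in the assumptions is the
  deformation \<open>U\<^sub>1\<close>, and \<open>e\<close> and \<open>f\<close> are the maps of \<open>U\<^sub>1\<close> and \<open>U\<close> to their localized completions.\<close>

locale deformation_completion = ring_hom_ring A M \<psi> + U: ring U
    + A: adic_subring A "e q" D + M: adic_subring M "f q" C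
  for A :: "('a, 'x) ring_scheme" (structure) and M :: "('c, 'y) ring_scheme" (structure) and \<psi>
    and U :: "('b, 'u) ring_scheme" (structure) and e :: "'b \<Rightarrow> 'a" and f :: "'b \<Rightarrow> 'c" and q D C +
  fixes F :: "nat \<Rightarrow> 'b set"
  assumes F_subgroup: "additive_subgroup (F n) U"
    and F_mono: "F n \<subseteq> F (Suc n)"
    and F_one: "\<one>\<^bsub>U\<^esub> \<in> F 0"
    and F_mult: "\<lbrakk>x \<in> F i; y \<in> F j\<rbrakk> \<Longrightarrow> x \<otimes>\<^bsub>U\<^esub> y \<in> F (i + j)"
    and F_exhaustive: "(\<Union>n. F n) = carrier U"
    and q_F: "q \<in> F 0"
    and q_central: "x \<in> carrier U \<Longrightarrow> x \<otimes>\<^bsub>U\<^esub> q = q \<otimes>\<^bsub>U\<^esub> x"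
    and e_D: "x \<in> additive_span U {q [^]\<^bsub>U\<^esub> n \<otimes>\<^bsub>U\<^esub> f | (n::nat) f. f \<in> F n} \<Longrightarrow> e x \<in> D"
    and e_add: "\<lbrakk>x \<in> additive_span U {q [^]\<^bsub>U\<^esub> n \<otimes>\<^bsub>U\<^esub> f | (n::nat) f. f \<in> F n};
      y \<in> additive_span U {q [^]\<^bsub>U\<^esub> n \<otimes>\<^bsub>U\<^esub> f | (n::nat) f. f \<in> F n}\<rbrakk> \<Longrightarrow> e (x \<oplus>\<^bsub>U\<^esub> y) = e x \<oplus>\<^bsub>A\<^esub> e y"
    and e_mult: "\<lbrakk>x \<in> additive_span U {q [^]\<^bsub>U\<^esub> n \<otimes>\<^bsub>U\<^esub> f | (n::nat) f. f \<in> F n};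
      y \<in> additive_span U {q [^]\<^bsub>U\<^esub> n \<otimes>\<^bsub>U\<^esub> f | (n::nat) f. f \<in> F n}\<rbrakk> \<Longrightarrow> e (x \<otimes>\<^bsub>U\<^esub> y) = e x \<otimes>\<^bsub>A\<^esub> e y"
    and e_one: "e \<one>\<^bsub>U\<^esub> = \<one>\<^bsub>A\<^esub>"
    and e_dense: "d \<in> D \<Longrightarrow>
      \<exists>x\<in>additive_span U {q [^]\<^bsub>U\<^esub> n \<otimes>\<^bsub>U\<^esub> f | (n::nat) f. f \<in> F n}. \<exists>d'\<in>D. d = e x \<oplus>\<^bsub>A\<^esub> e q \<otimes>\<^bsub>A\<^esub> d'"
    and p_unit: "e q \<in> Units A"
    and A_D: "a \<in> carrier A \<Longrightarrow> \<exists>n::nat. e q [^]\<^bsub>A\<^esub> n \<otimes>\<^bsub>A\<^esub> a \<in> D"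
    and M_C: "c \<in> carrier M \<Longrightarrow> \<exists>n::nat. f q [^]\<^bsub>M\<^esub> n \<otimes>\<^bsub>M\<^esub> c \<in> C"
    and f_hom: "f \<in> ring_hom U M"
    and f_C: "x \<in> carrier U \<Longrightarrow> f x \<in> C"
    and f_dense: "c \<in> C \<Longrightarrow> \<exists>x\<in>carrier U. \<exists>c'\<in>C. c = f x \<oplus>\<^bsub>M\<^esub> f q \<otimes>\<^bsub>M\<^esub> c'"
    and f_divisible: "\<lbrakk>x \<in> carrier U; c \<in> C; f x = f q \<otimes>\<^bsub>M\<^esub> c\<rbrakk> \<Longrightarrow> \<exists>y\<in>carrier U. x = q \<otimes>\<^bsub>U\<^esub> y"
    and \<psi>_e: "x \<in> additive_span U {q [^]\<^bsub>U\<^esub> n \<otimes>\<^bsub>U\<^esub> f | (n::nat) f. f \<in> F n} \<Longrightarrow> \<psi> (e x) = f x"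
    and \<psi>_D: "d \<in> D \<Longrightarrow> \<psi> d \<in> C"
begin

abbreviation "V \<equiv> additive_span U {q [^]\<^bsub>U\<^esub> n \<otimes>\<^bsub>U\<^esub> f | (n::nat) f. f \<in> F n}"

sublocale f: ring_hom_ring U M f by (rule ring_hom_ringI2[OF U.ring_axioms S.ring_axioms f_hom])

lemma F_closed [simp]: "x \<in> F n \<Longrightarrow> x \<in> carrier U"
  using F_exhaustive by blast

lemma q_closed [simp]: "q \<in> carrier U" by (rule F_closed[OF q_F])

lemma F_le: "m \<le> n \<Longrightarrow> F m \<subseteq> F n" by (rule lift_Suc_mono_le) (rule F_mono)

lemma F_ex: "x \<in> carrier U \<Longrightarrow> \<exists>n. x \<in> F n" using F_exhaustive by blast

lemma F_common:
  assumes "x \<in> carrier U" "y \<in> carrier U"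
  shows "\<exists>n. x \<in> F n \<and> y \<in> F n"
proof -
  obtain m n where "x \<in> F m" "y \<in> F n" using F_ex assms by blast
  then have "x \<in> F (max m n) \<and> y \<in> F (max m n)"
    using F_le[of m "max m n"] F_le[of n "max m n"] by auto
  then show ?thesis by (rule exI)
qed

lemma V_gen: "x \<in> F n \<Longrightarrow> q [^]\<^bsub>U\<^esub> n \<otimes>\<^bsub>U\<^esub> x \<in> V"
  by (rule additive_span.gen) blast

lemma V_subgroup: "additive_subgroup V U" by (rule U.additive_span_subgroup) auto

lemma V_closed: "x \<in> V \<Longrightarrow> x \<in> carrier U"
  using additive_subgroup.a_subset[OF V_subgroup] by blast

lemma F_q: "x \<in> F n \<Longrightarrow> q \<otimes>\<^bsub>U\<^esub> x \<in> F n" using F_mult[OF q_F, of x n] by simp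

lemma qp_Suc: "x \<in> carrier U \<Longrightarrow> q [^]\<^bsub>U\<^esub> Suc m \<otimes>\<^bsub>U\<^esub> x = q \<otimes>\<^bsub>U\<^esub> (q [^]\<^bsub>U\<^esub> m \<otimes>\<^bsub>U\<^esub> x)"
  by (simp add: U.m_assoc[symmetric] q_central)

lemma F_qp: "x \<in> F n \<Longrightarrow> q [^]\<^bsub>U\<^esub> (m::nat) \<otimes>\<^bsub>U\<^esub> x \<in> F n"
proof (induct m)
  case (Suc m)
  show ?case unfolding qp_Suc[OF F_closed[OF Suc(2)]] by (rule F_q[OF Suc(1)[OF Suc(2)]])
qed simp

lemma q_V: "q \<in> V" using V_gen[OF q_F] by simp

lemma qp_left_comm:
  "\<lbrakk>x \<in> carrier U; y \<in> carrier U\<rbrakk> \<Longrightarrow> x \<otimes>\<^bsub>U\<^esub> (q [^]\<^bsub>U\<^esub> (n::nat) \<otimes>\<^bsub>U\<^esub> y) = q [^]\<^bsub>U\<^esub> n \<otimes>\<^bsub>U\<^esub> (x \<otimes>\<^bsub>U\<^esub> y)"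
proof (induct n)
  case (Suc n)
  have "x \<otimes>\<^bsub>U\<^esub> (q [^]\<^bsub>U\<^esub> Suc n \<otimes>\<^bsub>U\<^esub> y) = q \<otimes>\<^bsub>U\<^esub> (x \<otimes>\<^bsub>U\<^esub> (q [^]\<^bsub>U\<^esub> n \<otimes>\<^bsub>U\<^esub> y))"
    unfolding qp_Suc[OF Suc(3)] using Suc(2,3) by (simp add: U.m_assoc[symmetric] q_central)
  then show ?case unfolding Suc(1)[OF Suc(2,3)] using Suc(2,3) qp_Suc[of "x \<otimes>\<^bsub>U\<^esub> y" n] by simp
qed simp

text \<open>The map \<open>e\<close> is under control on \<open>V\<close> only, so the factors
  \<open>q\<close> are taken out one by one, every intermediate argument remaining in
  \<open>V\<close>.\<close>

lemma e_gen: "x \<in> F n \<Longrightarrow> e (q [^]\<^bsub>U\<^esub> (m + n) \<otimes>\<^bsub>U\<^esub> x) = e q [^]\<^bsub>A\<^esub> m \<otimes>\<^bsub>A\<^esub> e (q [^]\<^bsub>U\<^esub> n \<otimes>\<^bsub>U\<^esub> x)"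
proof (induct m)
  case 0
  then show ?case using e_D[OF V_gen[OF 0]] by simp
next
  case (Suc m)
  have "q [^]\<^bsub>U\<^esub> (m + n) \<otimes>\<^bsub>U\<^esub> x = q [^]\<^bsub>U\<^esub> n \<otimes>\<^bsub>U\<^esub> (q [^]\<^bsub>U\<^esub> m \<otimes>\<^bsub>U\<^esub> x)"
    using Suc(2) by (simp add: U.m_assoc[symmetric] U.nat_pow_mult add.commute)
  then have V: "q [^]\<^bsub>U\<^esub> (m + n) \<otimes>\<^bsub>U\<^esub> x \<in> V" using V_gen[OF F_qp[OF Suc(2)]] by simp
  have "e (q [^]\<^bsub>U\<^esub> (Suc m + n) \<otimes>\<^bsub>U\<^esub> x) = e (q \<otimes>\<^bsub>U\<^esub> (q [^]\<^bsub>U\<^esub> (m + n) \<otimes>\<^bsub>U\<^esub> x))"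
    using Suc(2) by (simp only: add_Suc qp_Suc F_closed)
  also have "\<dots> = e q \<otimes>\<^bsub>A\<^esub> (e q [^]\<^bsub>A\<^esub> m \<otimes>\<^bsub>A\<^esub> e (q [^]\<^bsub>U\<^esub> n \<otimes>\<^bsub>U\<^esub> x))"
    unfolding e_mult[OF q_V V] Suc(1)[OF Suc(2)] ..
  also have "\<dots> = e q [^]\<^bsub>A\<^esub> Suc m \<otimes>\<^bsub>A\<^esub> e (q [^]\<^bsub>U\<^esub> n \<otimes>\<^bsub>U\<^esub> x)"
    using A.D_closed[OF e_D[OF V_gen[OF Suc(2)]]] by (simp add: R.m_assoc[symmetric] A.p_central)
  finally show ?case .
qed

lemma e_pow: "e (q [^]\<^bsub>U\<^esub> (m::nat)) = e q [^]\<^bsub>A\<^esub> m"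
  using e_gen[OF F_one, of m] by (simp add: e_one)

lemma qp_V: "q [^]\<^bsub>U\<^esub> (m::nat) \<in> V"
  using V_gen[OF F_qp[OF F_one], of m] by simp

text \<open>Every \<open>x \<in> F n\<close> satisfies \<open>q\<^sup>n x \<in> V\<close>, so that inverting \<open>e q\<close> extends \<open>e\<close> to \<open>U\<close>.\<close>

definition j :: "'b \<Rightarrow> 'a" where
  "j x = (THE a. a \<in> carrier A \<and> (\<forall>n. x \<in> F n \<longrightarrow> e q [^]\<^bsub>A\<^esub> n \<otimes>\<^bsub>A\<^esub> a = e (q [^]\<^bsub>U\<^esub> n \<otimes>\<^bsub>U\<^esub> x)))"

text \<open>For one \<open>n\<close> with \<open>x\<close> in \<open>F n\<close> the value must be
  e(q^n x) divided by the \<open>n\<close>-th power of e(q). For another exponent \<open>m\<close>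
  both sides agree after multiplication by that \<open>n\<close>-th power, which cancels.\<close>

lemma j_spec:
  assumes "x \<in> carrier U"
  shows "j x \<in> carrier A \<and> (\<forall>n. x \<in> F n \<longrightarrow> e q [^]\<^bsub>A\<^esub> n \<otimes>\<^bsub>A\<^esub> j x = e (q [^]\<^bsub>U\<^esub> n \<otimes>\<^bsub>U\<^esub> x))"
  unfolding j_def
proof (rule theI')
  obtain n where n: "x \<in> F n" using F_ex[OF assms] by blast
  have u: "e q [^]\<^bsub>A\<^esub> n \<in> Units A" by (rule R.Units_pow_closed[OF p_unit])
  let ?i = "inv\<^bsub>A\<^esub> (e q [^]\<^bsub>A\<^esub> n)"
  let ?e = "\<lambda>m. e (q [^]\<^bsub>U\<^esub> m \<otimes>\<^bsub>U\<^esub> x)"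
  have ec: "?e m \<in> carrier A" if "x \<in> F m" for m using e_D[OF V_gen[OF that]] by simp
  have a: "?i \<otimes>\<^bsub>A\<^esub> ?e n \<in> carrier A" using u ec[OF n] by simp
  have na: "e q [^]\<^bsub>A\<^esub> n \<otimes>\<^bsub>A\<^esub> (?i \<otimes>\<^bsub>A\<^esub> ?e n) = ?e n"
    using u ec[OF n] by (simp add: R.m_assoc[symmetric])
  show "\<exists>!a. a \<in> carrier A \<and> (\<forall>n. x \<in> F n \<longrightarrow> e q [^]\<^bsub>A\<^esub> n \<otimes>\<^bsub>A\<^esub> a = ?e n)"
  proof (rule ex1I[of _ "?i \<otimes>\<^bsub>A\<^esub> ?e n"], intro conjI allI impI a)
    fix m assume m: "x \<in> F m"
    have "e q [^]\<^bsub>A\<^esub> n \<otimes>\<^bsub>A\<^esub> (e q [^]\<^bsub>A\<^esub> m \<otimes>\<^bsub>A\<^esub> (?i \<otimes>\<^bsub>A\<^esub> ?e n))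
        = e q [^]\<^bsub>A\<^esub> m \<otimes>\<^bsub>A\<^esub> (e q [^]\<^bsub>A\<^esub> n \<otimes>\<^bsub>A\<^esub> (?i \<otimes>\<^bsub>A\<^esub> ?e n))"
      unfolding A.pp_add[OF a] by (simp add: add.commute)
    also have "\<dots> = e q [^]\<^bsub>A\<^esub> n \<otimes>\<^bsub>A\<^esub> ?e m"
      unfolding na e_gen[OF n, symmetric] e_gen[OF m, symmetric] by (simp add: add.commute)
    finally show "e q [^]\<^bsub>A\<^esub> m \<otimes>\<^bsub>A\<^esub> (?i \<otimes>\<^bsub>A\<^esub> ?e n) = ?e m"
      by (rule A.pp_cancel[rotated 2]) (use a ec[OF m] in simp_all)
  next
    fix b assume b: "b \<in> carrier A \<and> (\<forall>n. x \<in> F n \<longrightarrow> e q [^]\<^bsub>A\<^esub> n \<otimes>\<^bsub>A\<^esub> b = ?e n)"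
    then have "e q [^]\<^bsub>A\<^esub> n \<otimes>\<^bsub>A\<^esub> b = e q [^]\<^bsub>A\<^esub> n \<otimes>\<^bsub>A\<^esub> (?i \<otimes>\<^bsub>A\<^esub> ?e n)" using n na by simp
    then show "b = ?i \<otimes>\<^bsub>A\<^esub> ?e n" by (rule A.pp_cancel[rotated 2]) (use a b in simp_all)
  qed
qed

lemma j_closed: "x \<in> carrier U \<Longrightarrow> j x \<in> carrier A" by (rule conjunct1[OF j_spec])

lemma j_F: "x \<in> F n \<Longrightarrow> e q [^]\<^bsub>A\<^esub> n \<otimes>\<^bsub>A\<^esub> j x = e (q [^]\<^bsub>U\<^esub> n \<otimes>\<^bsub>U\<^esub> x)"
  using conjunct2[OF j_spec[of x]] by simp

lemma j_unique: "\<lbrakk>x \<in> F n; a \<in> carrier A; e q [^]\<^bsub>A\<^esub> n \<otimes>\<^bsub>A\<^esub> a = e (q [^]\<^bsub>U\<^esub> n \<otimes>\<^bsub>U\<^esub> x)\<rbrakk> \<Longrightarrow> j x = a"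
  by (rule A.pp_cancel[of _ _ n]) (simp_all add: j_closed j_F)

lemma j_V:
  assumes "x \<in> V"
  shows "j x = e x"
proof -
  obtain n where n: "x \<in> F n" using F_ex[OF V_closed[OF assms]] by blast
  show ?thesis
    by (rule j_unique[OF n]) (simp_all add: e_D assms e_mult[OF qp_V assms] e_pow)
qed

text \<open>By \<open>j_unique\<close> each identity has to be checked after multiplication by one
  power of e(q) only: the degrees add for a product, and a common degree serves for a sum.\<close>

lemma j_ring_hom: "j \<in> ring_hom U A"
proof (rule ring_hom_memI)
  fix x y assume x: "x \<in> carrier U" and y: "y \<in> carrier U"
  show "j x \<in> carrier A" by (rule j_closed[OF x])
  obtain m n where m: "x \<in> F m" and n: "y \<in> F n" using F_ex[OF x] F_ex[OF y] by blast
  show "j (x \<otimes>\<^bsub>U\<^esub> y) = j x \<otimes>\<^bsub>A\<^esub> j y"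
  proof (rule j_unique[OF F_mult[OF m n]])
    have "q [^]\<^bsub>U\<^esub> (m + n) \<otimes>\<^bsub>U\<^esub> (x \<otimes>\<^bsub>U\<^esub> y) = q [^]\<^bsub>U\<^esub> m \<otimes>\<^bsub>U\<^esub> (q [^]\<^bsub>U\<^esub> n \<otimes>\<^bsub>U\<^esub> (x \<otimes>\<^bsub>U\<^esub> y))"
      using x y by (simp add: U.m_assoc[symmetric] U.nat_pow_mult)
    also have "\<dots> = (q [^]\<^bsub>U\<^esub> m \<otimes>\<^bsub>U\<^esub> x) \<otimes>\<^bsub>U\<^esub> (q [^]\<^bsub>U\<^esub> n \<otimes>\<^bsub>U\<^esub> y)"
      using x y qp_left_comm[OF x y, of n] by (simp add: U.m_assoc)
    finally have "e (q [^]\<^bsub>U\<^esub> (m + n) \<otimes>\<^bsub>U\<^esub> (x \<otimes>\<^bsub>U\<^esub> y))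
        = (e q [^]\<^bsub>A\<^esub> m \<otimes>\<^bsub>A\<^esub> j x) \<otimes>\<^bsub>A\<^esub> (e q [^]\<^bsub>A\<^esub> n \<otimes>\<^bsub>A\<^esub> j y)"
      using e_mult[OF V_gen[OF m] V_gen[OF n]] by (simp add: j_F[OF m] j_F[OF n])
    also have "\<dots> = e q [^]\<^bsub>A\<^esub> m \<otimes>\<^bsub>A\<^esub> (e q [^]\<^bsub>A\<^esub> n \<otimes>\<^bsub>A\<^esub> (j x \<otimes>\<^bsub>A\<^esub> j y))"
      using A.pp_left_comm[OF j_closed[OF x] j_closed[OF y], of n] x y by (simp add: R.m_assoc j_closed)
    also have "\<dots> = e q [^]\<^bsub>A\<^esub> (m + n) \<otimes>\<^bsub>A\<^esub> (j x \<otimes>\<^bsub>A\<^esub> j y)"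
      using x y by (simp add: A.pp_add j_closed)
    finally show "e q [^]\<^bsub>A\<^esub> (m + n) \<otimes>\<^bsub>A\<^esub> (j x \<otimes>\<^bsub>A\<^esub> j y) = e (q [^]\<^bsub>U\<^esub> (m + n) \<otimes>\<^bsub>U\<^esub> (x \<otimes>\<^bsub>U\<^esub> y))" by simp
  qed (use x y j_closed in simp)
  obtain k where k: "x \<in> F k" "y \<in> F k" using F_common[OF x y] by blast
  show "j (x \<oplus>\<^bsub>U\<^esub> y) = j x \<oplus>\<^bsub>A\<^esub> j y"
  proof (rule j_unique[OF additive_subgroup.a_closed[OF F_subgroup k]])
    show "e q [^]\<^bsub>A\<^esub> k \<otimes>\<^bsub>A\<^esub> (j x \<oplus>\<^bsub>A\<^esub> j y) = e (q [^]\<^bsub>U\<^esub> k \<otimes>\<^bsub>U\<^esub> (x \<oplus>\<^bsub>U\<^esub> y))"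
      using x y e_add[OF V_gen[OF k(1)] V_gen[OF k(2)]]
      by (simp add: R.r_distr U.r_distr j_closed j_F[OF k(1)] j_F[OF k(2)])
  qed (use x y j_closed in simp)
next
  show "j \<one>\<^bsub>U\<^esub> = \<one>\<^bsub>A\<^esub>" by (rule j_unique[OF F_one]) (simp_all add: e_one)
qed

sublocale j: ring_hom_ring U A j by (rule ring_hom_ringI2[OF U.ring_axioms R.ring_axioms j_ring_hom])

lemma \<psi>_j:
  assumes "x \<in> carrier U"
  shows "\<psi> (j x) = f x"
proof -
  obtain n where n: "x \<in> F n" using F_ex[OF assms] by blast
  have pw: "\<psi> (e q [^]\<^bsub>A\<^esub> n) = f q [^]\<^bsub>M\<^esub> n"
    using \<psi>_e[OF qp_V, of n] by (simp add: e_pow f.hom_nat_pow)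
  have "f q [^]\<^bsub>M\<^esub> n \<otimes>\<^bsub>M\<^esub> \<psi> (j x) = \<psi> (e q [^]\<^bsub>A\<^esub> n \<otimes>\<^bsub>A\<^esub> j x)"
    using assms by (simp add: pw)
  also have "\<dots> = f (q [^]\<^bsub>U\<^esub> n \<otimes>\<^bsub>U\<^esub> x)" unfolding j_F[OF n] by (rule \<psi>_e[OF V_gen[OF n]])
  also have "\<dots> = f q [^]\<^bsub>M\<^esub> n \<otimes>\<^bsub>M\<^esub> f x" using assms by (simp add: f.hom_nat_pow)
  finally show ?thesis by (rule M.pp_cancel[rotated 2]) (use assms in simp_all)
qed

lemma j_filtered_adic: "filtered_adic A (e q) D (\<lambda>n. j ` F n)"
proof (intro filtered_adic.intro filtered_adic_axioms.intro A.adic_subring_axioms)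
  show "additive_subgroup (j ` F n) A" for n by (rule j.image_additive_subgroup[OF F_subgroup])
  show "j ` F n \<subseteq> j ` F (Suc n)" for n by (rule image_mono[OF F_mono])
  show "\<one>\<^bsub>A\<^esub> \<in> j ` F 0" by (rule image_eqI[of _ j "\<one>\<^bsub>U\<^esub>"]) (simp_all add: F_one)
  show "x \<otimes>\<^bsub>A\<^esub> y \<in> j ` F (i + k)" if "x \<in> j ` F i" "y \<in> j ` F k" for x y i k
    using that by (auto intro!: image_eqI[OF _ F_mult])
  show "e q \<otimes>\<^bsub>A\<^esub> x \<in> j ` F n" if "x \<in> j ` F n" for x n
    using that j_V[OF q_V] by (auto intro!: image_eqI[OF _ F_q])
  show "e q [^]\<^bsub>A\<^esub> n \<otimes>\<^bsub>A\<^esub> x \<in> D" if "x \<in> j ` F n" for x n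
    using that by (auto simp: j_F intro!: e_D V_gen)
  fix d assume "d \<in> D"
  then obtain x d' where d: "x \<in> V" "d' \<in> D" "d = e x \<oplus>\<^bsub>A\<^esub> e q \<otimes>\<^bsub>A\<^esub> d'" using e_dense by blast
  have "j x \<in> additive_span A (j ` {q [^]\<^bsub>U\<^esub> n \<otimes>\<^bsub>U\<^esub> f | (n::nat) f. f \<in> F n})"
    by (rule j.hom_additive_span[OF d(1)]) auto
  moreover have "j ` {q [^]\<^bsub>U\<^esub> n \<otimes>\<^bsub>U\<^esub> f | (n::nat) f. f \<in> F n}
      \<subseteq> {e q [^]\<^bsub>A\<^esub> n \<otimes>\<^bsub>A\<^esub> f | (n::nat) f. f \<in> j ` F n}"
  proof
    fix y assume "y \<in> j ` {q [^]\<^bsub>U\<^esub> n \<otimes>\<^bsub>U\<^esub> f | (n::nat) f. f \<in> F n}"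
    then obtain n f where "y = j (q [^]\<^bsub>U\<^esub> n \<otimes>\<^bsub>U\<^esub> f)" and f: "f \<in> F n" by blast
    then have "y = e q [^]\<^bsub>A\<^esub> n \<otimes>\<^bsub>A\<^esub> j f" using j_V[OF V_gen[OF f]] by (simp add: j_F)
    then show "y \<in> {e q [^]\<^bsub>A\<^esub> n \<otimes>\<^bsub>A\<^esub> f | (n::nat) f. f \<in> j ` F n}" using f by blast
  qed
  ultimately have "j x \<in> additive_span A {e q [^]\<^bsub>A\<^esub> n \<otimes>\<^bsub>A\<^esub> f | (n::nat) f. f \<in> j ` F n}"
    by (rule subsetD[OF additive_span_mono, rotated])
  moreover have "d \<ominus>\<^bsub>A\<^esub> j x \<in> A.nbhd 1"
  proof -
    have "d \<ominus>\<^bsub>A\<^esub> j x = (e x \<ominus>\<^bsub>A\<^esub> e x) \<oplus>\<^bsub>A\<^esub> e q \<otimes>\<^bsub>A\<^esub> d'"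
      unfolding j_V[OF d(1)] d(3) using d e_D[OF d(1)] by (simp add: R.minus_eq R.a_ac)
    also have "\<dots> = e q [^]\<^bsub>A\<^esub> (1::nat) \<otimes>\<^bsub>A\<^esub> d'" using d e_D[OF d(1)] by (simp add: R.minus_eq R.r_neg)
    finally show ?thesis using A.nbhdI[OF d(2), of 1] by simp
  qed
  ultimately show "\<exists>u\<in>additive_span A {e q [^]\<^bsub>A\<^esub> n \<otimes>\<^bsub>A\<^esub> f | (n::nat) f. f \<in> j ` F n}. d \<ominus>\<^bsub>A\<^esub> u \<in> A.nbhd 1"
    by (rule bexI[rotated])
qed

text \<open>A graded family in \<open>A\<close> is pulled back to \<open>U\<close>. Since
  \<open>L n\<close> lies in the image of \<open>F n\<close>, the pullback maps onto it, and the
  images of its generators generate.\<close>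

lemma j_graded_noetherian:
  assumes "graded_noetherian U F"
  shows "graded_noetherian A (\<lambda>n. j ` F n)"
  unfolding graded_noetherian_def
proof (intro allI impI)
  fix L assume L: "graded_family A (\<lambda>n. j ` F n) L"
  have L_sub: "additive_subgroup (L n) A" and LF: "L n \<subseteq> j ` F n"
    and L_low: "filt_lower (\<lambda>n. j ` F n) n \<subseteq> L n" for n using L unfolding graded_family_def by simp_all
  have L_mult: "x \<otimes>\<^bsub>A\<^esub> y \<in> L (n + m)" if "x \<in> L n" "y \<in> j ` F m" for x y n m
    using bspec[OF bspec[OF spec[OF spec[OF conjunct2[OF L[unfolded graded_family_def]]]] that(1)] that(2)] .
  define L' where "L' n = {x \<in> F n. j x \<in> L n}" for n
  have low: "filt_lower (\<lambda>n. j ` F n) n = j ` filt_lower F n" for n by (simp add: filt_lower_def)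
  have family: "graded_family U F L'"
    unfolding graded_family_def
  proof (intro conjI allI ballI)
    fix n
    show "additive_subgroup (L' n) U"
    proof (rule U.additive_subgroup_diffI)
      show "\<zero>\<^bsub>U\<^esub> \<in> L' n"
        by (simp add: L'_def additive_subgroup.zero_closed[OF F_subgroup] additive_subgroup.zero_closed[OF L_sub])
      fix x y assume "x \<in> L' n" "y \<in> L' n"
      then have xy: "x \<in> F n" "y \<in> F n" "j x \<in> L n" "j y \<in> L n" by (simp_all add: L'_def)
      then show "x \<ominus>\<^bsub>U\<^esub> y \<in> L' n"
        using U.additive_subgroup_diff[OF F_subgroup xy(1,2)] R.additive_subgroup_diff[OF L_sub xy(3,4)]
          j.hom_minus[OF F_closed[OF xy(1)] F_closed[OF xy(2)]] by (simp add: L'_def)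
    qed (auto simp: L'_def)
    show "L' n \<subseteq> F n" by (auto simp: L'_def)
    show "filt_lower F n \<subseteq> L' n"
      using L_low[of n] F_mono[of "n - 1"] by (cases n) (auto simp: L'_def filt_lower_def)
    fix m x y assume "x \<in> L' n" and y: "y \<in> F m"
    then have x: "x \<in> F n" "j x \<in> L n" by (simp_all add: L'_def)
    then show "x \<otimes>\<^bsub>U\<^esub> y \<in> L' (n + m)"
      using F_mult[OF x(1) y] L_mult[OF x(2) imageI[OF y]] j.hom_mult[OF F_closed[OF x(1)] F_closed[OF y]]
      by (simp add: L'_def)
  qed
  obtain J where J: "finite J" "\<forall>(m, g)\<in>J. g \<in> L' m"
    "\<forall>n. L' n \<subseteq> additive_span U ({g \<otimes>\<^bsub>U\<^esub> y | m g y. (m, g) \<in> J \<and> m \<le> n \<and> y \<in> F (n - m)} \<union> filt_lower F n)"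
    using mp[OF spec[OF assms[unfolded graded_noetherian_def]] family] by (elim exE conjE) (rule that)
  let ?J = "(\<lambda>(m, g). (m, j g)) ` J"
  let ?Q = "\<lambda>n. {g \<otimes>\<^bsub>U\<^esub> y | m g y. (m, g) \<in> J \<and> m \<le> n \<and> y \<in> F (n - m)} \<union> filt_lower F n"
  let ?Q' = "\<lambda>n. {g \<otimes>\<^bsub>A\<^esub> y | m g y. (m, g) \<in> ?J \<and> m \<le> n \<and> y \<in> j ` F (n - m)} \<union> filt_lower (\<lambda>n. j ` F n) n"
  have JF: "g \<in> carrier U" if "(m, g) \<in> J" for m g
    using bspec[OF J(2) that] by (auto simp: L'_def)
  have Qc: "?Q n \<subseteq> carrier U" for n using JF by (auto simp: filt_lower_def split: if_splits)
  have Q: "j ` ?Q n \<subseteq> ?Q' n" for n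
  proof
    fix z assume "z \<in> j ` ?Q n"
    then consider m g y where "z = j (g \<otimes>\<^bsub>U\<^esub> y)" "(m, g) \<in> J" "m \<le> n" "y \<in> F (n - m)"
      | "z \<in> j ` filt_lower F n" by blast
    then show "z \<in> ?Q' n"
    proof cases
      case 1
      have "z = j g \<otimes>\<^bsub>A\<^esub> j y" "(m, j g) \<in> ?J" "j y \<in> j ` F (n - m)"
        using 1 JF[OF 1(2)] by (force simp: image_iff)+
      then show ?thesis using 1(3) by blast
    qed (simp add: low)
  qed
  have "L n \<subseteq> additive_span A (?Q' n)" for n
  proof
    fix z assume z: "z \<in> L n"
    then obtain x where x: "x \<in> F n" "z = j x" using LF by blast
    then have "x \<in> additive_span U (?Q n)" using z spec[OF J(3), of n] by (auto simp: L'_def)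
    then show "z \<in> additive_span A (?Q' n)"
      unfolding x(2) by (intro subsetD[OF additive_span_mono[OF Q]] j.hom_additive_span Qc)
  qed
  moreover have "\<forall>(m, g)\<in>?J. g \<in> L m" using J(2) by (auto simp: L'_def)
  ultimately show "\<exists>J. finite J \<and> (\<forall>(m, g)\<in>J. g \<in> L m) \<and> (\<forall>n. L n \<subseteq> additive_span A
      ({g \<otimes>\<^bsub>A\<^esub> y | m g y. (m, g) \<in> J \<and> m \<le> n \<and> y \<in> j ` F (n - m)} \<union> filt_lower (\<lambda>n. j ` F n) n))"
    using J(1) by (intro exI[of _ ?J]) simp
qed

theorem equationally_flat:
  assumes "graded_noetherian U F"
  shows "equationally_flat A (ring_as_left_module \<psi> M)"
proof -
  interpret J: filtered_adic A "e q" D "\<lambda>n. j ` F n" by (rule j_filtered_adic)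
  have \<psi>q: "\<psi> (e q) = f q" by (rule \<psi>_e[OF q_V])
  have jB: "j x \<in> J.B" if "x \<in> carrier U" for x
    using F_ex[OF that] J.U_B by (auto simp: J.U_def)
  have M_adic: "adic_subring M (\<psi> (e q)) C" unfolding \<psi>q by (rule M.adic_subring_axioms)
  interpret CL: completed_localization A M \<psi> "e q" C J.B
  proof (intro completed_localization.intro completed_localization_axioms.intro ring_hom_ring_axioms M_adic)
    show "e q \<in> carrier A" by simp
    show "x \<otimes>\<^bsub>A\<^esub> e q = e q \<otimes>\<^bsub>A\<^esub> x" if "x \<in> carrier A" for x by (rule A.p_central[OF that])
    show "x = \<zero>\<^bsub>A\<^esub>" if "x \<in> carrier A" "e q \<otimes>\<^bsub>A\<^esub> x = \<zero>\<^bsub>A\<^esub>" for x by (rule A.p_cancel[OF that])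
    obtain i where "i \<in> carrier A" "i \<otimes>\<^bsub>A\<^esub> e q = \<one>\<^bsub>A\<^esub>" "e q \<otimes>\<^bsub>A\<^esub> i = \<one>\<^bsub>A\<^esub>"
      using p_unit by (auto simp: Units_def)
    then have "\<psi> i \<in> carrier M" "\<psi> i \<otimes>\<^bsub>M\<^esub> \<psi> (e q) = \<one>\<^bsub>M\<^esub>" "\<psi> (e q) \<otimes>\<^bsub>M\<^esub> \<psi> i = \<one>\<^bsub>M\<^esub>"
      by (simp_all flip: hom_mult)
    then show "\<psi> (e q) \<in> Units M" unfolding Units_def by auto
    show "additive_subgroup J.B A" by (rule J.B_subgroup)
    show "x \<otimes>\<^bsub>A\<^esub> y \<in> J.B" if "x \<in> J.B" "y \<in> J.B" for x y by (rule J.B_mult[OF that])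
    show "\<one>\<^bsub>A\<^esub> \<in> J.B" using jB[of "\<one>\<^bsub>U\<^esub>"] by simp
    show "e q \<in> J.B" using J.D_B A.D_p by blast
    show "finitely_generated_right_ideals A J.B"
      by (rule J.B_noetherian[OF j_graded_noetherian[OF assms]])
    show "\<exists>n::nat. e q [^]\<^bsub>A\<^esub> n \<otimes>\<^bsub>A\<^esub> x \<in> J.B" if "x \<in> carrier A" for x
      using A_D[OF that] J.D_B by blast
    show "\<exists>n::nat. \<psi> (e q) [^]\<^bsub>M\<^esub> n \<otimes>\<^bsub>M\<^esub> c \<in> C" if "c \<in> carrier M" for c
      unfolding \<psi>q by (rule M_C[OF that])
    have decomp: "\<exists>u\<in>carrier U. \<exists>d\<in>D. x = j u \<oplus>\<^bsub>A\<^esub> d" if "x \<in> J.B" for x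
      using J.B_decomp[OF that] by auto
    show "\<psi> x \<in> C" if x: "x \<in> J.B" for x
    proof -
      obtain u d where u: "u \<in> carrier U" "d \<in> D" "x = j u \<oplus>\<^bsub>A\<^esub> d" using decomp[OF x] by blast
      then have "\<psi> x = f u \<oplus>\<^bsub>M\<^esub> \<psi> d" by (simp add: \<psi>_j)
      then show ?thesis
        using additive_subgroup.a_closed[OF M.D_subgroup f_C[OF u(1)] \<psi>_D[OF u(2)]] by simp
    qed
    show "\<exists>x\<in>J.B. \<exists>c'\<in>C. c = \<psi> x \<oplus>\<^bsub>M\<^esub> \<psi> (e q) \<otimes>\<^bsub>M\<^esub> c'" if c: "c \<in> C" for c
    proof -
      obtain x c' where "x \<in> carrier U" "c' \<in> C" "c = f x \<oplus>\<^bsub>M\<^esub> f q \<otimes>\<^bsub>M\<^esub> c'"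
        using f_dense[OF c] by blast
      then show ?thesis by (intro bexI[of _ "j x"] bexI[of _ c']) (simp_all add: \<psi>_j \<psi>q jB)
    qed
    fix x c assume x: "x \<in> J.B" and c: "c \<in> C" and eq: "\<psi> x = \<psi> (e q) \<otimes>\<^bsub>M\<^esub> c"
    obtain u d where u: "u \<in> carrier U" "d \<in> D" "x = j u \<oplus>\<^bsub>A\<^esub> d" using decomp[OF x] by blast
    \<comment> \<open>Modulo e(q) \<open>D\<close>, elements of \<open>D\<close> come from
      \<open>V\<close> and hence from \<open>U\<close>. So \<open>x\<close> is the image of one
      element of \<open>U\<close> up to a multiple of e(q), and strictness reduces to
      \<open>f_divisible\<close>.\<close>
    obtain w d' where d: "w \<in> V" "d' \<in> D" "d = e w \<oplus>\<^bsub>A\<^esub> e q \<otimes>\<^bsub>A\<^esub> d'" using e_dense[OF u(2)] by blast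
    have wc: "w \<in> carrier U" by (rule V_closed[OF d(1)])
    have dC: "\<psi> d' \<in> C" by (rule \<psi>_D[OF d(2)])
    have xd: "x = j (u \<oplus>\<^bsub>U\<^esub> w) \<oplus>\<^bsub>A\<^esub> e q \<otimes>\<^bsub>A\<^esub> d'"
      unfolding u(3) d(3) j_V[OF d(1), symmetric] using u(1) wc d(2) by (simp add: R.a_assoc)
    then have "f (u \<oplus>\<^bsub>U\<^esub> w) \<oplus>\<^bsub>M\<^esub> f q \<otimes>\<^bsub>M\<^esub> \<psi> d' = f q \<otimes>\<^bsub>M\<^esub> c"
      using eq u(1) wc d(2) \<psi>_j[of "u \<oplus>\<^bsub>U\<^esub> w"] by (simp add: \<psi>q)
    then have "f (u \<oplus>\<^bsub>U\<^esub> w) = f q \<otimes>\<^bsub>M\<^esub> c \<ominus>\<^bsub>M\<^esub> f q \<otimes>\<^bsub>M\<^esub> \<psi> d'"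
      using u(1) wc dC by (simp add: S.minus_eq S.a_assoc S.r_neg flip: \<open>_ = f q \<otimes>\<^bsub>M\<^esub> c\<close>)
    also have "\<dots> = f q \<otimes>\<^bsub>M\<^esub> (c \<ominus>\<^bsub>M\<^esub> \<psi> d')"
      using c dC by (simp add: S.minus_eq S.r_distr S.r_minus)
    finally obtain y where y: "y \<in> carrier U" "u \<oplus>\<^bsub>U\<^esub> w = q \<otimes>\<^bsub>U\<^esub> y"
      using f_divisible[of "u \<oplus>\<^bsub>U\<^esub> w" "c \<ominus>\<^bsub>M\<^esub> \<psi> d'"] u(1) wc S.additive_subgroup_diff[OF M.D_subgroup c dC]
      by auto
    have "x = e q \<otimes>\<^bsub>A\<^esub> (j y \<oplus>\<^bsub>A\<^esub> d')"
      unfolding xd y(2) using y(1) d(2) j_V[OF q_V] by (simp add: R.r_distr)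
    moreover have "j y \<oplus>\<^bsub>A\<^esub> d' \<in> J.B"
      by (rule additive_subgroup.a_closed[OF J.B_subgroup jB[OF y(1)] subsetD[OF J.D_B d(2)]])
    ultimately show "\<exists>x'\<in>J.B. x = e q \<otimes>\<^bsub>A\<^esub> x'" by (rule bexI)
  qed
  show ?thesis by (rule CL.equationally_flat)
qed

end

section \<open>Passage to opposite rings\<close>

lemma (in ring) ring_opposite: "ring (opposite_ring R)"
proof (rule ringI)
  show "abelian_group (opposite_ring R)"
    by (rule abelian_groupI) (auto simp: a_ac intro!: bexI[of _ "\<ominus> x" for x] l_neg)
  show "monoid (opposite_ring R)" by unfold_locales (auto simp: m_assoc)
qed (auto simp: l_distr r_distr)

lemma (in ring) opposite_ring_pow:
  assumes "x \<in> carrier R"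
  shows "x [^]\<^bsub>opposite_ring R\<^esub> (n::nat) = x [^] n"
proof (induct n)
  case (Suc n)
  interpret O: ring "opposite_ring R" by (rule ring_opposite)
  show ?case using Suc assms nat_pow_Suc2[of x n] by (simp del: nat_pow_Suc)
qed (simp add: nat_pow_def)

lemma (in ring_hom_ring) opposite: "ring_hom_ring (opposite_ring R) (opposite_ring S) h"
proof (rule ring_hom_ringI2[OF R.ring_opposite S.ring_opposite])
  show "h \<in> ring_hom (opposite_ring R) (opposite_ring S)" by (rule ring_hom_memI) simp_all
qed

lemma (in ring) Units_opposite: "Units (opposite_ring R) = Units R"
  by (auto simp: Units_def)

lemma additive_subgroup_opposite: "additive_subgroup H (opposite_ring R) = additive_subgroup H R"
  by (simp add: additive_subgroup_def opposite_ring_def)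

lemma (in adic_subring) opposite: "adic_subring (opposite_ring A) p D"
proof -
  have im: "(\<lambda>d. p [^]\<^bsub>opposite_ring A\<^esub> n \<otimes>\<^bsub>opposite_ring A\<^esub> d) ` D = (\<lambda>d. p [^] n \<otimes> d) ` D" for n :: nat
    by (rule image_cong) (simp_all add: opposite_ring_pow pp_central)
  show ?thesis
  proof (intro adic_subring.intro adic_subring_axioms.intro ring_opposite, unfold im additive_subgroup_opposite)
    show "additive_subgroup D A" by (rule D_subgroup)
    show "\<exists>l\<in>D. \<forall>n. s n \<ominus>\<^bsub>opposite_ring A\<^esub> l \<in> (\<lambda>d. p [^] n \<otimes> d) ` D"
      if "\<And>n. s n \<in> D" "\<And>n. s (Suc n) \<ominus>\<^bsub>opposite_ring A\<^esub> s n \<in> (\<lambda>d. p [^] n \<otimes> d) ` D" for s :: "nat \<Rightarrow> 'a"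
      using D_complete[of s] that by simp
    show "x = \<zero>\<^bsub>opposite_ring A\<^esub>" if "\<And>n::nat. x \<in> (\<lambda>d. p [^] n \<otimes> d) ` D" for x
      using D_separated[OF that] by simp
  qed (simp_all add: p_central p_cancel D_mult D_p D_one)
qed

text \<open>The setting is symmetric because \<open>q\<close> and its images are central:
  \<open>V\<close>, the neighbourhoods and all divisibility conditions are the same on both
  sides.\<close>

lemma (in deformation_completion) opposite:
  "deformation_completion (opposite_ring A) (opposite_ring M) \<psi> (opposite_ring U) e f q D C F"
proof -
  have gens: "{q [^]\<^bsub>opposite_ring U\<^esub> n \<otimes>\<^bsub>opposite_ring U\<^esub> f | (n::nat) f. f \<in> F n}
      = {q [^]\<^bsub>U\<^esub> n \<otimes>\<^bsub>U\<^esub> f | (n::nat) f. f \<in> F n}"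
  proof -
    have "q [^]\<^bsub>opposite_ring U\<^esub> n \<otimes>\<^bsub>opposite_ring U\<^esub> f = q [^]\<^bsub>U\<^esub> n \<otimes>\<^bsub>U\<^esub> f" if "f \<in> F n" for f and n :: nat
      using qp_left_comm[of f "\<one>\<^bsub>U\<^esub>" n] that by (simp add: U.opposite_ring_pow)
    then show ?thesis by (intro Collect_cong ex_cong1) auto
  qed
  have A_pow: "e q [^]\<^bsub>opposite_ring A\<^esub> (n::nat) \<otimes>\<^bsub>opposite_ring A\<^esub> x = e q [^]\<^bsub>A\<^esub> n \<otimes>\<^bsub>A\<^esub> x" if "x \<in> carrier A" for x n
    using that by (simp add: R.opposite_ring_pow A.pp_central)
  have M_pow: "f q [^]\<^bsub>opposite_ring M\<^esub> (n::nat) \<otimes>\<^bsub>opposite_ring M\<^esub> x = f q [^]\<^bsub>M\<^esub> n \<otimes>\<^bsub>M\<^esub> x" if "x \<in> carrier M" for x n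
    using that by (simp add: S.opposite_ring_pow M.pp_central)
  show ?thesis
  proof (intro deformation_completion.intro deformation_completion_axioms.intro opposite U.ring_opposite
      A.opposite M.opposite, unfold gens additive_span_opposite additive_subgroup_opposite)
    show "additive_subgroup (F n) U" for n by (rule F_subgroup)
    show "F n \<subseteq> F (Suc n)" for n by (rule F_mono)
    show "x \<otimes>\<^bsub>opposite_ring U\<^esub> y \<in> F (i + k)" if "x \<in> F i" "y \<in> F k" for x y i k
      using F_mult[OF that(2,1)] by (simp add: add.commute)
    show "(\<Union>n. F n) = carrier (opposite_ring U)" using F_exhaustive by simp
    show "x \<otimes>\<^bsub>opposite_ring U\<^esub> q = q \<otimes>\<^bsub>opposite_ring U\<^esub> x" if "x \<in> carrier (opposite_ring U)" for x
      using that by (simp add: q_central)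
    show "e (x \<otimes>\<^bsub>opposite_ring U\<^esub> y) = e x \<otimes>\<^bsub>opposite_ring A\<^esub> e y" if "x \<in> V" "y \<in> V" for x y
      using e_mult[OF that(2,1)] by simp
    show "\<exists>x\<in>V. \<exists>d'\<in>D. d = e x \<oplus>\<^bsub>opposite_ring A\<^esub> e q \<otimes>\<^bsub>opposite_ring A\<^esub> d'" if d: "d \<in> D" for d
    proof -
      obtain x d' where "x \<in> V" "d' \<in> D" "d = e x \<oplus>\<^bsub>A\<^esub> e q \<otimes>\<^bsub>A\<^esub> d'" using e_dense[OF d] by blast
      then show ?thesis by (intro bexI[of _ x] bexI[of _ d']) (simp_all add: A.p_central)
    qed
    show "e q \<in> Units (opposite_ring A)" using p_unit by (simp add: R.Units_opposite)
    show "\<exists>n::nat. e q [^]\<^bsub>opposite_ring A\<^esub> n \<otimes>\<^bsub>opposite_ring A\<^esub> x \<in> D" if "x \<in> carrier (opposite_ring A)" for x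
      using A_D[of x] that A_pow[of x] by simp
    show "\<exists>n::nat. f q [^]\<^bsub>opposite_ring M\<^esub> n \<otimes>\<^bsub>opposite_ring M\<^esub> x \<in> C" if "x \<in> carrier (opposite_ring M)" for x
      using M_C[of x] that M_pow[of x] by simp
    show "f \<in> ring_hom (opposite_ring U) (opposite_ring M)"
      using ring_hom_ring.homh[OF f.opposite] .
    show "\<exists>x\<in>carrier (opposite_ring U). \<exists>c'\<in>C. c = f x \<oplus>\<^bsub>opposite_ring M\<^esub> f q \<otimes>\<^bsub>opposite_ring M\<^esub> c'" if c: "c \<in> C" for c
    proof -
      obtain x c' where "x \<in> carrier U" "c' \<in> C" "c = f x \<oplus>\<^bsub>M\<^esub> f q \<otimes>\<^bsub>M\<^esub> c'" using f_dense[OF c] by blast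
      then show ?thesis by (intro bexI[of _ x] bexI[of _ c']) (simp_all add: M.p_central)
    qed
    show "\<exists>y\<in>carrier (opposite_ring U). x = q \<otimes>\<^bsub>opposite_ring U\<^esub> y"
      if x: "x \<in> carrier (opposite_ring U)" "c \<in> C" "f x = f q \<otimes>\<^bsub>opposite_ring M\<^esub> c" for x c
    proof -
      obtain y where "y \<in> carrier U" "x = q \<otimes>\<^bsub>U\<^esub> y"
        using f_divisible[of x c] x M.p_central[OF M.D_closed[OF x(2)]] by auto
      then show ?thesis by (intro bexI[of _ y]) (simp_all add: q_central)
    qed
  qed (simp_all add: F_one q_F e_D e_add e_one f_C \<psi>_e \<psi>_D)
qed

section \<open>The first deformation as a subalgebra\<close>

lemma (in assoc_algebra) subalgebra:
  assumes H: "H \<subseteq> carrier U" "\<one>\<^bsub>U\<^esub> \<in> H"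
    and diff: "\<And>x y. \<lbrakk>x \<in> H; y \<in> H\<rbrakk> \<Longrightarrow> x \<ominus>\<^bsub>U\<^esub> y \<in> H"
    and mult: "\<And>x y. \<lbrakk>x \<in> H; y \<in> H\<rbrakk> \<Longrightarrow> x \<otimes>\<^bsub>U\<^esub> y \<in> H"
    and smult: "\<And>a x. \<lbrakk>a \<in> carrier R; x \<in> H\<rbrakk> \<Longrightarrow> a \<odot>\<^bsub>U\<^esub> x \<in> H"
  shows "assoc_algebra R (U\<lparr>carrier := H\<rparr>)"
proof -
  have zero: "\<zero>\<^bsub>U\<^esub> \<in> H" using diff[OF H(2) H(2)] by (simp add: M.minus_eq M.r_neg)
  have sub: "additive_subgroup H U" by (rule M.additive_subgroup_diffI[OF H(1) zero diff])
  have neg: "\<ominus>\<^bsub>U\<^esub> x \<in> H" if "x \<in> H" for x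
    using additive_subgroup.a_inv_closed[OF sub that] .
  have add: "x \<oplus>\<^bsub>U\<^esub> y \<in> H" if "x \<in> H" "y \<in> H" for x y
    using additive_subgroup.a_closed[OF sub that] .
  have Hc: "x \<in> carrier U" if "x \<in> H" for x using that H(1) by blast
  have r: "ring (U\<lparr>carrier := H\<rparr>)"
    by (rule U.subring_is_ring[OF U.subringI[OF H(1,2) neg mult add]])
  then have "abelian_group (U\<lparr>carrier := H\<rparr>)" by (rule ring.is_abelian_group)
  then show ?thesis
    using r R.is_cring
    by (intro assoc_algebra.intro left_module.intro left_module_axioms.intro assoc_algebra_axioms.intro R.ring_axioms)
       (simp_all add: Hc smult smult_l_distr smult_r_distr smult_assoc1 smult_mult_left smult_mult_right)
qed

context positively_filtered_algebra
begin

lemma smult_one_central: "\<lbrakk>a \<in> carrier R; x \<in> carrier U\<rbrakk> \<Longrightarrow> x \<otimes>\<^bsub>U\<^esub> (a \<odot>\<^bsub>U\<^esub> \<one>\<^bsub>U\<^esub>) = (a \<odot>\<^bsub>U\<^esub> \<one>\<^bsub>U\<^esub>) \<otimes>\<^bsub>U\<^esub> x"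
  by (simp add: smult_mult_left smult_mult_right)

lemma smult_one_pow: "a \<in> carrier R \<Longrightarrow> (a \<odot>\<^bsub>U\<^esub> \<one>\<^bsub>U\<^esub>) [^]\<^bsub>U\<^esub> (n::nat) = (a [^]\<^bsub>R\<^esub> n) \<odot>\<^bsub>U\<^esub> \<one>\<^bsub>U\<^esub>"
  by (induct n) (simp_all add: smult_mult_left smult_mult_right smult_assoc1[symmetric] R.m_comm)

text \<open>The sums in the definition have varying lengths, and a difference of two requires a
  common length, reached by padding with zeros. In exchange the span comes with an induction
  rule.\<close>

lemma carrier_deformation:
  assumes \<pi>: "\<pi> \<in> carrier R"
  shows "carrier (deformation R \<pi> U F 1) = additive_span U {(\<pi> [^]\<^bsub>R\<^esub> n) \<odot>\<^bsub>U\<^esub> f | (n::nat) f. f \<in> F n}"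
    (is "?H = additive_span U ?Q")
proof (rule equalityI)
  let ?s = "\<lambda>x m. finsum U (\<lambda>i. (\<pi> [^]\<^bsub>R\<^esub> (i::nat)) \<odot>\<^bsub>U\<^esub> x i) {..m}"
  have H: "?H = {?s x m | x m. \<forall>i\<le>m. x i \<in> F i}" by (simp add: deformation_def)
  have Qc: "?Q \<subseteq> carrier U" using \<pi> F_closed by auto
  show "?H \<subseteq> additive_span U ?Q"
  proof
    fix z assume "z \<in> ?H"
    then obtain x m where x: "z = ?s x m" "\<forall>i\<le>m. x i \<in> F i" unfolding H by blast
    show "z \<in> additive_span U ?Q"
      unfolding x(1)
    proof (rule M.finsum_in_subgroup[OF M.additive_span_subgroup[OF Qc]])
      fix i assume "i \<in> {..m}"
      then show "(\<pi> [^]\<^bsub>R\<^esub> i) \<odot>\<^bsub>U\<^esub> x i \<in> additive_span U ?Q"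
        using x(2) by (intro additive_span.gen) blast
    qed
  qed
  have pad: "?s x m = ?s (\<lambda>i. if i \<le> m then x i else \<zero>\<^bsub>U\<^esub>) (m + k)" if x: "\<forall>i\<le>m. x i \<in> F i" for x m k
  proof (induct k)
    case 0
    show ?case by (rule M.finsum_cong') (use x F_closed \<pi> in auto)
  next
    case (Suc k)
    have "?s (\<lambda>i. if i \<le> m then x i else \<zero>\<^bsub>U\<^esub>) (Suc (m + k))
        = (\<pi> [^]\<^bsub>R\<^esub> Suc (m + k)) \<odot>\<^bsub>U\<^esub> \<zero>\<^bsub>U\<^esub> \<oplus>\<^bsub>U\<^esub> ?s (\<lambda>i. if i \<le> m then x i else \<zero>\<^bsub>U\<^esub>) (m + k)"
      unfolding atMost_Suc by (subst M.finsum_insert) (use x F_closed \<pi> in auto)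
    moreover have "?s (\<lambda>i. if i \<le> m then x i else \<zero>\<^bsub>U\<^esub>) (m + k) \<in> carrier U"
      by (rule M.finsum_closed) (use x F_closed \<pi> in auto)
    ultimately show ?case using Suc \<pi> by simp
  qed
  have ext: "\<exists>x'. (\<forall>i. x' i \<in> F i) \<and> ?s x m = ?s x' (m + k)" if x: "\<forall>i\<le>m. x i \<in> F i" for x m k
    by (rule exI[of _ "\<lambda>i. if i \<le> m then x i else \<zero>\<^bsub>U\<^esub>"]) (use pad[OF x, of k] x zero_F in simp)
  have "additive_subgroup ?H U"
  proof (rule M.additive_subgroup_diffI)
    show "?H \<subseteq> carrier U" unfolding H using \<pi> F_closed by (auto intro!: M.finsum_closed)
    have "\<zero>\<^bsub>U\<^esub> = ?s (\<lambda>_. \<zero>\<^bsub>U\<^esub>) 0" using \<pi> by simp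
    then show "\<zero>\<^bsub>U\<^esub> \<in> ?H"
      unfolding H by (intro CollectI exI[of _ "\<lambda>_. \<zero>\<^bsub>U\<^esub>"] exI[of _ 0] conjI) (simp_all add: zero_F)
    fix a b assume "a \<in> ?H" "b \<in> ?H"
    then obtain x m y n where x: "a = ?s x m" "\<forall>i\<le>m. x i \<in> F i" and y: "b = ?s y n" "\<forall>i\<le>n. y i \<in> F i"
      unfolding H by blast
    obtain x' where x': "\<forall>i. x' i \<in> F i" "a = ?s x' (m + n)" using ext[OF x(2), of n] x(1) by blast
    obtain y' where y': "\<forall>i. y' i \<in> F i" "b = ?s y' (n + m)" using ext[OF y(2), of m] y(1) by blast
    have c: "x' i \<in> carrier U" "y' i \<in> carrier U" for i using x' y' F_closed by blast+
    have "a \<ominus>\<^bsub>U\<^esub> b = ?s (\<lambda>i. x' i \<ominus>\<^bsub>U\<^esub> y' i) (m + n)"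
    proof -
      have "?s (\<lambda>i. x' i \<ominus>\<^bsub>U\<^esub> y' i) (m + n)
          = finsum U (\<lambda>i. (\<pi> [^]\<^bsub>R\<^esub> i) \<odot>\<^bsub>U\<^esub> x' i \<oplus>\<^bsub>U\<^esub> \<ominus>\<^bsub>U\<^esub> ((\<pi> [^]\<^bsub>R\<^esub> i) \<odot>\<^bsub>U\<^esub> y' i)) {..m + n}"
        by (rule M.finsum_cong') (use c \<pi> in \<open>auto simp: M.minus_eq smult_r_distr smult_minus_right\<close>)
      also have "\<dots> = a \<oplus>\<^bsub>U\<^esub> finsum U (\<lambda>i. \<ominus>\<^bsub>U\<^esub> ((\<pi> [^]\<^bsub>R\<^esub> i) \<odot>\<^bsub>U\<^esub> y' i)) {..m + n}"
        unfolding x'(2) by (rule M.finsum_addf) (use c \<pi> in auto)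
      also have "finsum U (\<lambda>i. \<ominus>\<^bsub>U\<^esub> ((\<pi> [^]\<^bsub>R\<^esub> i) \<odot>\<^bsub>U\<^esub> y' i)) {..m + n} = \<ominus>\<^bsub>U\<^esub> b"
        unfolding y'(2) add.commute[of n m] by (rule M.finsum_minus) (use c \<pi> in auto)
      finally show ?thesis by (simp add: M.minus_eq)
    qed
    moreover have "\<forall>i\<le>m + n. x' i \<ominus>\<^bsub>U\<^esub> y' i \<in> F i"
      using x' y' M.additive_subgroup_diff[OF F_subgroup] by blast
    ultimately show "a \<ominus>\<^bsub>U\<^esub> b \<in> ?H"
      unfolding H by (intro CollectI exI[of _ "\<lambda>i. x' i \<ominus>\<^bsub>U\<^esub> y' i"] exI[of _ "m + n"] conjI)
  qed
  moreover have "?Q \<subseteq> ?H"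
  proof
    fix z assume "z \<in> ?Q"
    then obtain n f where z: "z = (\<pi> [^]\<^bsub>R\<^esub> n) \<odot>\<^bsub>U\<^esub> f" "f \<in> F n" by blast
    have "?s (\<lambda>i. if i = n then f else \<zero>\<^bsub>U\<^esub>) n
        = finsum U (\<lambda>i. if i = n then (\<pi> [^]\<^bsub>R\<^esub> i) \<odot>\<^bsub>U\<^esub> f else \<zero>\<^bsub>U\<^esub>) {..n}"
      by (rule M.finsum_cong') (use \<pi> z(2) F_closed in auto)
    also have "\<dots> = z"
      unfolding z(1) by (rule M.finsum_indicator) (use \<pi> z(2) F_closed in auto)
    finally have "z = ?s (\<lambda>i. if i = n then f else \<zero>\<^bsub>U\<^esub>) n" ..
    moreover have "\<forall>i\<le>n. (if i = n then f else \<zero>\<^bsub>U\<^esub>) \<in> F i" using z(2) zero_F by simp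
    ultimately show "z \<in> ?H"
      unfolding H by (intro CollectI exI[of _ "\<lambda>i. if i = n then f else \<zero>\<^bsub>U\<^esub>"] exI[of _ n] conjI)
  qed
  ultimately show "additive_span U ?Q \<subseteq> ?H" by (rule M.additive_span_le)
qed

text \<open>The product of \<pi>^n f and \<pi>^m g is \<pi>^(n + m) f g, and f g lies in
  \<open>F (n + m)\<close>; the rest is additivity in each factor.\<close>

lemma deformation_algebra:
  assumes \<pi>: "\<pi> \<in> carrier R"
  shows "assoc_algebra R (deformation R \<pi> U F 1)"
proof -
  let ?Q = "{(\<pi> [^]\<^bsub>R\<^esub> n) \<odot>\<^bsub>U\<^esub> f | (n::nat) f. f \<in> F n}"
  let ?H = "additive_span U ?Q"
  have Qc: "?Q \<subseteq> carrier U" using \<pi> F_closed by auto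
  have sub: "additive_subgroup ?H U" by (rule M.additive_span_subgroup[OF Qc])
  have Hc: "x \<in> carrier U" if "x \<in> ?H" for x using additive_subgroup.a_subset[OF sub] that by blast
  have genQ: "(\<pi> [^]\<^bsub>R\<^esub> n) \<odot>\<^bsub>U\<^esub> f \<in> ?H" if "f \<in> F n" for f and n :: nat
    using that by (intro additive_span.gen) blast
  have mult1: "((\<pi> [^]\<^bsub>R\<^esub> n) \<odot>\<^bsub>U\<^esub> f) \<otimes>\<^bsub>U\<^esub> y \<in> ?H" if f: "f \<in> F n" and y: "y \<in> ?H" for f y and n :: nat
    using y
  proof induct
    case zero
    then show ?case using f \<pi> F_closed additive_span.zero by simp
  next
    case (gen y)
    then obtain m g where g: "y = (\<pi> [^]\<^bsub>R\<^esub> m) \<odot>\<^bsub>U\<^esub> g" "g \<in> F m" by blast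
    have c: "f \<in> carrier U" "g \<in> carrier U" using f g(2) F_closed by auto
    have "((\<pi> [^]\<^bsub>R\<^esub> n) \<odot>\<^bsub>U\<^esub> f) \<otimes>\<^bsub>U\<^esub> y = (\<pi> [^]\<^bsub>R\<^esub> (n + m)) \<odot>\<^bsub>U\<^esub> (f \<otimes>\<^bsub>U\<^esub> g)"
      using c \<pi> by (simp add: g(1) smult_mult_left smult_mult_right smult_assoc1[symmetric] R.nat_pow_mult add.commute)
    then show ?case using genQ[OF filt_mult[OF f g(2)]] by simp
  next
    case (diff x y)
    have "((\<pi> [^]\<^bsub>R\<^esub> n) \<odot>\<^bsub>U\<^esub> f) \<otimes>\<^bsub>U\<^esub> (x \<ominus>\<^bsub>U\<^esub> y)
        = ((\<pi> [^]\<^bsub>R\<^esub> n) \<odot>\<^bsub>U\<^esub> f) \<otimes>\<^bsub>U\<^esub> x \<ominus>\<^bsub>U\<^esub> ((\<pi> [^]\<^bsub>R\<^esub> n) \<odot>\<^bsub>U\<^esub> f) \<otimes>\<^bsub>U\<^esub> y"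
      using Hc[OF diff(1)] Hc[OF diff(3)] F_closed[OF f] \<pi> by (simp add: M.minus_eq U.r_distr U.r_minus)
    then show ?case using additive_span.diff[OF diff(2,4)] by simp
  qed
  have mult: "x \<otimes>\<^bsub>U\<^esub> y \<in> ?H" if x: "x \<in> ?H" and y: "y \<in> ?H" for x y
    using x
  proof induct
    case zero
    then show ?case using Hc[OF y] additive_span.zero by simp
  next
    case (gen x)
    then show ?case using mult1[OF _ y] by blast
  next
    case (diff x z)
    have "(x \<ominus>\<^bsub>U\<^esub> z) \<otimes>\<^bsub>U\<^esub> y = x \<otimes>\<^bsub>U\<^esub> y \<ominus>\<^bsub>U\<^esub> z \<otimes>\<^bsub>U\<^esub> y"
      using Hc[OF diff(1)] Hc[OF diff(3)] Hc[OF y] by (simp add: M.minus_eq U.l_distr U.l_minus)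
    then show ?case using additive_span.diff[OF diff(2,4)] by simp
  qed
  have smult: "a \<odot>\<^bsub>U\<^esub> x \<in> ?H" if a: "a \<in> carrier R" and x: "x \<in> ?H" for a x
  proof -
    have "((\<pi> [^]\<^bsub>R\<^esub> (0::nat)) \<odot>\<^bsub>U\<^esub> (a \<odot>\<^bsub>U\<^esub> \<one>\<^bsub>U\<^esub>)) \<otimes>\<^bsub>U\<^esub> x \<in> ?H"
      by (rule mult1[OF F_smult[OF a filt_one] x])
    then show ?thesis using a Hc[OF x] by (simp add: smult_mult_left)
  qed
  have "assoc_algebra R (U\<lparr>carrier := ?H\<rparr>)"
    using genQ[OF filt_one] M.additive_subgroup_diff[OF sub] additive_subgroup.a_subset[OF sub]
    by (intro subalgebra mult smult) auto
  moreover have "deformation R \<pi> U F 1 = U\<lparr>carrier := ?H\<rparr>"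
    unfolding carrier_deformation[OF \<pi>, symmetric] by (simp add: deformation_def)
  ultimately show ?thesis by simp
qed

end

subsection \<open>The valuation ring and its fraction field\<close>

context complete_discretely_valued_field
begin

abbreviation "\<R> \<equiv> valuation_ring K v"

lemma val_one: "v \<one> = 0"
  using val_mult[of \<one> \<one>] by simp

text \<open>The square of -1 is 1, so twice its valuation is 0, and the integers have no
  torsion.\<close>

lemma val_neg:
  assumes "x \<in> carrier K" "x \<noteq> \<zero>"
  shows "v (\<ominus> x) = v x"
proof -
  have n: "\<ominus> \<one> \<in> carrier K - {\<zero>}" using minus_equality[of \<one> \<zero>] by (auto dest: arg_cong[of _ _ "\<lambda>x. \<ominus> x"])
  have "\<ominus> \<one> \<otimes> \<ominus> \<one> = \<one>" by (simp add: l_minus r_minus)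
  then have "v (\<ominus> \<one>) + v (\<ominus> \<one>) = 0" using val_mult[OF n n] val_one by simp
  moreover have "\<ominus> x = \<ominus> \<one> \<otimes> x" using assms by (simp add: l_minus)
  ultimately show ?thesis using val_mult[OF n, of x] assms by simp
qed

lemma val_pow: "\<lbrakk>x \<in> carrier K; x \<noteq> \<zero>\<rbrakk> \<Longrightarrow> v (x [^] (n::nat)) = int n * v x \<and> x [^] n \<noteq> \<zero>"
proof (induct n)
  case (Suc n)
  then show ?case using val_mult[of "x [^] n" x] integral_iff[of "x [^] n" x] by (simp add: algebra_simps)
qed (simp add: val_one)

lemma subring_val_ball: "subring (val_ball K v 0) K"
proof (rule subringI)
  show "val_ball K v 0 \<subseteq> carrier K" by (auto simp: val_ball_def)
  show "\<one> \<in> val_ball K v 0" by (simp add: val_ball_def val_one)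
  show "\<ominus> x \<in> val_ball K v 0" if "x \<in> val_ball K v 0" for x
    using that val_neg[of x] by (cases "x = \<zero>") (simp_all add: val_ball_def)
  fix x y assume xy: "x \<in> val_ball K v 0" "y \<in> val_ball K v 0"
  show "x \<otimes> y \<in> val_ball K v 0"
    using xy val_mult[of x y] by (cases "x = \<zero> \<or> y = \<zero>") (auto simp: val_ball_def)
  show "x \<oplus> y \<in> val_ball K v 0"
    using xy val_add[of x y] by (cases "x = \<zero> \<or> y = \<zero>") (auto simp: val_ball_def)
qed

lemma cring_valuation_ring: "cring \<R>"
  unfolding valuation_ring_def
  using subcring_iff[OF subringE(1)[OF subring_val_ball]] subcringI'[OF subring_val_ball] by simp

lemma valuation_ring_simps [simp]:
  "carrier \<R> = val_ball K v 0" "x \<otimes>\<^bsub>\<R>\<^esub> y = x \<otimes> y" "\<one>\<^bsub>\<R>\<^esub> = \<one>" "\<zero>\<^bsub>\<R>\<^esub> = \<zero>" "x \<oplus>\<^bsub>\<R>\<^esub> y = x \<oplus> y"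
  by (simp_all add: valuation_ring_def)

text \<open>An element of valuation 0 has an inverse of valuation 0 in the field, which is again
  integral.\<close>

lemma val_nonunit:
  assumes "\<pi> \<in> carrier \<R>" "\<pi> \<noteq> \<zero>" "\<pi> \<notin> Units \<R>"
  shows "0 < v \<pi>"
proof (rule ccontr)
  assume "\<not> 0 < v \<pi>"
  then have \<pi>: "\<pi> \<in> carrier K" "v \<pi> = 0" using assms(1,2) by (auto simp: val_ball_def)
  then have u: "\<pi> \<in> Units K" using assms(2) field_Units by simp
  have i: "inv \<pi> \<in> carrier K" "inv \<pi> \<otimes> \<pi> = \<one>" "\<pi> \<otimes> inv \<pi> = \<one>" using u by simp_all
  then have "inv \<pi> \<noteq> \<zero>" using \<pi> by auto
  then have "v (inv \<pi>) = 0" using val_mult[of "inv \<pi>" \<pi>] i \<pi> assms(2) val_one by simp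
  then have "inv \<pi> \<in> val_ball K v 0" using i by (simp add: val_ball_def)
  then have "\<pi> \<in> Units \<R>" using i assms(1) unfolding Units_def by auto
  then show False using assms(3) by simp
qed

lemma fraction:
  assumes "\<pi> \<in> carrier K" "\<pi> \<noteq> \<zero>" "0 < v \<pi>" "k \<in> carrier K"
  shows "\<exists>N::nat. \<forall>n\<ge>N. \<pi> [^] n \<otimes> k \<in> carrier \<R>"
proof (intro exI allI impI)
  \<comment> \<open>The valuation of \<pi> is at least 1, so already n \<ge> - v k makes the total
    valuation nonnegative.\<close>
  fix n assume n: "nat (- v k) \<le> n"
  have pw: "v (\<pi> [^] n) = int n * v \<pi>" "\<pi> [^] n \<noteq> \<zero>" using val_pow[OF assms(1,2), of n] by auto
  have "int n * 1 \<le> int n * v \<pi>" using assms(3) by (intro mult_left_mono) auto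
  then have "0 \<le> v (\<pi> [^] n) + v k" using n pw by linarith
  then show "\<pi> [^] n \<otimes> k \<in> carrier \<R>"
    using val_mult[of "\<pi> [^] n" k] pw assms by (cases "k = \<zero>") (auto simp: val_ball_def)
qed

lemma fraction_tensor_completion:
  assumes "torsion_free_algebra \<R> S \<pi>" "\<pi> \<noteq> \<zero>" "\<pi> \<notin> Units \<R>"
  shows "fraction_tensor \<R> (completion \<R> \<pi> S) K \<pi>"
proof -
  interpret T: torsion_free_algebra \<R> S \<pi> by fact
  have \<pi>: "\<pi> \<in> carrier \<R>" by (rule T.\<pi>_R)
  then have \<pi>K: "\<pi> \<in> carrier K" by (simp add: val_ball_def)
  show ?thesis
  proof (intro fraction_tensor.intro fraction_tensor_axioms.intro T.completion_algebra is_cring)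
    show "carrier \<R> \<subseteq> carrier K" by (auto simp: val_ball_def)
    show "\<R> = K\<lparr>carrier := carrier \<R>\<rparr>" by (simp add: valuation_ring_def)
    show "\<pi> \<in> Units K" using \<pi>K assms(2) field_Units by simp
    show "\<exists>N::nat. \<forall>n\<ge>N. \<pi> [^] n \<otimes> k \<in> carrier \<R>" if "k \<in> carrier K" for k
      by (rule fraction[OF \<pi>K assms(2) val_nonunit[OF \<pi> assms(2,3)] that])
  qed (use \<pi> T.completion_torsion_free in auto)
qed

end

section \<open>The localized completion of a torsion-free algebra\<close>

locale completed_fractions = torsion_free_algebra R S \<pi> + Q: fraction_tensor R "completion R \<pi> S" K \<pi>
  for R :: "('k, 'z) ring_scheme" (structure) and S :: "('k, 'm, 'x) module_scheme" (structure)
    and K :: "('k, 'z) ring_scheme" (structure) and \<pi>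
begin

definition e :: "'m \<Rightarrow> ((nat \<Rightarrow> 'm set) \<times> 'k \<Rightarrow>\<^sub>0 int) set" where "e x = Q.\<iota> (emb x)"
abbreviation "q \<equiv> \<pi> \<odot>\<^bsub>S\<^esub> \<one>\<^bsub>S\<^esub>"
abbreviation "D \<equiv> Q.\<iota> ` carrier Sh"

sublocale emb: ring_hom_ring S Sh emb
  by (rule ring_hom_ringI2[OF U.ring_axioms ring_completion emb_ring_hom])

lemma e_ring_hom: "e \<in> ring_hom S Q.A"
  by (rule ring_hom_memI) (simp_all add: e_def)

lemma e_q: "e q = Q.p"
  unfolding e_def Q.p_def by (simp add: emb_smult)

lemma \<iota>_inj: "\<lbrakk>x \<in> carrier Sh; y \<in> carrier Sh; Q.\<iota> x = Q.\<iota> y\<rbrakk> \<Longrightarrow> x = y"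
proof -
  assume xy: "x \<in> carrier Sh" "y \<in> carrier Sh" "Q.\<iota> x = Q.\<iota> y"
  then have "Q.\<iota> (x \<ominus>\<^bsub>Sh\<^esub> y) = \<zero>\<^bsub>Q.A\<^esub>" by (simp add: Q.\<iota>.hom_minus Q.A.r_right_minus_eq)
  then have "x \<ominus>\<^bsub>Sh\<^esub> y = \<zero>\<^bsub>Sh\<^esub>" using xy by (intro Q.\<iota>_inj) simp_all
  then show "x = y" using xy by (simp add: ring.r_right_minus_eq[OF ring_completion])
qed

text \<open>The map \<iota> is injective, so it identifies the neighbourhoods in the completion with
  those in its image, and completeness and separatedness are transported.\<close>

lemma adic: "adic_subring Q.A (e q) D"
proof -
  interpret Cm: adic_subring Sh "\<pi> \<odot>\<^bsub>Sh\<^esub> \<one>\<^bsub>Sh\<^esub>" "carrier Sh" by (rule completion_adic)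
  let ?N = "\<lambda>n. (\<lambda>d. (\<pi> \<odot>\<^bsub>Sh\<^esub> \<one>\<^bsub>Sh\<^esub>) [^]\<^bsub>Sh\<^esub> (n::nat) \<otimes>\<^bsub>Sh\<^esub> d) ` carrier Sh"
  have N: "(\<lambda>d. Q.p [^]\<^bsub>Q.A\<^esub> n \<otimes>\<^bsub>Q.A\<^esub> d) ` D = Q.\<iota> ` ?N n" for n
    unfolding image_image by (rule image_cong) (simp_all add: Q.p_def Q.\<iota>.hom_nat_pow)
  have Nc: "?N n \<subseteq> carrier Sh" for n by auto
  have mem: "x \<in> ?N n" if x: "x \<in> carrier Sh" "Q.\<iota> x \<in> Q.\<iota> ` ?N n" for x n
  proof -
    from x(2) obtain y where y: "Q.\<iota> x = Q.\<iota> y" "y \<in> ?N n" by (rule imageE)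
    show ?thesis using \<iota>_inj[OF x(1) subsetD[OF Nc y(2)] y(1)] y(2) by simp
  qed
  show ?thesis
    unfolding e_q
  proof (intro adic_subring.intro adic_subring_axioms.intro Q.A.ring_axioms Q.p_closed, unfold N)
    show "x \<otimes>\<^bsub>Q.A\<^esub> Q.p = Q.p \<otimes>\<^bsub>Q.A\<^esub> x" if "x \<in> carrier Q.A" for x by (rule Q.p_central[OF that])
    show "x = \<zero>\<^bsub>Q.A\<^esub>" if x: "x \<in> carrier Q.A" "Q.p \<otimes>\<^bsub>Q.A\<^esub> x = \<zero>\<^bsub>Q.A\<^esub>" for x
    proof -
      have "x = inv\<^bsub>Q.A\<^esub> Q.p \<otimes>\<^bsub>Q.A\<^esub> (Q.p \<otimes>\<^bsub>Q.A\<^esub> x)"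
        using x(1) Q.p_unit Q.p_closed by (simp add: Q.A.m_assoc[symmetric])
      then show ?thesis using x(2) Q.p_unit by simp
    qed
    show "additive_subgroup D Q.A"
      by (rule Q.\<iota>.image_additive_subgroup[OF Cm.D_subgroup])
    show "x \<otimes>\<^bsub>Q.A\<^esub> y \<in> D" if xy: "x \<in> D" "y \<in> D" for x y
    proof -
      obtain a b where "x = Q.\<iota> a" "y = Q.\<iota> b" "a \<in> carrier Sh" "b \<in> carrier Sh" using xy by blast
      then show ?thesis by (intro image_eqI[of _ Q.\<iota> "a \<otimes>\<^bsub>Sh\<^esub> b"]) simp_all
    qed
    show "Q.p \<in> D" unfolding Q.p_def by (rule imageI) simp
    show "\<one>\<^bsub>Q.A\<^esub> \<in> D" by (rule image_eqI[of _ Q.\<iota> "\<one>\<^bsub>Sh\<^esub>"]) simp_all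
    show "x = \<zero>\<^bsub>Q.A\<^esub>" if x: "\<And>n. x \<in> Q.\<iota> ` ?N n" for x
    proof -
      obtain y where y: "y \<in> carrier Sh" "x = Q.\<iota> y" using x[of 0] Nc[of 0] by blast
      have "y = \<zero>\<^bsub>Sh\<^esub>" by (rule Cm.D_separated, rule mem[OF y(1)]) (use x y(2) in simp)
      then show ?thesis using y(2) by simp
    qed
    fix s :: "nat \<Rightarrow> ((nat \<Rightarrow> 'm set) \<times> 'k \<Rightarrow>\<^sub>0 int) set"
    assume s: "\<And>n. s n \<in> D" "\<And>n. s (Suc n) \<ominus>\<^bsub>Q.A\<^esub> s n \<in> Q.\<iota> ` ?N n"
    have "\<forall>n. \<exists>t. t \<in> carrier Sh \<and> s n = Q.\<iota> t" using s(1) by blast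
    from choice[OF this] obtain t where "\<forall>n. t n \<in> carrier Sh \<and> s n = Q.\<iota> (t n)" ..
    note t = conjunct1[OF spec[OF this]] conjunct2[OF spec[OF this]]
    have "t (Suc n) \<ominus>\<^bsub>Sh\<^esub> t n \<in> ?N n" for n
      by (rule mem) (use t(1) s(2)[of n] in \<open>simp_all add: t(2) Q.\<iota>.hom_minus\<close>)
    then obtain l where l: "l \<in> carrier Sh" "\<forall>n. t n \<ominus>\<^bsub>Sh\<^esub> l \<in> ?N n"
      using Cm.D_complete[of t, OF t(1)] by blast
    have "s n \<ominus>\<^bsub>Q.A\<^esub> Q.\<iota> l \<in> Q.\<iota> ` ?N n" for n
      using imageI[OF spec[OF l(2)], of Q.\<iota> n] t(1) l(1) by (simp add: t(2) Q.\<iota>.hom_minus)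
    then show "\<exists>l\<in>D. \<forall>n. s n \<ominus>\<^bsub>Q.A\<^esub> l \<in> Q.\<iota> ` ?N n"
      by (intro bexI[of _ "Q.\<iota> l"] allI imageI l(1))
  qed
qed

lemma p_\<iota>: "x \<in> carrier Sh \<Longrightarrow> Q.p \<otimes>\<^bsub>Q.A\<^esub> Q.\<iota> x = Q.\<iota> (\<pi> \<odot>\<^bsub>Sh\<^esub> x)"
  using Q.p_mult_\<iota>[of x 1] Q.p_closed by simp

lemma e_D: "x \<in> carrier S \<Longrightarrow> e x \<in> D"
  unfolding e_def by (rule imageI) simp

lemma e_dense:
  assumes "d \<in> D"
  shows "\<exists>x\<in>carrier S. \<exists>d'\<in>D. d = e x \<oplus>\<^bsub>Q.A\<^esub> e q \<otimes>\<^bsub>Q.A\<^esub> d'"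
proof -
  obtain s where s: "s \<in> carrier Sh" "d = Q.\<iota> s" using assms by blast
  obtain x y where "x \<in> carrier S" "y \<in> carrier Sh" "s = emb x \<oplus>\<^bsub>Sh\<^esub> \<pi> \<odot>\<^bsub>Sh\<^esub> y"
    using completion_dense[OF s(1)] by blast
  then show ?thesis
    by (intro bexI[of _ x] bexI[of _ "Q.\<iota> y"] imageI) (simp_all add: s(2) e_def[of x] e_q p_\<iota>)
qed

text \<open>Injectivity of \<iota> brings the equation back to the completion, where divisibility of
  a constant sequence by \<pi> is divisibility in \<open>S\<close>.\<close>

lemma e_divisible:
  assumes x: "x \<in> carrier S" and c: "c \<in> D" and eq: "e x = e q \<otimes>\<^bsub>Q.A\<^esub> c"
  shows "\<exists>y\<in>carrier S. x = q \<otimes>\<^bsub>S\<^esub> y"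
proof -
  obtain s where s: "s \<in> carrier Sh" "c = Q.\<iota> s" using c by blast
  have "emb x = \<pi> \<odot>\<^bsub>Sh\<^esub> s"
    by (rule \<iota>_inj) (use x s eq in \<open>simp_all add: e_def[of x] e_q p_\<iota>\<close>)
  then have "\<exists>y\<in>carrier Sh. emb x = (\<pi> [^]\<^bsub>R\<^esub> (1::nat)) \<odot>\<^bsub>Sh\<^esub> y" using s(1) by (intro bexI[of _ s]) simp_all
  then obtain y where "y \<in> carrier S" "x = (\<pi> [^]\<^bsub>R\<^esub> (1::nat)) \<odot>\<^bsub>S\<^esub> y"
    using emb_divisible[OF x, of 1] P_iff[of x 1] by blast
  then show ?thesis by (intro bexI[of _ y]) (simp_all add: smult_mult_left)
qed

lemma A_D: "x \<in> carrier Q.A \<Longrightarrow> \<exists>n::nat. e q [^]\<^bsub>Q.A\<^esub> n \<otimes>\<^bsub>Q.A\<^esub> x \<in> D"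
  unfolding e_q by (rule Q.\<iota>_localizes)

end

section \<open>Assembling both sides of the theorem\<close>

lemma finsum_add_monoid_cong: "add_monoid M = add_monoid N \<Longrightarrow> finsum M = finsum N"
  by (simp add: finsum_def[abs_def])

lemma add_monoid_right_module: "add_monoid (ring_as_right_module \<phi> B) = add_monoid (ring_as_left_module \<phi> (opposite_ring B))"
  by (simp add: ring_as_right_module_def ring_as_left_module_def opposite_ring_def)

text \<open>The two records differ in their multiplication field alone, while modules and the
  equational criterion read only addition and scalar action.\<close>

lemma ring_as_right_module_opposite:
  shows "left_module A (ring_as_right_module \<phi> B) \<longleftrightarrow> left_module A (ring_as_left_module \<phi> (opposite_ring B))"
    and "equationally_flat A (ring_as_right_module \<phi> B) \<longleftrightarrow> equationally_flat A (ring_as_left_module \<phi> (opposite_ring B))"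
proof -
  have fields: "carrier (ring_as_right_module \<phi> B) = carrier (ring_as_left_module \<phi> (opposite_ring B))"
    "\<zero>\<^bsub>ring_as_right_module \<phi> B\<^esub> = \<zero>\<^bsub>ring_as_left_module \<phi> (opposite_ring B)\<^esub>"
    "add (ring_as_right_module \<phi> B) = add (ring_as_left_module \<phi> (opposite_ring B))"
    "smult (ring_as_right_module \<phi> B) = smult (ring_as_left_module \<phi> (opposite_ring B))"
    by (simp_all add: ring_as_right_module_def ring_as_left_module_def opposite_ring_def fun_eq_iff)
  show "left_module A (ring_as_right_module \<phi> B) \<longleftrightarrow> left_module A (ring_as_left_module \<phi> (opposite_ring B))"
    unfolding left_module_def left_module_axioms_def abelian_group_def abelian_monoid_def
      abelian_group_axioms_def add_monoid_right_module fields ..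
  show "equationally_flat A (ring_as_right_module \<phi> B) \<longleftrightarrow> equationally_flat A (ring_as_left_module \<phi> (opposite_ring B))"
    unfolding equationally_flat_def finsum_add_monoid_cong[OF add_monoid_right_module] fields ..
qed

text \<open>The maps send x to the class of its constant sequence tensor 1, \<open>D\<close> and
  \<open>C\<close> are the images of the two completions, and \<open>q\<close> is \<pi> times the
  unit. Behind the existential quantifier the tensor products disappear from the final
  argument.\<close>

lemma deformation_completion_exists:
  fixes K :: "'k ring" and U :: "('k, 'u) module"
  assumes K: "complete_discretely_valued_field K v"
    and \<pi>: "\<pi> \<in> carrier (valuation_ring K v)" "\<pi> \<noteq> \<zero>\<^bsub>valuation_ring K v\<^esub>" "\<pi> \<notin> Units (valuation_ring K v)"
    and U: "deformable (valuation_ring K v) U F"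
  shows "\<exists>e f q D C. deformation_completion
    (completion_K K v \<pi> (deformation (valuation_ring K v) \<pi> U F 1)) (completion_K K v \<pi> U)
    (completion_K_map K v \<pi> U (\<lambda>x. x)) U e f q D C F"
proof -
  note One_nat_def [simp del]
  interpret K: complete_discretely_valued_field K v by (rule K)
  let ?R = "valuation_ring K v"
  let ?U = "deformation ?R \<pi> U F 1"
  let ?\<psi> = "completion_K_map K v \<pi> U (\<lambda>x. x)"
  let ?q = "\<pi> \<odot>\<^bsub>U\<^esub> \<one>\<^bsub>U\<^esub>"
  interpret PF: positively_filtered_algebra ?R U F using U by (simp add: deformable_def)
  have flat: "flat_left_module TYPE('k) ?R (gr U F)" using U by (simp add: deformable_def)
  have \<pi>0: "\<pi> \<noteq> \<zero>\<^bsub>K\<^esub>" and \<pi>K: "\<pi> \<in> carrier K" using \<pi> by (auto simp: val_ball_def)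
  have inj: "a = \<zero>\<^bsub>?R\<^esub>" if "a \<in> carrier ?R" "\<pi> \<otimes>\<^bsub>?R\<^esub> a = \<zero>\<^bsub>?R\<^esub>" for a
    using that \<pi>0 \<pi>K K.integral_iff[of \<pi> a] by (auto simp: val_ball_def)
  \<comment> \<open>Flatness excludes \<pi>-torsion in the graded ring, and descent along the
    filtration excludes it in \<open>U\<close>; the subalgebra inherits this.\<close>
  have tf: "x = \<zero>\<^bsub>U\<^esub>" if "x \<in> carrier U" "\<pi> \<odot>\<^bsub>U\<^esub> x = \<zero>\<^bsub>U\<^esub>" for x
    by (rule PF.torsion_free_of_gr[OF \<pi>(1) flat_torsion_free[OF K.cring_valuation_ring flat \<pi>(1) inj] that])
  have tfU: "torsion_free_algebra ?R U \<pi>"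
    by (rule torsion_free_algebra.intro[OF PF.assoc_algebra_axioms torsion_free_algebra_axioms.intro[OF \<pi>(1) tf]])
  have ops: "x \<odot>\<^bsub>?U\<^esub> y = x \<odot>\<^bsub>U\<^esub> y" "\<zero>\<^bsub>?U\<^esub> = \<zero>\<^bsub>U\<^esub>" "\<one>\<^bsub>?U\<^esub> = \<one>\<^bsub>U\<^esub>"
    "z \<oplus>\<^bsub>?U\<^esub> w = z \<oplus>\<^bsub>U\<^esub> w" "z \<otimes>\<^bsub>?U\<^esub> w = z \<otimes>\<^bsub>U\<^esub> w" for x y z w
    by (simp_all add: deformation_def)
  let ?V = "additive_span U {?q [^]\<^bsub>U\<^esub> n \<otimes>\<^bsub>U\<^esub> f | (n::nat) f. f \<in> F n}"
  have V: "?V = carrier ?U"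
  proof -
    have "?q [^]\<^bsub>U\<^esub> n \<otimes>\<^bsub>U\<^esub> f = (\<pi> [^]\<^bsub>?R\<^esub> n) \<odot>\<^bsub>U\<^esub> f" if "f \<in> F n" for f and n :: nat
      using \<pi>(1) PF.F_closed[OF that] PF.R.nat_pow_closed[OF \<pi>(1), of n]
      by (simp add: PF.smult_one_pow PF.smult_mult_left del: K.valuation_ring_simps)
    then have "{?q [^]\<^bsub>U\<^esub> n \<otimes>\<^bsub>U\<^esub> f | (n::nat) f. f \<in> F n} = {(\<pi> [^]\<^bsub>?R\<^esub> n) \<odot>\<^bsub>U\<^esub> f | (n::nat) f. f \<in> F n}"
      by (intro Collect_cong ex_cong1) auto
    then show ?thesis unfolding PF.carrier_deformation[OF \<pi>(1)] by simp
  qed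
  have sub: "carrier ?U \<subseteq> carrier U"
    unfolding V[symmetric]
    by (rule additive_subgroup.a_subset[OF PF.M.additive_span_subgroup])
       (use PF.F_closed \<pi>(1) in \<open>auto simp del: K.valuation_ring_simps\<close>)
  have tfV: "torsion_free_algebra ?R ?U \<pi>"
    by (intro torsion_free_algebra.intro torsion_free_algebra_axioms.intro PF.deformation_algebra \<pi>(1))
       (use tf sub in \<open>auto simp: ops simp del: K.valuation_ring_simps\<close>)
  interpret CA: completed_fractions ?R ?U K \<pi>
    by (intro completed_fractions.intro tfV K.fraction_tensor_completion \<pi>0 \<pi>(3))
  interpret CM: completed_fractions ?R U K \<pi>
    by (intro completed_fractions.intro tfU K.fraction_tensor_completion \<pi>0 \<pi>(3))
  have A: "completion_K K v \<pi> ?U = CA.Q.A" and M: "completion_K K v \<pi> U = CM.Q.A"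
    by (simp_all add: completion_K_def)
  let ?c = "completion_map ?R \<pi> U (\<lambda>x. x)"
  have incl: "(\<lambda>x. x) \<in> linear_maps ?R ?U U" "(\<lambda>x. x) \<in> ring_hom ?U U"
    using sub by (auto simp: linear_maps_def hom_def ops intro!: ring_hom_memI)
  note c = completion_map_hom[OF tfV tfU incl]
  have idK: "(\<lambda>x. x) \<in> ring_hom CA.Q.KR CA.Q.KR" by (rule ring_hom_memI) simp_all
  have \<psi>_hom: "?\<psi> \<in> ring_hom CA.Q.A CM.Q.A"
    unfolding completion_K_map_def
    by (rule tensor_map_ring_hom[OF CA.Q.TA.tensor_of_algebras_axioms CM.Q.TA.tensor_of_algebras_axioms
          c(1,2) idK linear_maps_id])
  have \<psi>_\<iota>: "?\<psi> (CA.Q.\<iota> s) = CM.Q.\<iota> (?c s)" for s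
    unfolding completion_K_map_def CA.Q.\<iota>_def CM.Q.\<iota>_def
    using tensor_map_class(2)[OF CA.Q.TA.F.tensor_factors_axioms CM.Q.TA.F.tensor_factors_axioms c(2) linear_maps_id,
        of "frag_of (s, \<one>\<^bsub>K\<^esub>)"] by simp
  have \<psi>_e: "?\<psi> (CA.e x) = CM.e x" if "x \<in> carrier ?U" for x
    unfolding CA.e_def CM.e_def \<psi>_\<iota> c(3)[OF that] ..
  have q: "\<pi> \<odot>\<^bsub>?U\<^esub> \<one>\<^bsub>?U\<^esub> = ?q" by (simp add: ops)
  have e: "CA.e (x \<oplus>\<^bsub>U\<^esub> y) = CA.e x \<oplus>\<^bsub>CA.Q.A\<^esub> CA.e y" "CA.e (x \<otimes>\<^bsub>U\<^esub> y) = CA.e x \<otimes>\<^bsub>CA.Q.A\<^esub> CA.e y"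
    "CA.e \<one>\<^bsub>U\<^esub> = \<one>\<^bsub>CA.Q.A\<^esub>" if "x \<in> carrier ?U" "y \<in> carrier ?U" for x y
    using ring_hom_add[OF CA.e_ring_hom that] ring_hom_mult[OF CA.e_ring_hom that] ring_hom_one[OF CA.e_ring_hom]
    by (simp_all add: ops)
  have "deformation_completion CA.Q.A CM.Q.A ?\<psi> U CA.e CM.e ?q CA.D CM.D F"
  proof (intro deformation_completion.intro deformation_completion_axioms.intro, unfold V)
    show "ring_hom_ring CA.Q.A CM.Q.A ?\<psi>"
      by (rule ring_hom_ringI2[OF CA.Q.A.ring_axioms CM.Q.A.ring_axioms \<psi>_hom])
    show "ring U" by (rule PF.U.ring_axioms)
    show "adic_subring CA.Q.A (CA.e ?q) CA.D" using CA.adic unfolding q .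
    show "adic_subring CM.Q.A (CM.e ?q) CM.D" by (rule CM.adic)
    show "additive_subgroup (F n) U" for n by (rule PF.F_subgroup)
    show "F n \<subseteq> F (Suc n)" for n by (rule PF.filt_mono)
    show "\<one>\<^bsub>U\<^esub> \<in> F 0" by (rule PF.filt_one)
    show "x \<otimes>\<^bsub>U\<^esub> y \<in> F (i + j)" if "x \<in> F i" "y \<in> F j" for x y i j by (rule PF.filt_mult[OF that])
    show "(\<Union>n. F n) = carrier U" by (rule PF.filt_exhaustive)
    show "?q \<in> F 0" by (rule PF.F_smult[OF \<pi>(1) PF.filt_one])
    show "x \<otimes>\<^bsub>U\<^esub> ?q = ?q \<otimes>\<^bsub>U\<^esub> x" if "x \<in> carrier U" for x by (rule PF.smult_one_central[OF \<pi>(1) that])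
    show "CA.e x \<in> CA.D" if "x \<in> carrier ?U" for x by (rule CA.e_D[OF that])
    show "CA.e (x \<oplus>\<^bsub>U\<^esub> y) = CA.e x \<oplus>\<^bsub>CA.Q.A\<^esub> CA.e y" if "x \<in> carrier ?U" "y \<in> carrier ?U" for x y
      by (rule e(1)[OF that])
    show "CA.e (x \<otimes>\<^bsub>U\<^esub> y) = CA.e x \<otimes>\<^bsub>CA.Q.A\<^esub> CA.e y" if "x \<in> carrier ?U" "y \<in> carrier ?U" for x y
      by (rule e(2)[OF that])
    show "CA.e \<one>\<^bsub>U\<^esub> = \<one>\<^bsub>CA.Q.A\<^esub>" using ring_hom_one[OF CA.e_ring_hom] by (simp add: ops)
    show "\<exists>x\<in>carrier ?U. \<exists>d'\<in>CA.D. d = CA.e x \<oplus>\<^bsub>CA.Q.A\<^esub> CA.e ?q \<otimes>\<^bsub>CA.Q.A\<^esub> d'" if "d \<in> CA.D" for d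
      using CA.e_dense[OF that] unfolding q .
    show "CA.e ?q \<in> Units CA.Q.A" using CA.Q.p_unit CA.e_q unfolding q by simp
    show "\<exists>n::nat. CA.e ?q [^]\<^bsub>CA.Q.A\<^esub> n \<otimes>\<^bsub>CA.Q.A\<^esub> x \<in> CA.D" if "x \<in> carrier CA.Q.A" for x
      using CA.A_D[OF that] unfolding q .
    show "\<exists>n::nat. CM.e ?q [^]\<^bsub>CM.Q.A\<^esub> n \<otimes>\<^bsub>CM.Q.A\<^esub> x \<in> CM.D" if "x \<in> carrier CM.Q.A" for x
      by (rule CM.A_D[OF that])
    show "CM.e \<in> ring_hom U CM.Q.A" by (rule CM.e_ring_hom)
    show "CM.e x \<in> CM.D" if "x \<in> carrier U" for x by (rule CM.e_D[OF that])
    show "\<exists>x\<in>carrier U. \<exists>c'\<in>CM.D. c = CM.e x \<oplus>\<^bsub>CM.Q.A\<^esub> CM.e ?q \<otimes>\<^bsub>CM.Q.A\<^esub> c'" if "c \<in> CM.D" for c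
      by (rule CM.e_dense[OF that])
    show "\<exists>y\<in>carrier U. x = ?q \<otimes>\<^bsub>U\<^esub> y" if "x \<in> carrier U" "c \<in> CM.D" "CM.e x = CM.e ?q \<otimes>\<^bsub>CM.Q.A\<^esub> c" for x c
      by (rule CM.e_divisible[OF that])
    show "?\<psi> (CA.e x) = CM.e x" if "x \<in> carrier ?U" for x by (rule \<psi>_e[OF that])
    show "?\<psi> d \<in> CM.D" if d: "d \<in> CA.D" for d
    proof -
      from d obtain s where s: "d = CA.Q.\<iota> s" "s \<in> carrier (completion ?R \<pi> ?U)" by (rule imageE)
      show ?thesis unfolding s(1) \<psi>_\<iota> by (rule imageI[OF ring_hom_closed[OF c(1) s(2)]])
    qed
  qed
  then show ?thesis unfolding A M by (intro exI)
qed

theorem theorem6p6: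
  fixes K :: "'k ring" and v :: "'k \<Rightarrow> int" and \<pi> :: 'k
    and U :: "('k, 'u) module" and F :: "nat \<Rightarrow> 'u set"
  assumes "complete_discretely_valued_field K v"
    and "\<pi> \<in> carrier (valuation_ring K v)"
    and "\<pi> \<noteq> \<zero>\<^bsub>valuation_ring K v\<^esub>"
    and "\<pi> \<notin> Units (valuation_ring K v)"
    and "deformable (valuation_ring K v) U F"
    and "cring (gr U F)"
    and "noetherian_ring (gr U F)"
  shows "flat_left_module TYPE('n)
           (completion_K K v \<pi> (deformation (valuation_ring K v) \<pi> U F 1))
           (ring_as_left_module (completion_K_map K v \<pi> U (\<lambda>x. x)) (completion_K K v \<pi> U)) \<and>
         flat_right_module TYPE('n)
           (completion_K K v \<pi> (deformation (valuation_ring K v) \<pi> U F 1))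
           (ring_as_right_module (completion_K_map K v \<pi> U (\<lambda>x. x)) (completion_K K v \<pi> U))"
proof -
  let ?A = "completion_K K v \<pi> (deformation (valuation_ring K v) \<pi> U F 1)"
  let ?M = "completion_K K v \<pi> U" and ?\<psi> = "completion_K_map K v \<pi> U (\<lambda>x. x)"
  interpret PF: positively_filtered_algebra "valuation_ring K v" U F
    using assms(5) by (simp add: deformable_def)
  obtain e f q D C where "deformation_completion ?A ?M ?\<psi> U e f q D C F"
    using deformation_completion_exists[OF assms(1-5)] by blast
  then interpret L: deformation_completion ?A ?M ?\<psi> U e f q D C F .
  interpret O: deformation_completion "opposite_ring ?A" "opposite_ring ?M" ?\<psi> "opposite_ring U" e f q D C F
    by (rule L.opposite)
  have "flat_left_module TYPE('n) ?A (ring_as_left_module ?\<psi> ?M)"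
    by (rule equationally_flat_imp_flat[OF L.ring_as_left_module
          L.equationally_flat[OF PF.graded_noetherian_right[OF assms(6,7)]]])
  moreover have "flat_right_module TYPE('n) ?A (ring_as_right_module ?\<psi> ?M)"
  \<comment> \<open>The left-sided argument is repeated for the opposite rings; its Noetherian input
    is available there because \<open>gr U\<close> is commutative.\<close>
  proof (rule flat_right_module_opposite[OF equationally_flat_imp_flat])
    show "left_module (opposite_ring ?A) (ring_as_right_module ?\<psi> ?M)"
      unfolding ring_as_right_module_opposite by (rule O.ring_as_left_module)
    show "equationally_flat (opposite_ring ?A) (ring_as_right_module ?\<psi> ?M)"
      unfolding ring_as_right_module_opposite
      by (rule O.equationally_flat[OF PF.graded_noetherian_left[OF assms(6,7)]])
  qed
  ultimately show ?thesis ..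
qed

end
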